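(* There exist $h_0>0$ and a constant $C>0$, independent of $h$, such that for every mesh size $0<h\le h_0$ and every $\mu_h\in\Lambda_h$ there exists $v_h\in V_h$ satisfying $(v_h\cdot n_h)(m_e)=\mu_h(m_e)$ for all $e\in\mathcal E_h^\partial$, together with the stability estimate $$\|v_h\|_{V_h}\le C\|\mu_h\|_{1/2,\Lambda_h}.$$
   Context: **Domain and mesh.** $N\in\{2,3\}$; $\Omega\subset\mathbb R^N$ is a bounded smooth domain with boundary $\Gamma$. $\{\mathcal T_h\}_{h\downarrow0}$ is a fixed regular family of triangulations of polygonal/polyhedral domains $\Omega_h$: (1) each $T\in\mathcal T_h$ is a closed $N$-simplex with $h_T:=\operatorname{diam}T\le h$; (2) $\overline\Omega_h=\bigcup_{T\in\mathcal T_h}T$; (3) the intersection of two distinct elements is empty or a common face of dimension $\le N-1$; (4) the inscribed ball of $T$ has diameter $\rho_T\ge c\,h_T$ with $c>0$ independent of $h$ and $T$; (5) the vertices of every boundary face lie on $\Gamma$. $\Gamma_h:=\partial\Omega_h$ has outer unit normal $n_h$ (constant on each boundary face). For small $h$ it is known that the orthogonal projection onto $\Gamma$ restricts to a homeomorphism $\Gamma_h\to\Gamma$ and that points of a boundary face $e$ have distance at most $C h_e^2$ to $\Gamma$. $\mathcal E_h$ is the set of $(N-1)$-dimensional faces of elements, $\mathcal E_h^\partial$ those contained in $\Gamma_h$, $\mathring{\mathcal E}_h=\mathcal E_h\setminus\mathcal E_h^\partial$; $m_e$ is the barycenter of $e$, $h_e=\operatorname{diam}e$. $[v]$ is the jump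 of $v$ across an interior face. **Spaces and norms.** $V_h$ is the space of $v_h:\Omega_h\to\mathbb R^N$ with each $v_h|_T$ ($T\in\mathcal T_h$) affine and $[v_h](m_e)=0$ for all $e\in\mathring{\mathcal E}_h$ (Crouzeix–Raviart), with $\|v\|_{V_h}=\big(\|v\|_{L^2(\Omega_h)}^2+\sum_{T}\|\nabla v\|_{L^2(T)}^2\big)^{1/2}$. $\Lambda_h=\{\mu_h\in L^2(\Gamma_h):\mu_h|_e\text{ constant }\forall e\in\mathcal E_h^\partial\}$, $\overline\Lambda_h=\{\mu_h\in C(\Gamma_h):\mu_h|_e\text{ affine }\forall e\in\mathcal E_h^\partial\}$. The operator $E_h^\partial:\Lambda_h\to\overline\Lambda_h$ is $$E_h^\partial\mu_h=\sum_{p}\Big(\frac1{\#\mathcal E_h^\partial(p)}\sum_{e\in\mathcal E_h^\partial(p)}\mu_h(m_e)\Big)\bar\phi_p,$$ the sum being over all mesh vertices $p\in\Gamma_h$, where $\mathcal E_h^\partial(p)=\{e\in\mathcal E_h^\partial:p\in e\}$ and $\bar\phi_p$ is the continuous piecewise affine nodal basis function equal to $1$ at $p$ and $0$ at the other mesh vertices. With $\mathcal E_h^\partial(e)=\{e'\in\mathcal E_h^\partial:e\cap e'\ne\emptyset\}$, the discrete $H^{1/2}$-norm on $\Lambda_h$ is $$\|\mu_h\|_{1/2,\Lambda_h}=\Big(\|E_h^\partial\mu_h\|_{H^{1/2}(\Gamma_h)}^2+\sum_{e\in\mathcal E_h^\partial}\sum_{e'\in\mathcal E_h^\partial(e)}h_e^{N-2}|\mu_h(m_e)-\mu_h(m_{e'})|^2+h\|\mu_h\|_{L^2(\Gamma_h)}^2\Big)^{1/2}.$$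 Constants may depend on $N$, $\Omega$ and the fixed mesh-regularity constant. *)

theory Defs
  imports "HOL-Analysis.Analysis"
begin

section \<open>Bounded smooth domains\<close>

text \<open>On an open set \<open>U\<close>, \<open>f\<close> is of class \<open>C\<^sup>k\<^sup>+\<^sup>1\<close> iff it is differentiable and all its
  first partial derivatives are of class \<open>C\<^sup>k\<close>.\<close>

primrec C_k_on :: "nat \<Rightarrow> (real^'n) set \<Rightarrow> (real^'n \<Rightarrow> real) \<Rightarrow> bool" where
  "C_k_on 0 U f \<longleftrightarrow> continuous_on U f"
| "C_k_on (Suc k) U f \<longleftrightarrow>
     (\<forall>x\<in>U. f differentiable (at x)) \<and>
     (\<forall>i. C_k_on k U (\<lambda>x. frechet_derivative f (at x) (axis i 1)))"

definition C_infinity_on :: "(real^'n) set \<Rightarrow> (real^'n \<Rightarrow> real) \<Rightarrow> bool" where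
  "C_infinity_on U f \<longleftrightarrow> (\<forall>k. C_k_on k U f)"

text \<open>Smoothness of the boundary, by local defining functions with non-vanishing gradient. The
  condition forces \<open>frontier \<Omega> \<inter> U = {x \<in> U. \<rho> x = 0}\<close>, with \<open>\<Omega>\<close> on one side only.\<close>

definition bounded_smooth_domain :: "(real^'n) set \<Rightarrow> bool" where
  "bounded_smooth_domain \<Omega> \<longleftrightarrow>
     open \<Omega> \<and> connected \<Omega> \<and> bounded \<Omega> \<and> \<Omega> \<noteq> {} \<and>
     (\<forall>p\<in>frontier \<Omega>. \<exists>U \<rho>. open U \<and> p \<in> U \<and> C_infinity_on U \<rho> \<and>
        (\<forall>x\<in>U. frechet_derivative \<rho> (at x) \<noteq> (\<lambda>_. 0)) \<and>
        \<Omega> \<inter> U = {x\<in>U. \<rho> x < 0})"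


section \<open>Meshes\<close>

text \<open>A mesh is represented by its set \<open>\<T>\<close> of closed simplices. The polygonal or polyhedral
  domain it triangulates is recovered as the interior of the union; since the simplices have
  nonempty interior, the closure of that interior is the union.\<close>

definition mesh_domain :: "(real^'n) set set \<Rightarrow> (real^'n) set" where
  "mesh_domain \<T> = interior (\<Union>\<T>)"

definition mesh_boundary :: "(real^'n) set set \<Rightarrow> (real^'n) set" where
  "mesh_boundary \<T> = frontier (mesh_domain \<T>)"

definition mesh_vertices :: "(real^'n) set set \<Rightarrow> (real^'n) set" where
  "mesh_vertices \<T> = {p. \<exists>T\<in>\<T>. p extreme_point_of T}"

definition faces :: "(real^'n) set set \<Rightarrow> (real^'n) set set" where
  "faces \<T> = {e. \<exists>T\<in>\<T>. e facet_of T}"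

definition boundary_faces :: "(real^'n) set set \<Rightarrow> (real^'n) set set" where
  "boundary_faces \<T> = {e \<in> faces \<T>. e \<subseteq> mesh_boundary \<T>}"

definition interior_faces :: "(real^'n) set set \<Rightarrow> (real^'n) set set" where
  "interior_faces \<T> = faces \<T> - boundary_faces \<T>"

definition barycenter :: "(real^'n) set \<Rightarrow> real^'n" where
  "barycenter e = (1 / real (card {p. p extreme_point_of e})) *\<^sub>R (\<Sum>p | p extreme_point_of e. p)"

definition inscribed_diameter :: "(real^'n) set \<Rightarrow> real" where
  "inscribed_diameter T = Sup {2 * r | r x. 0 \<le> r \<and> cball x r \<subseteq> T}"

text \<open>The library's \<^const>\<open>triangulation\<close> says that \<open>\<T>\<close> is a finite set of simplices, any two of
  which meet in a common (possibly empty) face; for distinct \<open>N\<close>-simplices such a face has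
  dimension at most \<open>N - 1\<close>.\<close>

definition regular_mesh :: "(real^'n) set \<Rightarrow> real \<Rightarrow> real \<Rightarrow> (real^'n) set set \<Rightarrow> bool" where
  "regular_mesh \<Omega> c h \<T> \<longleftrightarrow>
     triangulation \<T> \<and> \<T> \<noteq> {} \<and> connected (mesh_domain \<T>) \<and>
     (\<forall>T\<in>\<T>. int CARD('n) simplex T \<and> diameter T \<le> h \<and> c * diameter T \<le> inscribed_diameter T) \<and>
     (\<forall>e\<in>boundary_faces \<T>. \<forall>p. p extreme_point_of e \<longrightarrow> p \<in> frontier \<Omega>)"

text \<open>A family of meshes indexed by a set \<open>H\<close> of positive mesh sizes accumulating at 0. The second
  part records the standing facts for small \<open>h\<close>: the orthogonal projection to \<open>\<Gamma> = frontier \<Omega>\<close>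
  (the nearest-point map, which is single-valued near the compact smooth \<open>\<Gamma>\<close>) is a homeomorphism
  from \<open>\<Gamma>\<^sub>h\<close> to \<open>\<Gamma>\<close>, and boundary faces lie within \<open>O(h\<^sub>e\<^sup>2)\<close> of \<open>\<Gamma>\<close>. The homeomorphism property is
  not a consequence of \<^const>\<open>regular_mesh\<close>: if \<open>\<Omega>\<close> is an annulus, a mesh of the filled disc
  is not excluded there.\<close>

definition regular_mesh_family ::
    "(real^'n) set \<Rightarrow> real \<Rightarrow> real set \<Rightarrow> (real \<Rightarrow> (real^'n) set set) \<Rightarrow> bool" where
  "regular_mesh_family \<Omega> c H \<T> \<longleftrightarrow>
     H \<subseteq> {0<..} \<and> 0 islimpt H \<and>
     (\<forall>h\<in>H. regular_mesh \<Omega> c h (\<T> h)) \<and>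
     (\<exists>h1>0. \<exists>K. \<forall>h\<in>H. h \<le> h1 \<longrightarrow>
        (\<exists>q. homeomorphism (mesh_boundary (\<T> h)) (frontier \<Omega>) (closest_point (frontier \<Omega>)) q) \<and>
        (\<forall>e\<in>boundary_faces (\<T> h). \<forall>x\<in>e. infdist x (frontier \<Omega>) \<le> K * (diameter e)\<^sup>2))"

definition outer_normal :: "(real^'n) set set \<Rightarrow> (real^'n) set \<Rightarrow> real^'n" where
  "outer_normal \<T> e = (THE n. norm n = 1 \<and> (\<forall>x\<in>e. \<forall>y\<in>e. n \<bullet> (x - y) = 0) \<and>
     (\<forall>x\<in>rel_interior e. \<forall>\<^sub>F t in at_right 0.
        x - t *\<^sub>R n \<in> mesh_domain \<T> \<and> x + t *\<^sub>R n \<notin> closure (mesh_domain \<T>)))"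


section \<open>Integration over the boundary\<close>

text \<open>Surface measure on a flat \<open>(N-1)\<close>-dimensional face \<open>e\<close> with unit normal \<open>n\<close>: as Lebesgue
  measure is the product of the surface measure on the hyperplane and of length along \<open>n\<close>, the
  area of \<open>A \<subseteq> e\<close> is the volume of the right prism of height 1 over \<open>A\<close>. The choice of the sign of
  \<open>n\<close> is immaterial.\<close>

definition face_normal :: "(real^'n) set \<Rightarrow> real^'n" where
  "face_normal e = (SOME n. norm n = 1 \<and> (\<forall>x\<in>e. \<forall>y\<in>e. n \<bullet> (x - y) = 0))"

definition face_prism :: "(real^'n) set \<Rightarrow> (real^'n) set" where
  "face_prism e = {x + t *\<^sub>R face_normal e | x t. x \<in> e \<and> 0 \<le> t \<and> t \<le> 1}"

definition face_projection :: "(real^'n) set \<Rightarrow> real^'n \<Rightarrow> real^'n" where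
  "face_projection e x = x - (face_normal e \<bullet> (x - barycenter e)) *\<^sub>R face_normal e"

definition face_measure :: "(real^'n) set \<Rightarrow> (real^'n) measure" where
  "face_measure e =
     completion (distr (restrict_space lborel (face_prism e)) borel (face_projection e))"

text \<open>\<open>\<Gamma>\<^sub>h\<close> is the union of the boundary faces, which overlap in null sets only, so integrals over
  \<open>\<Gamma>\<^sub>h\<close> are sums over the boundary faces.\<close>

definition L2_boundary :: "(real^'n) set set \<Rightarrow> (real^'n \<Rightarrow> real) \<Rightarrow> bool" where
  "L2_boundary \<T> f \<longleftrightarrow> (\<forall>e\<in>boundary_faces \<T>.
     f \<in> borel_measurable (face_measure e) \<and> integrable (face_measure e) (\<lambda>x. (f x)\<^sup>2))"

definition L2_norm_boundary :: "(real^'n) set set \<Rightarrow> (real^'n \<Rightarrow> real) \<Rightarrow> real" where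
  "L2_norm_boundary \<T> f = sqrt (\<Sum>e\<in>boundary_faces \<T>. LINT x|face_measure e. (f x)\<^sup>2)"

text \<open>The Sobolev-Slobodeckij norm of \<open>H\<^sup>1\<^sup>/\<^sup>2(\<Gamma>\<^sub>h)\<close>. The kernel exponent is
  \<open>(N-1) + 2 * (1/2) = N\<close>. It is applied to Lipschitz functions on \<open>\<Gamma>\<^sub>h\<close> only, for which the double
  integral converges.\<close>

definition H_half_norm_boundary :: "(real^'n) set set \<Rightarrow> (real^'n \<Rightarrow> real) \<Rightarrow> real" where
  "H_half_norm_boundary \<T> f = sqrt ((L2_norm_boundary \<T> f)\<^sup>2 +
     (\<Sum>e\<in>boundary_faces \<T>. \<Sum>e'\<in>boundary_faces \<T>.
        LINT z|(face_measure e \<Otimes>\<^sub>M face_measure e').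
          (f (fst z) - f (snd z))\<^sup>2 / norm (fst z - snd z) ^ CARD('n)))"


section \<open>The Crouzeix-Raviart space\<close>

text \<open>Elements of \<open>V\<^sub>h\<close> are represented by functions whose values on the union of the faces (a null
  set) and outside \<open>\<Omega>\<^sub>h\<close> are irrelevant. The restriction to an element \<open>T\<close>, as a function on the
  closed simplex, is recovered as the limit from the interior of \<open>T\<close>.\<close>

definition elem_trace :: "(real^'n) set \<Rightarrow> (real^'n \<Rightarrow> real^'n) \<Rightarrow> real^'n \<Rightarrow> real^'n" where
  "elem_trace T v x = Lim (at x within interior T) v"

definition CR_space :: "(real^'n) set set \<Rightarrow> (real^'n \<Rightarrow> real^'n) set" where
  "CR_space \<T> = {v.
     (\<forall>T\<in>\<T>. \<exists>A b. \<forall>x\<in>interior T. v x = A *v x + b) \<and>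
     (\<forall>e\<in>interior_faces \<T>. \<forall>T\<in>\<T>. \<forall>T'\<in>\<T>. e facet_of T \<and> e facet_of T' \<longrightarrow>
        elem_trace T v (barycenter e) - elem_trace T' v (barycenter e) = 0)}"

text \<open>The norm of \<^typ>\<open>real^'n^'n\<close> is the Frobenius norm.\<close>

definition CR_norm :: "(real^'n) set set \<Rightarrow> (real^'n \<Rightarrow> real^'n) \<Rightarrow> real" where
  "CR_norm \<T> v = sqrt (
     (LINT x:mesh_domain \<T>|lebesgue. (norm (v x))\<^sup>2) +
     (\<Sum>T\<in>\<T>. LINT x:interior T|lebesgue. (norm (matrix (frechet_derivative v (at x))))\<^sup>2))"


section \<open>The multiplier spaces and the discrete norm\<close>

text \<open>Elements of \<open>\<Lambda>\<^sub>h\<close> are represented by functions that are constant on the relative interior of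
  each boundary face (so that the value at the barycenter is meaningful); the values on the null
  set where faces meet are left free.\<close>

definition Lambda :: "(real^'n) set set \<Rightarrow> (real^'n \<Rightarrow> real) set" where
  "Lambda \<T> = {\<mu>. L2_boundary \<T> \<mu> \<and>
     (\<forall>e\<in>boundary_faces \<T>. \<exists>a. \<forall>x\<in>rel_interior e. \<mu> x = a)}"

definition Lambda_bar :: "(real^'n) set set \<Rightarrow> (real^'n \<Rightarrow> real) set" where
  "Lambda_bar \<T> = {\<mu>. continuous_on (mesh_boundary \<T>) \<mu> \<and>
     (\<forall>e\<in>boundary_faces \<T>. \<exists>a b. \<forall>x\<in>e. \<mu> x = a \<bullet> x + b)}"

text \<open>Extension by 0 outside \<open>\<Gamma>\<^sub>h\<close> makes the basis function unique as a HOL function.\<close>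

definition nodal_basis :: "(real^'n) set set \<Rightarrow> real^'n \<Rightarrow> (real^'n \<Rightarrow> real)" where
  "nodal_basis \<T> p = (THE \<phi>. \<phi> \<in> Lambda_bar \<T> \<and> \<phi> p = 1 \<and>
     (\<forall>q \<in> mesh_vertices \<T> \<inter> mesh_boundary \<T>. q \<noteq> p \<longrightarrow> \<phi> q = 0) \<and>
     (\<forall>x. x \<notin> mesh_boundary \<T> \<longrightarrow> \<phi> x = 0))"

definition faces_at :: "(real^'n) set set \<Rightarrow> real^'n \<Rightarrow> (real^'n) set set" where
  "faces_at \<T> p = {e \<in> boundary_faces \<T>. p \<in> e}"

definition boundary_averaging ::
    "(real^'n) set set \<Rightarrow> (real^'n \<Rightarrow> real) \<Rightarrow> (real^'n \<Rightarrow> real)" where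
  "boundary_averaging \<T> \<mu> x = (\<Sum>p \<in> mesh_vertices \<T> \<inter> mesh_boundary \<T>.
     (1 / real (card (faces_at \<T> p)) * (\<Sum>e\<in>faces_at \<T> p. \<mu> (barycenter e))) * nodal_basis \<T> p x)"

definition Lambda_half_norm ::
    "real \<Rightarrow> (real^'n) set set \<Rightarrow> (real^'n \<Rightarrow> real) \<Rightarrow> real" where
  "Lambda_half_norm h \<T> \<mu> = sqrt (
     (H_half_norm_boundary \<T> (boundary_averaging \<T> \<mu>))\<^sup>2 +
     (\<Sum>e\<in>boundary_faces \<T>. \<Sum>e' | e' \<in> boundary_faces \<T> \<and> e \<inter> e' \<noteq> {}.
        diameter e ^ (CARD('n) - 2) * \<bar>\<mu> (barycenter e) - \<mu> (barycenter e')\<bar>\<^sup>2) +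
     h * (L2_norm_boundary \<T> \<mu>)\<^sup>2)"

end

theory Submission
  imports Defs
begin

text \<open>
  A Crouzeix-Raviart function is determined by arbitrary values at the barycenters of the facets.
  On a boundary face \<open>e\<close> the value is \<open>\<mu>(m\<^sub>e) n\<^sub>e\<close>; on an interior facet it is the value at an inner
  point of an adjacent element of a discrete Whitney extension of the boundary values, that is, of
  the average of the boundary values over the faces whose distance and size are comparable to the
  distance to the boundary. The energy of the result is bounded by the weighted sum of
  \<open>|v\<^sub>e - v\<^sub>e\<^sub>'|\<^sup>2 / d(e, e')\<^sup>N\<close> over pairs of boundary faces plus an \<open>L\<^sup>2\<close> term. This uses that the
  faces within distance \<open>R\<close> of a point have total area of order \<open>R\<^sup>N\<^sup>-\<^sup>1\<close>, which holds because
  \<open>\<Gamma>\<^sub>h\<close> is locally a graph: its faces have slope \<open>O(h)\<close> with respect to \<open>\<Gamma>\<close>, and the projection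
  to \<open>\<Gamma>\<close> is injective.

  The discrete Gagliardo sum of \<open>\<mu>\<close> is compared with the double integral of the averaged function,
  which differs from \<open>\<mu>\<close> on a face by at most the jumps to the touching faces. The normals are
  Lipschitz on the scale of the faces, so the product with \<open>n\<^sub>e\<close> costs only the \<open>L\<^sup>2\<close> term.
\<close>

section \<open>Barycentric coordinates on a simplex\<close>

text \<open>The mesh is only shape regular: face sizes may vary strongly along the boundary, and no
  chart of the discrete boundary is given. That touching boundary faces have comparable sizes, that
  areas are bounded from both sides and that nearby outer normals agree in sign must all be drawn
  from quadratic contact with the tangent planes, from injectivity of the projection and from
  connectedness. Quadratic contact is expressed by touching regions on both sides of the frontier,
  so that the normal field never has to be differentiated. No trace or extension theorem for Sobolev
  functions enters. Growth bounds come from packing and covering by balls, singular integrals become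
  dyadic sums, and the passage from elements to pairs of faces is an exchange of finite sums. All
  constants are built from \<open>\<kappa>\<close>, \<open>K\<close>, \<open>r\<close> and the
  dimension. The bound can therefore be fixed before the mesh family; only the threshold for the
  mesh size depends on the family.\<close>

definition vertices :: "(real^'n) set \<Rightarrow> (real^'n) set" where
  "vertices T = {p. p extreme_point_of T}"

text \<open>If \<open>a\<close> is no vertex of a full simplex, the prescribed values are all 0 and
  the coordinate vanishes identically, so sums may also run over the vertices of another
  element.\<close>

definition bary_grad :: "(real^'n) set \<Rightarrow> real^'n \<Rightarrow> real^'n" where
  "bary_grad T a = (SOME g. \<exists>b. \<forall>v\<in>vertices T. g \<bullet> v + b = (if v = a then 1 else 0))"

definition bary_offset :: "(real^'n) set \<Rightarrow> real^'n \<Rightarrow> real" where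
  "bary_offset T a = (SOME b. \<forall>v\<in>vertices T. bary_grad T a \<bullet> v + b = (if v = a then 1 else 0))"

definition bary :: "(real^'n) set \<Rightarrow> real^'n \<Rightarrow> real^'n \<Rightarrow> real" where
  "bary T a x = bary_grad T a \<bullet> x + bary_offset T a"

text \<open>Subtracting one point turns affine into linear independence, where a linear form with
  prescribed values exists; its adjoint at 1 is the gradient vector.\<close>

lemma affine_function_interpolation:
  fixes V :: "(real^'n) set" and f :: "real^'n \<Rightarrow> real"
  assumes "\<not> affine_dependent V"
  shows "\<exists>g b. \<forall>v\<in>V. g \<bullet> v + b = f v"
proof (cases "V = {}")
  case False
  then obtain a where a: "a \<in> V" by blast
  have ind: "independent ((\<lambda>x. - a + x) ` (V - {a}))"
    using assms affine_dependent_iff_dependent2[OF a] by blast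
  obtain h :: "real^'n \<Rightarrow> real" where h: "linear h"
    "\<And>y. y \<in> (\<lambda>x. - a + x) ` (V - {a}) \<Longrightarrow> h y = f (a + y) - f a"
    using linear_independent_extend[OF ind, of "\<lambda>y. f (a + y) - f a"] by blast
  define g where "g = adjoint h 1"
  have g: "g \<bullet> x = h x" for x
    using adjoint_works[OF h(1), of x 1] by (simp add: g_def inner_commute)
  have "g \<bullet> v + (f a - g \<bullet> a) = f v" if "v \<in> V" for v
  proof (cases "v = a")
    case False
    then have "h (- a + v) = f (a + (- a + v)) - f a" using h(2) that by blast
    moreover have "h (- a + v) = h v - h a"
      using linear_diff[OF h(1), of v a] by simp
    ultimately show ?thesis by (simp add: g)
  qed simp
  then show ?thesis by blast
qed auto

context
  fixes T :: "(real^'n) set"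
  assumes T: "int CARD('n) simplex T"
begin

lemma simplex_hull_vertices:
  shows "\<not> affine_dependent (vertices T)" "card (vertices T) = CARD('n) + 1"
    "T = convex hull (vertices T)"
proof -
  obtain C where C: "\<not> affine_dependent C" "int (card C) = int CARD('n) + 1" "T = convex hull C"
    using T unfolding simplex_def by blast
  have "vertices T = C"
    using extreme_point_of_convex_hull_affine_independent[OF C(1)] C(3) by (auto simp: vertices_def)
  then show "\<not> affine_dependent (vertices T)" "card (vertices T) = CARD('n) + 1"
    "T = convex hull (vertices T)" using C by auto
qed

lemma finite_vertices: "finite (vertices T)"
  using simplex_hull_vertices(2) by (metis Suc_eq_plus1 card.infinite nat.distinct(1))

lemma vertices_subset: "vertices T \<subseteq> T"
  by (auto simp: vertices_def extreme_point_of_def)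

lemma affine_hull_vertices: "affine hull (vertices T) = UNIV"
  using affine_independent_span_eq[OF simplex_hull_vertices(1)] simplex_hull_vertices(2) by simp

lemma bary_vertex:
  assumes "v \<in> vertices T"
  shows "bary T a v = (if v = a then 1 else 0)"
proof -
  have "\<exists>g b. \<forall>v\<in>vertices T. g \<bullet> v + b = (if v = a then 1 else 0)"
    using affine_function_interpolation[OF simplex_hull_vertices(1), of "\<lambda>v. if v = a then 1 else 0"] .
  then have "\<exists>b. \<forall>v\<in>vertices T. bary_grad T a \<bullet> v + b = (if v = a then 1 else 0)"
    unfolding bary_grad_def by (rule someI_ex)
  then have "\<forall>v\<in>vertices T. bary_grad T a \<bullet> v + bary_offset T a = (if v = a then 1 else 0)"
    unfolding bary_offset_def by (rule someI_ex)
  then show ?thesis using assms by (simp add: bary_def)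
qed

lemma bary_affine_combination:
  assumes "sum u (vertices T) = 1"
  shows "bary T a (\<Sum>v\<in>vertices T. u v *\<^sub>R v) = (if a \<in> vertices T then u a else 0)"
proof -
  have "bary T a (\<Sum>v\<in>vertices T. u v *\<^sub>R v) =
      (\<Sum>v\<in>vertices T. u v * (bary_grad T a \<bullet> v)) + bary_offset T a * sum u (vertices T)"
    using assms by (simp add: bary_def inner_sum_right)
  also have "\<dots> = (\<Sum>v\<in>vertices T. u v * bary T a v)"
    by (simp add: bary_def sum_distrib_left sum.distrib algebra_simps)
  also have "\<dots> = (\<Sum>v\<in>vertices T. if v = a then u a else 0)"
    by (rule sum.cong) (auto simp: bary_vertex)
  also have "\<dots> = (if a \<in> vertices T then u a else 0)"
    using finite_vertices by (simp add: sum.delta)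
  finally show ?thesis .
qed

lemma bary_expansion_obtain:
  obtains u where "sum u (vertices T) = 1" "(\<Sum>v\<in>vertices T. u v *\<^sub>R v) = x"
    "\<And>a. a \<in> vertices T \<Longrightarrow> bary T a x = u a" "\<And>a. a \<notin> vertices T \<Longrightarrow> bary T a x = 0"
proof -
  have "x \<in> affine hull (vertices T)" by (simp add: affine_hull_vertices)
  then obtain u where u: "sum u (vertices T) = 1" "(\<Sum>v\<in>vertices T. u v *\<^sub>R v) = x"
    using affine_hull_finite[OF finite_vertices] by auto
  show thesis
    using bary_affine_combination[OF u(1)] u(2) by (intro that[OF u]) simp_all
qed

lemma bary_sum: "(\<Sum>a\<in>vertices T. bary T a x) = 1"
proof (rule bary_expansion_obtain[of x])
  fix u assume u: "sum u (vertices T) = 1" "\<And>a. a \<in> vertices T \<Longrightarrow> bary T a x = u a"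
  then show ?thesis by (metis (mono_tags, lifting) sum.cong)
qed

lemma bary_expansion: "(\<Sum>a\<in>vertices T. bary T a x *\<^sub>R a) = x"
proof (rule bary_expansion_obtain[of x])
  fix u assume u: "(\<Sum>v\<in>vertices T. u v *\<^sub>R v) = x" "\<And>a. a \<in> vertices T \<Longrightarrow> bary T a x = u a"
  have "(\<Sum>a\<in>vertices T. bary T a x *\<^sub>R a) = (\<Sum>v\<in>vertices T. u v *\<^sub>R v)"
    by (rule sum.cong) (simp_all add: u(2))
  then show ?thesis using u(1) by simp
qed

lemma bary_not_vertex:
  assumes "a \<notin> vertices T" shows "bary T a x = 0"
proof (rule bary_expansion_obtain[of x])
  fix u assume "\<And>a. a \<notin> vertices T \<Longrightarrow> bary T a x = 0"
  then show ?thesis using assms .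
qed

lemma bary_unique:
  assumes "sum u (vertices T) = 1" "(\<Sum>v\<in>vertices T. u v *\<^sub>R v) = x" "a \<in> vertices T"
  shows "u a = bary T a x"
  using bary_affine_combination[OF assms(1)] assms by simp

text \<open>Weights on \<open>c\<close>, extended by 0 to the other vertices, form an affine
  expansion over all vertices, and that expansion is unique.\<close>

lemma convex_hull_subvertices_iff:
  assumes c: "c \<subseteq> vertices T"
  shows "x \<in> convex hull c \<longleftrightarrow>
    (\<forall>a\<in>c. 0 \<le> bary T a x) \<and> (\<forall>a\<in>vertices T - c. bary T a x = 0)"
proof -
  have fin: "finite c" using c finite_vertices finite_subset by blast
  show ?thesis
  proof
    assume "x \<in> convex hull c"
    then obtain u where u: "\<forall>a\<in>c. 0 \<le> u a" "sum u c = 1" "(\<Sum>v\<in>c. u v *\<^sub>R v) = x"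
      using convex_hull_finite[OF fin] by auto
    define w where "w a = (if a \<in> c then u a else 0)" for a
    have w: "sum w (vertices T) = 1"
      using u(2) sum.mono_neutral_cong_right[OF finite_vertices c, of w u] by (auto simp: w_def)
    have "(\<Sum>v\<in>vertices T. w v *\<^sub>R v) = (\<Sum>v\<in>c. u v *\<^sub>R v)"
      by (rule sum.mono_neutral_cong_right[OF finite_vertices c]) (auto simp: w_def)
    then have wb: "bary T a x = w a" if "a \<in> vertices T" for a
      using bary_unique[OF w] u(3) that by auto
    then show "(\<forall>a\<in>c. 0 \<le> bary T a x) \<and> (\<forall>a\<in>vertices T - c. bary T a x = 0)"
      using u(1) wb w_def c by (metis DiffE subsetD)
  next
    assume R: "(\<forall>a\<in>c. 0 \<le> bary T a x) \<and> (\<forall>a\<in>vertices T - c. bary T a x = 0)"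
    have "(\<Sum>a\<in>c. bary T a x) = (\<Sum>a\<in>vertices T. bary T a x)"
      by (rule sum.mono_neutral_left[OF finite_vertices c]) (use R in blast)
    then have 1: "(\<Sum>a\<in>c. bary T a x) = 1" by (simp only: bary_sum)
    have "(\<Sum>a\<in>c. bary T a x *\<^sub>R a) = (\<Sum>a\<in>vertices T. bary T a x *\<^sub>R a)"
      by (rule sum.mono_neutral_left[OF finite_vertices c]) (use R in simp)
    then have 2: "(\<Sum>a\<in>c. bary T a x *\<^sub>R a) = x" by (simp only: bary_expansion)
    show "x \<in> convex hull c"
      unfolding convex_hull_finite[OF fin]
      by (intro CollectI exI[of _ "\<lambda>a. bary T a x"]) (use R 1 2 in simp)
  qed
qed

lemma rel_interior_hull_subvertices_iff:
  assumes c: "c \<subseteq> vertices T"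
  shows "x \<in> rel_interior (convex hull c) \<longleftrightarrow>
    (\<forall>a\<in>c. 0 < bary T a x) \<and> (\<forall>a\<in>vertices T - c. bary T a x = 0)"
proof -
  have fin: "finite c" using c finite_vertices finite_subset by blast
  have ind: "\<not> affine_dependent c"
    using affine_independent_subset[OF simplex_hull_vertices(1) c] .
  show ?thesis
  proof
    assume "x \<in> rel_interior (convex hull c)"
    then obtain u where u: "\<forall>a\<in>c. 0 < u a" "sum u c = 1" "(\<Sum>v\<in>c. u v *\<^sub>R v) = x"
      using rel_interior_convex_hull_explicit[OF ind] by auto
    define w where "w a = (if a \<in> c then u a else 0)" for a
    have w: "sum w (vertices T) = 1"
      using u(2) sum.mono_neutral_cong_right[OF finite_vertices c, of w u] by (auto simp: w_def)
    have "(\<Sum>v\<in>vertices T. w v *\<^sub>R v) = (\<Sum>v\<in>c. u v *\<^sub>R v)"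
      by (rule sum.mono_neutral_cong_right[OF finite_vertices c]) (auto simp: w_def)
    then have wb: "bary T a x = w a" if "a \<in> vertices T" for a
      using bary_unique[OF w] u(3) that by auto
    then show "(\<forall>a\<in>c. 0 < bary T a x) \<and> (\<forall>a\<in>vertices T - c. bary T a x = 0)"
      using u(1) wb w_def c by (metis DiffE subsetD)
  next
    assume R: "(\<forall>a\<in>c. 0 < bary T a x) \<and> (\<forall>a\<in>vertices T - c. bary T a x = 0)"
    have "(\<Sum>a\<in>c. bary T a x) = (\<Sum>a\<in>vertices T. bary T a x)"
      by (rule sum.mono_neutral_left[OF finite_vertices c]) (use R in blast)
    then have 1: "(\<Sum>a\<in>c. bary T a x) = 1" by (simp only: bary_sum)
    have "(\<Sum>a\<in>c. bary T a x *\<^sub>R a) = (\<Sum>a\<in>vertices T. bary T a x *\<^sub>R a)"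
      by (rule sum.mono_neutral_left[OF finite_vertices c]) (use R in simp)
    then have 2: "(\<Sum>a\<in>c. bary T a x *\<^sub>R a) = x" by (simp only: bary_expansion)
    show "x \<in> rel_interior (convex hull c)"
      unfolding rel_interior_convex_hull_explicit[OF ind]
      by (intro CollectI exI[of _ "\<lambda>a. bary T a x"]) (use R 1 2 in simp)
  qed
qed

lemma simplex_mem_iff: "x \<in> T \<longleftrightarrow> (\<forall>a\<in>vertices T. 0 \<le> bary T a x)"
  using convex_hull_subvertices_iff[of "vertices T" x] simplex_hull_vertices(3) by auto

lemma affine_hull_simplex: "affine hull T = UNIV"
  by (metis affine_hull_convex_hull affine_hull_vertices simplex_hull_vertices(3))

lemma interior_simplex_iff: "x \<in> interior T \<longleftrightarrow> (\<forall>a\<in>vertices T. 0 < bary T a x)"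
proof -
  have "rel_interior T = interior T"
    by (rule rel_interior_interior[OF affine_hull_simplex])
  then show ?thesis
    using rel_interior_hull_subvertices_iff[of "vertices T" x] simplex_hull_vertices(3) by auto
qed

lemma simplex_face_iff: "F face_of T \<longleftrightarrow> (\<exists>c\<subseteq>vertices T. F = convex hull c)"
  using face_of_convex_hull_affine_independent[OF simplex_hull_vertices(1)] simplex_hull_vertices(3)
  by metis

lemma simplex_facet_iff:
  "e facet_of T \<longleftrightarrow> (\<exists>a\<in>vertices T. e = convex hull (vertices T - {a}))"
proof -
  have "0 < CARD('n)" by simp
  then have "2 \<le> card (vertices T)" using simplex_hull_vertices(2) by linarith
  then show ?thesis
    using facet_of_convex_hull_affine_independent_alt[OF simplex_hull_vertices(1), of e]
      simplex_hull_vertices(3) by auto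
qed

lemma vertices_hull_subvertices:
  assumes "c \<subseteq> vertices T" shows "vertices (convex hull c) = c"
  using extreme_point_of_convex_hull_affine_independent
    [OF affine_independent_subset[OF simplex_hull_vertices(1) assms]] by (auto simp: vertices_def)

lemma closure_interior_simplex: "closure (interior T) = T" and
  interior_simplex_ne: "interior T \<noteq> {}" and compact_simplex': "compact T" and
  convex_simplex': "convex T"
proof -
  show conv: "convex T" and comp: "compact T" using T convex_simplex compact_simplex by auto
  have "T \<noteq> {}" using simplex_hull_vertices(2) vertices_subset by (metis Suc_eq_plus1 card.empty empty_iff equals0I nat.distinct(1) subset_empty)
  then have "rel_interior T \<noteq> {}" using rel_interior_eq_empty conv by blast
  then show ne: "interior T \<noteq> {}" using rel_interior_interior[OF affine_hull_simplex] by simp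
  show "closure (interior T) = T"
    using convex_closure_interior[OF conv ne] comp by (simp add: compact_imp_closed)
qed

end

lemma continuous_on_bary [continuous_intros]: "continuous_on S (bary T a)"
  unfolding bary_def by (intro continuous_intros)

lemma bary_diff: "bary T a x - bary T a y = bary_grad T a \<bullet> (x - y)"
  by (simp add: bary_def inner_diff_right)

text \<open>The coordinates add up to the constant 1; the difference of this constant between the
  gradient sum and the origin is the squared norm of that sum.\<close>

lemma bary_grad_sum:
  fixes T :: "(real^'n) set"
  assumes "int CARD('n) simplex T"
  shows "(\<Sum>a\<in>vertices T. bary_grad T a) = 0"
proof -
  let ?g = "\<Sum>a\<in>vertices T. bary_grad T a"
  have "?g \<bullet> ?g = (\<Sum>a\<in>vertices T. bary T a ?g - bary T a 0)"
    by (simp add: bary_diff inner_sum_left)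
  also have "\<dots> = 0" using bary_sum[OF assms] by (simp add: sum_subtractf)
  finally show ?thesis by simp
qed

text \<open>On \<open>T\<close> the coordinate lies between 0 and 1, while along the diameter of the
  ball in gradient direction it varies by \<open>norm (bary_grad T a) * (2 * r)\<close>.\<close>

lemma norm_bary_grad_le:
  fixes T :: "(real^'n) set"
  assumes T: "int CARD('n) simplex T" and r: "0 < r" "cball x r \<subseteq> T" and a: "a \<in> vertices T"
  shows "norm (bary_grad T a) * (2 * r) \<le> 1"
proof (cases "bary_grad T a = 0")
  case False
  let ?u = "(1 / norm (bary_grad T a)) *\<^sub>R bary_grad T a"
  have u: "norm ?u = 1" using False by simp
  have mem: "x + r *\<^sub>R ?u \<in> T" "x - r *\<^sub>R ?u \<in> T"
  proof -
    have "x + r *\<^sub>R ?u \<in> cball x r" "x - r *\<^sub>R ?u \<in> cball x r"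
      using r(1) False by (simp_all add: dist_norm)
    then show "x + r *\<^sub>R ?u \<in> T" "x - r *\<^sub>R ?u \<in> T" using r(2) by auto
  qed
  have le1: "bary T a y \<le> 1" if "y \<in> T" for y
  proof -
    have "bary T a y \<le> (\<Sum>b\<in>vertices T. bary T b y)"
      using that simplex_mem_iff[OF T, of y] finite_vertices[OF T] a by (intro member_le_sum) auto
    then show ?thesis using bary_sum[OF T] by simp
  qed
  have "bary T a (x + r *\<^sub>R ?u) - bary T a (x - r *\<^sub>R ?u) = bary_grad T a \<bullet> ((2 * r) *\<^sub>R ?u)"
    unfolding bary_diff by (simp add: algebra_simps flip: scaleR_2)
  also have "\<dots> = norm (bary_grad T a) * (2 * r)"
    using False by (simp add: dot_square_norm power2_eq_square)
  finally have *: "norm (bary_grad T a) * (2 * r) = bary T a (x + r *\<^sub>R ?u) - bary T a (x - r *\<^sub>R ?u)"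
    by simp
  have "0 \<le> bary T a (x - r *\<^sub>R ?u)" using mem(2) simplex_mem_iff[OF T] a by blast
  with * le1[OF mem(1)] show ?thesis by linarith
qed simp

text \<open>Along an edge at \<open>a\<close> the coordinate of \<open>a\<close> drops from 1 to 0,
  which a gradient of norm at most \<open>1 / (2 * r)\<close> allows only over a length of at least
  \<open>2 * r\<close>.\<close>

lemma vertices_dist_ge:
  fixes T :: "(real^'n) set"
  assumes T: "int CARD('n) simplex T" and r: "0 < r" "cball x r \<subseteq> T"
    and ab: "a \<in> vertices T" "b \<in> vertices T" "a \<noteq> b"
  shows "2 * r \<le> dist a b"
proof -
  have "1 = bary_grad T a \<bullet> (a - b)"
    using bary_diff[of T a a b] bary_vertex[OF T] ab by simp
  also have "\<dots> \<le> norm (bary_grad T a) * norm (a - b)" by (rule norm_cauchy_schwarz)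
  finally have 1: "1 \<le> norm (bary_grad T a) * dist a b" by (simp add: dist_norm)
  have "2 * r * 1 \<le> 2 * r * (norm (bary_grad T a) * dist a b)"
    using 1 r(1) by (intro mult_left_mono) auto
  also have "\<dots> = (norm (bary_grad T a) * (2 * r)) * dist a b" by simp
  also have "\<dots> \<le> 1 * dist a b"
    by (intro mult_right_mono norm_bary_grad_le[OF T r ab(1)]) auto
  finally show ?thesis by simp
qed


section \<open>Simplicial meshes\<close>

lemma affine_function_via_bary:
  fixes T :: "(real^'n) set"
  assumes T: "int CARD('n) simplex T"
  shows "g \<bullet> y + b = (\<Sum>v\<in>vertices T. bary T v y * (g \<bullet> v + b))"
proof -
  have "g \<bullet> y + b = g \<bullet> (\<Sum>v\<in>vertices T. bary T v y *\<^sub>R v) + b * (\<Sum>v\<in>vertices T. bary T v y)"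
    by (simp only: bary_expansion[OF T] bary_sum[OF T] mult_1_right)
  also have "\<dots> = (\<Sum>v\<in>vertices T. bary T v y * (g \<bullet> v + b))"
    by (simp add: inner_sum_right sum_distrib_left sum.distrib algebra_simps)
  finally show ?thesis .
qed

lemma eventually_bary_pos:
  assumes "finite B" "\<And>b. b \<in> B \<Longrightarrow> 0 < bary T b x"
  shows "\<exists>\<epsilon>>0. \<forall>y\<in>ball x \<epsilon>. \<forall>b\<in>B. 0 < bary T b y"
proof -
  have "open (\<Inter>b\<in>B. {y. 0 < bary T b y})"
    by (intro open_INT assms(1) ballI open_Collect_less continuous_intros)
  moreover have "x \<in> (\<Inter>b\<in>B. {y. 0 < bary T b y})" using assms(2) by auto
  ultimately obtain \<epsilon> where "\<epsilon> > 0" "ball x \<epsilon> \<subseteq> (\<Inter>b\<in>B. {y. 0 < bary T b y})"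
    using openE by blast
  then show ?thesis by blast
qed

lemma bary_grad_nonzero:
  fixes T :: "(real^'n) set"
  assumes T: "int CARD('n) simplex T" and "a \<in> vertices T"
  shows "bary_grad T a \<noteq> 0"
proof
  assume 0: "bary_grad T a = 0"
  have "card (vertices T) > 1" using simplex_hull_vertices(2)[OF T] by simp
  then obtain b where b: "b \<in> vertices T" "b \<noteq> a"
    using assms(2) by (metis card_le_Suc0_iff_eq finite_vertices[OF T] not_less One_nat_def)
  have "bary T a a - bary T a b = 0" using 0 by (simp add: bary_diff)
  then show False using bary_vertex[OF T] assms(2) b by simp
qed

lemma negligible_UN_finite:
  "finite I \<Longrightarrow> (\<And>i. i \<in> I \<Longrightarrow> negligible (f i)) \<Longrightarrow> negligible (\<Union>i\<in>I. f i)"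
  by (rule negligible_Union) auto

locale simplicial_mesh =
  fixes \<T> :: "(real^'n) set set"
  assumes triangulation: "triangulation \<T>"
    and full_simplex: "\<And>T. T \<in> \<T> \<Longrightarrow> int CARD('n) simplex T"
    and dim_ge_2: "2 \<le> CARD('n)"
begin

lemma finite_mesh: "finite \<T>"
  using triangulation by (simp add: triangulation_def)

lemma closed_Union_mesh: "closed (\<Union>\<T>)"
  using finite_mesh full_simplex by (intro closed_Union) (auto intro: closed_simplex)

lemma interior_subset_mesh_domain: "T \<in> \<T> \<Longrightarrow> interior T \<subseteq> mesh_domain \<T>"
  unfolding mesh_domain_def by (intro interior_mono) auto

lemma open_mesh_domain: "open (mesh_domain \<T>)"
  by (simp add: mesh_domain_def)

lemma closure_mesh_domain: "closure (mesh_domain \<T>) = \<Union>\<T>"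
proof
  show "closure (mesh_domain \<T>) \<subseteq> \<Union>\<T>"
    unfolding mesh_domain_def using closed_Union_mesh by (simp add: closure_minimal interior_subset)
  show "\<Union>\<T> \<subseteq> closure (mesh_domain \<T>)"
    using closure_interior_simplex[OF full_simplex] closure_mono[OF interior_subset_mesh_domain] by blast
qed

lemma mesh_boundary_eq: "mesh_boundary \<T> = \<Union>\<T> - mesh_domain \<T>"
  unfolding mesh_boundary_def frontier_def closure_mesh_domain
  using open_mesh_domain by (simp add: interior_open)

text \<open>The intersection is a face of either element, hence spanned by some vertices of each;
  both sets consist of the extreme points of the same hull and so agree. A shared vertex has its own
  coordinate equal to 1 and cannot be missing from them.\<close>

lemma mesh_Int_hull:
  assumes "T \<in> \<T>" "T' \<in> \<T>"
  shows "T \<inter> T' = convex hull (vertices T \<inter> vertices T')"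
proof -
  have "(T \<inter> T') face_of T" "(T' \<inter> T) face_of T'"
    using triangulation assms unfolding triangulation_def by blast+
  then obtain c c' where c: "c \<subseteq> vertices T" "T \<inter> T' = convex hull c"
      and c': "c' \<subseteq> vertices T'" "T \<inter> T' = convex hull c'"
    using simplex_face_iff[OF full_simplex[OF assms(1)]] simplex_face_iff[OF full_simplex[OF assms(2)]]
    by (metis inf_commute)
  have "c = c'"
    using vertices_hull_subvertices[OF full_simplex[OF assms(1)] c(1)]
      vertices_hull_subvertices[OF full_simplex[OF assms(2)] c'(1)] c(2) c'(2) by simp
  moreover have "v \<in> c" if v: "v \<in> vertices T" "v \<in> vertices T'" for v
  proof (rule ccontr)
    assume "v \<notin> c"
    have "v \<in> convex hull c"
      using v vertices_subset[OF full_simplex[OF assms(1)]] vertices_subset[OF full_simplex[OF assms(2)]] c(2)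
      by blast
    then have "bary T v v = 0"
      using convex_hull_subvertices_iff[OF full_simplex[OF assms(1)] c(1)] v \<open>v \<notin> c\<close> by blast
    then show False using bary_vertex[OF full_simplex[OF assms(1)] v(1)] by simp
  qed
  ultimately have "c = vertices T \<inter> vertices T'" using c(1) c'(1) by blast
  then show ?thesis using c(2) by simp
qed

lemma mesh_eq_if_vertices_subset:
  assumes "T \<in> \<T>" "T' \<in> \<T>" "vertices T \<subseteq> vertices T'"
  shows "T = T'"
proof -
  have "vertices T = vertices T'"
    using assms card_subset_eq[OF finite_vertices[OF full_simplex[OF assms(2)]] assms(3)]
      simplex_hull_vertices(2)[OF full_simplex] by metis
  then show ?thesis using simplex_hull_vertices(3)[OF full_simplex] assms by metis
qed

text \<open>On the common face the coordinates of unshared vertices vanish, in the interior none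
  does; so all vertices would be shared.\<close>

lemma mesh_interior_Int:
  assumes "T \<in> \<T>" "T' \<in> \<T>" "T \<noteq> T'"
  shows "interior T \<inter> T' = {}"
proof (rule ccontr)
  assume "interior T \<inter> T' \<noteq> {}"
  then obtain x where x: "x \<in> interior T" "x \<in> T'" by blast
  then have "x \<in> convex hull (vertices T \<inter> vertices T')"
    using mesh_Int_hull[OF assms(1,2)] interior_subset by blast
  then have "\<forall>a\<in>vertices T - vertices T'. bary T a x = 0"
    using convex_hull_subvertices_iff[OF full_simplex[OF assms(1)], of "vertices T \<inter> vertices T'"] by blast
  moreover have "\<forall>a\<in>vertices T. 0 < bary T a x"
    using interior_simplex_iff[OF full_simplex[OF assms(1)]] x(1) by blast
  ultimately have "vertices T \<subseteq> vertices T'" by force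
  then show False using mesh_eq_if_vertices_subset assms by blast
qed

text \<open>The expansion of \<open>x\<close> in \<open>T\<close> uses only shared vertices, so it
  is also the expansion in \<open>T'\<close>. This is what makes the hat functions single valued and
  continuous across elements.\<close>

lemma bary_agree:
  assumes T: "T \<in> \<T>" "x \<in> T" and T': "T' \<in> \<T>" "x \<in> T'"
  shows "bary T a x = bary T' a x"
proof -
  note fT = full_simplex[OF T(1)] and fT' = full_simplex[OF T'(1)]
  let ?c = "vertices T \<inter> vertices T'"
  have x: "x \<in> convex hull ?c" using mesh_Int_hull[OF T(1) T'(1)] T T' by blast
  have 0: "bary T b x = 0" if "b \<notin> ?c" for b
    using convex_hull_subvertices_iff[OF fT, of ?c] x bary_not_vertex[OF fT] that by blast
  have 00: "bary T' b x = 0" if "b \<notin> ?c" for b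
    using convex_hull_subvertices_iff[OF fT', of ?c] x bary_not_vertex[OF fT'] that by blast
  have "(\<Sum>b\<in>vertices T'. bary T b x) = (\<Sum>b\<in>?c. bary T b x)"
    by (rule sum.mono_neutral_right[OF finite_vertices[OF fT']]) (use 0 in auto)
  also have "\<dots> = (\<Sum>b\<in>vertices T. bary T b x)"
    by (rule sum.mono_neutral_left[OF finite_vertices[OF fT]]) (use 0 in auto)
  finally have s: "(\<Sum>b\<in>vertices T'. bary T b x) = 1" by (simp only: bary_sum[OF fT])
  have "(\<Sum>b\<in>vertices T'. bary T b x *\<^sub>R b) = (\<Sum>b\<in>?c. bary T b x *\<^sub>R b)"
    by (rule sum.mono_neutral_right[OF finite_vertices[OF fT']]) (use 0 in auto)
  also have "\<dots> = (\<Sum>b\<in>vertices T. bary T b x *\<^sub>R b)"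
    by (rule sum.mono_neutral_left[OF finite_vertices[OF fT]]) (use 0 in auto)
  finally have e: "(\<Sum>b\<in>vertices T'. bary T b x *\<^sub>R b) = x" by (simp only: bary_expansion[OF fT])
  show ?thesis
  proof (cases "a \<in> ?c")
    case True
    then show ?thesis using bary_unique[OF fT' s e, of a] by simp
  next
    case False
    then show ?thesis using 0 00 by simp
  qed
qed

lemma facet_opposite:
  assumes "T \<in> \<T>" "e facet_of T"
  obtains a where "a \<in> vertices T" "e = convex hull (vertices T - {a})" "vertices e = vertices T - {a}"
proof -
  obtain a where a: "a \<in> vertices T" "e = convex hull (vertices T - {a})"
    using simplex_facet_iff[OF full_simplex[OF assms(1)]] assms(2) by blast
  then show thesis using that vertices_hull_subvertices[OF full_simplex[OF assms(1)], of "vertices T - {a}"] by blast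
qed

lemma facet_subset: "T \<in> \<T> \<Longrightarrow> e facet_of T \<Longrightarrow> e \<subseteq> T"
  by (simp add: facet_of_imp_subset)

lemma finite_faces: "finite (faces \<T>)"
proof -
  have "faces \<T> \<subseteq> (\<Union>T\<in>\<T>. (\<lambda>a. convex hull (vertices T - {a})) ` vertices T)"
  proof
    fix e assume "e \<in> faces \<T>"
    then obtain T where T: "T \<in> \<T>" "e facet_of T" unfolding faces_def by blast
    obtain a where "a \<in> vertices T" "e = convex hull (vertices T - {a})"
      by (rule facet_opposite[OF T])
    with T(1) show "e \<in> (\<Union>T\<in>\<T>. (\<lambda>a. convex hull (vertices T - {a})) ` vertices T)"
      by blast
  qed
  then show ?thesis
    using finite_mesh finite_vertices[OF full_simplex] by (meson finite_UN_I finite_imageI finite_subset)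
qed

lemma finite_boundary_faces: "finite (boundary_faces \<T>)"
  using finite_faces by (simp add: boundary_faces_def)

lemma boundary_face_obtain:
  assumes "e \<in> boundary_faces \<T>"
  obtains T a where "T \<in> \<T>" "e facet_of T" "a \<in> vertices T" "e = convex hull (vertices T - {a})"
    "vertices e = vertices T - {a}"
proof -
  obtain T where T: "T \<in> \<T>" "e facet_of T" using assms unfolding boundary_faces_def faces_def by blast
  show thesis by (rule facet_opposite[OF T]) (use that T in blast)
qed

lemma mem_facet_iff:
  assumes "T \<in> \<T>" "a \<in> vertices T"
  shows "x \<in> convex hull (vertices T - {a}) \<longleftrightarrow> (\<forall>b\<in>vertices T - {a}. 0 \<le> bary T b x) \<and> bary T a x = 0"
  using convex_hull_subvertices_iff[OF full_simplex[OF assms(1)], of "vertices T - {a}" x] assms(2) by auto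

lemma rel_interior_facet_iff:
  assumes "T \<in> \<T>" "a \<in> vertices T"
  shows "x \<in> rel_interior (convex hull (vertices T - {a})) \<longleftrightarrow>
    (\<forall>b\<in>vertices T - {a}. 0 < bary T b x) \<and> bary T a x = 0"
  using rel_interior_hull_subvertices_iff[OF full_simplex[OF assms(1)], of "vertices T - {a}" x] assms(2) by auto

text \<open>These values make \<open>1 - N * bary T b\<close> a Crouzeix-Raviart basis function: it
  is 1 at the barycenter of the facet opposite \<open>b\<close> and 0 at the other
  barycenters.\<close>

lemma bary_barycenter:
  assumes T: "T \<in> \<T>" and a: "a \<in> vertices T" and b: "b \<in> vertices T"
  shows "bary T b (barycenter (convex hull (vertices T - {a}))) = (if b = a then 0 else 1 / CARD('n))"
proof -
  note fT = full_simplex[OF T]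
  have V: "{p. p extreme_point_of (convex hull (vertices T - {a}))} = vertices T - {a}"
    using vertices_hull_subvertices[OF fT, of "vertices T - {a}"] by (auto simp: vertices_def)
  have c: "card (vertices T - {a}) = CARD('n)"
    using a simplex_hull_vertices(2)[OF fT] finite_vertices[OF fT] by simp
  let ?u = "\<lambda>v. if v = a then 0 else 1 / real CARD('n)"
  have s: "sum ?u (vertices T) = 1"
  proof -
    have "sum ?u (vertices T) = sum ?u (vertices T - {a})"
      by (rule sum.mono_neutral_right[OF finite_vertices[OF fT]]) auto
    also have "\<dots> = (\<Sum>v\<in>vertices T - {a}. 1 / real CARD('n))" by (rule sum.cong) auto
    also have "\<dots> = 1" using c by simp
    finally show ?thesis .
  qed
  have "barycenter (convex hull (vertices T - {a})) = (\<Sum>v\<in>vertices T - {a}. (1 / real CARD('n)) *\<^sub>R v)"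
    unfolding barycenter_def V c by (simp add: scaleR_sum_right)
  also have "\<dots> = (\<Sum>v\<in>vertices T - {a}. ?u v *\<^sub>R v)" by (rule sum.cong) auto
  also have "\<dots> = (\<Sum>v\<in>vertices T. ?u v *\<^sub>R v)"
    by (rule sum.mono_neutral_left[OF finite_vertices[OF fT]]) auto
  finally have e: "(\<Sum>v\<in>vertices T. ?u v *\<^sub>R v) = barycenter (convex hull (vertices T - {a}))" by simp
  show ?thesis using bary_unique[OF fT s e b] by simp
qed

lemma barycenter_rel_interior:
  assumes T: "T \<in> \<T>" and a: "a \<in> vertices T"
  shows "barycenter (convex hull (vertices T - {a})) \<in> rel_interior (convex hull (vertices T - {a}))"
  unfolding rel_interior_facet_iff[OF assms] using bary_barycenter[OF assms] a by auto

text \<open>Once the facet is shared, the coordinates of the two opposite vertices are affine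
  functions vanishing on the same plane, hence proportional. The factor is negative, so near
  \<open>x\<close> the two elements fill the two half spaces.\<close>

lemma facet_neighbour:
  assumes T: "T \<in> \<T>" "a \<in> vertices T" and x: "x \<in> rel_interior (convex hull (vertices T - {a}))"
    and T': "T' \<in> \<T>" "T' \<noteq> T" "x \<in> T'"
  shows "vertices T - {a} \<subseteq> vertices T'" "\<exists>\<epsilon>>0. ball x \<epsilon> \<subseteq> T \<union> T'"
proof -
  note fT = full_simplex[OF T(1)] and fT' = full_simplex[OF T'(1)]
  have pos: "\<And>b. b \<in> vertices T - {a} \<Longrightarrow> 0 < bary T b x" and z: "bary T a x = 0"
    using x rel_interior_facet_iff[OF T] by auto
  have xT: "x \<in> T" using pos z simplex_mem_iff[OF fT] by (metis Diff_iff empty_iff insert_iff less_eq_real_def)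
  have "x \<in> convex hull (vertices T \<inter> vertices T')" using xT T' mesh_Int_hull[OF T(1) T'(1)] by blast
  then have "\<forall>b\<in>vertices T - vertices T'. bary T b x = 0"
    using convex_hull_subvertices_iff[OF fT, of "vertices T \<inter> vertices T'"] by blast
  then show sub: "vertices T - {a} \<subseteq> vertices T'" using pos by force
  have aT': "a \<notin> vertices T'"
    using sub mesh_eq_if_vertices_subset[OF T(1) T'(1)] T'(2) by auto
  have "\<exists>a'. vertices T' = insert a' (vertices T - {a})"
  proof -
    have "card (vertices T' - (vertices T - {a})) = 1"
      using sub T(2) simplex_hull_vertices(2)[OF fT] simplex_hull_vertices(2)[OF fT'] finite_vertices[OF fT]
      by (subst card_Diff_subset) auto
    then obtain a' where "vertices T' - (vertices T - {a}) = {a'}" by (meson card_1_singletonE)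
    then show ?thesis using sub by blast
  qed
  then obtain a' where a': "vertices T' = insert a' (vertices T - {a})" by blast
  have a'T: "a' \<notin> vertices T - {a}"
    using a' aT' simplex_hull_vertices(2)[OF fT] simplex_hull_vertices(2)[OF fT'] T(2) finite_vertices[OF fT]
    by (metis add_implies_diff card_Diff_singleton insert_absorb n_not_Suc_n plus_1_eq_Suc add.commute)
  define k where "k = bary T' a' a"
  have k: "bary T' a' y = k * bary T a y" for y
  proof -
    have "bary T' a' y = (\<Sum>v\<in>vertices T. bary T v y * bary T' a' v)"
      unfolding bary_def[of T' a'] by (rule affine_function_via_bary[OF fT])
    also have "\<dots> = (\<Sum>v\<in>vertices T. if v = a then bary T a y * k else 0)"
      by (rule sum.cong) (use a' a'T in \<open>auto simp: k_def bary_vertex[OF fT']\<close>)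
    also have "\<dots> = k * bary T a y" using T(2) finite_vertices[OF fT] by simp
    finally show ?thesis .
  qed
  have pos': "0 < bary T' b x" if "b \<in> vertices T - {a}" for b
    using pos[OF that] bary_agree[OF T(1) xT T'(1,3)] by simp
  obtain \<epsilon>1 where \<epsilon>1: "\<epsilon>1 > 0" "\<forall>y\<in>ball x \<epsilon>1. \<forall>b\<in>vertices T - {a}. 0 < bary T b y"
    using eventually_bary_pos[of "vertices T - {a}" T x] finite_vertices[OF fT] pos by auto
  obtain \<epsilon>2 where \<epsilon>2: "\<epsilon>2 > 0" "\<forall>y\<in>ball x \<epsilon>2. \<forall>b\<in>vertices T - {a}. 0 < bary T' b y"
    using eventually_bary_pos[of "vertices T - {a}" T' x] finite_vertices[OF fT] pos' by auto
  define \<epsilon> where "\<epsilon> = min \<epsilon>1 \<epsilon>2"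
  have \<epsilon>: "\<epsilon> > 0" using \<epsilon>1 \<epsilon>2 by (simp add: \<epsilon>_def)
  \<comment> \<open>Otherwise an interior point of \<open>T\<close> close to \<open>x\<close> would
    have nonnegative coordinates in \<open>T'\<close> as well, and the interiors would
    overlap.\<close>
  have "k < 0"
  proof (rule ccontr)
    assume "\<not> k < 0"
    have "x \<in> closure (interior T)" using closure_interior_simplex[OF fT] xT by simp
    then obtain y where y: "y \<in> interior T" "dist y x < \<epsilon>" using \<epsilon> closure_approachable by blast
    have "0 < bary T a y" using y interior_simplex_iff[OF fT] T(2) by blast
    then have "0 \<le> bary T' a' y" using k \<open>\<not> k < 0\<close> by simp
    moreover have "\<forall>b\<in>vertices T - {a}. 0 < bary T' b y"
      using \<epsilon>2(2) y(2) by (simp add: \<epsilon>_def dist_commute)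
    ultimately have "y \<in> T'" using simplex_mem_iff[OF fT'] a' by (metis insert_iff less_eq_real_def)
    then show False using mesh_interior_Int[OF T(1) T'(1)] T'(2) y(1) by blast
  qed
  have "ball x \<epsilon> \<subseteq> T \<union> T'"
  proof
    fix y assume y: "y \<in> ball x \<epsilon>"
    then have 1: "\<forall>b\<in>vertices T - {a}. 0 < bary T b y" and 2: "\<forall>b\<in>vertices T - {a}. 0 < bary T' b y"
      using \<epsilon>1(2) \<epsilon>2(2) by (simp_all add: \<epsilon>_def)
    show "y \<in> T \<union> T'"
    proof (cases "0 \<le> bary T a y")
      case True
      then have "y \<in> T" using 1 simplex_mem_iff[OF fT] by (metis Diff_iff empty_iff insert_iff less_eq_real_def)
      then show ?thesis by blast
    next
      case False
      then have "0 \<le> bary T' a' y" using k \<open>k < 0\<close> by (simp add: mult_nonpos_nonpos)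
      then have "y \<in> T'" using 2 simplex_mem_iff[OF fT'] a' by (metis insert_iff less_eq_real_def)
      then show ?thesis by blast
    qed
  qed
  then show "\<exists>\<epsilon>>0. ball x \<epsilon> \<subseteq> T \<union> T'" using \<epsilon> by blast
qed

text \<open>Near \<open>x\<close> the other coordinates stay positive and no other element is
  present, so a single coordinate decides membership in the union.\<close>

lemma half_ball:
  assumes T: "T \<in> \<T>" "a \<in> vertices T" and x: "x \<in> rel_interior (convex hull (vertices T - {a}))"
    and only: "\<And>T'. T' \<in> \<T> \<Longrightarrow> x \<in> T' \<Longrightarrow> T' = T"
  shows "\<exists>\<epsilon>>0. \<forall>y\<in>ball x \<epsilon>. (y \<in> \<Union>\<T> \<longleftrightarrow> 0 \<le> bary T a y) \<and> (y \<in> mesh_domain \<T> \<longleftrightarrow> 0 < bary T a y)"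
proof -
  note fT = full_simplex[OF T(1)]
  have pos: "\<And>b. b \<in> vertices T - {a} \<Longrightarrow> 0 < bary T b x" and z: "bary T a x = 0"
    using x rel_interior_facet_iff[OF T] by auto
  obtain \<epsilon>1 where \<epsilon>1: "\<epsilon>1 > 0" "\<forall>y\<in>ball x \<epsilon>1. \<forall>b\<in>vertices T - {a}. 0 < bary T b y"
    using eventually_bary_pos[of "vertices T - {a}" T x] finite_vertices[OF fT] pos by auto
  have "closed (\<Union>(\<T> - {T}))"
    using finite_mesh full_simplex by (intro closed_Union) (auto intro: closed_simplex)
  moreover have "x \<notin> \<Union>(\<T> - {T})" using only by blast
  ultimately obtain \<epsilon>2 where \<epsilon>2: "\<epsilon>2 > 0" "ball x \<epsilon>2 \<subseteq> - \<Union>(\<T> - {T})"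
    using openE[of "- \<Union>(\<T> - {T})" x] by auto
  define \<epsilon> where "\<epsilon> = min \<epsilon>1 \<epsilon>2"
  have mem: "y \<in> \<Union>\<T> \<longleftrightarrow> 0 \<le> bary T a y" if y: "y \<in> ball x \<epsilon>" for y
  proof -
    have "y \<in> \<Union>\<T> \<longleftrightarrow> y \<in> T" using \<epsilon>2(2) y T(1) by (auto simp: \<epsilon>_def)
    also have "\<dots> \<longleftrightarrow> 0 \<le> bary T a y"
      using \<epsilon>1(2) y simplex_mem_iff[OF fT, of y] T(2)
      by (metis Diff_iff \<epsilon>_def empty_iff insert_iff less_eq_real_def mem_ball min_less_iff_conj)
    finally show ?thesis .
  qed
  have "y \<in> mesh_domain \<T> \<longleftrightarrow> 0 < bary T a y" if y: "y \<in> ball x \<epsilon>" for y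
  proof
    assume yd: "y \<in> mesh_domain \<T>"
    show "0 < bary T a y"
    proof (rule ccontr)
      assume n: "\<not> 0 < bary T a y"
      have "open (ball x \<epsilon> \<inter> mesh_domain \<T>)" using open_mesh_domain by blast
      then obtain \<delta> where \<delta>: "\<delta> > 0" "ball y \<delta> \<subseteq> ball x \<epsilon> \<inter> mesh_domain \<T>"
        using y yd openE by blast
      let ?g = "bary_grad T a"
      have g: "norm ?g > 0" using bary_grad_nonzero[OF fT T(2)] by simp
      \<comment> \<open>A point with coordinate at most 0 is not interior to the union: a small step
        against the gradient makes the coordinate negative.\<close>
      let ?w = "y - (\<delta> / (2 * norm ?g)) *\<^sub>R ?g"
      have w: "?w \<in> ball y \<delta>" using \<delta>(1) g by (simp add: dist_norm)
      have "bary T a ?w - bary T a y = ?g \<bullet> (?w - y)" by (rule bary_diff)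
      also have "\<dots> = - (\<delta> / (2 * norm ?g)) * (norm ?g)\<^sup>2" by (simp add: power2_norm_eq_inner)
      also have "\<dots> < 0" using \<delta>(1) g by simp
      finally have "bary T a ?w < 0" using n by linarith
      moreover have "?w \<in> \<Union>\<T>" "?w \<in> ball x \<epsilon>"
        using w \<delta>(2) interior_subset unfolding mesh_domain_def by blast+
      ultimately show False using mem by force
    qed
  next
    assume p: "0 < bary T a y"
    have "y \<in> interior T"
      unfolding interior_simplex_iff[OF fT] using p \<epsilon>1(2) y by (auto simp: \<epsilon>_def)
    then show "y \<in> mesh_domain \<T>" using interior_subset_mesh_domain[OF T(1)] by blast
  qed
  moreover have "\<epsilon> > 0" using \<epsilon>1 \<epsilon>2 by (simp add: \<epsilon>_def)
  ultimately show ?thesis using mem by blast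
qed

lemma boundary_face_only:
  assumes T: "T \<in> \<T>" "a \<in> vertices T" and e: "convex hull (vertices T - {a}) \<in> boundary_faces \<T>"
    and x: "x \<in> rel_interior (convex hull (vertices T - {a}))" and T': "T' \<in> \<T>" "x \<in> T'"
  shows "T' = T"
proof (rule ccontr)
  assume "T' \<noteq> T"
  then obtain \<epsilon> where "\<epsilon> > 0" "ball x \<epsilon> \<subseteq> T \<union> T'" using facet_neighbour(2)[OF T x T'(1) _ T'(2)] by blast
  then have "x \<in> mesh_domain \<T>"
    unfolding mesh_domain_def using T T' by (auto simp: mem_interior intro!: exI[of _ \<epsilon>])
  moreover have "x \<in> mesh_boundary \<T>"
    using e x rel_interior_subset by (auto simp: boundary_faces_def)
  ultimately show False unfolding mesh_boundary_eq by blast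
qed

text \<open>Being the only element carries over from \<open>x\<close> to the whole relative
  interior: a second element at any such point would contain the full facet, and with it
  \<open>x\<close>.\<close>

lemma boundary_faceI:
  assumes T: "T \<in> \<T>" "a \<in> vertices T" and x: "x \<in> rel_interior (convex hull (vertices T - {a}))"
    and only: "\<And>T'. T' \<in> \<T> \<Longrightarrow> x \<in> T' \<Longrightarrow> T' = T"
  shows "convex hull (vertices T - {a}) \<in> boundary_faces \<T>"
proof -
  let ?e = "convex hull (vertices T - {a})"
  note fT = full_simplex[OF T(1)]
  have xe: "x \<in> ?e" using x rel_interior_subset by blast
  have "rel_interior ?e \<subseteq> mesh_boundary \<T>"
  proof
    fix y assume y: "y \<in> rel_interior ?e"
    have only': "T' = T" if T': "T' \<in> \<T>" "y \<in> T'" for T'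
    proof (rule ccontr)
      assume ne: "T' \<noteq> T"
      have "vertices T - {a} \<subseteq> vertices T'" using facet_neighbour(1)[OF T y T'(1) ne T'(2)] .
      then have "?e \<subseteq> T'" using simplex_hull_vertices(3)[OF full_simplex[OF T'(1)]] hull_mono by metis
      then show False using only[OF T'(1)] xe ne by blast
    qed
    obtain \<epsilon> where "\<epsilon> > 0" "\<forall>w\<in>ball y \<epsilon>. (w \<in> \<Union>\<T> \<longleftrightarrow> 0 \<le> bary T a w) \<and> (w \<in> mesh_domain \<T> \<longleftrightarrow> 0 < bary T a w)"
      using half_ball[OF T y only'] by blast
    moreover have "bary T a y = 0" using y rel_interior_facet_iff[OF T] by blast
    ultimately show "y \<in> mesh_boundary \<T>" unfolding mesh_boundary_eq
      by (metis DiffI centre_in_ball less_irrefl order_refl)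
  qed
  then have "closure (rel_interior ?e) \<subseteq> mesh_boundary \<T>"
    by (rule closure_minimal) (simp add: mesh_boundary_def)
  moreover have "closure (rel_interior ?e) = closure ?e"
    by (rule convex_closure_rel_interior) simp
  ultimately have "?e \<subseteq> mesh_boundary \<T>" using closure_subset by blast
  moreover have "?e facet_of T" using simplex_facet_iff[OF fT] T(2) by blast
  ultimately show ?thesis using T(1) by (auto simp: boundary_faces_def faces_def)
qed

text \<open>A priori the frontier could have points that lie on lower-dimensional faces only. Near
  such a point a segment in general position leaves the union through the relative interior of a
  facet, and this facet is then a boundary face close to the point.\<close>

lemma mesh_boundary_eq_Union: "mesh_boundary \<T> = \<Union>(boundary_faces \<T>)"
proof
  show "\<Union>(boundary_faces \<T>) \<subseteq> mesh_boundary \<T>" by (auto simp: boundary_faces_def)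
  show "mesh_boundary \<T> \<subseteq> \<Union>(boundary_faces \<T>)"
  proof
    fix x assume x: "x \<in> mesh_boundary \<T>"
    show "x \<in> \<Union>(boundary_faces \<T>)"
    proof (rule ccontr)
      assume nx: "x \<notin> \<Union>(boundary_faces \<T>)"
      have "closed e" if e: "e \<in> boundary_faces \<T>" for e
        by (rule boundary_face_obtain[OF e])
          (simp add: compact_imp_closed finite_imp_compact_convex_hull finite_vertices[OF full_simplex])
      then have "closed (\<Union>(boundary_faces \<T>))" using finite_boundary_faces by (intro closed_Union) auto
      then obtain \<epsilon> where \<epsilon>: "\<epsilon> > 0" "ball x \<epsilon> \<subseteq> - \<Union>(boundary_faces \<T>)"
        using openE[of "- \<Union>(boundary_faces \<T>)" x] nx by auto
      have "x \<in> \<Union>\<T>" "x \<notin> interior (\<Union>\<T>)" using x unfolding mesh_boundary_eq mesh_domain_def by auto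
      then obtain z where z: "z \<in> ball x \<epsilon>" "z \<notin> \<Union>\<T>" using \<epsilon>(1) unfolding mem_interior by blast
      obtain T0 where T0: "T0 \<in> \<T>" "x \<in> T0" using \<open>x \<in> \<Union>\<T>\<close> by blast
      note f0 = full_simplex[OF T0(1)]
      have "x \<in> closure (interior T0)" using closure_interior_simplex[OF f0] T0(2) by simp
      then have ne: "interior T0 \<inter> ball x \<epsilon> \<noteq> {}"
        using \<epsilon>(1) by (metis Int_commute centre_in_ball closure_iff_nhds_not_empty interior_open interior_subset open_ball open_Int_closure_eq_empty disjoint_iff)
      \<comment> \<open>For \<open>y\<close> outside these null sets the segment from
        \<open>y\<close> to \<open>z\<close> misses every face of codimension 2.\<close>
      let ?N = "\<Union>T\<in>\<T>. \<Union>a\<in>vertices T. \<Union>b\<in>vertices T - {a}. affine hull (insert z (vertices T - {a, b}))"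
      have "negligible ?N"
      proof (intro negligible_UN_finite)
        fix T a b assume T: "T \<in> \<T>" and a: "a \<in> vertices T" and b: "b \<in> vertices T - {a}"
        note fT = full_simplex[OF T]
        have "card (vertices T - {a, b}) = CARD('n) - 1"
          using a b simplex_hull_vertices(2)[OF fT] finite_vertices[OF fT]
          by (subst card_Diff_subset) auto
        then have "card (insert z (vertices T - {a, b})) \<le> CARD('n)"
          using dim_ge_2 card_insert_le_m1[of "CARD('n)" "vertices T - {a, b}" z] by simp
        then show "negligible (affine hull (insert z (vertices T - {a, b})))"
          using finite_vertices[OF fT]
          by (subst negligible_convex_interior) (auto intro!: empty_interior_affine_hull simp: affine_imp_convex)
      qed (auto simp: finite_mesh finite_vertices[OF full_simplex])
      then have "\<not> interior T0 \<inter> ball x \<epsilon> \<subseteq> ?N"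
        using ne open_not_negligible[of "interior T0 \<inter> ball x \<epsilon>"] negligible_subset by blast
      then obtain y where y: "y \<in> interior T0" "y \<in> ball x \<epsilon>" "y \<notin> ?N" by blast
      define f where "f t = y + t *\<^sub>R (z - y)" for t :: real
      have fc: "continuous_on {0..1} f" unfolding f_def by (intro continuous_intros)
      have fball: "f t \<in> ball x \<epsilon>" if "t \<in> {0..1}" for t
      proof -
        have "f t = (1 - t) *\<^sub>R y + t *\<^sub>R z" by (simp add: f_def algebra_simps)
        then show ?thesis using convexD[OF convex_ball[of x \<epsilon>] y(2) z(1), of "1 - t" t] that by auto
      qed
      let ?A = "{t \<in> {0..1}. f t \<in> \<Union>\<T>}"
      have Acl: "compact ?A"
      proof -
        have "closed ({0..1} \<inter> f -` (\<Union>\<T>))"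
          using continuous_on_closed_vimage[of "{0..1}" f] closed_Union_mesh fc by (metis closed_atLeastAtMost inf_commute)
        moreover have "?A = {0..1} \<inter> f -` (\<Union>\<T>)" by auto
        ultimately show ?thesis
          by (metis (no_types) bounded_subset bounded_closed_interval compact_eq_bounded_closed inf_le1)
      qed
      have "0 \<in> ?A" using y(1) T0(1) interior_subset by (auto simp: f_def)
      \<comment> \<open>The last parameter in the union: the segment stays outside beyond it, so
        \<open>f s\<close> is not interior to the union.\<close>
      then obtain s where s: "s \<in> ?A" "\<And>t. t \<in> ?A \<Longrightarrow> t \<le> s"
        using compact_attains_sup[OF Acl] by blast
      have s1: "s < 1"
      proof -
        have "f 1 = z" by (simp add: f_def)
        then have "s \<noteq> 1" using s(1) z(2) by auto
        then show ?thesis using s(1) by simp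
      qed
      define w where "w = f s"
      have wz: "w \<noteq> z" using s(1) z(2) by (auto simp: w_def)
      obtain T where T: "T \<in> \<T>" "w \<in> T" using s(1) by (auto simp: w_def)
      note fT = full_simplex[OF T(1)]
      have wint: "w \<notin> interior (\<Union>\<T>)"
      proof
        assume "w \<in> interior (\<Union>\<T>)"
        then obtain \<delta> where \<delta>: "\<delta> > 0" "ball w \<delta> \<subseteq> \<Union>\<T>" by (auto simp: mem_interior)
        have zy: "norm (z - y) > 0" using z(2) y(1) T0(1) interior_subset by auto
        define t where "t = min 1 (s + \<delta> / (2 * norm (z - y)))"
        have ts: "s < t" "t \<le> 1" using s1 \<delta>(1) zy by (auto simp: t_def)
        have "f t - w = (t - s) *\<^sub>R (z - y)" by (simp add: f_def w_def algebra_simps)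
        then have "norm (f t - w) = (t - s) * norm (z - y)" using ts by simp
        also have "\<dots> \<le> \<delta> / (2 * norm (z - y)) * norm (z - y)"
          using zy by (intro mult_right_mono) (auto simp: t_def)
        also have "\<dots> < \<delta>" using zy \<delta>(1) by simp
        finally have "f t \<in> ball w \<delta>" by (simp add: dist_norm norm_minus_commute)
        then have "t \<in> ?A" using \<delta>(2) ts s(1) by auto
        from s(2)[OF this] ts show False by simp
      qed
      have "w \<notin> interior T" using wint T(1) by (meson Union_upper interior_mono subsetD)
      then obtain a where a: "a \<in> vertices T" "bary T a w \<le> 0"
        using interior_simplex_iff[OF fT] by (meson not_less)
      then have a0: "bary T a w = 0" using T(2) simplex_mem_iff[OF fT] by (meson order_antisym)
      have "0 < bary T b w" if b: "b \<in> vertices T - {a}" for b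
      proof (rule ccontr)
        assume "\<not> 0 < bary T b w"
        then have b0: "bary T b w = 0" using T(2) simplex_mem_iff[OF fT] b by force
        have "w \<in> convex hull (vertices T - {a, b})"
          unfolding convex_hull_subvertices_iff[OF fT Diff_subset]
          using a0 b0 a(1) T(2) simplex_mem_iff[OF fT] by auto
        then have w: "w \<in> affine hull (insert z (vertices T - {a, b}))" (is "_ \<in> ?H")
          using convex_hull_subset_affine_hull hull_mono by (metis (no_types, lifting) subset_insertI subsetD)
        have "z \<in> ?H" by (simp add: hull_inc)
        have "y = (1 / (1 - s)) *\<^sub>R w + (1 - 1 / (1 - s)) *\<^sub>R z"
        proof -
          have "w = (1 - s) *\<^sub>R y + s *\<^sub>R z" by (simp add: w_def f_def algebra_simps)
          moreover have "1 - 1 / (1 - s) = - (s / (1 - s))" using s1 by (simp add: field_simps)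
          ultimately show ?thesis using s1 by (simp add: scaleR_add_right)
        qed
        moreover have "\<dots> \<in> ?H"
          by (rule mem_affine[OF affine_affine_hull w \<open>z \<in> ?H\<close>]) simp
        ultimately have "y \<in> ?H" by simp
        then show False using y(3) T(1) a(1) b by blast
      qed
      then have wr: "w \<in> rel_interior (convex hull (vertices T - {a}))"
        using rel_interior_facet_iff[OF T(1) a(1)] a0 by blast
      have "T' = T" if T': "T' \<in> \<T>" "w \<in> T'" for T'
      proof (rule ccontr)
        assume "T' \<noteq> T"
        then obtain \<delta> where "\<delta> > 0" "ball w \<delta> \<subseteq> T \<union> T'"
          using facet_neighbour(2)[OF T(1) a(1) wr T'(1) _ T'(2)] by blast
        then have "ball w \<delta> \<subseteq> \<Union>\<T>" using T(1) T'(1) by blast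
        then show False using wint \<open>\<delta> > 0\<close> by (auto simp: mem_interior)
      qed
      then have "convex hull (vertices T - {a}) \<in> boundary_faces \<T>"
        using boundary_faceI[OF T(1) a(1) wr] by blast
      moreover have "w \<in> convex hull (vertices T - {a})" using wr rel_interior_subset by blast
      moreover have "w \<in> ball x \<epsilon>" using fball s(1) by (auto simp: w_def)
      ultimately show False using \<epsilon>(2) by blast
    qed
  qed
qed

end


section \<open>Outer normals and the averaging operator\<close>

context simplicial_mesh
begin

text \<open>In the description of \<open>outer_normal\<close>, orthogonality to the facet leaves
  only multiples of the gradient, the one-sided condition fixes the sign and the norm fixes the
  size. This is why the definite description denotes something.\<close>

lemma
  assumes T: "T \<in> \<T>" "a \<in> vertices T" and e: "e = convex hull (vertices T - {a})" "e \<in> boundary_faces \<T>"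
  shows outer_normal_eq: "outer_normal \<T> e = - (1 / norm (bary_grad T a)) *\<^sub>R bary_grad T a"
    and face_orthogonal: "\<And>x y. x \<in> e \<Longrightarrow> y \<in> e \<Longrightarrow> outer_normal \<T> e \<bullet> (x - y) = 0"
    and boundary_face_half_ball: "\<And>x. x \<in> rel_interior e \<Longrightarrow>
      \<exists>\<epsilon>>0. \<forall>y\<in>ball x \<epsilon>. (y \<in> \<Union>\<T> \<longleftrightarrow> outer_normal \<T> e \<bullet> (y - x) \<le> 0) \<and>
        (y \<in> mesh_domain \<T> \<longleftrightarrow> outer_normal \<T> e \<bullet> (y - x) < 0)"
proof -
  note fT = full_simplex[OF T(1)]
  define g where "g = bary_grad T a"
  have gpos: "norm g > 0" using bary_grad_nonzero[OF fT T(2)] by (simp add: g_def)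
  define n where "n = - (1 / norm g) *\<^sub>R g"
  have n1: "norm n = 1" using gpos by (simp add: n_def)
  have nb: "n \<bullet> (y - x) = - (1 / norm g) * (bary T a y - bary T a x)" for x y
    by (simp add: n_def g_def bary_diff)
  have e0: "bary T a x = 0" if "x \<in> e" for x
    using that mem_facet_iff[OF T] e(1) by blast
  have orth: "n \<bullet> (x - y) = 0" if "x \<in> e" "y \<in> e" for x y using that e0 by (simp add: nb)
  have half: "\<exists>\<epsilon>>0. \<forall>y\<in>ball x \<epsilon>. (y \<in> \<Union>\<T> \<longleftrightarrow> n \<bullet> (y - x) \<le> 0) \<and>
        (y \<in> mesh_domain \<T> \<longleftrightarrow> n \<bullet> (y - x) < 0)" if x: "x \<in> rel_interior e" for x
  proof -
    have "x \<in> e" using x rel_interior_subset by blast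
    then have x0: "bary T a x = 0" by (rule e0)
    have "n \<bullet> (y - x) \<le> 0 \<longleftrightarrow> 0 \<le> bary T a y" "n \<bullet> (y - x) < 0 \<longleftrightarrow> 0 < bary T a y" for y
      using gpos x0 by (auto simp: nb field_simps zero_le_mult_iff zero_less_mult_iff)
    then show ?thesis
      using half_ball[OF T, of x] boundary_face_only[OF T, of x] x e by auto
  qed
  have ev: "\<forall>\<^sub>F t in at_right 0. x - t *\<^sub>R n \<in> mesh_domain \<T> \<and> x + t *\<^sub>R n \<notin> closure (mesh_domain \<T>)"
    if x: "x \<in> rel_interior e" for x
  proof -
    obtain \<epsilon> where \<epsilon>: "\<epsilon> > 0" "\<forall>y\<in>ball x \<epsilon>. (y \<in> \<Union>\<T> \<longleftrightarrow> n \<bullet> (y - x) \<le> 0) \<and>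
        (y \<in> mesh_domain \<T> \<longleftrightarrow> n \<bullet> (y - x) < 0)" using half[OF x] by blast
    have nn: "n \<bullet> n = 1" using n1 by (simp add: dot_square_norm)
    have "x - t *\<^sub>R n \<in> mesh_domain \<T> \<and> x + t *\<^sub>R n \<notin> closure (mesh_domain \<T>)" if t: "0 < t" "t < \<epsilon>" for t
    proof -
      have b: "x - t *\<^sub>R n \<in> ball x \<epsilon>" "x + t *\<^sub>R n \<in> ball x \<epsilon>" using t n1 by (auto simp: dist_norm)
      have "x - t *\<^sub>R n \<in> mesh_domain \<T>" using \<epsilon>(2) b(1) t nn by auto
      moreover have "x + t *\<^sub>R n \<notin> \<Union>\<T>" using \<epsilon>(2) b(2) t nn by auto
      ultimately show ?thesis unfolding closure_mesh_domain by blast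
    qed
    then show ?thesis unfolding eventually_at_right_field using \<epsilon>(1) by blast
  qed
  have nO: "outer_normal \<T> e = n"
    unfolding outer_normal_def
  proof (rule the_equality)
    show "norm n = 1 \<and> (\<forall>x\<in>e. \<forall>y\<in>e. n \<bullet> (x - y) = 0) \<and> (\<forall>x\<in>rel_interior e.
      \<forall>\<^sub>F t in at_right 0. x - t *\<^sub>R n \<in> mesh_domain \<T> \<and> x + t *\<^sub>R n \<notin> closure (mesh_domain \<T>))"
      using n1 orth ev by blast
  next
    fix m assume m: "norm m = 1 \<and> (\<forall>x\<in>e. \<forall>y\<in>e. m \<bullet> (x - y) = 0) \<and> (\<forall>x\<in>rel_interior e.
      \<forall>\<^sub>F t in at_right 0. x - t *\<^sub>R m \<in> mesh_domain \<T> \<and> x + t *\<^sub>R m \<notin> closure (mesh_domain \<T>))"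
    let ?x = "barycenter e"
    have xr: "?x \<in> rel_interior e" using barycenter_rel_interior[OF T] e(1) by simp
    then have xe: "?x \<in> e" using rel_interior_subset by blast
    have ve: "v \<in> e" if "v \<in> vertices T - {a}" for v using that e(1) hull_inc by metis
    \<comment> \<open>An affine function vanishing on the facet is the coordinate of the opposite
      vertex times its value there.\<close>
    define \<kappa> where "\<kappa> = m \<bullet> (a - ?x)"
    have mk: "m \<bullet> (y - ?x) = bary T a y * \<kappa>" for y
    proof -
      have "m \<bullet> y + - (m \<bullet> ?x) = (\<Sum>v\<in>vertices T. bary T v y * (m \<bullet> v + - (m \<bullet> ?x)))"
        by (rule affine_function_via_bary[OF fT])
      also have "\<dots> = (\<Sum>v\<in>vertices T. if v = a then bary T a y * \<kappa> else 0)"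
      proof (rule sum.cong[OF refl])
        fix v assume v: "v \<in> vertices T"
        show "bary T v y * (m \<bullet> v + - (m \<bullet> ?x)) = (if v = a then bary T a y * \<kappa> else 0)"
        proof (cases "v = a")
          case False
          then have "m \<bullet> (v - ?x) = 0" using m ve v xe by blast
          then show ?thesis using False by (simp add: inner_diff_right)
        qed (simp add: \<kappa>_def inner_diff_right)
      qed
      also have "\<dots> = bary T a y * \<kappa>" using T(2) finite_vertices[OF fT] by simp
      finally show ?thesis by (simp add: inner_diff_right)
    qed
    have x0: "bary T a ?x = 0" using e0 xe by blast
    have "m = \<kappa> *\<^sub>R g"
    proof (rule vector_eq_rdot[THEN iffD1], intro allI)
      fix z
      have "m \<bullet> (?x + z - ?x) = (bary T a (?x + z) - bary T a ?x) * \<kappa>" unfolding mk x0 by simp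
      then show "m \<bullet> z = (\<kappa> *\<^sub>R g) \<bullet> z" by (simp add: bary_diff g_def)
    qed
    moreover have "\<kappa> < 0"
    proof (rule ccontr)
      assume "\<not> \<kappa> < 0"
      have "\<forall>\<^sub>F t in at_right (0::real). ?x - t *\<^sub>R m \<in> mesh_domain \<T>"
        using m xr by (auto elim: eventually_mono)
      moreover obtain \<epsilon> where \<epsilon>: "\<epsilon> > 0" "\<forall>y\<in>ball ?x \<epsilon>. (y \<in> mesh_domain \<T> \<longleftrightarrow> n \<bullet> (y - ?x) < 0)"
        using half[OF xr] by blast
      have "\<forall>\<^sub>F t in at_right (0::real). t < \<epsilon> \<and> 0 < t"
        using \<epsilon>(1) by (auto simp: eventually_at_right_field intro!: exI[of _ \<epsilon>])
      ultimately have "\<forall>\<^sub>F t in at_right (0::real). ?x - t *\<^sub>R m \<in> mesh_domain \<T> \<and> t < \<epsilon> \<and> 0 < t"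
        by eventually_elim auto
      then have "\<exists>t>0. t < \<epsilon> \<and> ?x - t *\<^sub>R m \<in> mesh_domain \<T>"
        by (metis (mono_tags, lifting) eventually_at_right_field dense)
      then obtain t where t: "t > 0" "t < \<epsilon>" "?x - t *\<^sub>R m \<in> mesh_domain \<T>" by blast
      have "?x - t *\<^sub>R m \<in> ball ?x \<epsilon>" using t m by (simp add: dist_norm)
      then have "n \<bullet> (?x - t *\<^sub>R m - ?x) < 0" using \<epsilon>(2) t(3) by blast
      then have "- t * (n \<bullet> m) < 0" by simp
      moreover have "n \<bullet> m = - (1 / norm g) * \<kappa> * (norm g)\<^sup>2"
        unfolding \<open>m = \<kappa> *\<^sub>R g\<close> n_def by (simp add: power2_norm_eq_inner)
      then have "n \<bullet> m \<le> 0" using \<open>\<not> \<kappa> < 0\<close> gpos by (simp add: mult_nonneg_nonneg)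
      ultimately show False using t(1) by (simp add: zero_less_mult_iff)
    qed
    moreover have "\<bar>\<kappa>\<bar> * norm g = 1" using m \<open>m = \<kappa> *\<^sub>R g\<close> by simp
    ultimately have "\<kappa> = - (1 / norm g)" using gpos by (simp add: field_simps)
    then show "m = n" using \<open>m = \<kappa> *\<^sub>R g\<close> n_def by simp
  qed
  show "outer_normal \<T> e = - (1 / norm (bary_grad T a)) *\<^sub>R bary_grad T a"
    using nO by (simp add: n_def g_def)
  show "\<And>x y. x \<in> e \<Longrightarrow> y \<in> e \<Longrightarrow> outer_normal \<T> e \<bullet> (x - y) = 0" using orth nO by simp
  show "\<And>x. x \<in> rel_interior e \<Longrightarrow>
      \<exists>\<epsilon>>0. \<forall>y\<in>ball x \<epsilon>. (y \<in> \<Union>\<T> \<longleftrightarrow> outer_normal \<T> e \<bullet> (y - x) \<le> 0) \<and>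
        (y \<in> mesh_domain \<T> \<longleftrightarrow> outer_normal \<T> e \<bullet> (y - x) < 0)" using half nO by simp
qed

lemma norm_outer_normal:
  assumes "e \<in> boundary_faces \<T>" shows "norm (outer_normal \<T> e) = 1"
proof (rule boundary_face_obtain[OF assms])
  fix T a assume *: "T \<in> \<T>" "a \<in> vertices T" "e = convex hull (vertices T - {a})"
  show ?thesis unfolding outer_normal_eq[OF * assms]
    using bary_grad_nonzero[OF full_simplex[OF *(1)] *(2)] by simp
qed

lemma mesh_vertices_eq: "mesh_vertices \<T> = (\<Union>T\<in>\<T>. vertices T)"
  by (auto simp: mesh_vertices_def vertices_def)

lemma finite_mesh_vertices: "finite (mesh_vertices \<T>)"
  unfolding mesh_vertices_eq using finite_mesh finite_vertices[OF full_simplex] by blast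

lemma boundary_face_compact_convex:
  assumes "e \<in> boundary_faces \<T>"
  shows "compact e" "convex e" "e \<noteq> {}" "barycenter e \<in> rel_interior e" "barycenter e \<in> e"
    "e \<subseteq> mesh_boundary \<T>" "finite (vertices e)" "e = convex hull (vertices e)"
    "vertices e \<subseteq> mesh_vertices \<T> \<inter> mesh_boundary \<T>"
proof -
  obtain T a where *: "T \<in> \<T>" "a \<in> vertices T" "e = convex hull (vertices T - {a})"
      "vertices e = vertices T - {a}"
    by (rule boundary_face_obtain[OF assms])
  note fT = full_simplex[OF *(1)]
  show "compact e" using finite_vertices[OF fT] *(3) by (simp add: finite_imp_compact_convex_hull)
  show "convex e" using *(3) by simp
  show b: "barycenter e \<in> rel_interior e" using barycenter_rel_interior[OF *(1,2)] *(3) by simp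
  then show b': "barycenter e \<in> e" using rel_interior_subset by blast
  then show "e \<noteq> {}" by blast
  show s: "e \<subseteq> mesh_boundary \<T>" using assms by (simp add: boundary_faces_def)
  show "finite (vertices e)" using *(4) finite_vertices[OF fT] by simp
  show h: "e = convex hull (vertices e)" using *(3,4) by simp
  have "vertices e \<subseteq> e" using h hull_subset by metis
  then show "vertices e \<subseteq> mesh_vertices \<T> \<inter> mesh_boundary \<T>"
    using s *(1,4) unfolding mesh_vertices_eq by blast
qed

text \<open>The coordinates of the elements agree at common points and glue to a hat function. It is
  the only candidate, because a member of \<open>Lambda_bar\<close> is determined on each boundary
  face by its values at the vertices.\<close>

lemma nodal_basis_eq:
  assumes p: "p \<in> mesh_vertices \<T> \<inter> mesh_boundary \<T>"
    and x: "x \<in> mesh_boundary \<T>" and T: "T \<in> \<T>" "x \<in> T"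
  shows "nodal_basis \<T> p x = bary T p x"
proof -
  define \<phi> where "\<phi> y = (if y \<in> mesh_boundary \<T> then bary (SOME T. T \<in> \<T> \<and> y \<in> T) p y else 0)" for y
  have \<phi>: "\<phi> y = bary S p y" if "y \<in> mesh_boundary \<T>" "S \<in> \<T>" "y \<in> S" for y S
  proof -
    have "(SOME T. T \<in> \<T> \<and> y \<in> T) \<in> \<T> \<and> y \<in> (SOME T. T \<in> \<T> \<and> y \<in> T)"
      by (rule someI[of _ S]) (use that in blast)
    then have "bary (SOME T. T \<in> \<T> \<and> y \<in> T) p y = bary S p y"
      using bary_agree that by blast
    then show ?thesis using that(1) by (simp only: \<phi>_def if_True)
  qed
  have face: "\<exists>S. S \<in> \<T> \<and> e \<subseteq> S \<and> (\<forall>y\<in>e. \<phi> y = bary S p y)" if e: "e \<in> boundary_faces \<T>" for e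
  proof (rule boundary_face_obtain[OF e])
    fix S assume S: "S \<in> \<T>" "e facet_of S"
    then have "e \<subseteq> S" by (rule facet_subset)
    moreover have "e \<subseteq> mesh_boundary \<T>" using e by (simp add: boundary_faces_def)
    ultimately show ?thesis using S(1) \<phi> by blast
  qed
  have aff: "\<exists>a b. \<forall>y\<in>e. \<phi> y = a \<bullet> y + b" if e: "e \<in> boundary_faces \<T>" for e
    using face[OF e] unfolding bary_def by blast
  have cont: "continuous_on (mesh_boundary \<T>) \<phi>"
  proof -
    have "continuous_on e \<phi>" if e: "e \<in> boundary_faces \<T>" for e
    proof -
      obtain S where "\<forall>y\<in>e. \<phi> y = bary S p y" using face[OF e] by blast
      then show ?thesis using continuous_on_bary[of e S p] continuous_on_cong by metis
    qed
    then have "continuous_on (\<Union>e\<in>boundary_faces \<T>. e) \<phi>"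
      using boundary_face_compact_convex(1)
      by (intro continuous_on_closed_Union finite_boundary_faces compact_imp_closed)
    then show ?thesis unfolding mesh_boundary_eq_Union by simp
  qed
  have val: "\<phi> q = (if q = p then 1 else 0)" if q: "q \<in> mesh_vertices \<T> \<inter> mesh_boundary \<T>" for q
  proof -
    obtain S where S: "S \<in> \<T>" "q \<in> vertices S" using q unfolding mesh_vertices_eq by blast
    then have "\<phi> q = bary S p q"
      using q \<phi> vertices_subset[OF full_simplex[OF S(1)]] by blast
    then show ?thesis using bary_vertex[OF full_simplex[OF S(1)] S(2)] by simp
  qed
  have "nodal_basis \<T> p = \<phi>"
    unfolding nodal_basis_def
  proof (rule the_equality)
    show "\<phi> \<in> Lambda_bar \<T> \<and> \<phi> p = 1 \<and>
     (\<forall>q \<in> mesh_vertices \<T> \<inter> mesh_boundary \<T>. q \<noteq> p \<longrightarrow> \<phi> q = 0) \<and>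
     (\<forall>x. x \<notin> mesh_boundary \<T> \<longrightarrow> \<phi> x = 0)"
      using cont aff val p by (auto simp: Lambda_bar_def \<phi>_def)
  next
    fix \<psi> assume \<psi>: "\<psi> \<in> Lambda_bar \<T> \<and> \<psi> p = 1 \<and>
     (\<forall>q \<in> mesh_vertices \<T> \<inter> mesh_boundary \<T>. q \<noteq> p \<longrightarrow> \<psi> q = 0) \<and>
     (\<forall>x. x \<notin> mesh_boundary \<T> \<longrightarrow> \<psi> x = 0)"
    show "\<psi> = \<phi>"
    proof
      fix y
      show "\<psi> y = \<phi> y"
      proof (cases "y \<in> mesh_boundary \<T>")
        case False
        then show ?thesis using \<psi> by (simp add: \<phi>_def)
      next
        case True
        then obtain e where e: "e \<in> boundary_faces \<T>" "y \<in> e" unfolding mesh_boundary_eq_Union by blast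
        obtain a b where ab: "\<And>z. z \<in> e \<Longrightarrow> \<phi> z = a \<bullet> z + b" using aff[OF e(1)] by blast
        have "\<psi> \<in> Lambda_bar \<T>" using \<psi> by (rule conjunct1)
        then have "\<exists>a b. \<forall>z\<in>e. \<psi> z = a \<bullet> z + b" using e(1) unfolding Lambda_bar_def by simp
        then obtain a' b' where ab': "\<And>z. z \<in> e \<Longrightarrow> \<psi> z = a' \<bullet> z + b'" by blast
        note ce = boundary_face_compact_convex[OF e(1)]
        have ve: "v \<in> e" if "v \<in> vertices e" for v using ce(8) that hull_inc by metis
        have eq: "\<psi> v = \<phi> v" if "v \<in> vertices e" for v
          using val[of v] \<psi> that ce(9) p by (metis subsetD)
        obtain u where u: "sum u (vertices e) = 1" "(\<Sum>v\<in>vertices e. u v *\<^sub>R v) = y"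
          using e(2) ce(7,8) convex_hull_finite[OF ce(7)] by blast
        have comb: "c \<bullet> y + d = (\<Sum>v\<in>vertices e. u v * (c \<bullet> v + d))" for c d
        proof -
          have "c \<bullet> y + d = c \<bullet> (\<Sum>v\<in>vertices e. u v *\<^sub>R v) + d * sum u (vertices e)" using u by simp
          then show ?thesis by (simp add: inner_sum_right sum_distrib_left sum.distrib algebra_simps)
        qed
        have "\<psi> y = (\<Sum>v\<in>vertices e. u v * (a' \<bullet> v + b'))" using ab'[OF e(2)] comb by simp
        also have "\<dots> = (\<Sum>v\<in>vertices e. u v * (a \<bullet> v + b))"
          by (rule sum.cong) (use ab ab' ve eq in auto)
        also have "\<dots> = \<phi> y" using ab[OF e(2)] comb by simp
        finally show ?thesis .
      qed
    qed
  qed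
  then show ?thesis using \<phi>[OF x T] by simp
qed

lemma nodal_basis_partition:
  assumes e: "e \<in> boundary_faces \<T>" "x \<in> e"
  shows "\<And>p. p \<in> mesh_vertices \<T> \<inter> mesh_boundary \<T> \<Longrightarrow> 0 \<le> nodal_basis \<T> p x"
    "\<And>p. p \<in> mesh_vertices \<T> \<inter> mesh_boundary \<T> \<Longrightarrow> nodal_basis \<T> p x \<noteq> 0 \<Longrightarrow> p \<in> e"
    "(\<Sum>p\<in>mesh_vertices \<T> \<inter> mesh_boundary \<T>. nodal_basis \<T> p x) = 1"
proof -
  obtain T a where T: "T \<in> \<T>" "a \<in> vertices T" "e = convex hull (vertices T - {a})"
      "vertices e = vertices T - {a}" "e facet_of T"
    by (rule boundary_face_obtain[OF e(1)])
  note fT = full_simplex[OF T(1)]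
  let ?P = "mesh_vertices \<T> \<inter> mesh_boundary \<T>"
  note ce = boundary_face_compact_convex[OF e(1)]
  have xT: "x \<in> T" using facet_subset[OF T(1,5)] e(2) by blast
  have nb: "nodal_basis \<T> p x = bary T p x" if "p \<in> ?P" for p
    using nodal_basis_eq[OF that _ T(1) xT] ce(6) e(2) by blast
  have b: "bary T p x \<ge> 0" "bary T p x \<noteq> 0 \<Longrightarrow> p \<in> vertices e" for p
    using mem_facet_iff[OF T(1,2), of x] e(2) T(3,4) bary_not_vertex[OF fT, of p x]
    by (metis Diff_iff empty_iff insert_iff order_refl)+
  show "0 \<le> nodal_basis \<T> p x" if "p \<in> ?P" for p using nb[OF that] b by simp
  show "p \<in> e" if "p \<in> ?P" "nodal_basis \<T> p x \<noteq> 0" for p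
    using nb[OF that(1)] b that(2) ce(8) hull_inc by metis
  have "(\<Sum>p\<in>?P. nodal_basis \<T> p x) = (\<Sum>p\<in>?P. bary T p x)" by (rule sum.cong) (use nb in auto)
  also have "\<dots> = (\<Sum>p\<in>vertices e. bary T p x)"
    by (rule sum.mono_neutral_right) (use finite_mesh_vertices ce(9) b in auto)
  also have "\<dots> = (\<Sum>p\<in>vertices T. bary T p x)"
    by (rule sum.mono_neutral_left[OF finite_vertices[OF fT]]) (use T(4) b in auto)
  also have "\<dots> = 1" by (rule bary_sum[OF fT])
  finally show "(\<Sum>p\<in>?P. nodal_basis \<T> p x) = 1" .
qed

text \<open>On \<open>e\<close> all hat functions are coordinates of one and the same element.
  Affinity on each face later yields measurability and boundedness of the integrands.\<close>

lemma boundary_averaging_affine: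
  assumes e: "e \<in> boundary_faces \<T>"
  shows "\<exists>g b. \<forall>x\<in>e. boundary_averaging \<T> \<mu> x = g \<bullet> x + b"
proof -
  obtain T where T: "T \<in> \<T>" "e facet_of T"
    by (rule boundary_face_obtain[OF e])
  let ?P = "mesh_vertices \<T> \<inter> mesh_boundary \<T>"
  define c where "c p = 1 / real (card (faces_at \<T> p)) * (\<Sum>e\<in>faces_at \<T> p. \<mu> (barycenter e))" for p
  have "boundary_averaging \<T> \<mu> x = (\<Sum>p\<in>?P. c p *\<^sub>R bary_grad T p) \<bullet> x + (\<Sum>p\<in>?P. c p * bary_offset T p)"
    if x: "x \<in> e" for x
  proof -
    have "boundary_averaging \<T> \<mu> x = (\<Sum>p\<in>?P. c p * nodal_basis \<T> p x)"
      by (simp add: boundary_averaging_def c_def)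
    also have "\<dots> = (\<Sum>p\<in>?P. c p * bary T p x)"
      using nodal_basis_eq[OF _ _ T(1)] facet_subset[OF T] x boundary_face_compact_convex(6)[OF e]
      by (intro sum.cong refl) (simp add: subset_iff)
    finally show ?thesis by (simp add: bary_def inner_sum_left sum.distrib algebra_simps)
  qed
  then show ?thesis by blast
qed

text \<open>The nodal value at a vertex of \<open>e\<close> averages over faces touching
  \<open>e\<close> there, so it differs from the value on \<open>e\<close> by at most the root of
  the jump sum. Inside \<open>e\<close> only such vertices contribute, in a convex
  combination.\<close>

lemma boundary_averaging_deviation:
  assumes e: "e \<in> boundary_faces \<T>" and x: "x \<in> e"
  shows "(boundary_averaging \<T> \<mu> x - \<mu> (barycenter e))\<^sup>2 \<le>
    (\<Sum>e' | e' \<in> boundary_faces \<T> \<and> e \<inter> e' \<noteq> {}. \<bar>\<mu> (barycenter e) - \<mu> (barycenter e')\<bar>\<^sup>2)" (is "_ \<le> ?J")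
proof -
  let ?P = "mesh_vertices \<T> \<inter> mesh_boundary \<T>"
  define m where "m = \<mu> (barycenter e)"
  define c where "c p = 1 / real (card (faces_at \<T> p)) * (\<Sum>e\<in>faces_at \<T> p. \<mu> (barycenter e))" for p
  have J0: "0 \<le> ?J" by (intro sum_nonneg) simp
  have near: "\<bar>\<mu> (barycenter e') - m\<bar> \<le> sqrt ?J" if "e' \<in> boundary_faces \<T>" "e \<inter> e' \<noteq> {}" for e'
  proof -
    have "\<bar>\<mu> (barycenter e) - \<mu> (barycenter e')\<bar>\<^sup>2 \<le> ?J"
      by (rule member_le_sum[of e' "{e'. e' \<in> boundary_faces \<T> \<and> e \<inter> e' \<noteq> {}}"
            "\<lambda>e'. \<bar>\<mu> (barycenter e) - \<mu> (barycenter e')\<bar>\<^sup>2"]) (use that finite_boundary_faces in auto)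
    from real_sqrt_le_mono[OF this] show ?thesis unfolding m_def
      by (subst abs_minus_commute) (simp only: power2_abs real_sqrt_abs)
  qed
  have c: "\<bar>c p - m\<bar> \<le> sqrt ?J" if p: "p \<in> e" for p
  proof -
    let ?F = "faces_at \<T> p"
    have fin: "finite ?F" using finite_boundary_faces by (simp add: faces_at_def)
    have "e \<in> ?F" using e p by (simp add: faces_at_def)
    then have pos: "0 < real (card ?F)" using fin by (simp add: card_gt_0_iff) blast
    have "c p - m = 1 / real (card ?F) * (\<Sum>e\<in>?F. \<mu> (barycenter e) - m)"
      using pos by (simp add: c_def sum_subtractf field_simps)
    then have "\<bar>c p - m\<bar> = 1 / real (card ?F) * \<bar>\<Sum>e\<in>?F. \<mu> (barycenter e) - m\<bar>"
      using pos by (simp add: abs_mult)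
    also have "\<dots> \<le> 1 / real (card ?F) * (\<Sum>e\<in>?F. sqrt ?J)"
    proof (intro mult_left_mono order_trans[OF sum_abs] sum_mono)
      fix e' assume "e' \<in> ?F"
      then show "\<bar>\<mu> (barycenter e') - m\<bar> \<le> sqrt ?J" using p near by (auto simp: faces_at_def)
    qed simp
    also have "\<dots> = sqrt ?J" using pos by simp
    finally show ?thesis .
  qed
  note nbp = nodal_basis_partition[OF e x]
  have "boundary_averaging \<T> \<mu> x - m = (\<Sum>p\<in>?P. c p * nodal_basis \<T> p x) - m * (\<Sum>p\<in>?P. nodal_basis \<T> p x)"
    by (simp add: boundary_averaging_def c_def nbp(3))
  also have "\<dots> = (\<Sum>p\<in>?P. (c p - m) * nodal_basis \<T> p x)"
    by (simp add: sum_distrib_left sum_subtractf algebra_simps)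
  finally have "\<bar>boundary_averaging \<T> \<mu> x - m\<bar> \<le> (\<Sum>p\<in>?P. \<bar>(c p - m) * nodal_basis \<T> p x\<bar>)"
    using sum_abs by metis
  also have "\<dots> \<le> (\<Sum>p\<in>?P. sqrt ?J * nodal_basis \<T> p x)"
  proof (rule sum_mono)
    fix p assume p: "p \<in> ?P"
    show "\<bar>(c p - m) * nodal_basis \<T> p x\<bar> \<le> sqrt ?J * nodal_basis \<T> p x"
    proof (cases "nodal_basis \<T> p x = 0")
      case False
      then show ?thesis using nbp(1,2)[OF p] c by (simp add: abs_mult mult_right_mono)
    qed simp
  qed
  also have "\<dots> = sqrt ?J" using nbp(3) by (simp flip: sum_distrib_left)
  finally have "\<bar>boundary_averaging \<T> \<mu> x - m\<bar>\<^sup>2 \<le> (sqrt ?J)\<^sup>2" by (intro power_mono) auto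
  then show ?thesis using J0 by (simp add: m_def)
qed

end


section \<open>Quadratic contact of a smooth domain with its tangent planes\<close>

text \<open>For \<open>K > 0\<close> each of the two regions is a ball of radius
  \<open>1 / (2 * K)\<close> tangent to the hyperplane at \<open>q\<close>, cut off at distance
  \<open>r\<close>: an interior and exterior ball condition with \<open>n\<close> pointing
  outward.\<close>

definition two_sided :: "(real^'n) set \<Rightarrow> real \<Rightarrow> real \<Rightarrow> real^'n \<Rightarrow> real^'n \<Rightarrow> bool" where
  "two_sided \<Omega> K r q n \<longleftrightarrow> norm n = 1 \<and>
     (\<forall>y\<in>ball q r. ((y - q) \<bullet> n < - K * (norm (y - q))\<^sup>2 \<longrightarrow> y \<in> \<Omega>) \<and>
                   ((y - q) \<bullet> n > K * (norm (y - q))\<^sup>2 \<longrightarrow> y \<notin> closure \<Omega>))"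

lemma two_sided_mono:
  assumes "two_sided \<Omega> K r q n" "K \<le> K'" "r' \<le> r"
  shows "two_sided \<Omega> K' r' q n"
proof -
  have "K * (norm (y - q))\<^sup>2 \<le> K' * (norm (y - q))\<^sup>2" for y
    using assms(2) by (intro mult_right_mono) auto
  then show ?thesis using assms(1,3) unfolding two_sided_def
    by (smt (verit, ccfv_threshold) mem_ball minus_mult_left)
qed

text \<open>On a compact set the partial derivatives are bounded, the sum of their bounds dominates
  the operator norm, and the mean value inequality applies on the convex set.\<close>

lemma lipschitz_of_continuous_partials:
  fixes f :: "real^'n \<Rightarrow> real"
  assumes diff: "\<And>x. x \<in> S \<Longrightarrow> f differentiable (at x)"
    and cont: "\<And>j. continuous_on S (\<lambda>x. frechet_derivative f (at x) (axis j 1))"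
    and S: "compact S" "convex S"
  shows "\<exists>L\<ge>0. \<forall>x\<in>S. \<forall>y\<in>S. \<bar>f x - f y\<bar> \<le> L * norm (x - y)"
proof -
  have "\<exists>B. \<forall>x\<in>S. \<bar>frechet_derivative f (at x) (axis j 1)\<bar> \<le> B" for j
  proof -
    have "bounded ((\<lambda>x. frechet_derivative f (at x) (axis j 1)) ` S)"
      using compact_continuous_image[OF cont S(1)] compact_imp_bounded by blast
    then show ?thesis unfolding bounded_iff by auto
  qed
  then obtain B where B: "\<And>j x. x \<in> S \<Longrightarrow> \<bar>frechet_derivative f (at x) (axis j 1)\<bar> \<le> B j" by metis
  define L where "L = (\<Sum>j\<in>UNIV. \<bar>B j\<bar>)"
  have L0: "0 \<le> L" by (auto simp: L_def intro: sum_nonneg)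
  have "norm (f x - f y) \<le> L * norm (x - y)" if "x \<in> S" "y \<in> S" for x y
  proof (rule differentiable_bound[OF S(2), of f "\<lambda>x. frechet_derivative f (at x)"])
    fix z assume z: "z \<in> S"
    have hd: "(f has_derivative frechet_derivative f (at z)) (at z)"
      using diff[OF z] frechet_derivative_works by blast
    then show "(f has_derivative frechet_derivative f (at z)) (at z within S)"
      by (rule has_derivative_at_withinI)
    have lin: "linear (frechet_derivative f (at z))" using hd has_derivative_linear by blast
    show "onorm (frechet_derivative f (at z)) \<le> L"
    proof (rule onorm_le)
      fix h :: "real^'n"
      have "frechet_derivative f (at z) h = frechet_derivative f (at z) (\<Sum>j\<in>UNIV. h $ j *\<^sub>R axis j 1)"
        by (simp add: basis_expansion flip: scalar_mult_eq_scaleR)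
      also have "\<dots> = (\<Sum>j\<in>UNIV. h $ j * frechet_derivative f (at z) (axis j 1))"
        by (simp add: linear_sum[OF lin] linear_cmul[OF lin])
      finally have "norm (frechet_derivative f (at z) h) \<le> (\<Sum>j\<in>UNIV. norm (h $ j * frechet_derivative f (at z) (axis j 1)))"
        using norm_sum by metis
      also have "\<dots> \<le> (\<Sum>j\<in>UNIV. norm h * \<bar>B j\<bar>)"
      proof (rule sum_mono)
        fix j
        have "\<bar>frechet_derivative f (at z) (axis j 1)\<bar> \<le> \<bar>B j\<bar>" using B[OF z, of j] by linarith
        then show "norm (h $ j * frechet_derivative f (at z) (axis j 1)) \<le> norm h * \<bar>B j\<bar>"
          unfolding real_norm_def abs_mult by (intro mult_mono component_le_norm_cart) auto
      qed
      finally show "norm (frechet_derivative f (at z) h) \<le> L * norm h"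
        by (simp add: L_def sum_distrib_left[symmetric] mult.commute)
    qed
  qed (use that in auto)
  then show ?thesis using L0 by auto
qed

text \<open>Taylor expansion of the defining function at a zero \<open>q\<close>: the remainder is
  at most \<open>M\<close> times the squared distance, so the linear term decides the sign as soon
  as the normal component exceeds a multiple of the squared distance.\<close>

lemma two_sided_local:
  fixes \<Omega> :: "(real^'n) set"
  assumes "open \<Omega>" and U: "open U" "p \<in> U" "C_infinity_on U \<rho>"
    and nz: "\<And>x. x \<in> U \<Longrightarrow> frechet_derivative \<rho> (at x) \<noteq> (\<lambda>_. 0)"
    and \<Omega>: "\<Omega> \<inter> U = {x\<in>U. \<rho> x < 0}"
  shows "\<exists>s>0. \<exists>K>0. \<forall>q\<in>frontier \<Omega> \<inter> ball p s. \<exists>n. two_sided \<Omega> K s q n"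
proof -
  let ?D = "\<lambda>i x. frechet_derivative \<rho> (at x) (axis i 1)"
  have C2: "C_k_on 2 U \<rho>" using U(3) by (simp add: C_infinity_on_def)
  then have d0: "\<And>x. x \<in> U \<Longrightarrow> \<rho> differentiable (at x)"
    and d1: "\<And>i x. x \<in> U \<Longrightarrow> ?D i differentiable (at x)"
    and d2: "\<And>i j. continuous_on U (\<lambda>x. frechet_derivative (?D i) (at x) (axis j 1))"
    by (auto simp: numeral_2_eq_2)
  obtain s0 where s0: "s0 > 0" "cball p s0 \<subseteq> U" using U(1,2) open_contains_cball by blast
  \<comment> \<open>Half the radius, so that balls of radius \<open>s\<close> about points of
    \<open>ball p s\<close> stay in the compact ball on which the bounds hold.\<close>
  define s where "s = s0 / 2"
  have s: "s > 0" using s0 by (simp add: s_def)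
  let ?S = "cball p s0"
  have "\<exists>L\<ge>0. \<forall>x\<in>?S. \<forall>y\<in>?S. \<bar>?D i x - ?D i y\<bar> \<le> L * norm (x - y)" for i
    by (rule lipschitz_of_continuous_partials) (use s0(2) d1 continuous_on_subset[OF d2 s0(2)] in auto)
  then obtain L where L: "\<And>i. L i \<ge> 0"
    "\<And>i x y. x \<in> ?S \<Longrightarrow> y \<in> ?S \<Longrightarrow> \<bar>?D i x - ?D i y\<bar> \<le> L i * norm (x - y)" by metis
  define g where "g x = (\<chi> i. ?D i x)" for x
  have g: "frechet_derivative \<rho> (at x) h = g x \<bullet> h" if "x \<in> U" for x h
  proof -
    have lin: "linear (frechet_derivative \<rho> (at x))"
      using d0[OF that] frechet_derivative_works has_derivative_linear by blast
    have "frechet_derivative \<rho> (at x) h = frechet_derivative \<rho> (at x) (\<Sum>j\<in>UNIV. h $ j *\<^sub>R axis j 1)"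
      by (simp add: basis_expansion flip: scalar_mult_eq_scaleR)
    also have "\<dots> = (\<Sum>j\<in>UNIV. h $ j * ?D j x)"
      by (simp add: linear_sum[OF lin] linear_cmul[OF lin])
    finally show ?thesis by (simp add: g_def inner_vec_def mult.commute)
  qed
  define M where "M = (\<Sum>i\<in>UNIV. L i)"
  have M0: "M \<ge> 0" using L(1) by (auto simp: M_def intro: sum_nonneg)
  have gL: "norm (g x - g y) \<le> M * norm (x - y)" if "x \<in> ?S" "y \<in> ?S" for x y
  proof -
    have "norm (g x - g y) \<le> (\<Sum>i\<in>UNIV. \<bar>(g x - g y) $ i\<bar>)" by (rule norm_le_l1_cart)
    also have "\<dots> \<le> (\<Sum>i\<in>UNIV. L i * norm (x - y))"
      by (rule sum_mono) (use L(2)[OF that] in \<open>simp add: g_def\<close>)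
    finally show ?thesis by (simp add: M_def sum_distrib_right)
  qed
  have "continuous_on ?S (\<lambda>x. norm (g x))"
  proof (intro continuous_on_norm)
    have "M-lipschitz_on ?S g" using gL M0 by (simp add: lipschitz_on_def dist_norm)
    then show "continuous_on ?S g" by (rule lipschitz_on_continuous_on)
  qed
  then obtain x0 where x0: "x0 \<in> ?S" "\<And>x. x \<in> ?S \<Longrightarrow> norm (g x0) \<le> norm (g x)"
    using continuous_attains_inf[of ?S "\<lambda>x. norm (g x)"] s0(1) by auto
  define m where "m = norm (g x0)"
  have "g x0 \<noteq> 0"
  proof
    assume "g x0 = 0"
    then have "frechet_derivative \<rho> (at x0) = (\<lambda>_. 0)" using g s0(2) x0(1) by (auto simp: fun_eq_iff)
    then show False using nz s0(2) x0(1) by blast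
  qed
  then have m: "m > 0" by (simp add: m_def)
  \<comment> \<open>\<open>M / m\<close> compares the remainder with the smallest gradient norm;
    adding 1 keeps \<open>K\<close> positive when \<open>M = 0\<close>.\<close>
  define K where "K = M / m + 1"
  have K: "K > 0" using M0 m by (simp add: K_def add_nonneg_pos)
  have taylor: "\<bar>\<rho> y - \<rho> q - g q \<bullet> (y - q)\<bar> \<le> M * (norm (y - q))\<^sup>2" if q: "q \<in> ?S" and y: "y \<in> ?S" for q y
  proof -
    have seg: "closed_segment q y \<subseteq> ?S" using q y closed_segment_subset convex_cball by blast
    have "norm ((\<rho> y - g q \<bullet> y) - (\<rho> q - g q \<bullet> q)) \<le> (M * norm (y - q)) * norm (y - q)"
    proof (rule differentiable_bound[of "closed_segment q y" "\<lambda>x. \<rho> x - g q \<bullet> x" "\<lambda>x h. (g x - g q) \<bullet> h"])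
      fix z assume z: "z \<in> closed_segment q y"
      then have zS: "z \<in> ?S" "z \<in> U" using seg s0(2) by auto
      have "(\<rho> has_derivative (\<lambda>h. g z \<bullet> h)) (at z)"
        using d0[OF zS(2)] frechet_derivative_works g[OF zS(2)] by (metis ext)
      then have "(\<rho> has_derivative (\<lambda>h. g z \<bullet> h)) (at z within closed_segment q y)"
        by (rule has_derivative_at_withinI)
      from has_derivative_diff[OF this has_derivative_inner_right[OF has_derivative_ident], of "g q"]
      show "((\<lambda>x. \<rho> x - g q \<bullet> x) has_derivative (\<lambda>h. (g z - g q) \<bullet> h)) (at z within closed_segment q y)"
        by (simp add: inner_diff_left)
      have "norm (z - q) \<le> norm (y - q)" using segment_bound(1)[OF z] by (simp add: norm_minus_commute)
      then have "norm (g z - g q) \<le> M * norm (y - q)"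
        using gL[OF zS(1) q] M0 by (meson mult_left_mono order_trans)
      then show "onorm (\<lambda>h. (g z - g q) \<bullet> h) \<le> M * norm (y - q)"
        by (intro onorm_le order_trans[OF Cauchy_Schwarz_ineq2[folded real_norm_def]] mult_right_mono) auto
    qed (auto simp: convex_closed_segment)
    then show ?thesis by (simp add: power2_eq_square inner_diff_right algebra_simps)
  qed
  have "two_sided \<Omega> K s q ((1 / norm (g q)) *\<^sub>R g q)" if q: "q \<in> frontier \<Omega>" "q \<in> ball p s" for q
  proof -
    have qS: "q \<in> ?S" "q \<in> U" using q(2) s0 s_def by auto
    have gq: "m \<le> norm (g q)" using x0(2)[OF qS(1)] by (simp add: m_def)
    have gp: "norm (g q) > 0" using gq m by linarith
    have contU: "continuous_on U \<rho>"
      using d0 by (meson continuous_at_imp_continuous_on differentiable_imp_continuous_within)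
    have out: "y \<notin> closure \<Omega>" if "y \<in> U" "\<rho> y > 0" for y
    proof -
      have op: "open (U \<inter> \<rho> -` {0<..})" by (rule continuous_open_preimage[OF contU U(1) open_greaterThan])
      have "(U \<inter> \<rho> -` {0<..}) \<inter> \<Omega> = {}" using \<Omega> by force
      then show ?thesis using open_Int_closure_eq_empty[OF op] that by blast
    qed
    have \<rho>q: "\<rho> q = 0"
    proof -
      have "q \<notin> \<Omega>" using q(1) \<open>open \<Omega>\<close> by (simp add: frontier_def interior_open)
      then have "\<not> \<rho> q < 0" using \<Omega> qS(2) by blast
      moreover have "\<not> \<rho> q > 0" using out qS(2) q(1) by (auto simp: frontier_def)
      ultimately show ?thesis by linarith
    qed
    have ineq: "M * (norm (y - q))\<^sup>2 \<le> K * (norm (y - q))\<^sup>2 * norm (g q)" for y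
    proof -
      have "M \<le> K * m" using m by (simp add: K_def field_simps)
      also have "\<dots> \<le> K * norm (g q)" using gq K by simp
      finally show ?thesis by (metis mult.assoc mult.commute mult_right_mono zero_le_power2)
    qed
    show ?thesis unfolding two_sided_def
    proof (intro conjI ballI impI)
      show "norm ((1 / norm (g q)) *\<^sub>R g q) = 1" using gq m by auto
    next
      fix y assume y: "y \<in> ball q s" and *: "(y - q) \<bullet> ((1 / norm (g q)) *\<^sub>R g q) < - K * (norm (y - q))\<^sup>2"
      have "dist p y \<le> dist p q + dist q y" by (rule dist_triangle)
      then have yS: "y \<in> ?S" using y q(2) by (simp add: s_def)
      have "g q \<bullet> (y - q) < - (K * (norm (y - q))\<^sup>2 * norm (g q))"
        using * gp by (simp add: field_simps inner_commute)
      then have "\<rho> y < 0" using taylor[OF qS(1) yS] \<rho>q ineq[of y] by linarith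
      then show "y \<in> \<Omega>" using \<Omega> yS s0(2) by blast
    next
      fix y assume y: "y \<in> ball q s" and *: "(y - q) \<bullet> ((1 / norm (g q)) *\<^sub>R g q) > K * (norm (y - q))\<^sup>2"
      have "dist p y \<le> dist p q + dist q y" by (rule dist_triangle)
      then have yS: "y \<in> ?S" using y q(2) by (simp add: s_def)
      have "g q \<bullet> (y - q) > K * (norm (y - q))\<^sup>2 * norm (g q)"
        using * gp by (simp add: field_simps inner_commute)
      then have "\<rho> y > 0" using taylor[OF qS(1) yS] \<rho>q ineq[of y] by linarith
      then show "y \<notin> closure \<Omega>" using out yS s0(2) by blast
    qed
  qed
  then show ?thesis using s K by blast
qed

lemma smooth_domain_two_sided:
  fixes \<Omega> :: "(real^'n) set"
  assumes "bounded_smooth_domain \<Omega>"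
  shows "\<exists>K>0. \<exists>r>0. \<forall>q\<in>frontier \<Omega>. \<exists>n. two_sided \<Omega> K r q n"
proof -
  have o: "open \<Omega>" "bounded \<Omega>" using assms by (auto simp: bounded_smooth_domain_def)
  have "\<exists>s>0. \<exists>K>0. \<forall>q\<in>frontier \<Omega> \<inter> ball p s. \<exists>n. two_sided \<Omega> K s q n" if p: "p \<in> frontier \<Omega>" for p
  proof -
    have "\<forall>p\<in>frontier \<Omega>. \<exists>U \<rho>. open U \<and> p \<in> U \<and> C_infinity_on U \<rho> \<and>
        (\<forall>x\<in>U. frechet_derivative \<rho> (at x) \<noteq> (\<lambda>_. 0)) \<and> \<Omega> \<inter> U = {x\<in>U. \<rho> x < 0}"
      using assms by (simp add: bounded_smooth_domain_def)
    from bspec[OF this p] show ?thesis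
      by (elim exE conjE) (rule two_sided_local[OF o(1)], auto)
  qed
  then obtain s K where sK: "\<And>p. p \<in> frontier \<Omega> \<Longrightarrow> s p > 0 \<and> K p > 0 \<and>
      (\<forall>q\<in>frontier \<Omega> \<inter> ball p (s p). \<exists>n. two_sided \<Omega> (K p) (s p) q n)" by metis
  have "compact (frontier \<Omega>)" using o(2) by (simp add: compact_frontier_bounded)
  then obtain P where P: "P \<subseteq> frontier \<Omega>" "finite P" "frontier \<Omega> \<subseteq> (\<Union>p\<in>P. ball p (s p))"
  proof (rule compactE_image[of _ "frontier \<Omega>" "\<lambda>p. ball p (s p)"])
    show "frontier \<Omega> \<subseteq> (\<Union>p\<in>frontier \<Omega>. ball p (s p))" using sK by auto
  qed auto
  define r where "r = Min (insert 1 (s ` P))"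
  define C where "C = Max (insert 1 (K ` P))"
  have r: "r > 0" using P(1,2) sK by (auto simp: r_def)
  have C: "C > 0" using P(2) by (auto simp: C_def less_le_trans[OF zero_less_one])
  have "\<exists>n. two_sided \<Omega> C r q n" if q: "q \<in> frontier \<Omega>" for q
  proof -
    obtain p where p: "p \<in> P" "q \<in> ball p (s p)" using P(3) q by blast
    then obtain n where "two_sided \<Omega> (K p) (s p) q n" using sK P(1) q by blast
    moreover have "K p \<le> C" "r \<le> s p" using P(2) p(1) by (auto simp: C_def r_def)
    ultimately show ?thesis using two_sided_mono by blast
  qed
  then show ?thesis using r C by blast
qed

lemma two_sided_frontier:
  assumes "two_sided \<Omega> K r q n" "y \<in> frontier \<Omega>" "open \<Omega>" "y \<in> ball q r"
  shows "\<bar>(y - q) \<bullet> n\<bar> \<le> K * (norm (y - q))\<^sup>2"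
proof -
  have "y \<notin> \<Omega>" "y \<in> closure \<Omega>" using assms(2,3) by (auto simp: frontier_def interior_open)
  then have "\<not> (y - q) \<bullet> n < - K * (norm (y - q))\<^sup>2" "\<not> (y - q) \<bullet> n > K * (norm (y - q))\<^sup>2"
    using assms(1,4) unfolding two_sided_def by blast+
  then show ?thesis by linarith
qed

text \<open>Probing the touching regions at \<open>q\<close> in the direction \<open>n - n'\<close> from \<open>q'\<close> gives the
  Lipschitz bound without differentiating the normal field.\<close>

lemma two_sided_normal_lipschitz:
  assumes ts: "two_sided \<Omega> K r q n" "two_sided \<Omega> K r q' n'" and "open \<Omega>" "K \<ge> 0"
    and f: "q' \<in> frontier \<Omega>" and d: "2 * dist q q' < r"
  shows "norm (n - n') \<le> 10 * K * dist q q'"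
proof (cases "dist q q' = 0 \<or> n = n'")
  case True
  show ?thesis
  proof (cases "n = n'")
    case False
    \<comment> \<open>At a single point the normal is unique: a short step along
      \<open>n - n'\<close> would lie in the outer region of \<open>n\<close> and in the inner
      region of \<open>n'\<close>.\<close>
    then have "q = q'" using True by simp
    define u where "u = (1 / norm (n - n')) *\<^sub>R (n - n')"
    have nn: "norm n = 1" "norm n' = 1" using ts by (auto simp: two_sided_def)
    then have ip: "n \<bullet> n = 1" "n' \<bullet> n' = 1" by (auto simp: dot_square_norm)
    define a where "a = norm (n - n')"
    have a: "a > 0" using False by (simp add: a_def)
    have a2: "a\<^sup>2 = 2 - 2 * (n \<bullet> n')"
      by (simp add: a_def power2_norm_eq_inner inner_diff_left inner_diff_right ip inner_commute)
    have un: "u \<bullet> n = a / 2" and un': "u \<bullet> n' = - a / 2"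
      using a a2 by (simp_all add: u_def a_def[symmetric] inner_diff_left inner_diff_right ip field_simps power2_eq_square inner_commute)
    have u1: "norm u = 1" using a by (simp add: u_def a_def[symmetric])
    have r: "r > 0" using d by (smt (verit) zero_le_dist)
    define t where "t = min (r / 2) (a / (4 * (K + 1)))"
    have t: "t > 0" "t < r" using r a \<open>K \<ge> 0\<close> by (auto simp: t_def)
    have tK: "K * t < a / 2"
    proof -
      have "K * t \<le> K * (a / (4 * (K + 1)))" using \<open>K \<ge> 0\<close> by (intro mult_left_mono) (auto simp: t_def)
      also have "\<dots> < a / 2" using \<open>K \<ge> 0\<close> a by (simp add: field_simps) (smt (verit) mult_nonneg_nonneg)
      finally show ?thesis .
    qed
    have in_ball: "q + t *\<^sub>R u \<in> ball q r" using t u1 by (simp add: dist_norm)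
    have "t * (u \<bullet> n) > K * t\<^sup>2" "t * (u \<bullet> n') < - K * t\<^sup>2"
      using tK t(1) by (simp_all add: un un' power2_eq_square)
    then have "q + t *\<^sub>R u \<notin> closure \<Omega>" "q + t *\<^sub>R u \<in> \<Omega>"
      using ts in_ball \<open>q = q'\<close> t(1) u1 unfolding two_sided_def by auto
    then show ?thesis using closure_subset by blast
  qed (use \<open>K \<ge> 0\<close> in simp)
next
  case False
  define d where "d = dist q q'"
  have d0: "d > 0" using False by (simp add: d_def)
  define u where "u = (1 / norm (n - n')) *\<^sub>R (n - n')"
  have nn: "norm n = 1" "norm n' = 1" using ts by (auto simp: two_sided_def)
  then have ip: "n \<bullet> n = 1" "n' \<bullet> n' = 1" by (auto simp: dot_square_norm)
  define a where "a = norm (n - n')"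
  have a: "a > 0" using False by (simp add: a_def)
  have a2: "a\<^sup>2 = 2 - 2 * (n \<bullet> n')"
    by (simp add: a_def power2_norm_eq_inner inner_diff_left inner_diff_right ip inner_commute)
  have un: "u \<bullet> n = a / 2" and un': "u \<bullet> n' = - a / 2"
    using a a2 by (simp_all add: u_def a_def[symmetric] inner_diff_left inner_diff_right ip field_simps power2_eq_square inner_commute)
  have u1: "norm u = 1" using a by (simp add: u_def a_def[symmetric])
  show ?thesis
  proof (cases "a / 2 > K * d")
    case True
    define y where "y = q' + d *\<^sub>R u"
    have yq': "norm (y - q') = d" using d0 u1 by (simp add: y_def)
    have yq: "norm (y - q) \<le> 2 * d"
      using norm_triangle_ineq[of "y - q'" "q' - q"] yq' by (simp add: d_def dist_norm norm_minus_commute)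
    have "(y - q') \<bullet> n' = - d * (a / 2)" using un' by (simp add: y_def)
    also have "\<dots> < - d * (K * d)" using True d0 by simp
    also have "- d * (K * d) = - K * (norm (y - q'))\<^sup>2" unfolding yq' by (simp add: power2_eq_square)
    finally have "(y - q') \<bullet> n' < - K * (norm (y - q'))\<^sup>2" .
    moreover have dr: "d < r" "2 * d < r" using d[folded d_def] d0 by auto
    then have "y \<in> ball q' r" using yq' by (simp only: mem_ball dist_norm norm_minus_commute[of q' y])
    ultimately have "y \<in> \<Omega>" using ts(2) unfolding two_sided_def by blast
    then have "y \<in> closure \<Omega>" using closure_subset by blast
    moreover have "y \<in> ball q r"
      using yq dr by (simp only: mem_ball dist_norm norm_minus_commute[of q y])
    ultimately have "(y - q) \<bullet> n \<le> K * (norm (y - q))\<^sup>2" using ts(1) unfolding two_sided_def by (meson not_less)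
    also have "\<dots> \<le> K * (2 * d)\<^sup>2" using yq \<open>K \<ge> 0\<close> by (intro mult_left_mono power_mono) auto
    finally have 1: "(y - q) \<bullet> n \<le> 4 * K * d\<^sup>2" by (simp add: power2_eq_square)
    have "q' \<in> ball q r" using dr by (simp add: d_def)
    then have "\<bar>(q' - q) \<bullet> n\<bar> \<le> K * (norm (q' - q))\<^sup>2" using two_sided_frontier[OF ts(1) f \<open>open \<Omega>\<close>] by blast
    then have 2: "\<bar>(q' - q) \<bullet> n\<bar> \<le> K * d\<^sup>2" by (simp add: d_def dist_norm norm_minus_commute)
    have "(y - q) \<bullet> n = (q' - q) \<bullet> n + d * (a / 2)" using un by (simp add: y_def inner_diff_left inner_add_left)
    \<comment> \<open>The probe lies within \<open>2 * d\<close> of \<open>q\<close> and costs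
      \<open>4 * K * d^2\<close>; the offset of \<open>q'\<close> from the tangent plane at
      \<open>q\<close> costs another \<open>K * d^2\<close>. Doubling the resulting 5 gives the
      10.\<close>
    then have "d * (a / 2) \<le> d * (5 * K * d)" using 1 2 by (simp add: power2_eq_square algebra_simps)
    then have "a / 2 \<le> 5 * K * d" using d0 by simp
    then show ?thesis by (simp add: a_def d_def)
  next
    case False
    then have "a \<le> 2 * (K * d)" by simp
    also have "\<dots> \<le> 10 * K * d" using \<open>K \<ge> 0\<close> d0 by simp
    finally show ?thesis by (simp add: a_def d_def)
  qed
qed

text \<open>The open ball about \<open>z\<close> through \<open>q\<close> contains no frontier point
  and so lies on one side. If \<open>z - q\<close> were not normal, a short step from
  \<open>q\<close> along the sum or the difference of its unit vector and \<open>n\<close> would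
  stay in this ball and yet enter the touching region of the other side.\<close>

lemma nearest_point_normal:
  assumes ts: "two_sided \<Omega> K r q n" and "open \<Omega>" "K > 0" "r > 0"
    and q: "q \<in> frontier \<Omega>" and near: "\<And>y. y \<in> frontier \<Omega> \<Longrightarrow> dist z q \<le> dist z y"
  shows "\<exists>t. \<bar>t\<bar> = dist z q \<and> z = q + t *\<^sub>R n"
proof (cases "z = q")
  case False
  define R where "R = dist z q"
  have R: "R > 0" using False by (simp add: R_def)
  define u where "u = (1 / R) *\<^sub>R (z - q)"
  have zu: "z = q + R *\<^sub>R u" using R by (simp add: u_def)
  have u1: "norm u = 1" using R by (simp add: u_def R_def dist_norm)
  have n1: "norm n = 1" using ts by (simp add: two_sided_def)
  have ip: "u \<bullet> u = 1" "n \<bullet> n = 1" using u1 n1 by (auto simp: dot_square_norm)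
  have disj: "ball z R \<inter> frontier \<Omega> = {}" using near by (force simp: R_def)
  define t where "t = min (R / 2) (min (1 / (4 * K)) (r / 4))"
  have "t \<le> R / 2" "t \<le> r / 4" "t \<le> 1 / (4 * K)" and t0: "t > 0"
    using R \<open>K > 0\<close> \<open>r > 0\<close> by (auto simp: t_def)
  then have t: "t > 0" "t < R" "2 * t < r" "2 * K * t < 1"
    using R \<open>K > 0\<close> \<open>r > 0\<close> by (auto simp: field_simps)
  \<comment> \<open>Both \<open>u + n\<close> and \<open>u - n\<close> satisfy the first condition;
    it puts the squared distance from \<open>z\<close> below \<open>R^2\<close> because
    \<open>t < R\<close>.\<close>
  have inb: "q + t *\<^sub>R w \<in> ball z R" if w: "w \<bullet> w = 2 * (w \<bullet> u)" "w \<bullet> u > 0" for w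
  proof -
    have "(norm (z - (q + t *\<^sub>R w)))\<^sup>2 = R\<^sup>2 - 2 * (t * R * (w \<bullet> u)) + t\<^sup>2 * (w \<bullet> w)"
      unfolding zu by (simp add: power2_norm_eq_inner inner_diff_left inner_diff_right ip inner_commute)
        (simp add: power2_eq_square algebra_simps)
    also have "\<dots> = R\<^sup>2 - 2 * t * (w \<bullet> u) * (R - t)" unfolding w(1) by (simp add: power2_eq_square algebra_simps)
    also have "\<dots> < R\<^sup>2" using t w by simp
    finally show ?thesis using R by (simp add: dist_norm power2_less_imp_less)
  qed
  have nw: "norm w \<le> 2" if "w = u + n \<or> w = u - n" for w
    using that norm_triangle_ineq[of u n] norm_triangle_ineq4[of u n] u1 n1 by auto
  show ?thesis
  proof (cases "ball z R \<subseteq> \<Omega>")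
    case True
    have "u = - n"
    proof (rule ccontr)
      assume "u \<noteq> - n"
      define w where "w = u + n"
      define s where "s = 1 + u \<bullet> n"
      have "w \<noteq> 0" using \<open>u \<noteq> - n\<close> by (auto simp: w_def add_eq_0_iff2)
      then have "w \<bullet> w > 0" by simp
      moreover have ww: "w \<bullet> w = 2 * s" "w \<bullet> u = s" "w \<bullet> n = s"
        by (simp_all add: w_def s_def inner_add_left inner_add_right ip inner_commute)
      ultimately have s: "s > 0" by simp
      have "q + t *\<^sub>R w \<in> \<Omega>" using inb[of w] ww s True by auto
      moreover have "q + t *\<^sub>R w \<notin> closure \<Omega>"
      proof -
        have "norm (t *\<^sub>R w) \<le> t * 2" using nw[of w] t(1) by (simp add: w_def)
        then have "norm (t *\<^sub>R w) < r" using t(3) by simp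
        then have "q + t *\<^sub>R w \<in> ball q r" by (simp only: mem_ball dist_norm) (simp add: norm_minus_commute)
        moreover have "(q + t *\<^sub>R w - q) \<bullet> n > K * (norm (q + t *\<^sub>R w - q))\<^sup>2"
        proof -
          have "K * (norm (t *\<^sub>R w))\<^sup>2 = (2 * K * t) * (t * s)"
            unfolding power2_norm_eq_inner inner_scaleR_left inner_scaleR_right ww(1) by simp
          also have "\<dots> < 1 * (t * s)" using t s by (intro mult_strict_right_mono) auto
          finally show ?thesis using ww(3) by simp
        qed
        ultimately show ?thesis using ts unfolding two_sided_def by blast
      qed
      ultimately show False using closure_subset by blast
    qed
    then show ?thesis using zu R by (intro exI[of _ "- R"]) (simp add: R_def)
  next
    case False
    have "ball z R \<inter> \<Omega> = {}"
    proof (rule ccontr)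
      assume "ball z R \<inter> \<Omega> \<noteq> {}"
      then have "ball z R \<inter> frontier \<Omega> \<noteq> {}"
        using connected_Int_frontier[OF connected_ball[of z R]] False by blast
      then show False using disj by blast
    qed
    have "u = n"
    proof (rule ccontr)
      assume "u \<noteq> n"
      define w where "w = u - n"
      define s where "s = 1 - u \<bullet> n"
      have "w \<noteq> 0" using \<open>u \<noteq> n\<close> by (auto simp: w_def)
      then have "w \<bullet> w > 0" by simp
      moreover have ww: "w \<bullet> w = 2 * s" "w \<bullet> u = s" "w \<bullet> n = - s"
        by (simp_all add: w_def s_def inner_diff_left inner_diff_right ip inner_commute)
      ultimately have s: "s > 0" by simp
      have "q + t *\<^sub>R w \<notin> \<Omega>" using inb[of w] ww s \<open>ball z R \<inter> \<Omega> = {}\<close> by auto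
      moreover have "q + t *\<^sub>R w \<in> \<Omega>"
      proof -
        have "norm (t *\<^sub>R w) \<le> t * 2" using nw[of w] t(1) by (simp add: w_def)
        then have "norm (t *\<^sub>R w) < r" using t(3) by simp
        then have "q + t *\<^sub>R w \<in> ball q r" by (simp only: mem_ball dist_norm) (simp add: norm_minus_commute)
        moreover have "(q + t *\<^sub>R w - q) \<bullet> n < - K * (norm (q + t *\<^sub>R w - q))\<^sup>2"
        proof -
          have "K * (norm (t *\<^sub>R w))\<^sup>2 = (2 * K * t) * (t * s)"
            unfolding power2_norm_eq_inner inner_scaleR_left inner_scaleR_right ww(1) by simp
          also have "\<dots> < 1 * (t * s)" using t s by (intro mult_strict_right_mono) auto
          finally show ?thesis using ww(3) by simp
        qed
        ultimately show ?thesis using ts unfolding two_sided_def by blast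
      qed
      ultimately show False by blast
    qed
    then show ?thesis using zu R by (intro exI[of _ R]) (simp add: R_def)
  qed
qed (auto intro: exI[of _ 0])

text \<open>A frontier point at least as close as \<open>q\<close> is within
  \<open>2 * \<bar>t\<bar>\<close> of \<open>q\<close>, where the frontier deviates quadratically
  from the tangent plane. Expanding the squared distance then leaves \<open>q\<close> as the only
  possibility when \<open>2 * \<bar>t\<bar> * K < 1\<close>.\<close>

lemma closest_point_normal_line:
  fixes \<Omega> :: "(real^'n) set"
  assumes ts: "two_sided \<Omega> K r q n" and "open \<Omega>" "K > 0"
    and q: "q \<in> frontier \<Omega>" and t: "2 * \<bar>t\<bar> < r" "2 * \<bar>t\<bar> * K < 1"
  shows "closest_point (frontier \<Omega>) (q + t *\<^sub>R n) = q"
proof (rule ccontr)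
  let ?z = "q + t *\<^sub>R n"
  define y where "y = closest_point (frontier \<Omega>) ?z"
  assume "closest_point (frontier \<Omega>) ?z \<noteq> q"
  then have yq: "y \<noteq> q" by (simp add: y_def)
  have n1: "norm n = 1" using ts by (simp add: two_sided_def)
  then have ip: "n \<bullet> n = 1" by (simp add: dot_square_norm)
  have y: "y \<in> frontier \<Omega>" "dist ?z y \<le> dist ?z q"
    using closest_point_exists[of "frontier \<Omega>" ?z] q by (auto simp: y_def)
  then have le: "dist ?z y \<le> \<bar>t\<bar>" using n1 by (simp add: dist_norm)
  have "dist q y \<le> dist q ?z + dist ?z y" by (rule dist_triangle)
  then have "dist q y \<le> 2 * \<bar>t\<bar>" using le n1 by (simp add: dist_norm)
  then have "y \<in> ball q r" using t(1) by simp
  then have b: "\<bar>(y - q) \<bullet> n\<bar> \<le> K * (norm (y - q))\<^sup>2" by (rule two_sided_frontier[OF ts y(1) \<open>open \<Omega>\<close>])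
  have pos: "(norm (y - q))\<^sup>2 > 0" using yq by simp
  have "(dist ?z y)\<^sup>2 = (norm (y - q))\<^sup>2 - 2 * (t * ((y - q) \<bullet> n)) + t\<^sup>2"
  proof -
    define v where "v = y - q"
    have "?z - y = t *\<^sub>R n - v" by (simp add: v_def)
    then have "(dist ?z y)\<^sup>2 = (t *\<^sub>R n - v) \<bullet> (t *\<^sub>R n - v)"
      by (simp only: dist_norm power2_norm_eq_inner)
    also have "\<dots> = v \<bullet> v - 2 * (t * (v \<bullet> n)) + t\<^sup>2"
      by (simp add: inner_diff_left inner_diff_right ip inner_commute[of n v] power2_eq_square algebra_simps)
    finally show ?thesis by (simp add: v_def power2_norm_eq_inner)
  qed
  moreover have "\<bar>t * ((y - q) \<bullet> n)\<bar> \<le> \<bar>t\<bar> * (K * (norm (y - q))\<^sup>2)"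
    unfolding abs_mult using b by (intro mult_left_mono) auto
  moreover have "2 * (\<bar>t\<bar> * (K * (norm (y - q))\<^sup>2)) < (norm (y - q))\<^sup>2"
    using mult_strict_right_mono[OF t(2) pos] by (simp add: algebra_simps)
  ultimately have "(dist ?z y)\<^sup>2 > \<bar>t\<bar>\<^sup>2" by (simp; linarith)
  moreover have "(dist ?z y)\<^sup>2 \<le> \<bar>t\<bar>\<^sup>2" using le by (intro power_mono) auto
  ultimately show False by linarith
qed


section \<open>Shape-regular meshes fitted to a smooth boundary\<close>

locale shape_regular_mesh = simplicial_mesh \<T> for \<T> :: "(real^'n) set set" +
  fixes \<kappa> h :: real
  assumes \<kappa>_pos: "0 < \<kappa>"
    and diameter_le: "\<And>T. T \<in> \<T> \<Longrightarrow> diameter T \<le> h"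
    and inball: "\<And>T. T \<in> \<T> \<Longrightarrow> \<exists>x. cball x (\<kappa> * diameter T) \<subseteq> T"
begin

lemma bounded_simplex: "T \<in> \<T> \<Longrightarrow> bounded T"
  using compact_simplex'[OF full_simplex] compact_imp_bounded by blast

lemma diameter_simplex_pos:
  assumes "T \<in> \<T>" shows "0 < diameter T"
proof -
  note fT = full_simplex[OF assms]
  have "card (vertices T) > 1" using simplex_hull_vertices(2)[OF fT] dim_ge_2 by simp
  then obtain a b where ab: "a \<in> vertices T" "b \<in> vertices T" "a \<noteq> b"
    by (metis One_nat_def card_le_Suc0_iff_eq finite_vertices[OF fT] not_less)
  then have "dist a b \<le> diameter T"
    using diameter_bounded_bound[OF bounded_simplex[OF assms]] vertices_subset[OF fT] by blast
  then show ?thesis using ab(3) by (smt (verit) zero_less_dist_iff)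
qed

lemma vertices_dist_ge_diameter:
  assumes "T \<in> \<T>" "a \<in> vertices T" "b \<in> vertices T" "a \<noteq> b"
  shows "2 * \<kappa> * diameter T \<le> dist a b"
proof -
  obtain x where "cball x (\<kappa> * diameter T) \<subseteq> T" using inball[OF assms(1)] by blast
  then show ?thesis
    using vertices_dist_ge[OF full_simplex[OF assms(1)] _ _ assms(2-4), of "\<kappa> * diameter T" x]
      \<kappa>_pos diameter_simplex_pos[OF assms(1)] by simp
qed

lemma facet_diameter:
  assumes T: "T \<in> \<T>" "e facet_of T"
  shows "2 * \<kappa> * diameter T \<le> diameter e" "diameter e \<le> diameter T" "0 < diameter e" "diameter e \<le> h"
    "bounded e"
proof -
  obtain a where a: "a \<in> vertices T" "e = convex hull (vertices T - {a})" "vertices e = vertices T - {a}"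
    by (rule facet_opposite[OF T])
  note fT = full_simplex[OF T(1)]
  have fin: "finite (vertices T - {a})" using finite_vertices[OF fT] by blast
  have "card (vertices T - {a}) > 1"
    using a(1) simplex_hull_vertices(2)[OF fT] dim_ge_2 finite_vertices[OF fT] by simp
  then obtain u v where uv: "u \<in> vertices T - {a}" "v \<in> vertices T - {a}" "u \<noteq> v"
    by (metis One_nat_def card_le_Suc0_iff_eq fin not_less)
  show b: "bounded e" using bounded_simplex[OF T(1)] facet_subset[OF T] bounded_subset by blast
  have "u \<in> e" "v \<in> e" using uv hull_inc unfolding a(2) by metis+
  then have "dist u v \<le> diameter e" using diameter_bounded_bound[OF b] by blast
  then show 1: "2 * \<kappa> * diameter T \<le> diameter e"
    using vertices_dist_ge_diameter[OF T(1), of u v] uv by simp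
  show 2: "diameter e \<le> diameter T"
    by (rule diameter_subset[OF facet_subset[OF T] bounded_simplex[OF T(1)]])
  have "0 < 2 * \<kappa> * diameter T" using \<kappa>_pos diameter_simplex_pos[OF T(1)] by simp
  then show "0 < diameter e" using 1 by linarith
  show "diameter e \<le> h" using 2 diameter_le[OF T(1)] by linarith
qed

text \<open>Projection from the vertex \<open>a\<close> carries the slice of the ball at the height
  of its centre into the facet and stretches it by \<open>1 / (1 - s)\<close>. The disc only grows,
  and convexity cuts it back to translations by \<open>\<tau>\<close> itself.\<close>

lemma facet_inball:
  assumes T: "T \<in> \<T>" "a \<in> vertices T"
  shows "\<exists>y\<in>convex hull (vertices T - {a}). \<forall>\<tau>. bary_grad T a \<bullet> \<tau> = 0 \<longrightarrow> norm \<tau> \<le> \<kappa> * diameter T \<longrightarrow>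
    y + \<tau> \<in> convex hull (vertices T - {a})"
proof -
  let ?e = "convex hull (vertices T - {a})"
  note fT = full_simplex[OF T(1)]
  define \<rho> where "\<rho> = \<kappa> * diameter T"
  have \<rho>: "\<rho> > 0" using \<kappa>_pos diameter_simplex_pos[OF T(1)] by (simp add: \<rho>_def)
  obtain x where x: "cball x \<rho> \<subseteq> T" using inball[OF T(1)] by (auto simp: \<rho>_def)
  define s where "s = bary T a x"
  have "x \<in> interior T"
    using x \<rho> by (meson ball_subset_cball centre_in_ball interior_maximal open_ball order_trans subsetD)
  then have pos: "\<And>b. b \<in> vertices T \<Longrightarrow> 0 < bary T b x" using interior_simplex_iff[OF fT] by blast
  have "card (vertices T - {a}) > 0"
    using T(2) simplex_hull_vertices(2)[OF fT] finite_vertices[OF fT] by simp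
  then obtain b where b: "b \<in> vertices T - {a}" by (metis card_gt_0_iff ex_in_conv)
  have "1 = bary T a x + (\<Sum>v\<in>vertices T - {a}. bary T v x)"
    using bary_sum[OF fT, of x] sum.remove[OF finite_vertices[OF fT] T(2), of "\<lambda>v. bary T v x"] by simp
  moreover have "(\<Sum>v\<in>vertices T - {a}. bary T v x) > 0"
    using pos b finite_vertices[OF fT] by (intro sum_pos) auto
  ultimately have s: "0 < s" "s < 1" using pos[OF T(2)] by (auto simp: s_def)
  define P where "P z = (1 / (1 - s)) *\<^sub>R (z - s *\<^sub>R a)" for z :: "real^'n"
  have P: "P z \<in> ?e" if z: "z \<in> T" "bary T a z = s" for z
  proof -
    have "bary T b (P z) = (1 / (1 - s)) * (bary T b z - s * bary T b a)" for b
    proof -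
      have k: "(1 / (1 - s)) * (1 - s) = 1" using s(2) by simp
      have "bary T b (P z) = (1 / (1 - s)) * (bary_grad T b \<bullet> z - s * (bary_grad T b \<bullet> a)) +
          ((1 / (1 - s)) * (1 - s)) * bary_offset T b"
        unfolding k by (simp add: bary_def P_def inner_diff_right)
      also have "\<dots> = (1 / (1 - s)) * (bary T b z - s * bary T b a)"
        unfolding mult.assoc distrib_left[symmetric] by (simp add: bary_def algebra_simps)
      finally show ?thesis .
    qed
    then show ?thesis
      unfolding mem_facet_iff[OF T] using z simplex_mem_iff[OF fT] s bary_vertex[OF fT T(2)] by auto
  qed
  have sa: "bary T a (x + \<tau>) = s" if "bary_grad T a \<bullet> \<tau> = 0" for \<tau>
    using bary_diff[of T a "x + \<tau>" x] that by (simp add: s_def)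
  have "x \<in> T" using x \<rho> by (meson centre_in_cball less_imp_le subsetD)
  then have y: "P x \<in> ?e" by (rule P) (simp add: s_def)
  have "P x + \<tau> \<in> ?e" if \<tau>: "bary_grad T a \<bullet> \<tau> = 0" "norm \<tau> \<le> \<rho>" for \<tau>
  proof -
    have "x + \<tau> \<in> T" using x \<tau>(2) by (auto simp: dist_norm subset_iff)
    then have "P (x + \<tau>) \<in> ?e" using P sa[OF \<tau>(1)] by blast
    then have "s *\<^sub>R P x + (1 - s) *\<^sub>R P (x + \<tau>) \<in> ?e"
      using convexD[OF convex_convex_hull y, of "P (x + \<tau>)" s "1 - s"] s by simp
    moreover have "(1 - s) *\<^sub>R P (x + \<tau>) = (1 - s) *\<^sub>R P x + \<tau>"
      using s(2) by (simp add: P_def algebra_simps)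
    then have "s *\<^sub>R P x + (1 - s) *\<^sub>R P (x + \<tau>) = P x + \<tau>" by (simp add: algebra_simps)
    ultimately show ?thesis by simp
  qed
  with y show ?thesis by (auto simp: \<rho>_def)
qed

lemma boundary_face_inball:
  assumes e: "e \<in> boundary_faces \<T>"
  obtains T y where "T \<in> \<T>" "e facet_of T" "y \<in> e"
    "\<And>\<tau>. outer_normal \<T> e \<bullet> \<tau> = 0 \<Longrightarrow> norm \<tau> \<le> \<kappa> * diameter T \<Longrightarrow> y + \<tau> \<in> e"
proof -
  obtain T a where T: "T \<in> \<T>" "e facet_of T" "a \<in> vertices T" "e = convex hull (vertices T - {a})"
    by (rule boundary_face_obtain[OF e])
  have n: "outer_normal \<T> e \<bullet> \<tau> = 0 \<longleftrightarrow> bary_grad T a \<bullet> \<tau> = 0" for \<tau>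
    using outer_normal_eq[OF T(1,3,4) e] bary_grad_nonzero[OF full_simplex[OF T(1)] T(3)] by simp
  obtain y where "y \<in> e" "\<forall>\<tau>. bary_grad T a \<bullet> \<tau> = 0 \<longrightarrow> norm \<tau> \<le> \<kappa> * diameter T \<longrightarrow> y + \<tau> \<in> e"
    using facet_inball[OF T(1,3)] T(4) by blast
  then show thesis using that[OF T(1,2), of y] n by simp
qed

lemma boundary_face_diameter:
  assumes "e \<in> boundary_faces \<T>"
  shows "0 < diameter e" "diameter e \<le> h" "bounded e"
proof -
  obtain T where T: "T \<in> \<T>" "e facet_of T" by (rule boundary_face_obtain[OF assms])
  show "0 < diameter e" "diameter e \<le> h" "bounded e" using facet_diameter[OF T] by blast+
qed

text \<open>The topological tool of all later side arguments: a connected set can change sides only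
  across the frontier.\<close>

lemma mesh_connected_cases:
  assumes "connected A" "A \<inter> mesh_boundary \<T> = {}"
  shows "A \<subseteq> mesh_domain \<T> \<or> A \<inter> \<Union>\<T> = {}"
proof (cases "A \<inter> mesh_domain \<T> = {}")
  case True
  then show ?thesis using assms(2) unfolding mesh_boundary_eq by blast
next
  case False
  then have "A \<subseteq> mesh_domain \<T>"
    using connected_Int_frontier[OF assms(1) False] assms(2) unfolding mesh_boundary_def by blast
  then show ?thesis by blast
qed

end

section \<open>Meshes fitted to the frontier: slopes of the faces and steep cones\<close>

lemma convex_cone_set:
  fixes z m :: "'a::real_inner"
  assumes "0 \<le> a"
  shows "convex {w. a * norm (w - z) < (w - z) \<bullet> m}"
proof (rule convexI)
  fix x y and u v :: real
  assume x: "x \<in> {w. a * norm (w - z) < (w - z) \<bullet> m}" and y: "y \<in> {w. a * norm (w - z) < (w - z) \<bullet> m}"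
    and uv: "0 \<le> u" "0 \<le> v" "u + v = 1"
  have eq: "u *\<^sub>R x + v *\<^sub>R y - z = u *\<^sub>R (x - z) + v *\<^sub>R (y - z)"
    using uv(3) by (simp add: algebra_simps flip: scaleR_left_distrib)
  have "norm (u *\<^sub>R (x - z) + v *\<^sub>R (y - z)) \<le> u * norm (x - z) + v * norm (y - z)"
    using norm_triangle_ineq[of "u *\<^sub>R (x - z)" "v *\<^sub>R (y - z)"] uv by simp
  then have "a * norm (u *\<^sub>R (x - z) + v *\<^sub>R (y - z)) \<le> a * (u * norm (x - z) + v * norm (y - z))"
    using assms by (intro mult_left_mono)
  also have "\<dots> = u * (a * norm (x - z)) + v * (a * norm (y - z))" by (simp add: algebra_simps)
  also have "\<dots> < u * ((x - z) \<bullet> m) + v * ((y - z) \<bullet> m)"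
  proof (cases "u = 0")
    case True
    then show ?thesis using y uv by simp
  next
    case False
    then show ?thesis using x y uv by (intro add_less_le_mono mult_strict_left_mono mult_left_mono) auto
  qed
  also have "\<dots> = (u *\<^sub>R (x - z) + v *\<^sub>R (y - z)) \<bullet> m" by (simp add: inner_add_left)
  finally show "u *\<^sub>R x + v *\<^sub>R y \<in> {w. a * norm (w - z) < (w - z) \<bullet> m}"
    unfolding mem_Collect_eq eq .
qed

text \<open>The numerical conditions are calibrated to slopes. \<open>Kr\<close> keeps frontier
  normals at distance up to \<open>r / 3\<close> within 1/20 of each other,
  \<open>100 * K * h \<le> \<kappa>\<close> keeps a face within slope 1/20 of the tangent plane at
  its vertices, and \<open>h_tiny\<close> makes the mesh size at most the cut-off distance
  \<open>r2\<close> of the extension.\<close>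

locale boundary_fitted_mesh = shape_regular_mesh \<T> \<kappa> h for \<T> :: "(real^'n) set set" and \<kappa> h +
  fixes \<Omega> :: "(real^'n) set" and K r :: real and \<nu> :: "real^'n \<Rightarrow> real^'n"
  assumes open_\<Omega>: "open \<Omega>" and K_pos: "0 < K" and r_pos: "0 < r" and Kr: "100 * K * r \<le> 1"
    and normal: "\<And>q. q \<in> frontier \<Omega> \<Longrightarrow> two_sided \<Omega> K r q (\<nu> q)"
    and vertices_on: "\<And>e p. e \<in> boundary_faces \<T> \<Longrightarrow> p \<in> vertices e \<Longrightarrow> p \<in> frontier \<Omega>"
    and proj_inj: "inj_on (closest_point (frontier \<Omega>)) (mesh_boundary \<T>)"
    and proj_surj: "closest_point (frontier \<Omega>) ` mesh_boundary \<T> = frontier \<Omega>"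
    and near: "\<And>x. x \<in> mesh_boundary \<T> \<Longrightarrow> infdist x (frontier \<Omega>) \<le> r / 1000"
    and h_small: "1000 * h \<le> r" "100 * K * h \<le> \<kappa>" and r_le_1: "r \<le> 1"
    and h_tiny: "10000 * (1 + 1 / \<kappa>\<^sup>2) * h \<le> r"
begin

abbreviation "cp \<equiv> closest_point (frontier \<Omega>)"

lemma norm_\<nu>: "q \<in> frontier \<Omega> \<Longrightarrow> norm (\<nu> q) = 1"
  using normal by (simp add: two_sided_def)

lemma \<nu>_lipschitz:
  assumes "q \<in> frontier \<Omega>" "q' \<in> frontier \<Omega>" "2 * dist q q' < r"
  shows "norm (\<nu> q - \<nu> q') \<le> 10 * K * dist q q'"
  using two_sided_normal_lipschitz[OF normal[OF assms(1)] normal[OF assms(2)] open_\<Omega>] assms K_pos by simp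

lemma cp_mem:
  assumes "x \<in> mesh_boundary \<T>"
  shows "cp x \<in> frontier \<Omega>" "dist x (cp x) \<le> r / 1000"
proof -
  show c: "cp x \<in> frontier \<Omega>" using proj_surj assms by blast
  have "dist x (cp x) \<le> dist x y" if "y \<in> frontier \<Omega>" for y
    using closest_point_le[of "frontier \<Omega>" y x] that by simp
  then have "dist x (cp x) \<le> infdist x (frontier \<Omega>)"
    unfolding infdist_def using c by (auto intro!: cINF_greatest)
  then show "dist x (cp x) \<le> r / 1000" using near[OF assms] by linarith
qed

lemma normal_coordinate:
  assumes "x \<in> mesh_boundary \<T>"
  shows "\<exists>t. \<bar>t\<bar> \<le> r / 1000 \<and> x = cp x + t *\<^sub>R \<nu> (cp x)"
proof -
  have "dist x (cp x) \<le> dist x y" if "y \<in> frontier \<Omega>" for y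
    using closest_point_le[of "frontier \<Omega>" y x] that by simp
  then obtain t where "\<bar>t\<bar> = dist x (cp x)" "x = cp x + t *\<^sub>R \<nu> (cp x)"
    using nearest_point_normal[OF normal[OF cp_mem(1)[OF assms]] open_\<Omega> K_pos r_pos cp_mem(1)[OF assms]] by blast
  then show ?thesis using cp_mem(2)[OF assms] by metis
qed

text \<open>The vertices of \<open>e\<close> are frontier points, hence by convexity all of
  \<open>e\<close> lies within \<open>K * diameter e ^ 2\<close> of the tangent plane at
  \<open>q\<close>. As \<open>e\<close> contains a disc of radius at least
  \<open>\<kappa> * diameter e\<close>, dividing by this radius bounds the slope.\<close>

lemma face_slope_vertex:
  assumes e: "e \<in> boundary_faces \<T>" and q: "q \<in> vertices e" and \<tau>: "outer_normal \<T> e \<bullet> \<tau> = 0"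
  shows "\<bar>\<nu> q \<bullet> \<tau>\<bar> \<le> 2 * K / \<kappa> * diameter e * norm \<tau>"
proof -
  obtain T y where T: "T \<in> \<T>" "e facet_of T" "y \<in> e"
    and y: "\<And>\<tau>. outer_normal \<T> e \<bullet> \<tau> = 0 \<Longrightarrow> norm \<tau> \<le> \<kappa> * diameter T \<Longrightarrow> y + \<tau> \<in> e"
    using boundary_face_inball[OF e] by metis
  define d where "d = diameter e"
  note fdist = facet_diameter[OF T(1,2)]
  note ce = boundary_face_compact_convex[OF e]
  have ve: "v \<in> e" if "v \<in> vertices e" for v using ce(8) that hull_inc by metis
  have vb: "\<bar>\<nu> q \<bullet> (v - q)\<bar> \<le> K * d\<^sup>2" if v: "v \<in> vertices e" for v
  proof -
    have "dist v q \<le> d" using diameter_bounded_bound[OF fdist(5) ve[OF v] ve[OF q]] by (simp add: d_def)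
    moreover have "d < r" using fdist(4) h_small(1) r_pos fdist(3) unfolding d_def by linarith
    ultimately have "v \<in> ball q r" by (simp add: dist_commute)
    then have "\<bar>(v - q) \<bullet> \<nu> q\<bar> \<le> K * (norm (v - q))\<^sup>2"
      using two_sided_frontier[OF normal[OF vertices_on[OF e q]] vertices_on[OF e v] open_\<Omega>] by blast
    also have "\<dots> \<le> K * d\<^sup>2"
      using \<open>dist v q \<le> d\<close> K_pos by (intro mult_left_mono power_mono) (auto simp: dist_norm)
    finally show ?thesis by (simp add: inner_commute)
  qed
  have xb: "\<bar>\<nu> q \<bullet> (x - q)\<bar> \<le> K * d\<^sup>2" if x: "x \<in> e" for x
  proof -
    obtain u where u: "\<forall>v\<in>vertices e. 0 \<le> u v" "sum u (vertices e) = 1" "(\<Sum>v\<in>vertices e. u v *\<^sub>R v) = x"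
      using x ce(7,8) convex_hull_finite[OF ce(7)] by blast
    have "\<nu> q \<bullet> (x - q) = \<nu> q \<bullet> ((\<Sum>v\<in>vertices e. u v *\<^sub>R v) - sum u (vertices e) *\<^sub>R q)" using u by simp
    also have "\<dots> = (\<Sum>v\<in>vertices e. u v * (\<nu> q \<bullet> (v - q)))"
      by (simp add: inner_diff_right inner_sum_right sum_distrib_right sum_subtractf algebra_simps)
    finally have "\<bar>\<nu> q \<bullet> (x - q)\<bar> \<le> (\<Sum>v\<in>vertices e. \<bar>u v * (\<nu> q \<bullet> (v - q))\<bar>)" using sum_abs by metis
    also have "\<dots> \<le> (\<Sum>v\<in>vertices e. u v * (K * d\<^sup>2))"
      by (intro sum_mono) (use u(1) vb in \<open>simp add: abs_mult mult_left_mono\<close>)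
    also have "\<dots> = K * d\<^sup>2" using u(2) by (simp flip: sum_distrib_right)
    finally show ?thesis .
  qed
  show ?thesis
  proof (cases "\<tau> = 0")
    case False
    define \<rho> where "\<rho> = \<kappa> * diameter T"
    have \<rho>: "\<rho> > 0" using \<kappa>_pos diameter_simplex_pos[OF T(1)] by (simp add: \<rho>_def)
    have "y + (\<rho> / norm \<tau>) *\<^sub>R \<tau> \<in> e" using y \<tau> \<rho> False by (simp add: \<rho>_def)
    from xb[OF this] xb[OF T(3)]
    have "\<bar>\<nu> q \<bullet> ((\<rho> / norm \<tau>) *\<^sub>R \<tau>)\<bar> \<le> 2 * (K * d\<^sup>2)"
      by (simp add: inner_diff_right inner_add_right)
    then have 1: "\<rho> * \<bar>\<nu> q \<bullet> \<tau>\<bar> \<le> 2 * (K * d\<^sup>2) * norm \<tau>"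
      using False \<rho> by (simp add: abs_mult field_simps)
    have "\<kappa> * d \<le> \<rho>" using fdist(2) \<kappa>_pos by (simp add: \<rho>_def d_def)
    then have "\<kappa> * d * \<bar>\<nu> q \<bullet> \<tau>\<bar> \<le> 2 * (K * d\<^sup>2) * norm \<tau>"
      using 1 by (meson abs_ge_zero mult_right_mono order_trans)
    then have "d * (\<kappa> * \<bar>\<nu> q \<bullet> \<tau>\<bar>) \<le> d * (2 * K * d * norm \<tau>)" by (simp add: power2_eq_square algebra_simps)
    then have "\<kappa> * \<bar>\<nu> q \<bullet> \<tau>\<bar> \<le> 2 * K * d * norm \<tau>" using fdist(3) by (simp add: d_def)
    then show ?thesis using \<kappa>_pos by (simp add: d_def field_simps)
  qed simp
qed

text \<open>Tested against the part \<open>p\<close> of \<open>m\<close> orthogonal to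
  \<open>n\<close>, the slope bound becomes \<open>norm p \<le> \<epsilon>\<close>; the component
  along \<open>n\<close> is then close to 1 or -1.\<close>

lemma unit_vector_decomposition:
  fixes n m :: "real^'n"
  assumes n: "norm n = 1" and m: "norm m = 1" and \<epsilon>: "\<And>\<tau>. n \<bullet> \<tau> = 0 \<Longrightarrow> \<bar>m \<bullet> \<tau>\<bar> \<le> \<epsilon> * norm \<tau>"
  shows "1 - \<epsilon> \<le> \<bar>m \<bullet> n\<bar>" "0 < m \<bullet> n \<Longrightarrow> norm (n - m) \<le> 2 * \<epsilon>" "m \<bullet> n < 0 \<Longrightarrow> norm (n + m) \<le> 2 * \<epsilon>"
proof -
  define p where "p = m - (m \<bullet> n) *\<^sub>R n"
  have nn: "n \<bullet> n = 1" "m \<bullet> m = 1" using n m by (auto simp: dot_square_norm)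
  have np: "n \<bullet> p = 0" by (simp add: p_def inner_diff_right nn inner_commute)
  have "m \<bullet> p = p \<bullet> p" by (simp add: p_def inner_diff_right inner_diff_left nn inner_commute)
  then have "(norm p)\<^sup>2 \<le> \<epsilon> * norm p" using \<epsilon>[OF np] by (simp add: power2_norm_eq_inner)
  moreover have e0: "0 \<le> \<epsilon> * norm p" using \<epsilon>[OF np] by linarith
  ultimately have p: "norm p \<le> \<epsilon> \<or> p = 0" by (auto simp: power2_eq_square)
  \<comment> \<open>For \<open>p = 0\<close> the bound at \<open>p\<close> says nothing about the
    sign of \<open>\<epsilon>\<close>. It is tested at a nonzero vector orthogonal to
    \<open>n\<close>, which exists in dimension at least 2.\<close>
  have e0': "0 \<le> \<epsilon>"
  proof -
    obtain i where i: "n $ i \<noteq> 0" using n by (metis norm_zero vec_eq_iff zero_index zero_neq_one)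
    have "2 \<le> CARD('n)" by (rule dim_ge_2)
    then obtain j where j: "j \<noteq> i" by (metis UNIV_I card_1_singleton_iff finite_UNIV is_singletonI' is_singleton_altdef empty_not_UNIV numeral_le_one_iff semiring_norm(69))
    define \<tau> where "\<tau> = (n $ i) *\<^sub>R axis j 1 - (n $ j) *\<^sub>R axis i (1::real)"
    have "n \<bullet> \<tau> = 0" by (simp add: \<tau>_def inner_diff_right inner_axis)
    moreover have "\<tau> $ j \<noteq> 0" using i j by (simp add: \<tau>_def axis_def)
    then have "norm \<tau> > 0" by auto
    ultimately show ?thesis using \<epsilon>[of \<tau>] by (smt (verit) mult_neg_pos)
  qed
  then have p: "norm p \<le> \<epsilon>" using p by auto
  have mp: "m = p + (m \<bullet> n) *\<^sub>R n" by (simp add: p_def)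
  have "1 \<le> norm p + \<bar>m \<bullet> n\<bar>" using norm_triangle_ineq[of p "(m \<bullet> n) *\<^sub>R n"] mp m n by simp
  then show a: "1 - \<epsilon> \<le> \<bar>m \<bullet> n\<bar>" using p by linarith
  have b: "\<bar>m \<bullet> n\<bar> \<le> 1" using Cauchy_Schwarz_ineq2[of m n] m n by simp
  show "norm (n - m) \<le> 2 * \<epsilon>" if "0 < m \<bullet> n"
  proof -
    have "n - m = (1 - m \<bullet> n) *\<^sub>R n - p" by (simp add: p_def algebra_simps)
    then have "norm (n - m) \<le> \<bar>1 - m \<bullet> n\<bar> + norm p" using norm_triangle_ineq4[of "(1 - m \<bullet> n) *\<^sub>R n" p] n by simp
    then show ?thesis using a b p that by linarith
  qed
  show "norm (n + m) \<le> 2 * \<epsilon>" if "m \<bullet> n < 0"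
  proof -
    have "n + m = (1 + m \<bullet> n) *\<^sub>R n + p" by (simp add: p_def algebra_simps)
    then have "norm (n + m) \<le> \<bar>1 + m \<bullet> n\<bar> + norm p" using norm_triangle_ineq[of "(1 + m \<bullet> n) *\<^sub>R n" p] n by simp
    then show ?thesis using a b p that by linarith
  qed
qed

lemma vertices_mem: "e \<in> boundary_faces \<T> \<Longrightarrow> v \<in> vertices e \<Longrightarrow> v \<in> e"
  using boundary_face_compact_convex(8) hull_inc by metis

lemma boundary_face_has_vertex: "e \<in> boundary_faces \<T> \<Longrightarrow> \<exists>q. q \<in> vertices e"
  using boundary_face_compact_convex(3,8) by (metis convex_hull_empty ex_in_conv)

lemma boundary_face_dist:
  assumes "e \<in> boundary_faces \<T>" "x \<in> e" "y \<in> e" shows "dist x y \<le> diameter e"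
  using diameter_bounded_bound[OF boundary_face_diameter(3)] assms by blast

text \<open>Two contributions of 1/20: the slope against the tangent plane at a vertex of
  \<open>e\<close>, and the turn of the frontier normal between that vertex and
  \<open>p\<close>.\<close>

lemma face_slope:
  assumes e: "e \<in> boundary_faces \<T>" and p: "p \<in> frontier \<Omega>" and x: "x \<in> e" "x \<in> ball p (r / 4)"
    and \<tau>: "outer_normal \<T> e \<bullet> \<tau> = 0"
  shows "\<bar>\<nu> p \<bullet> \<tau>\<bar> \<le> (1 / 10) * norm \<tau>"
proof -
  obtain q where q: "q \<in> vertices e" using boundary_face_has_vertex[OF e] by blast
  have "dist q x \<le> h" using boundary_face_dist[OF e vertices_mem[OF e q] x(1)] boundary_face_diameter(2)[OF e] by linarith
  then have d: "dist q p \<le> r / 3" using dist_triangle[of q p x] x(2) h_small(1) r_pos by (simp add: dist_commute)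
  have "norm (\<nu> p - \<nu> q) \<le> 10 * K * dist p q"
    using \<nu>_lipschitz[OF p vertices_on[OF e q]] d r_pos by (simp add: dist_commute)
  also have "\<dots> \<le> 10 * K * (r / 3)" using d K_pos by (intro mult_left_mono) (auto simp: dist_commute)
  also have "\<dots> \<le> 1 / 20" using Kr by simp
  finally have 1: "norm (\<nu> p - \<nu> q) \<le> 1 / 20" .
  have "\<bar>(\<nu> p - \<nu> q) \<bullet> \<tau>\<bar> \<le> norm (\<nu> p - \<nu> q) * norm \<tau>" by (rule Cauchy_Schwarz_ineq2)
  also have "\<dots> \<le> 1 / 20 * norm \<tau>" using 1 by (intro mult_right_mono) auto
  finally have 2: "\<bar>(\<nu> p - \<nu> q) \<bullet> \<tau>\<bar> \<le> 1 / 20 * norm \<tau>" .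
  have "2 * K / \<kappa> * diameter e \<le> 2 * K / \<kappa> * h"
    using boundary_face_diameter(2)[OF e] K_pos \<kappa>_pos by (intro mult_left_mono) auto
  also have "\<dots> \<le> 1 / 20" using h_small(2) \<kappa>_pos K_pos by (simp add: field_simps)
  finally have "2 * K / \<kappa> * diameter e * norm \<tau> \<le> 1 / 20 * norm \<tau>" by (intro mult_right_mono) auto
  then have "\<bar>\<nu> q \<bullet> \<tau>\<bar> \<le> 1 / 20 * norm \<tau>" using face_slope_vertex[OF e q \<tau>] by linarith
  then show ?thesis using 2 unfolding inner_diff_left by linarith
qed

text \<open>Frontier points near \<open>p\<close> deviate from the tangent plane by at most
  \<open>K * r^2\<close>, which is at most \<open>r / 100\<close>, and the mesh boundary is within
  \<open>r / 1000\<close> of the frontier.\<close>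

lemma cap_bound:
  assumes p: "p \<in> frontier \<Omega>" and x: "x \<in> mesh_boundary \<T>" "x \<in> ball p (9 / 10 * r)"
  shows "\<bar>(x - p) \<bullet> \<nu> p\<bar> \<le> r / 50"
proof -
  have c: "cp x \<in> frontier \<Omega>" "dist x (cp x) \<le> r / 1000" using cp_mem[OF x(1)] by auto
  have d: "dist p (cp x) < r" using dist_triangle[of p "cp x" x] x(2) c(2) r_pos by (simp add: dist_commute)
  then have "\<bar>(cp x - p) \<bullet> \<nu> p\<bar> \<le> K * (norm (cp x - p))\<^sup>2"
    using two_sided_frontier[OF normal[OF p] c(1) open_\<Omega>] by simp
  also have "\<dots> \<le> K * r\<^sup>2" using d K_pos by (intro mult_left_mono power_mono) (auto simp: dist_norm norm_minus_commute)
  also have "\<dots> \<le> r / 100" using mult_right_mono[OF Kr, of r] r_pos by (simp add: power2_eq_square)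
  finally have 1: "\<bar>(cp x - p) \<bullet> \<nu> p\<bar> \<le> r / 100" .
  have "\<bar>(x - cp x) \<bullet> \<nu> p\<bar> \<le> norm (x - cp x) * norm (\<nu> p)" by (rule Cauchy_Schwarz_ineq2)
  then have "\<bar>(x - cp x) \<bullet> \<nu> p\<bar> \<le> r / 1000" using c(2) norm_\<nu>[OF p] by (simp add: dist_norm)
  moreover have "(x - p) \<bullet> \<nu> p = (x - cp x) \<bullet> \<nu> p + (cp x - p) \<bullet> \<nu> p" by (simp add: inner_diff_left)
  ultimately show ?thesis using 1 r_pos by linarith
qed

text \<open>All points of a short normal segment have the same nearest frontier point, so
  injectivity of the projection leaves room for only one point of the mesh boundary on it.\<close>

lemma normal_line_misses:
  assumes z: "z \<in> mesh_boundary \<T>" and s: "s \<noteq> 0" "\<bar>s\<bar> \<le> r / 4"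
  shows "z + s *\<^sub>R \<nu> (cp z) \<notin> mesh_boundary \<T>"
proof
  assume m: "z + s *\<^sub>R \<nu> (cp z) \<in> mesh_boundary \<T>"
  obtain t where t: "\<bar>t\<bar> \<le> r / 1000" "z = cp z + t *\<^sub>R \<nu> (cp z)" using normal_coordinate[OF z] by blast
  have st: "\<bar>t + s\<bar> \<le> r / 3" using t(1) s(2) r_pos by linarith
  have eq: "z + s *\<^sub>R \<nu> (cp z) = cp z + (t + s) *\<^sub>R \<nu> (cp z)" by (subst t(2)) (simp add: algebra_simps)
  have "\<bar>t + s\<bar> * K \<le> r / 3 * K" using st K_pos by (intro mult_right_mono) auto
  also have "r / 3 * K \<le> 1 / 300" using Kr by (simp add: mult.commute mult.left_commute)
  finally have "2 * \<bar>t + s\<bar> * K < 1" by simp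
  moreover have "2 * \<bar>t + s\<bar> < r"
  proof -
    have "2 * \<bar>t + s\<bar> \<le> 2 * (r / 3)" using st by simp
    also have "\<dots> < r" using r_pos by simp
    finally show ?thesis .
  qed
  ultimately have "cp (cp z + (t + s) *\<^sub>R \<nu> (cp z)) = cp z"
    using closest_point_normal_line[OF normal[OF cp_mem(1)[OF z]] open_\<Omega> K_pos cp_mem(1)[OF z]] by blast
  then have "cp (z + s *\<^sub>R \<nu> (cp z)) = cp z" using eq by simp
  then have "z + s *\<^sub>R \<nu> (cp z) = z" using proj_inj m z by (meson inj_onD)
  then show False using s(1) norm_\<nu>[OF cp_mem(1)[OF z]] by auto
qed

text \<open>Close to \<open>z\<close> only faces through \<open>z\<close> occur. Their slope is at
  most 1/10, so a cone of slope 1/2 with apex \<open>z\<close> avoids them, and being convex it is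
  connected.\<close>

lemma local_cone:
  assumes p: "p \<in> frontier \<Omega>" and z: "z \<in> mesh_boundary \<T>" "z \<in> ball p (r / 4)" and \<sigma>: "\<sigma> = 1 \<or> \<sigma> = -1"
  shows "\<exists>\<epsilon>>0. \<forall>A. A = {w. w \<in> ball z \<epsilon> \<and> (1 / 2) * norm (w - z) < \<sigma> * ((w - z) \<bullet> \<nu> p)} \<longrightarrow>
    connected A \<and> A \<inter> mesh_boundary \<T> = {}"
proof -
  let ?F = "{e \<in> boundary_faces \<T>. z \<notin> e}"
  have "closed (\<Union>?F)"
    using finite_boundary_faces boundary_face_compact_convex(1) compact_imp_closed by (intro closed_Union) auto
  moreover have "z \<notin> \<Union>?F" by blast
  ultimately obtain \<epsilon> where \<epsilon>: "\<epsilon> > 0" "ball z \<epsilon> \<subseteq> - \<Union>?F" using openE[of "- \<Union>?F" z] by auto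
  let ?A = "{w. w \<in> ball z \<epsilon> \<and> (1 / 2) * norm (w - z) < \<sigma> * ((w - z) \<bullet> \<nu> p)}"
  have cc: "convex {w. (1 / 2) * norm (w - z) < \<sigma> * ((w - z) \<bullet> \<nu> p)}"
    using convex_cone_set[of "1 / 2" z "\<sigma> *\<^sub>R \<nu> p"] by simp
  have "?A = ball z \<epsilon> \<inter> {w. (1 / 2) * norm (w - z) < \<sigma> * ((w - z) \<bullet> \<nu> p)}" by blast
  then have "convex ?A" using convex_Int[OF convex_ball[of z \<epsilon>] cc] by (simp only:)
  then have c: "connected ?A" by (rule convex_connected)
  have "w \<notin> mesh_boundary \<T>" if w: "w \<in> ?A" for w
  proof
    assume "w \<in> mesh_boundary \<T>"
    then obtain e where e: "e \<in> boundary_faces \<T>" "w \<in> e" unfolding mesh_boundary_eq_Union by blast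
    have "z \<in> e" using e \<epsilon>(2) w by blast
    obtain T a where T: "T \<in> \<T>" "a \<in> vertices T" "e = convex hull (vertices T - {a})"
      by (rule boundary_face_obtain[OF e(1)])
    have "outer_normal \<T> e \<bullet> (w - z) = 0" by (rule face_orthogonal[OF T e(1) e(2) \<open>z \<in> e\<close>])
    then have "\<bar>\<nu> p \<bullet> (w - z)\<bar> \<le> (1 / 10) * norm (w - z)" by (rule face_slope[OF e(1) p \<open>z \<in> e\<close> z(2)])
    moreover have "\<sigma> * ((w - z) \<bullet> \<nu> p) \<le> \<bar>\<nu> p \<bullet> (w - z)\<bar>" using \<sigma> by (auto simp: inner_commute)
    ultimately have "(1 / 2) * norm (w - z) < (1 / 10) * norm (w - z)" using w by (simp only: mem_Collect_eq) linarith
    then show False using norm_ge_zero[of "w - z"] by linarith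
  qed
  then have "?A \<inter> mesh_boundary \<T> = {}" by blast
  with c \<epsilon>(1) show ?thesis by blast
qed

end


section \<open>The discrete boundary as a Lipschitz graph\<close>

context boundary_fitted_mesh
begin

lemma nu_close:
  assumes p: "p \<in> frontier \<Omega>" and q: "q \<in> frontier \<Omega>" "dist p q \<le> r / 3"
  shows "19 / 20 \<le> \<nu> q \<bullet> \<nu> p"
proof -
  have "norm (\<nu> p - \<nu> q) \<le> 10 * K * dist p q" using \<nu>_lipschitz[OF p q(1)] q(2) r_pos by simp
  also have "\<dots> \<le> 10 * K * (r / 3)" using q(2) K_pos by (intro mult_left_mono) auto
  also have "\<dots> \<le> 1 / 20" using Kr by simp
  finally have 1: "norm (\<nu> p - \<nu> q) \<le> 1 / 20" .
  have pp: "\<nu> p \<bullet> \<nu> p = 1" using norm_\<nu>[OF p] by (simp add: dot_square_norm)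
  have "\<bar>(\<nu> p - \<nu> q) \<bullet> \<nu> p\<bar> \<le> norm (\<nu> p - \<nu> q) * norm (\<nu> p)" by (rule Cauchy_Schwarz_ineq2)
  then have "\<bar>(\<nu> p - \<nu> q) \<bullet> \<nu> p\<bar> \<le> 1 / 20" using 1 norm_\<nu>[OF p] by simp
  then show ?thesis unfolding inner_diff_left pp by linarith
qed

text \<open>The caps on the two sides of the tangent plane at \<open>p\<close> are free of mesh
  boundary, so each is wholly inside or wholly outside the mesh. They are the reference from which
  the side of nearby cones and normal lines is read off.\<close>

definition cap :: "real^'n \<Rightarrow> real \<Rightarrow> (real^'n) set" where
  "cap p \<sigma> = {y \<in> ball p (9 / 10 * r). r / 50 < \<sigma> * ((y - p) \<bullet> \<nu> p)}"

lemma cap_misses: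
  assumes "p \<in> frontier \<Omega>" "\<sigma> = 1 \<or> \<sigma> = -1"
  shows "connected (cap p \<sigma>)" "cap p \<sigma> \<inter> mesh_boundary \<T> = {}"
proof -
  have "{y. r / 50 < \<sigma> * ((y - p) \<bullet> \<nu> p)} = {y. (\<sigma> *\<^sub>R \<nu> p) \<bullet> y > r / 50 + \<sigma> * (\<nu> p \<bullet> p)}"
    by (simp add: inner_diff_left inner_diff_right right_diff_distrib inner_commute[of _ "\<nu> p"] algebra_simps)
  then have "convex {y. r / 50 < \<sigma> * ((y - p) \<bullet> \<nu> p)}" by (simp only: convex_halfspace_gt)
  moreover have "cap p \<sigma> = ball p (9 / 10 * r) \<inter> {y. r / 50 < \<sigma> * ((y - p) \<bullet> \<nu> p)}" by (auto simp: cap_def)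
  ultimately have "convex (cap p \<sigma>)" using convex_Int[OF convex_ball] by (simp only:)
  then show "connected (cap p \<sigma>)" by (rule convex_connected)
  show "cap p \<sigma> \<inter> mesh_boundary \<T> = {}"
  proof (rule ccontr)
    assume "cap p \<sigma> \<inter> mesh_boundary \<T> \<noteq> {}"
    then obtain x where x: "x \<in> mesh_boundary \<T>" "x \<in> ball p (9 / 10 * r)" "r / 50 < \<sigma> * ((x - p) \<bullet> \<nu> p)"
      by (auto simp: cap_def)
    have "\<sigma> * ((x - p) \<bullet> \<nu> p) \<le> \<bar>(x - p) \<bullet> \<nu> p\<bar>" using assms(2) by auto
    then show False using cap_bound[OF assms(1) x(1,2)] x(3) by linarith
  qed
qed

text \<open>The normal segment from \<open>z\<close> meets no mesh boundary after its start and has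
  reached the cap at length \<open>r / 4\<close>, so it carries the side of the cap down to
  \<open>z\<close>. This is where injectivity of the projection rules out several sheets of the
  boundary.\<close>

lemma normal_line_side:
  assumes p: "p \<in> frontier \<Omega>" and z: "z \<in> mesh_boundary \<T>" "z \<in> ball p (r / 4)" and \<sigma>: "\<sigma> = 1 \<or> \<sigma> = -1"
    and s: "0 < s" "s \<le> r / 4"
  shows "cap p \<sigma> \<subseteq> mesh_domain \<T> \<Longrightarrow> z + (\<sigma> * s) *\<^sub>R \<nu> (cp z) \<in> mesh_domain \<T>"
    "cap p \<sigma> \<inter> \<Union>\<T> = {} \<Longrightarrow> z + (\<sigma> * s) *\<^sub>R \<nu> (cp z) \<notin> \<Union>\<T>"
proof -
  let ?A = "(\<lambda>s. z + (\<sigma> * s) *\<^sub>R \<nu> (cp z)) ` {0<..r / 4}"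
  have "connected ?A" by (intro connected_continuous_image continuous_intros connected_Ioc)
  moreover have "?A \<inter> mesh_boundary \<T> = {}"
  proof -
    have "z + (\<sigma> * s) *\<^sub>R \<nu> (cp z) \<notin> mesh_boundary \<T>" if "s \<in> {0<..r / 4}" for s
      by (rule normal_line_misses[OF z(1)]) (use \<sigma> that in auto)
    then show ?thesis by blast
  qed
  ultimately have A: "?A \<subseteq> mesh_domain \<T> \<or> ?A \<inter> \<Union>\<T> = {}" by (rule mesh_connected_cases)
  have c: "cp z \<in> frontier \<Omega>" "dist z (cp z) \<le> r / 1000" using cp_mem[OF z(1)] by auto
  have "dist p (cp z) \<le> r / 3" using dist_triangle[of p "cp z" z] z(2) c(2) r_pos by simp
  then have i: "19 / 20 \<le> \<nu> (cp z) \<bullet> \<nu> p" by (rule nu_close[OF p c(1)])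
  let ?w = "z + (\<sigma> * (r / 4)) *\<^sub>R \<nu> (cp z)"
  have "?w \<in> cap p \<sigma>"
  proof -
    have "dist p ?w \<le> dist p z + dist z ?w" by (rule dist_triangle)
    also have "dist z ?w = r / 4" using \<sigma> norm_\<nu>[OF c(1)] r_pos by (auto simp: dist_norm)
    finally have "?w \<in> ball p (9 / 10 * r)" using z(2) r_pos by simp
    moreover have "r / 50 < \<sigma> * ((?w - p) \<bullet> \<nu> p)"
    proof -
      have "z \<in> ball p (9 / 10 * r)" using z(2) r_pos by simp
      then have "\<bar>(z - p) \<bullet> \<nu> p\<bar> \<le> r / 50" by (rule cap_bound[OF p z(1)])
      then have "- (r / 50) \<le> \<sigma> * ((z - p) \<bullet> \<nu> p)" using \<sigma> by auto
      moreover have "\<sigma> * ((?w - p) \<bullet> \<nu> p) = \<sigma> * ((z - p) \<bullet> \<nu> p) + (r / 4) * (\<nu> (cp z) \<bullet> \<nu> p)"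
      proof -
        have "\<sigma> * ((?w - p) \<bullet> \<nu> p) = \<sigma> * ((z - p) \<bullet> \<nu> p) + \<sigma> * \<sigma> * ((r / 4) * (\<nu> (cp z) \<bullet> \<nu> p))"
          by (simp add: inner_diff_left inner_add_left algebra_simps)
        moreover have "\<sigma> * \<sigma> = 1" using \<sigma> by auto
        ultimately show ?thesis by simp
      qed
      moreover have "(r / 4) * (19 / 20) \<le> (r / 4) * (\<nu> (cp z) \<bullet> \<nu> p)"
        using i r_pos by (intro mult_left_mono) auto
      ultimately show ?thesis using r_pos by linarith
    qed
    ultimately show ?thesis by (simp add: cap_def)
  qed
  moreover have "?w \<in> ?A" by (rule imageI) (use r_pos in simp)
  moreover have "z + (\<sigma> * s) *\<^sub>R \<nu> (cp z) \<in> ?A" by (rule imageI) (use s in simp)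
  moreover have "mesh_domain \<T> \<subseteq> \<Union>\<T>" by (simp add: mesh_domain_def interior_subset)
  ultimately show "cap p \<sigma> \<subseteq> mesh_domain \<T> \<Longrightarrow> z + (\<sigma> * s) *\<^sub>R \<nu> (cp z) \<in> mesh_domain \<T>"
    "cap p \<sigma> \<inter> \<Union>\<T> = {} \<Longrightarrow> z + (\<sigma> * s) *\<^sub>R \<nu> (cp z) \<notin> \<Union>\<T>" using A by blast+
qed

text \<open>Nearby frontier normals are almost parallel, so the beginning of the normal segment lies
  in the cone at \<open>z\<close>; cone and cap are therefore on the same side.\<close>

lemma local_cone_side:
  assumes p: "p \<in> frontier \<Omega>" and z: "z \<in> mesh_boundary \<T>" "z \<in> ball p (r / 4)" and \<sigma>: "\<sigma> = 1 \<or> \<sigma> = -1"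
  shows "\<exists>\<epsilon>>0. (cap p \<sigma> \<subseteq> mesh_domain \<T> \<longrightarrow>
      (\<forall>w\<in>ball z \<epsilon>. (1 / 2) * norm (w - z) < \<sigma> * ((w - z) \<bullet> \<nu> p) \<longrightarrow> w \<in> mesh_domain \<T>)) \<and>
    (cap p \<sigma> \<inter> \<Union>\<T> = {} \<longrightarrow>
      (\<forall>w\<in>ball z \<epsilon>. (1 / 2) * norm (w - z) < \<sigma> * ((w - z) \<bullet> \<nu> p) \<longrightarrow> w \<notin> \<Union>\<T>))"
proof -
  obtain \<epsilon> where \<epsilon>: "\<epsilon> > 0" "\<And>A. A = {w. w \<in> ball z \<epsilon> \<and> (1 / 2) * norm (w - z) < \<sigma> * ((w - z) \<bullet> \<nu> p)} \<Longrightarrow>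
    connected A \<and> A \<inter> mesh_boundary \<T> = {}" using local_cone[OF assms] by blast
  let ?A = "{w. w \<in> ball z \<epsilon> \<and> (1 / 2) * norm (w - z) < \<sigma> * ((w - z) \<bullet> \<nu> p)}"
  have A: "?A \<subseteq> mesh_domain \<T> \<or> ?A \<inter> \<Union>\<T> = {}" using mesh_connected_cases[of ?A] \<epsilon>(2)[OF refl] by blast
  define s where "s = min (\<epsilon> / 2) (r / 4)"
  have s: "0 < s" "s \<le> r / 4" "s < \<epsilon>" using \<epsilon>(1) r_pos by (auto simp: s_def)
  let ?w = "z + (\<sigma> * s) *\<^sub>R \<nu> (cp z)"
  have c: "cp z \<in> frontier \<Omega>" "dist z (cp z) \<le> r / 1000" using cp_mem[OF z(1)] by auto
  have "dist p (cp z) \<le> r / 3" using dist_triangle[of p "cp z" z] z(2) c(2) r_pos by simp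
  then have i: "19 / 20 \<le> \<nu> (cp z) \<bullet> \<nu> p" by (rule nu_close[OF p c(1)])
  have nw: "norm (?w - z) = s" using \<sigma> norm_\<nu>[OF c(1)] s by auto
  have "\<sigma> * ((?w - z) \<bullet> \<nu> p) = s * (\<nu> (cp z) \<bullet> \<nu> p)" using \<sigma> by auto
  moreover have "s * (19 / 20) \<le> s * (\<nu> (cp z) \<bullet> \<nu> p)" using i s by (intro mult_left_mono) auto
  ultimately have "(1 / 2) * norm (?w - z) < \<sigma> * ((?w - z) \<bullet> \<nu> p)" using nw s by linarith
  moreover have "?w \<in> ball z \<epsilon>" using nw s(3) by (simp add: dist_norm)
  ultimately have wA: "?w \<in> ?A" by blast
  have sub: "mesh_domain \<T> \<subseteq> \<Union>\<T>" by (simp add: mesh_domain_def interior_subset)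
  have 1: "?A \<subseteq> mesh_domain \<T>" if "cap p \<sigma> \<subseteq> mesh_domain \<T>"
    using normal_line_side(1)[OF p z \<sigma> s(1,2) that] A wA sub by blast
  have 2: "?A \<inter> \<Union>\<T> = {}" if "cap p \<sigma> \<inter> \<Union>\<T> = {}"
    using normal_line_side(2)[OF p z \<sigma> s(1,2) that] A wA sub by blast
  show ?thesis using \<epsilon>(1) 1 2 by blast
qed

lemma face_normal_slope:
  assumes e: "e \<in> boundary_faces \<T>" and p: "p \<in> frontier \<Omega>" and x: "x \<in> e" "x \<in> ball p (r / 4)"
  shows "9 / 10 \<le> \<bar>\<nu> p \<bullet> outer_normal \<T> e\<bar>"
  using unit_vector_decomposition(1)[OF norm_outer_normal[OF e] norm_\<nu>[OF p], of "1 / 10"]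
    face_slope[OF e p x] by simp

text \<open>At the barycenter of a face the mesh is exactly a half ball, so the cones above and
  below, and with them the two caps of \<open>p\<close>, are on opposite sides. The caps depend on
  \<open>p\<close> only, which forces one sign \<open>\<sigma>\<close> for all nearby faces.\<close>

lemma opposite_sides:
  assumes p: "p \<in> frontier \<Omega>"
  shows "\<exists>\<sigma>. (\<sigma> = 1 \<or> \<sigma> = -1) \<and> cap p (- \<sigma>) \<subseteq> mesh_domain \<T> \<and> cap p \<sigma> \<inter> \<Union>\<T> = {} \<and>
    (\<forall>e\<in>boundary_faces \<T>. barycenter e \<in> ball p (r / 4) \<longrightarrow> 9 / 10 \<le> outer_normal \<T> e \<bullet> (\<sigma> *\<^sub>R \<nu> p))"
proof -
  have sub: "mesh_domain \<T> \<subseteq> \<Union>\<T>" by (simp add: mesh_domain_def interior_subset)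
  have key: "cap p (- sgn (outer_normal \<T> e \<bullet> \<nu> p)) \<subseteq> mesh_domain \<T> \<and>
      cap p (sgn (outer_normal \<T> e \<bullet> \<nu> p)) \<inter> \<Union>\<T> = {} \<and> 9 / 10 \<le> \<bar>outer_normal \<T> e \<bullet> \<nu> p\<bar>"
    if e: "e \<in> boundary_faces \<T>" "barycenter e \<in> ball p (r / 4)" for e
  proof -
    let ?z = "barycenter e" and ?n = "outer_normal \<T> e"
    note ce = boundary_face_compact_convex[OF e(1)]
    have z: "?z \<in> mesh_boundary \<T>" using ce(5,6) by blast
    have n9: "9 / 10 \<le> \<bar>?n \<bullet> \<nu> p\<bar>" using face_normal_slope[OF e(1) p ce(5) e(2)] by (simp add: inner_commute)
    define \<sigma> where "\<sigma> = sgn (?n \<bullet> \<nu> p)"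
    have \<sigma>: "\<sigma> = 1 \<or> \<sigma> = -1" using n9 by (auto simp: \<sigma>_def sgn_real_def)
    have ns: "\<sigma> * (?n \<bullet> \<nu> p) = \<bar>?n \<bullet> \<nu> p\<bar>" by (simp add: \<sigma>_def abs_sgn mult.commute)
    obtain T a where T: "T \<in> \<T>" "a \<in> vertices T" "e = convex hull (vertices T - {a})"
      by (rule boundary_face_obtain[OF e(1)])
    obtain \<epsilon>0 where \<epsilon>0: "\<epsilon>0 > 0" "\<forall>y\<in>ball ?z \<epsilon>0. (y \<in> \<Union>\<T> \<longleftrightarrow> ?n \<bullet> (y - ?z) \<le> 0) \<and>
        (y \<in> mesh_domain \<T> \<longleftrightarrow> ?n \<bullet> (y - ?z) < 0)"
      using boundary_face_half_ball[OF T e(1) ce(4)] by blast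
    have np1: "norm (\<nu> p) = 1" by (rule norm_\<nu>[OF p])
    then have npp: "\<nu> p \<bullet> \<nu> p = 1" by (simp add: dot_square_norm)
    have side: "(\<tau> = - \<sigma> \<longrightarrow> cap p \<tau> \<subseteq> mesh_domain \<T>) \<and> (\<tau> = \<sigma> \<longrightarrow> cap p \<tau> \<inter> \<Union>\<T> = {})"
      if \<tau>: "\<tau> = 1 \<or> \<tau> = -1" for \<tau>
    proof -
      obtain \<epsilon> where \<epsilon>: "\<epsilon> > 0" "cap p \<tau> \<subseteq> mesh_domain \<T> \<Longrightarrow>
         (\<forall>w\<in>ball ?z \<epsilon>. (1 / 2) * norm (w - ?z) < \<tau> * ((w - ?z) \<bullet> \<nu> p) \<longrightarrow> w \<in> mesh_domain \<T>)"
        "cap p \<tau> \<inter> \<Union>\<T> = {} \<Longrightarrow>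
         (\<forall>w\<in>ball ?z \<epsilon>. (1 / 2) * norm (w - ?z) < \<tau> * ((w - ?z) \<bullet> \<nu> p) \<longrightarrow> w \<notin> \<Union>\<T>)"
        using local_cone_side[OF p z e(2) \<tau>] by blast
      define s where "s = min (\<epsilon> / 2) (\<epsilon>0 / 2)"
      have s: "0 < s" "s < \<epsilon>" "s < \<epsilon>0" using \<epsilon>(1) \<epsilon>0(1) by (auto simp: s_def)
      let ?w = "?z + (\<tau> * s) *\<^sub>R \<nu> p"
      have nw: "norm (?w - ?z) = s" using \<tau> np1 s by auto
      have wb: "?w \<in> ball ?z \<epsilon>" "?w \<in> ball ?z \<epsilon>0" using nw s by (auto simp: dist_norm)
      have cone: "(1 / 2) * norm (?w - ?z) < \<tau> * ((?w - ?z) \<bullet> \<nu> p)"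
        unfolding nw using \<tau> npp s by auto
      have nip: "?n \<bullet> (?w - ?z) = s * (\<tau> * (?n \<bullet> \<nu> p))" by simp
      have cases: "cap p \<tau> \<subseteq> mesh_domain \<T> \<or> cap p \<tau> \<inter> \<Union>\<T> = {}"
        by (rule mesh_connected_cases[OF cap_misses[OF p \<tau>]])
      have 1: "cap p \<tau> \<subseteq> mesh_domain \<T>" if "\<tau> = - \<sigma>"
      proof -
        have "?n \<bullet> (?w - ?z) < 0" unfolding nip using that ns n9 s(1) by (simp add: mult_pos_neg)
        then have "?w \<in> mesh_domain \<T>" using \<epsilon>0(2) wb(2) by blast
        then show ?thesis using cases \<epsilon>(3) wb(1) cone sub by blast
      qed
      have 2: "cap p \<tau> \<inter> \<Union>\<T> = {}" if "\<tau> = \<sigma>"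
      proof -
        have "?n \<bullet> (?w - ?z) > 0" unfolding nip using that ns n9 s(1) by simp
        then have "?w \<notin> \<Union>\<T>" using \<epsilon>0(2) wb(2) by (metis not_le)
        then show ?thesis using cases \<epsilon>(2) wb(1) cone sub by blast
      qed
      show ?thesis using 1 2 by blast
    qed
    have "cap p (- \<sigma>) \<subseteq> mesh_domain \<T>" using side[of "- \<sigma>"] \<sigma> by auto
    moreover have "cap p \<sigma> \<inter> \<Union>\<T> = {}" using side[of \<sigma>] \<sigma> by auto
    ultimately show ?thesis using n9 by (simp add: \<sigma>_def)
  qed
  \<comment> \<open>Surjectivity of the projection supplies a point of the mesh boundary over
    \<open>p\<close>, hence a face near \<open>p\<close> that fixes the sign.\<close>
  obtain x where x: "x \<in> mesh_boundary \<T>" "cp x = p" using proj_surj p by (metis imageE)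
  obtain e0 where e0: "e0 \<in> boundary_faces \<T>" "x \<in> e0" using x(1) unfolding mesh_boundary_eq_Union by blast
  have "dist x p \<le> r / 1000" using cp_mem(2)[OF x(1)] x(2) by simp
  moreover have "dist x (barycenter e0) \<le> h"
    using boundary_face_dist[OF e0 boundary_face_compact_convex(5)[OF e0(1)]] boundary_face_diameter(2)[OF e0(1)] by linarith
  ultimately have "barycenter e0 \<in> ball p (r / 4)"
    using dist_triangle[of p "barycenter e0" x] h_small(1) r_pos by (simp add: dist_commute)
  note k0 = key[OF e0(1) this]
  define \<sigma> where "\<sigma> = sgn (outer_normal \<T> e0 \<bullet> \<nu> p)"
  have \<sigma>: "\<sigma> = 1 \<or> \<sigma> = -1" using k0 by (auto simp: \<sigma>_def sgn_real_def)
  have ne: "cap p \<tau> \<noteq> {}" if \<tau>: "\<tau> = 1 \<or> \<tau> = -1" for \<tau>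
  proof -
    have "p + (\<tau> * (r / 4)) *\<^sub>R \<nu> p \<in> cap p \<tau>"
      using \<tau> norm_\<nu>[OF p] r_pos by (auto simp: cap_def dist_norm dot_square_norm)
    then show ?thesis by blast
  qed
  have "9 / 10 \<le> outer_normal \<T> e \<bullet> (\<sigma> *\<^sub>R \<nu> p)" if e: "e \<in> boundary_faces \<T>" "barycenter e \<in> ball p (r / 4)" for e
  proof -
    note k = key[OF e]
    have "sgn (outer_normal \<T> e \<bullet> \<nu> p) = \<sigma>"
    proof (rule ccontr)
      assume "sgn (outer_normal \<T> e \<bullet> \<nu> p) \<noteq> \<sigma>"
      moreover have "sgn (outer_normal \<T> e \<bullet> \<nu> p) = 1 \<or> sgn (outer_normal \<T> e \<bullet> \<nu> p) = -1"
        using k by (auto simp: sgn_real_def)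
      ultimately have "sgn (outer_normal \<T> e \<bullet> \<nu> p) = - \<sigma>" using \<sigma> by auto
      then have "cap p (- \<sigma>) \<inter> \<Union>\<T> = {}" using k by simp
      moreover have "cap p (- \<sigma>) \<subseteq> mesh_domain \<T>" using k0 by (simp add: \<sigma>_def)
      moreover have "cap p (- \<sigma>) \<noteq> {}" using ne[of "- \<sigma>"] \<sigma> by auto
      ultimately show False using sub by blast
    qed
    then have "outer_normal \<T> e \<bullet> (\<sigma> *\<^sub>R \<nu> p) = \<bar>outer_normal \<T> e \<bullet> \<nu> p\<bar>" by (auto simp: abs_sgn mult.commute)
    then show ?thesis using k by simp
  qed
  then show ?thesis using \<sigma> k0 unfolding \<sigma>_def by blast
qed

text \<open>The crossing argument: along a steep segment, every point of \<open>\<Gamma>\<^sub>h\<close> is passed from inside to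
  outside, so the segment can meet \<open>\<Gamma>\<^sub>h\<close> only once.\<close>

lemma chart:
  assumes x0: "x0 \<in> mesh_boundary \<T>"
  obtains n where "norm n = 1"
    "\<And>e x y. e \<in> boundary_faces \<T> \<Longrightarrow> e \<inter> ball x0 (r / 8) \<noteq> {} \<Longrightarrow> x \<in> e \<Longrightarrow> y \<in> e \<Longrightarrow>
      \<bar>(x - y) \<bullet> n\<bar> \<le> (1 / 10) * norm (x - y)"
    "\<And>e. e \<in> boundary_faces \<T> \<Longrightarrow> e \<inter> ball x0 (r / 8) \<noteq> {} \<Longrightarrow> 9 / 10 \<le> outer_normal \<T> e \<bullet> n"
    "n = \<nu> (cp x0) \<or> n = - \<nu> (cp x0)"
    "\<And>x y. x \<in> \<Union>\<T> \<Longrightarrow> x \<in> ball x0 (r / 8) \<Longrightarrow> y \<in> ball x0 (r / 8) \<Longrightarrow>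
      (y - x) \<bullet> n < - (1 / 2) * norm (y - x) \<Longrightarrow> y \<in> mesh_domain \<T>"
    "\<And>x y. x \<notin> mesh_domain \<T> \<Longrightarrow> x \<in> ball x0 (r / 8) \<Longrightarrow> y \<in> ball x0 (r / 8) \<Longrightarrow>
      (1 / 2) * norm (y - x) < (y - x) \<bullet> n \<Longrightarrow> y \<notin> \<Union>\<T>"
proof -
  define p where "p = cp x0"
  have p: "p \<in> frontier \<Omega>" "dist x0 p \<le> r / 1000" using cp_mem[OF x0] by (auto simp: p_def)
  obtain \<sigma> where \<sigma>: "\<sigma> = 1 \<or> \<sigma> = -1" "cap p (- \<sigma>) \<subseteq> mesh_domain \<T>" "cap p \<sigma> \<inter> \<Union>\<T> = {}"
    "\<And>e. e \<in> boundary_faces \<T> \<Longrightarrow> barycenter e \<in> ball p (r / 4) \<Longrightarrow> 9 / 10 \<le> outer_normal \<T> e \<bullet> (\<sigma> *\<^sub>R \<nu> p)"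
    using opposite_sides[OF p(1)] by blast
  have \<sigma>': "- \<sigma> = 1 \<or> - \<sigma> = -1" using \<sigma>(1) by auto
  define n where "n = \<sigma> *\<^sub>R \<nu> p"
  have n1: "norm n = 1" using \<sigma>(1) norm_\<nu>[OF p(1)] by (auto simp: n_def)
  have ball: "w \<in> ball p (r / 4)" if "w \<in> ball x0 (r / 8)" for w
    using that p(2) dist_triangle[of p w x0] r_pos by (simp add: dist_commute)
  have cone: "\<exists>\<epsilon>>0. \<forall>w\<in>ball z \<epsilon>. ((w - z) \<bullet> n < - (1 / 2) * norm (w - z) \<longrightarrow> w \<in> mesh_domain \<T>) \<and>
      ((1 / 2) * norm (w - z) < (w - z) \<bullet> n \<longrightarrow> w \<notin> \<Union>\<T>)"
    if z: "z \<in> mesh_boundary \<T>" "z \<in> ball x0 (r / 8)" for z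
  proof -
    obtain \<epsilon>1 where \<epsilon>1: "\<epsilon>1 > 0"
      "\<And>w. w \<in> ball z \<epsilon>1 \<Longrightarrow> (1 / 2) * norm (w - z) < - \<sigma> * ((w - z) \<bullet> \<nu> p) \<Longrightarrow> w \<in> mesh_domain \<T>"
      using local_cone_side[OF p(1) z(1) ball[OF z(2)] \<sigma>'] \<sigma>(2) by blast
    obtain \<epsilon>2 where \<epsilon>2: "\<epsilon>2 > 0"
      "\<And>w. w \<in> ball z \<epsilon>2 \<Longrightarrow> (1 / 2) * norm (w - z) < \<sigma> * ((w - z) \<bullet> \<nu> p) \<Longrightarrow> w \<notin> \<Union>\<T>"
      using local_cone_side[OF p(1) z(1) ball[OF z(2)] \<sigma>(1)] \<sigma>(3) by blast
    show ?thesis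
      by (rule exI[of _ "min \<epsilon>1 \<epsilon>2"]) (use \<epsilon>1 \<epsilon>2 in \<open>auto simp: n_def\<close>)
  qed
  have slope: "\<bar>(x - y) \<bullet> n\<bar> \<le> (1 / 10) * norm (x - y)"
    if e: "e \<in> boundary_faces \<T>" "e \<inter> ball x0 (r / 8) \<noteq> {}" "x \<in> e" "y \<in> e" for e x y
  proof -
    obtain w where w: "w \<in> e" "w \<in> ball x0 (r / 8)" using e(2) by blast
    obtain T a where T: "T \<in> \<T>" "a \<in> vertices T" "e = convex hull (vertices T - {a})"
      by (rule boundary_face_obtain[OF e(1)])
    have "outer_normal \<T> e \<bullet> (x - y) = 0" by (rule face_orthogonal[OF T e(1,3,4)])
    then have "\<bar>\<nu> p \<bullet> (x - y)\<bar> \<le> (1 / 10) * norm (x - y)"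
      by (rule face_slope[OF e(1) p(1) w(1) ball[OF w(2)]])
    then show ?thesis using \<sigma>(1) by (auto simp: n_def inner_commute)
  qed
  have normal: "9 / 10 \<le> outer_normal \<T> e \<bullet> n"
    if e: "e \<in> boundary_faces \<T>" "e \<inter> ball x0 (r / 8) \<noteq> {}" for e
  proof -
    obtain w where w: "w \<in> e" "w \<in> ball x0 (r / 8)" using e(2) by blast
    have "dist w (barycenter e) \<le> h"
      using boundary_face_dist[OF e(1) w(1) boundary_face_compact_convex(5)[OF e(1)]] boundary_face_diameter(2)[OF e(1)] by linarith
    moreover have "dist p w \<le> r / 7" using w(2) p(2) dist_triangle[of p w x0] r_pos by (simp add: dist_commute)
    ultimately have "barycenter e \<in> ball p (r / 4)"
      using dist_triangle[of p "barycenter e" w] h_small(1) r_pos by simp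
    then show ?thesis unfolding n_def by (rule \<sigma>(4)[OF e(1)])
  qed
  have seg: "x + t *\<^sub>R (y - x) \<in> ball x0 (r / 8)"
    if "x \<in> ball x0 (r / 8)" "y \<in> ball x0 (r / 8)" "0 \<le> t" "t \<le> 1" for x y t
  proof -
    have "x + t *\<^sub>R (y - x) = (1 - t) *\<^sub>R x + t *\<^sub>R y" by (simp add: algebra_simps)
    then show ?thesis using convexD[OF convex_ball that(1,2), of "1 - t" t] that(3,4) by simp
  qed
  have sub: "mesh_domain \<T> \<subseteq> \<Union>\<T>" by (simp add: mesh_domain_def interior_subset)
  have down: "y \<in> mesh_domain \<T>"
    if x: "x \<in> \<Union>\<T>" "x \<in> ball x0 (r / 8)" and y: "y \<in> ball x0 (r / 8)" "(y - x) \<bullet> n < - (1 / 2) * norm (y - x)" for x y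
  proof (rule ccontr)
    assume ny: "y \<notin> mesh_domain \<T>"
    define f where "f t = x + t *\<^sub>R (y - x)" for t :: real
    have yx: "norm (y - x) > 0" using y(2) by (metis inner_zero_left mult_zero_right norm_zero zero_less_norm_iff less_irrefl)
    \<comment> \<open>Right after its start the descending segment is inside: either
      \<open>x\<close> is an inner point, or the cone below \<open>x\<close> applies.\<close>
    have init: "\<exists>\<delta>>0. \<forall>t. 0 < t \<longrightarrow> t < \<delta> \<longrightarrow> f t \<in> mesh_domain \<T>"
    proof (cases "x \<in> mesh_domain \<T>")
      case True
      then obtain \<epsilon> where \<epsilon>: "\<epsilon> > 0" "ball x \<epsilon> \<subseteq> mesh_domain \<T>" using open_mesh_domain openE by blast
      show ?thesis
      proof (intro exI[of _ "\<epsilon> / norm (y - x)"] conjI allI impI)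
        fix t :: real assume t: "0 < t" "t < \<epsilon> / norm (y - x)"
        have "dist x (f t) = t * norm (y - x)" using t(1) by (simp add: f_def dist_norm)
        then have "f t \<in> ball x \<epsilon>" using t yx by (simp add: pos_less_divide_eq)
        then show "f t \<in> mesh_domain \<T>" using \<epsilon> by blast
      qed (use \<epsilon> yx in simp)
    next
      case False
      then have "x \<in> mesh_boundary \<T>" using x(1) unfolding mesh_boundary_eq by blast
      then obtain \<epsilon> where \<epsilon>: "\<epsilon> > 0" "\<And>w. w \<in> ball x \<epsilon> \<Longrightarrow> (w - x) \<bullet> n < - (1 / 2) * norm (w - x) \<Longrightarrow> w \<in> mesh_domain \<T>"
        using cone[OF _ x(2)] by blast
      show ?thesis
      proof (intro exI[of _ "\<epsilon> / norm (y - x)"] conjI allI impI)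
        fix t :: real assume t: "0 < t" "t < \<epsilon> / norm (y - x)"
        have "dist x (f t) = t * norm (y - x)" using t(1) by (simp add: f_def dist_norm)
        then have "f t \<in> ball x \<epsilon>" using t yx by (simp add: pos_less_divide_eq)
        moreover have "(f t - x) \<bullet> n < - (1 / 2) * norm (f t - x)"
          using mult_strict_left_mono[OF y(2) t(1)] t(1) by (simp add: f_def mult.left_commute)
        ultimately show "f t \<in> mesh_domain \<T>" by (rule \<epsilon>(2))
      qed (use \<epsilon> yx in simp)
    qed
    then obtain \<delta> where \<delta>: "\<delta> > 0" "\<And>t. 0 < t \<Longrightarrow> t < \<delta> \<Longrightarrow> f t \<in> mesh_domain \<T>" by blast
    \<comment> \<open>The minimum of this set is the first exit. The cone above the exit point is
      outside the mesh, yet it contains earlier points of the segment.\<close>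
    let ?B = "{t \<in> {\<delta> / 2..1}. f t \<notin> mesh_domain \<T>}"
    have f1: "f 1 = y" by (simp add: f_def)
    have "\<delta> \<le> 1" using \<delta>(2)[of 1] f1 ny by force
    have "closed ({\<delta> / 2..1} \<inter> f -` (- mesh_domain \<T>))"
      using open_mesh_domain by (intro continuous_closed_preimage) (auto simp: f_def intro!: continuous_intros)
    moreover have "?B = {\<delta> / 2..1} \<inter> f -` (- mesh_domain \<T>)" by auto
    moreover have "bounded ?B" by (rule bounded_subset[OF bounded_closed_interval[of "\<delta> / 2" 1]]) auto
    ultimately have "compact ?B" by (simp add: compact_eq_bounded_closed)
    moreover have "1 \<in> ?B" using f1 ny \<open>\<delta> \<le> 1\<close> \<delta>(1) by auto
    ultimately obtain s where s: "s \<in> ?B" "\<And>t. t \<in> ?B \<Longrightarrow> s \<le> t" using compact_attains_inf[of ?B] by blast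
    have "s \<ge> \<delta>" using s(1) \<delta> by (force simp: not_less[symmetric])
    have before: "f t \<in> mesh_domain \<T>" if "0 < t" "t < s" for t
    proof (cases "t < \<delta>")
      case False
      then show ?thesis using s(2)[of t] s(1) that by force
    qed (use \<delta> that in blast)
    have fs: "f s \<in> ball x0 (r / 8)" unfolding f_def using seg[OF x(2) y(1)] s(1) \<delta>(1) by simp
    have "f s \<in> \<Union>\<T>"
    proof -
      have "f s \<in> closure (mesh_domain \<T>)"
        unfolding closure_approachable
      proof (intro allI impI)
        fix \<epsilon> :: real assume "\<epsilon> > 0"
        define t where "t = max (s / 2) (s - \<epsilon> / (2 * norm (y - x)))"
        have t: "0 < t" "t < s" using \<open>s \<ge> \<delta>\<close> \<delta>(1) \<open>\<epsilon> > 0\<close> yx by (auto simp: t_def)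
        have "f s - f t = (s - t) *\<^sub>R (y - x)" by (simp add: f_def algebra_simps)
        then have "dist (f t) (f s) = (s - t) * norm (y - x)" using t by (simp add: dist_norm norm_minus_commute[of "f t"])
        also have "\<dots> \<le> \<epsilon> / (2 * norm (y - x)) * norm (y - x)" using yx by (intro mult_right_mono) (auto simp: t_def)
        also have "\<dots> < \<epsilon>" using yx \<open>\<epsilon> > 0\<close> by simp
        finally show "\<exists>w\<in>mesh_domain \<T>. dist w (f s) < \<epsilon>" using before[OF t] by blast
      qed
      then show ?thesis by (simp only: closure_mesh_domain)
    qed
    then have "f s \<in> mesh_boundary \<T>" using s(1) unfolding mesh_boundary_eq by blast
    then obtain \<epsilon> where \<epsilon>: "\<epsilon> > 0" "\<And>w. w \<in> ball (f s) \<epsilon> \<Longrightarrow> (1 / 2) * norm (w - f s) < (w - f s) \<bullet> n \<Longrightarrow> w \<notin> \<Union>\<T>"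
      using cone[OF _ fs] by blast
    define t where "t = max (s / 2) (s - \<epsilon> / (2 * norm (y - x)))"
    have t: "0 < t" "t < s" using \<open>s \<ge> \<delta>\<close> \<delta>(1) \<open>\<epsilon> > 0\<close> yx by (auto simp: t_def)
    have d: "f t - f s = (s - t) *\<^sub>R (x - y)" by (simp add: f_def algebra_simps)
    have nd: "norm (f t - f s) = (s - t) * norm (y - x)" unfolding d using t by (simp add: norm_minus_commute)
    also have "\<dots> \<le> \<epsilon> / (2 * norm (y - x)) * norm (y - x)" using yx by (intro mult_right_mono) (auto simp: t_def)
    also have "\<dots> < \<epsilon>" using yx \<open>\<epsilon> > 0\<close> by simp
    finally have "f t \<in> ball (f s) \<epsilon>" by (simp add: dist_norm norm_minus_commute)
    moreover have "(1 / 2) * norm (f t - f s) < (f t - f s) \<bullet> n"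
    proof -
      have "(f t - f s) \<bullet> n = (s - t) * (- ((y - x) \<bullet> n))" unfolding d by (simp add: inner_diff_left)
      moreover have "(s - t) * ((1 / 2) * norm (y - x)) < (s - t) * (- ((y - x) \<bullet> n))"
        using y(2) t by (intro mult_strict_left_mono) auto
      ultimately show ?thesis unfolding nd by simp
    qed
    ultimately have "f t \<notin> \<Union>\<T>" by (rule \<epsilon>(2))
    then show False using before[OF t] sub by blast
  qed
  have up: "y \<notin> \<Union>\<T>"
    if x: "x \<notin> mesh_domain \<T>" "x \<in> ball x0 (r / 8)" and y: "y \<in> ball x0 (r / 8)" "(1 / 2) * norm (y - x) < (y - x) \<bullet> n" for x y
  proof
    assume yU: "y \<in> \<Union>\<T>"
    have "(x - y) \<bullet> n < - (1 / 2) * norm (x - y)"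
      using y(2) by (simp add: inner_diff_left norm_minus_commute)
    then show False using down[OF yU y(1) x(2)] x(1) by blast
  qed
  show thesis
    by (rule that[OF n1 slope normal _ down up]) (use \<sigma>(1) in \<open>auto simp: n_def p_def\<close>)
qed

text \<open>Each outer normal is, up to sign, close to the frontier normal at a vertex of its face,
  with an error of the order of the face diameter. The chart at \<open>barycenter e\<close> gives
  both faces the same sign, and then the Lipschitz bound for \<open>\<nu>\<close> applies.\<close>

lemma outer_normal_lipschitz:
  assumes e: "e \<in> boundary_faces \<T>" "e' \<in> boundary_faces \<T>" and d: "dist (barycenter e) (barycenter e') < r / 8"
  shows "norm (outer_normal \<T> e - outer_normal \<T> e') \<le>
    (4 * K / \<kappa> + 10 * K) * (dist (barycenter e) (barycenter e') + diameter e + diameter e')"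
proof -
  let ?D = "dist (barycenter e) (barycenter e') + diameter e + diameter e'"
  define x0 where "x0 = barycenter e"
  note ce = boundary_face_compact_convex[OF e(1)] and ce' = boundary_face_compact_convex[OF e(2)]
  have x0: "x0 \<in> mesh_boundary \<T>" using ce by (auto simp: x0_def)
  obtain n where n: "norm n = 1"
    "\<And>e. e \<in> boundary_faces \<T> \<Longrightarrow> e \<inter> ball x0 (r / 8) \<noteq> {} \<Longrightarrow> 9 / 10 \<le> outer_normal \<T> e \<bullet> n"
    "n = \<nu> (cp x0) \<or> n = - \<nu> (cp x0)"
  proof (rule chart[OF x0])
    fix n assume "norm n = 1"
      "\<And>e. e \<in> boundary_faces \<T> \<Longrightarrow> e \<inter> ball x0 (r / 8) \<noteq> {} \<Longrightarrow> 9 / 10 \<le> outer_normal \<T> e \<bullet> n"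
      "n = \<nu> (cp x0) \<or> n = - \<nu> (cp x0)"
    then show thesis by (rule that)
  qed
  obtain \<sigma> where \<sigma>: "\<sigma> = 1 \<or> \<sigma> = -1" "n = \<sigma> *\<^sub>R \<nu> (cp x0)" using n(3) by (metis scaleR_minus1_left scaleR_one)
  have c: "cp x0 \<in> frontier \<Omega>" "dist x0 (cp x0) \<le> r / 1000" using cp_mem[OF x0] by auto
  have key: "norm (outer_normal \<T> f - \<sigma> *\<^sub>R \<nu> q) \<le> 2 * (2 * K / \<kappa> * diameter f)"
    if f: "f \<in> boundary_faces \<T>" "barycenter f \<in> ball x0 (r / 8)" and q: "q \<in> vertices f" for f q
  proof -
    let ?n = "outer_normal \<T> f"
    let ?\<epsilon> = "2 * K / \<kappa> * diameter f"
    note unit = norm_outer_normal[OF f(1)] norm_\<nu>[OF vertices_on[OF f(1) q]]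
    have u1: "1 - ?\<epsilon> \<le> \<bar>\<nu> q \<bullet> ?n\<bar>"
      by (rule unit_vector_decomposition(1)[OF unit]) (rule face_slope_vertex[OF f(1) q])
    have u2: "norm (?n - \<nu> q) \<le> 2 * ?\<epsilon>" if "0 < \<nu> q \<bullet> ?n"
      by (rule unit_vector_decomposition(2)[OF unit _ that]) (rule face_slope_vertex[OF f(1) q])
    have u3: "norm (?n + \<nu> q) \<le> 2 * ?\<epsilon>" if "\<nu> q \<bullet> ?n < 0"
      by (rule unit_vector_decomposition(3)[OF unit _ that]) (rule face_slope_vertex[OF f(1) q])
    note cf = boundary_face_compact_convex[OF f(1)]
    have "?\<epsilon> \<le> 2 * K / \<kappa> * h"
      using boundary_face_diameter(2)[OF f(1)] K_pos \<kappa>_pos by (intro mult_left_mono) auto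
    also have "\<dots> \<le> 1 / 20" using h_small(2) \<kappa>_pos K_pos by (simp add: field_simps)
    finally have \<epsilon>: "?\<epsilon> \<le> 1 / 20" .
    have nf: "9 / 10 \<le> ?n \<bullet> n" using n(2)[OF f(1)] f(2) cf(5) by blast
    have "dist (barycenter f) q \<le> h"
      using boundary_face_dist[OF f(1) cf(5) vertices_mem[OF f(1) q]] boundary_face_diameter(2)[OF f(1)] by linarith
    moreover have "dist x0 (barycenter f) < r / 8" using f(2) by simp
    moreover have "dist (cp x0) q \<le> dist x0 (cp x0) + dist x0 (barycenter f) + dist (barycenter f) q"
      using dist_triangle[of "cp x0" q x0] dist_triangle[of x0 q "barycenter f"] by (simp add: dist_commute)
    ultimately have "dist (cp x0) q \<le> r / 3" using c(2) h_small(1) r_pos by linarith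
    then have qc: "19 / 20 \<le> \<nu> q \<bullet> \<nu> (cp x0)" by (rule nu_close[OF c(1) vertices_on[OF f(1) q]])
    \<comment> \<open>With the wrong sign the components along \<open>n\<close>, which are at least
      9/10 and 19/20, would have to add up to at most 1/10.\<close>
    have not_opp: False if "norm (?n + \<sigma> *\<^sub>R \<nu> q) \<le> 2 * ?\<epsilon>"
    proof -
      have "\<bar>(?n + \<sigma> *\<^sub>R \<nu> q) \<bullet> n\<bar> \<le> norm (?n + \<sigma> *\<^sub>R \<nu> q) * norm n" by (rule Cauchy_Schwarz_ineq2)
      then have "(?n + \<sigma> *\<^sub>R \<nu> q) \<bullet> n \<le> 1 / 10" using that \<epsilon> n(1) by simp
      moreover have "(\<sigma> *\<^sub>R \<nu> q) \<bullet> n = \<nu> q \<bullet> \<nu> (cp x0)" using \<sigma> by auto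
      ultimately show False using nf qc by (simp add: inner_add_left)
    qed
    have "\<nu> q \<bullet> ?n \<noteq> 0" using u1 \<epsilon> by auto
    then consider "0 < \<nu> q \<bullet> ?n" | "\<nu> q \<bullet> ?n < 0" by linarith
    then show ?thesis
    proof cases
      case 1
      then have "norm (?n - \<nu> q) \<le> 2 * ?\<epsilon>" by (rule u2)
      then show ?thesis using \<sigma>(1) not_opp by auto
    next
      case 2
      then have "norm (?n + \<nu> q) \<le> 2 * ?\<epsilon>" by (rule u3)
      then show ?thesis using \<sigma>(1) not_opp by auto
    qed
  qed
  obtain q where q: "q \<in> vertices e" using boundary_face_has_vertex[OF e(1)] by blast
  obtain q' where q': "q' \<in> vertices e'" using boundary_face_has_vertex[OF e(2)] by blast
  have dq: "dist q q' \<le> ?D"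
    using boundary_face_dist[OF e(1) vertices_mem[OF e(1) q] ce(5)]
      boundary_face_dist[OF e(2) vertices_mem[OF e(2) q'] ce'(5)]
      dist_triangle[of q q' "barycenter e"] dist_triangle[of "barycenter e" q' "barycenter e'"]
    by (simp add: dist_commute)
  have "norm (\<sigma> *\<^sub>R \<nu> q - \<sigma> *\<^sub>R \<nu> q') = norm (\<nu> q - \<nu> q')"
    using \<sigma>(1) by (auto simp: norm_minus_commute)
  also have "\<dots> \<le> 10 * K * dist q q'"
  proof (rule \<nu>_lipschitz[OF vertices_on[OF e(1) q] vertices_on[OF e(2) q']])
    have "?D \<le> r / 8 + h + h" using d boundary_face_diameter(2)[OF e(1)] boundary_face_diameter(2)[OF e(2)] by linarith
    then show "2 * dist q q' < r" using dq h_small(1) r_pos by linarith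
  qed
  also have "\<dots> \<le> 10 * K * ?D" using dq K_pos by (intro mult_left_mono) auto
  finally have 1: "norm (\<sigma> *\<^sub>R \<nu> q - \<sigma> *\<^sub>R \<nu> q') \<le> 10 * K * ?D" .
  have 2: "norm (outer_normal \<T> e - \<sigma> *\<^sub>R \<nu> q) \<le> 4 * K / \<kappa> * diameter e"
    using key[OF e(1) _ q] r_pos by (simp add: x0_def)
  have 3: "norm (outer_normal \<T> e' - \<sigma> *\<^sub>R \<nu> q') \<le> 4 * K / \<kappa> * diameter e'"
    using key[OF e(2) _ q'] d by (simp add: x0_def)
  have tri: "norm (A + B - C) \<le> norm A + norm B + norm C" for A B C :: "real^'n"
    using norm_triangle_ineq4[of "A + B" C] norm_triangle_ineq[of A B] by linarith
  have "outer_normal \<T> e - outer_normal \<T> e' =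
      (outer_normal \<T> e - \<sigma> *\<^sub>R \<nu> q) + (\<sigma> *\<^sub>R \<nu> q - \<sigma> *\<^sub>R \<nu> q') - (outer_normal \<T> e' - \<sigma> *\<^sub>R \<nu> q')" by simp
  then have "norm (outer_normal \<T> e - outer_normal \<T> e') \<le>
      norm (outer_normal \<T> e - \<sigma> *\<^sub>R \<nu> q) + norm (\<sigma> *\<^sub>R \<nu> q - \<sigma> *\<^sub>R \<nu> q') + norm (outer_normal \<T> e' - \<sigma> *\<^sub>R \<nu> q')"
    using tri by (simp only:)
  also have "\<dots> \<le> 4 * K / \<kappa> * (diameter e + diameter e') + 10 * K * ?D" using 1 2 3 by (simp add: distrib_left)
  also have "\<dots> \<le> 4 * K / \<kappa> * ?D + 10 * K * ?D"
    using K_pos \<kappa>_pos by (intro add_right_mono mult_left_mono) auto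
  finally show ?thesis by (simp add: distrib_right)
qed

end


section \<open>Local comparability of boundary faces\<close>

lemma ball_fmeasurable: "ball (x::'a::euclidean_space) s \<in> fmeasurable lborel"
  by (intro fmeasurableI emeasure_bounded_finite bounded_ball) simp

lemma ball_packing:
  fixes x :: "'i \<Rightarrow> 'a::euclidean_space"
  assumes fin: "finite I" and \<rho>: "\<And>i. i \<in> I \<Longrightarrow> 0 \<le> \<rho> i"
    and sub: "\<And>i. i \<in> I \<Longrightarrow> ball (x i) (\<rho> i) \<subseteq> ball X R" and R: "0 \<le> R"
    and disj: "\<And>i j. i \<in> I \<Longrightarrow> j \<in> I \<Longrightarrow> i \<noteq> j \<Longrightarrow> ball (x i) (\<rho> i) \<inter> ball (x j) (\<rho> j) = {}"
  shows "(\<Sum>i\<in>I. \<rho> i ^ DIM('a)) \<le> R ^ DIM('a)"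
proof -
  let ?v = "unit_ball_vol (real DIM('a))"
  have v: "?v > 0" by simp
  have "?v * (\<Sum>i\<in>I. \<rho> i ^ DIM('a)) = (\<Sum>i\<in>I. measure lborel (ball (x i) (\<rho> i)))"
    unfolding sum_distrib_left by (rule sum.cong) (auto simp: \<rho> content_ball)
  also have "\<dots> = measure lborel (\<Union>i\<in>I. ball (x i) (\<rho> i))"
  proof (rule measure_finite_Union[symmetric, OF fin])
    show "disjoint_family_on (\<lambda>i. ball (x i) (\<rho> i)) I" using disj by (auto simp: disjoint_family_on_def)
    show "emeasure lborel (ball (x i) (\<rho> i)) \<noteq> \<infinity>" for i
      using emeasure_bounded_finite[OF bounded_ball] by (simp add: less_top)
  qed auto
  also have "\<dots> \<le> measure lborel (ball X R)"
    using sub fin ball_fmeasurable by (intro measure_mono_fmeasurable) auto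
  also have "\<dots> = ?v * R ^ DIM('a)" using R by (simp add: content_ball)
  finally show ?thesis using v by simp
qed

lemma ball_covering:
  fixes x :: "'i \<Rightarrow> 'a::euclidean_space"
  assumes fin: "finite I" and \<rho>: "\<And>i. i \<in> I \<Longrightarrow> 0 \<le> \<rho> i"
    and sub: "ball X R \<subseteq> (\<Union>i\<in>I. ball (x i) (\<rho> i))" and R: "0 \<le> R"
  shows "R ^ DIM('a) \<le> (\<Sum>i\<in>I. \<rho> i ^ DIM('a))"
proof -
  let ?v = "unit_ball_vol (real DIM('a))"
  have v: "?v > 0" by simp
  have "?v * R ^ DIM('a) = measure lborel (ball X R)" using R by (simp add: content_ball)
  also have "\<dots> \<le> measure lborel (\<Union>i\<in>I. ball (x i) (\<rho> i))"
    using sub fin ball_fmeasurable by (intro measure_mono_fmeasurable fmeasurable.finite_UN) auto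
  also have "\<dots> \<le> (\<Sum>i\<in>I. measure lborel (ball (x i) (\<rho> i)))"
    using ball_fmeasurable by (intro measure_UNION_le[OF fin]) auto
  also have "\<dots> = ?v * (\<Sum>i\<in>I. \<rho> i ^ DIM('a))"
    unfolding sum_distrib_left by (rule sum.cong) (auto simp: \<rho> content_ball)
  finally show ?thesis using v by simp
qed

context shape_regular_mesh
begin

lemma \<kappa>_le_half:
  assumes "T \<in> \<T>" shows "2 * \<kappa> \<le> 1"
proof -
  obtain x where x: "cball x (\<kappa> * diameter T) \<subseteq> T" using inball[OF assms] by blast
  have "diameter (cball x (\<kappa> * diameter T)) \<le> diameter T"
    by (rule diameter_subset[OF x bounded_simplex[OF assms]])
  moreover have "0 \<le> \<kappa> * diameter T" using \<kappa>_pos diameter_simplex_pos[OF assms] by simp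
  then have "diameter (cball x (\<kappa> * diameter T)) = 2 * (\<kappa> * diameter T)"
    by (intro trans[OF diameter_cball if_not_P]) linarith
  ultimately have "2 * \<kappa> * diameter T \<le> 1 * diameter T" by simp
  then show ?thesis using diameter_simplex_pos[OF assms] by simp
qed

text \<open>The elements at \<open>z\<close> may have very different sizes. A homothety with centre
  \<open>z\<close> shrinks the inner ball of each to the common radius
  \<open>\<kappa> * \<epsilon>\<close>; by convexity the image stays in its element, so these balls
  are disjoint and all lie within \<open>2 * \<epsilon>\<close> of \<open>z\<close>.\<close>

lemma card_elements_at:
  "real (card {T \<in> \<T>. z \<in> T}) \<le> (2 / \<kappa>) ^ CARD('n)"
proof (cases "{T \<in> \<T>. z \<in> T} = {}")
  case True
  then show ?thesis using \<kappa>_pos by (simp only: card.empty) simp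
next
  case False
  let ?S = "{T \<in> \<T>. z \<in> T}"
  have fin: "finite ?S" using finite_mesh by simp
  define \<epsilon> where "\<epsilon> = Min (diameter ` ?S)"
  have \<epsilon>: "\<epsilon> \<le> diameter T" if "T \<in> ?S" for T using fin that by (simp add: \<epsilon>_def)
  have "\<epsilon> \<in> diameter ` ?S" unfolding \<epsilon>_def using fin False by (intro Min_in) auto
  then have \<epsilon>0: "\<epsilon> > 0" using diameter_simplex_pos by auto
  have "\<forall>T\<in>?S. \<exists>x. cball x (\<kappa> * diameter T) \<subseteq> T" using inball by blast
  then obtain c where c: "\<And>T. T \<in> ?S \<Longrightarrow> cball (c T) (\<kappa> * diameter T) \<subseteq> T" by metis
  define l where "l T = \<epsilon> / diameter T" for T :: "(real^'n) set"
  have l: "0 < l T" "l T \<le> 1" "l T * diameter T = \<epsilon>" if "T \<in> ?S" for T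
    using \<epsilon>[OF that] \<epsilon>0 by (auto simp: l_def)
  define y where "y T = z + l T *\<^sub>R (c T - z)" for T
  have sub: "ball (y T) (\<kappa> * \<epsilon>) \<subseteq> interior T" if T: "T \<in> ?S" for T
  proof (rule interior_maximal)
    show "ball (y T) (\<kappa> * \<epsilon>) \<subseteq> T"
    proof
      fix w assume w: "w \<in> ball (y T) (\<kappa> * \<epsilon>)"
      define w' where "w' = z + (1 / l T) *\<^sub>R (w - z)"
      have "w' - c T = (1 / l T) *\<^sub>R (w - y T)" using l[OF T] by (simp add: w'_def y_def algebra_simps)
      then have "norm (w' - c T) = (1 / l T) * norm (w - y T)" using l[OF T] by simp
      also have "\<dots> \<le> (1 / l T) * (\<kappa> * \<epsilon>)" using w l[OF T] by (intro mult_left_mono) (auto simp: dist_norm norm_minus_commute)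
      also have "\<dots> = \<kappa> * diameter T" using l[OF T] by (metis (no_types, opaque_lifting) mult.left_commute nonzero_mult_div_cancel_left less_irrefl times_divide_eq_left mult_1)
      finally have "w' \<in> cball (c T) (\<kappa> * diameter T)" by (simp add: dist_norm norm_minus_commute)
      then have "w' \<in> T" using c[OF T] by blast
      moreover have "w = (1 - l T) *\<^sub>R z + l T *\<^sub>R w'" using l[OF T] by (simp add: w'_def algebra_simps)
      ultimately show "w \<in> T"
        using convexD[OF convex_simplex'[OF full_simplex], of T z w' "1 - l T" "l T"] T l[OF T] by simp
    qed
  qed simp
  have "(\<Sum>T\<in>?S. (\<kappa> * \<epsilon>) ^ DIM(real^'n)) \<le> (2 * \<epsilon>) ^ DIM(real^'n)"
  proof (rule ball_packing[where x = y and X = z])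
    show "ball (y T) (\<kappa> * \<epsilon>) \<subseteq> ball z (2 * \<epsilon>)" if T: "T \<in> ?S" for T
    proof
      fix w assume w: "w \<in> ball (y T) (\<kappa> * \<epsilon>)"
      have "c T \<in> T" using c[OF T] \<kappa>_pos diameter_simplex_pos T by (smt (verit, best) centre_in_cball mem_Collect_eq mult_pos_pos subsetD)
      then have "dist z (c T) \<le> diameter T" using diameter_bounded_bound[OF bounded_simplex] T by blast
      then have "l T * norm (c T - z) \<le> l T * diameter T" using l[OF T] by (intro mult_left_mono) (auto simp: dist_norm norm_minus_commute)
      then have "dist z (y T) \<le> \<epsilon>" using l[OF T] by (simp add: y_def dist_norm)
      moreover have "\<kappa> * \<epsilon> \<le> (1 / 2) * \<epsilon>" using \<kappa>_le_half[of T] T \<epsilon>0 by (intro mult_right_mono) auto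
      ultimately show "w \<in> ball z (2 * \<epsilon>)"
        using w dist_triangle[of z w "y T"] \<epsilon>0 unfolding mem_ball by linarith
    qed
    show "ball (y T) (\<kappa> * \<epsilon>) \<inter> ball (y T') (\<kappa> * \<epsilon>) = {}" if "T \<in> ?S" "T' \<in> ?S" "T \<noteq> T'" for T T'
      using sub[OF that(1)] sub[OF that(2)] mesh_interior_Int[of T T'] that interior_subset[of T'] by blast
  qed (use fin \<epsilon>0 \<kappa>_pos in auto)
  then have "real (card ?S) * (\<kappa> * \<epsilon>) ^ CARD('n) \<le> (2 * \<epsilon>) ^ CARD('n)" by simp
  then have "(real (card ?S) * \<kappa> ^ CARD('n)) * \<epsilon> ^ CARD('n) \<le> 2 ^ CARD('n) * \<epsilon> ^ CARD('n)"
    by (simp add: power_mult_distrib mult.assoc)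
  then have "real (card ?S) * \<kappa> ^ CARD('n) \<le> 2 ^ CARD('n)" using \<epsilon>0 by simp
  then show ?thesis using \<kappa>_pos by (simp add: power_divide field_simps)
qed

text \<open>Two common points require two common vertices; the edge between them is long relative to
  \<open>T\<close> and fits into \<open>T'\<close>.\<close>

lemma shared_edge:
  assumes T: "T \<in> \<T>" "T' \<in> \<T>" and zw: "z \<in> T \<inter> T'" "w \<in> T \<inter> T'" "z \<noteq> w"
  shows "2 * \<kappa> * diameter T \<le> diameter T'"
proof -
  let ?c = "vertices T \<inter> vertices T'"
  have c: "z \<in> convex hull ?c" "w \<in> convex hull ?c" using zw mesh_Int_hull[OF T] by auto
  have "\<exists>a b. a \<in> ?c \<and> b \<in> ?c \<and> a \<noteq> b"
  proof (rule ccontr)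
    assume "\<nexists>a b. a \<in> ?c \<and> b \<in> ?c \<and> a \<noteq> b"
    then have "?c = {} \<or> (\<exists>a. ?c = {a})" by blast
    then show False using c zw(3) by (metis convex_hull_empty convex_hull_singleton empty_iff singletonD)
  qed
  then obtain a b where ab: "a \<in> ?c" "b \<in> ?c" "a \<noteq> b" by blast
  have "2 * \<kappa> * diameter T \<le> dist a b" using vertices_dist_ge_diameter[OF T(1)] ab by blast
  also have "\<dots> \<le> diameter T'"
    using diameter_bounded_bound[OF bounded_simplex[OF T(2)]] vertices_subset[OF full_simplex[OF T(2)]] ab by blast
  finally show ?thesis .
qed

lemma rel_interior_boundary_faces_disjoint:
  assumes e: "e \<in> boundary_faces \<T>" "e' \<in> boundary_faces \<T>" and x: "x \<in> rel_interior e" "x \<in> e'"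
  shows "e = e'"
proof -
  obtain T a where T: "T \<in> \<T>" "a \<in> vertices T" "e = convex hull (vertices T - {a})"
    by (rule boundary_face_obtain[OF e(1)])
  obtain T' a' where T': "T' \<in> \<T>" "e' facet_of T'" "a' \<in> vertices T'" "e' = convex hull (vertices T' - {a'})"
    by (rule boundary_face_obtain[OF e(2)])
  have "x \<in> T'" using facet_subset[OF T'(1,2)] x(2) by blast
  then have "T' = T" using boundary_face_only[OF T(1,2) _ _ T'(1)] e(1) x(1) T(3) by blast
  have "bary T a' x = 0" using mem_facet_iff[OF T'(1,3)] x(2) T'(4) \<open>T' = T\<close> by blast
  then have "a' = a" using rel_interior_facet_iff[OF T(1,2)] x(1) T(3) T'(3) \<open>T' = T\<close> by force
  then show ?thesis using T(3) T'(4) \<open>T' = T\<close> by simp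
qed

lemma boundary_face_plate:
  assumes e: "e \<in> boundary_faces \<T>"
  obtains y where "y \<in> e" "\<And>x. outer_normal \<T> e \<bullet> (x - y) = 0 \<Longrightarrow> norm (x - y) < \<kappa> * diameter e \<Longrightarrow> x \<in> rel_interior e"
proof -
  obtain T y where T: "T \<in> \<T>" "e facet_of T" "y \<in> e"
    and y: "\<And>\<tau>. outer_normal \<T> e \<bullet> \<tau> = 0 \<Longrightarrow> norm \<tau> \<le> \<kappa> * diameter T \<Longrightarrow> y + \<tau> \<in> e"
    using boundary_face_inball[OF e] by metis
  obtain S a where S: "S \<in> \<T>" "a \<in> vertices S" "e = convex hull (vertices S - {a})"
    by (rule boundary_face_obtain[OF e])
  have aff: "outer_normal \<T> e \<bullet> (w - y) = 0" if "w \<in> affine hull e" for w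
  proof -
    have "affine hull e \<subseteq> {w. outer_normal \<T> e \<bullet> w = outer_normal \<T> e \<bullet> y}"
      by (rule hull_minimal)
        (use face_orthogonal[OF S e _ T(3)] in \<open>auto simp: affine_hyperplane inner_diff_right\<close>)
    then show ?thesis using that by (auto simp: inner_diff_right)
  qed
  have d: "\<kappa> * diameter e \<le> \<kappa> * diameter T" using facet_diameter(2)[OF T(1,2)] \<kappa>_pos by simp
  have ine: "x \<in> e" if "outer_normal \<T> e \<bullet> (x - y) = 0" "norm (x - y) < \<kappa> * diameter e" for x
    using y[of "x - y"] that d by simp
  have "x \<in> rel_interior e" if x: "outer_normal \<T> e \<bullet> (x - y) = 0" "norm (x - y) < \<kappa> * diameter e" for x
  proof -
    let ?\<delta> = "\<kappa> * diameter e - norm (x - y)"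
    have "ball x ?\<delta> \<inter> affine hull e \<subseteq> e"
    proof
      fix w assume w: "w \<in> ball x ?\<delta> \<inter> affine hull e"
      then have "norm (w - y) < \<kappa> * diameter e"
        using norm_triangle_ineq[of "w - x" "x - y"] by (simp add: dist_norm norm_minus_commute)
      then show "w \<in> e" using ine aff w by blast
    qed
    moreover have "0 < ?\<delta>" using x(2) by simp
    ultimately show ?thesis unfolding mem_rel_interior_ball using ine[OF x] by blast
  qed
  then show thesis using that[OF T(3)] by blast
qed

end

context boundary_fitted_mesh
begin

text \<open>Removing \<open>z\<close> from a small cone below it leaves a connected set, so two elements at \<open>z\<close> of sizes
  on both sides of \<open>t\<close> share a further point and hence an edge, which makes them comparable. As only
  boundedly many elements meet at \<open>z\<close>, all of them are then comparable.\<close>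

lemma sizes_no_gap:
  assumes z: "z \<in> mesh_boundary \<T>" and T1: "T1 \<in> \<T>" "z \<in> T1" "diameter T1 \<le> t"
    and T3: "T3 \<in> \<T>" "z \<in> T3" "t < diameter T3"
  shows "\<exists>T T'. T \<in> \<T> \<and> T' \<in> \<T> \<and> z \<in> T \<and> z \<in> T' \<and> diameter T \<le> t \<and> t < diameter T' \<and>
    2 * \<kappa> * diameter T' \<le> diameter T"
proof -
  obtain n where n: "norm n = 1"
    "\<And>x y. x \<in> \<Union>\<T> \<Longrightarrow> x \<in> ball z (r / 8) \<Longrightarrow> y \<in> ball z (r / 8) \<Longrightarrow>
      (y - x) \<bullet> n < - (1 / 2) * norm (y - x) \<Longrightarrow> y \<in> mesh_domain \<T>"
  proof (rule chart[OF z])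
    fix n assume "norm n = 1"
      "\<And>x y. x \<in> \<Union>\<T> \<Longrightarrow> x \<in> ball z (r / 8) \<Longrightarrow> y \<in> ball z (r / 8) \<Longrightarrow>
      (y - x) \<bullet> n < - (1 / 2) * norm (y - x) \<Longrightarrow> y \<in> mesh_domain \<T>"
    then show thesis by (rule that)
  qed
  have nn: "n \<bullet> n = 1" using n(1) by (simp add: dot_square_norm)
  have closedU: "closed (\<Union>\<S>)" if "\<S> \<subseteq> \<T>" for \<S>
    using that finite_mesh full_simplex finite_subset by (intro closed_Union) (auto intro: closed_simplex)
  have "closed (\<Union>{T \<in> \<T>. z \<notin> T})" by (rule closedU) blast
  then obtain \<epsilon>0 where \<epsilon>0: "\<epsilon>0 > 0" "ball z \<epsilon>0 \<subseteq> - \<Union>{T \<in> \<T>. z \<notin> T}"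
    using openE[of "- \<Union>{T \<in> \<T>. z \<notin> T}" z] by auto
  define \<epsilon> where "\<epsilon> = min \<epsilon>0 (r / 8)"
  have \<epsilon>: "\<epsilon> > 0" using \<epsilon>0 r_pos by (simp add: \<epsilon>_def)
  define Q where "Q = ball z \<epsilon> \<inter> {w. (1 / 2) * norm (w - z) < (w - z) \<bullet> (- n)}"
  have Qc: "connected Q" unfolding Q_def
    by (intro convex_connected convex_Int convex_ball convex_cone_set) simp
  have zU: "z \<in> \<Union>\<T>" using T1 by blast
  have Qd: "Q \<subseteq> mesh_domain \<T>"
    using n(2)[OF zU] r_pos by (auto simp: Q_def \<epsilon>_def)
  \<comment> \<open>A vertical segment leads from inside \<open>T\<close> down into the cone
    \<open>Q\<close>; the chart keeps everything below its start in the mesh domain.\<close>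
  have leg: "\<exists>S. connected S \<and> S \<subseteq> mesh_domain \<T> \<and> S \<subseteq> ball z \<epsilon> \<and> S \<inter> T \<noteq> {} \<and> S \<inter> Q \<noteq> {}"
    if T: "T \<in> \<T>" "z \<in> T" for T
  proof -
    note fT = full_simplex[OF T(1)]
    have "z \<in> closure (interior T)" using closure_interior_simplex[OF fT] T(2) by simp
    then obtain y where y: "y \<in> interior T" "dist y z < \<epsilon> / 8" using \<epsilon> closure_approachable[of z "interior T"] by (metis divide_pos_pos zero_less_numeral)
    let ?S = "(\<lambda>t. y - t *\<^sub>R n) ` {0..\<epsilon> / 2}"
    have yT: "y \<in> T" using y(1) interior_subset by blast
    have inb: "y - t *\<^sub>R n \<in> ball z \<epsilon>" if "t \<in> {0..\<epsilon> / 2}" for t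
    proof -
      have "dist z (y - t *\<^sub>R n) \<le> dist z y + dist y (y - t *\<^sub>R n)" by (rule dist_triangle)
      moreover have "dist y (y - t *\<^sub>R n) = t" using n(1) that by (simp add: dist_norm)
      moreover have "t \<le> \<epsilon> / 2" "dist z y < \<epsilon> / 8" using that y(2) by (simp_all add: dist_commute)
      ultimately show ?thesis using \<epsilon> unfolding mem_ball by linarith
    qed
    have "y - t *\<^sub>R n \<in> mesh_domain \<T>" if t: "t \<in> {0..\<epsilon> / 2}" for t
    proof (cases "t = 0")
      case True
      then show ?thesis using y(1) interior_subset_mesh_domain[OF T(1)] by auto
    next
      case False
      show ?thesis
      proof (rule n(2)[of y])
        show "y \<in> \<Union>\<T>" using yT T(1) by blast
        show "y \<in> ball z (r / 8)" using inb[of 0] \<epsilon> by (simp add: \<epsilon>_def)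
        show "y - t *\<^sub>R n \<in> ball z (r / 8)" using inb[OF t] by (simp add: \<epsilon>_def)
        show "(y - t *\<^sub>R n - y) \<bullet> n < - (1 / 2) * norm (y - t *\<^sub>R n - y)"
          using False t n(1) nn by simp
      qed
    qed
    then have 1: "?S \<subseteq> mesh_domain \<T>" by blast
    have 2: "?S \<subseteq> ball z \<epsilon>" using inb by blast
    have 3: "connected ?S" by (intro connected_continuous_image continuous_intros connected_Icc)
    have "y \<in> ?S" using \<epsilon> by (intro image_eqI[of _ _ 0]) auto
    then have 4: "?S \<inter> T \<noteq> {}" using yT by blast
    let ?w = "y - (\<epsilon> / 2) *\<^sub>R n"
    have "?w \<in> Q"
    proof -
      have "(?w - z) \<bullet> (- n) = \<epsilon> / 2 - (y - z) \<bullet> n" using nn by (simp add: inner_diff_left inner_diff_right)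
      moreover have "\<bar>(y - z) \<bullet> n\<bar> \<le> norm (y - z)" using Cauchy_Schwarz_ineq2[of "y - z" n] n(1) by simp
      moreover have "norm (?w - z) \<le> norm (y - z) + \<epsilon> / 2"
        using norm_triangle_ineq4[of "y - z" "(\<epsilon> / 2) *\<^sub>R n"] n(1) \<epsilon> by (simp add: algebra_simps)
      moreover have "norm (y - z) < \<epsilon> / 8" using y(2) by (simp add: dist_norm)
      ultimately have "(1 / 2) * norm (?w - z) < (?w - z) \<bullet> (- n)" by linarith
      then show ?thesis using inb[of "\<epsilon> / 2"] \<epsilon> by (simp add: Q_def)
    qed
    moreover have "?w \<in> ?S" by (rule imageI) (use \<epsilon> in simp)
    ultimately have "?S \<inter> Q \<noteq> {}" by blast
    with 1 2 3 4 show ?thesis by blast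
  qed
  obtain S1 where S1: "connected S1" "S1 \<subseteq> mesh_domain \<T>" "S1 \<subseteq> ball z \<epsilon>" "S1 \<inter> T1 \<noteq> {}" "S1 \<inter> Q \<noteq> {}"
    using leg[OF T1(1,2)] by blast
  obtain S3 where S3: "connected S3" "S3 \<subseteq> mesh_domain \<T>" "S3 \<subseteq> ball z \<epsilon>" "S3 \<inter> T3 \<noteq> {}" "S3 \<inter> Q \<noteq> {}"
    using leg[OF T3(1,2)] by blast
  \<comment> \<open>A connected subset of the domain that meets both size classes at
    \<open>z\<close>. Two closed sets cover it, so some point lies in both; this point is not
    \<open>z\<close>, which is on the boundary.\<close>
  let ?S = "(S1 \<union> Q) \<union> S3"
  have Sc: "connected ?S"
    by (intro connected_Un S1(1) S3(1) Qc) (use S1(5) S3(5) in blast)+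
  have Sd: "?S \<subseteq> mesh_domain \<T>" using S1 S3 Qd by blast
  have Sb: "?S \<subseteq> ball z \<epsilon>" using S1 S3 by (auto simp: Q_def)
  let ?A = "\<Union>{T \<in> \<T>. z \<in> T \<and> diameter T \<le> t}" and ?B = "\<Union>{T \<in> \<T>. z \<in> T \<and> t < diameter T}"
  have cov: "?S \<subseteq> ?A \<union> ?B"
  proof
    fix x assume x: "x \<in> ?S"
    then have "x \<in> \<Union>\<T>" using Sd interior_subset unfolding mesh_domain_def by blast
    then obtain T where T: "T \<in> \<T>" "x \<in> T" by blast
    have "x \<in> ball z \<epsilon>0" using x Sb by (auto simp: \<epsilon>_def)
    then have "z \<in> T" using \<epsilon>0(2) T by blast
    then show "x \<in> ?A \<union> ?B" using T by (cases "diameter T \<le> t") auto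
  qed
  have cA: "closed ?A" and cB: "closed ?B" by (rule closedU, blast)+
  have neA: "?A \<inter> ?S \<noteq> {}" using S1(4) T1 by blast
  have neB: "?B \<inter> ?S \<noteq> {}" using S3(4) T3 by blast
  have "?A \<inter> ?B \<inter> ?S \<noteq> {}"
  proof
    assume "?A \<inter> ?B \<inter> ?S = {}"
    from connected_closedD[OF Sc this cov cA cB] show False using neA neB by (elim disjE) simp_all
  qed
  then obtain w T T' where w: "w \<in> ?S" "T \<in> \<T>" "z \<in> T" "diameter T \<le> t" "w \<in> T"
      "T' \<in> \<T>" "z \<in> T'" "t < diameter T'" "w \<in> T'" by blast
  have "w \<noteq> z" using w(1) Sd z unfolding mesh_boundary_eq by blast
  then have "2 * \<kappa> * diameter T' \<le> diameter T" using shared_edge[of T' T z w] w by blast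
  then show ?thesis using w by blast
qed

text \<open>The exponent bounds the number of elements at a point, the base the ratio of sizes of
  two elements that share an edge.\<close>

definition \<Lambda>0 :: real where "\<Lambda>0 = (1 / (2 * \<kappa>)) ^ nat \<lceil>(2 / \<kappa>) ^ CARD('n)\<rceil>"

text \<open>As long as \<open>\<beta> ^ j * m\<close> is below the larger diameter, some element has
  its size between this threshold and the next one. Each step adds an element to the count, and the
  bound on the number of elements at \<open>z\<close> ends the process.\<close>

lemma boundary_elements_comparable:
  assumes z: "z \<in> mesh_boundary \<T>" and T: "T \<in> \<T>" "z \<in> T" and T': "T' \<in> \<T>" "z \<in> T'"
  shows "diameter T' \<le> \<Lambda>0 * diameter T"
proof -
  let ?S = "{T \<in> \<T>. z \<in> T}"
  have fin: "finite ?S" using finite_mesh by simp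
  have finP: "finite {S \<in> ?S. P S}" for P by (rule finite_subset[OF _ fin]) blast
  define \<beta> where "\<beta> = 1 / (2 * \<kappa>)"
  define m where "m = diameter T"
  have m: "m > 0" using diameter_simplex_pos[OF T(1)] by (simp add: m_def)
  have \<beta>: "1 \<le> \<beta>" using \<kappa>_le_half[OF T(1)] \<kappa>_pos by (simp add: \<beta>_def)
  have count: "j + 1 \<le> card {S \<in> ?S. diameter S \<le> \<beta> ^ j * m}" if "\<beta> ^ j * m < diameter T'" for j
    using that
  proof (induction j)
    case 0
    have "T \<in> {S \<in> ?S. diameter S \<le> \<beta> ^ 0 * m}" using T by (simp add: m_def)
    then have "{S \<in> ?S. diameter S \<le> \<beta> ^ 0 * m} \<noteq> {}" by blast
    then have "card {S \<in> ?S. diameter S \<le> \<beta> ^ 0 * m} > 0"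
      using finP by (intro card_gt_0_iff[THEN iffD2] conjI)
    then show ?case by simp
  next
    case (Suc j)
    have le: "\<beta> ^ j * m \<le> \<beta> ^ Suc j * m" using \<beta> m by (intro mult_right_mono power_increasing) auto
    then have lt: "\<beta> ^ j * m < diameter T'" using Suc.prems by linarith
    have "m \<le> \<beta> ^ j * m" using m \<beta> one_le_power[OF \<beta>, of j] by simp
    then obtain S S' where S: "S \<in> \<T>" "S' \<in> \<T>" "z \<in> S'" "diameter S \<le> \<beta> ^ j * m"
      "\<beta> ^ j * m < diameter S'" "2 * \<kappa> * diameter S' \<le> diameter S"
      using sizes_no_gap[OF z T(1,2) _ T' lt] by (auto simp: m_def)
    have "diameter S' = \<beta> * (2 * \<kappa> * diameter S')" using \<kappa>_pos by (simp add: \<beta>_def)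
    also have "\<dots> \<le> \<beta> * (\<beta> ^ j * m)" using S(4,6) \<beta> by (intro mult_left_mono) auto
    finally have "S' \<in> {S \<in> ?S. diameter S \<le> \<beta> ^ Suc j * m}" using S by simp
    moreover have "S' \<notin> {S \<in> ?S. diameter S \<le> \<beta> ^ j * m}" using S(5) by simp
    moreover have "{S \<in> ?S. diameter S \<le> \<beta> ^ j * m} \<subseteq> {S \<in> ?S. diameter S \<le> \<beta> ^ Suc j * m}" using le by auto
    ultimately have "{S \<in> ?S. diameter S \<le> \<beta> ^ j * m} \<subset> {S \<in> ?S. diameter S \<le> \<beta> ^ Suc j * m}" by blast
    then have "card {S \<in> ?S. diameter S \<le> \<beta> ^ j * m} < card {S \<in> ?S. diameter S \<le> \<beta> ^ Suc j * m}"
      by (rule psubset_card_mono[OF finP])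
    then show ?case using Suc.IH[OF lt] by simp
  qed
  define M where "M = nat \<lceil>(2 / \<kappa>) ^ CARD('n)\<rceil>"
  have "card ?S \<le> M" using card_elements_at[of z] unfolding M_def by linarith
  moreover have "card {S \<in> ?S. diameter S \<le> \<beta> ^ M * m} \<le> card ?S" using fin by (intro card_mono) auto
  ultimately have "\<not> \<beta> ^ M * m < diameter T'" using count[of M] by linarith
  then show ?thesis by (simp add: \<Lambda>0_def M_def \<beta>_def m_def)
qed

definition \<Lambda>1 :: real where "\<Lambda>1 = \<Lambda>0 / (2 * \<kappa>)"

lemma touching_faces_comparable:
  assumes e: "e \<in> boundary_faces \<T>" "e' \<in> boundary_faces \<T>" "e \<inter> e' \<noteq> {}"
  shows "diameter e' \<le> \<Lambda>1 * diameter e"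
proof -
  obtain z where z: "z \<in> e" "z \<in> e'" using e(3) by blast
  obtain T where T: "T \<in> \<T>" "e facet_of T" by (rule boundary_face_obtain[OF e(1)])
  obtain T' where T': "T' \<in> \<T>" "e' facet_of T'" by (rule boundary_face_obtain[OF e(2)])
  have "z \<in> mesh_boundary \<T>" using boundary_face_compact_convex(6)[OF e(1)] z by blast
  then have 1: "diameter T' \<le> \<Lambda>0 * diameter T"
    using boundary_elements_comparable[OF _ T(1) _ T'(1)] facet_subset[OF T] facet_subset[OF T'] z by blast
  have 2: "diameter e' \<le> diameter T'" using facet_diameter(2)[OF T'] .
  have 3: "diameter T \<le> diameter e / (2 * \<kappa>)" using facet_diameter(1)[OF T] \<kappa>_pos by (simp add: field_simps)
  have L0: "\<Lambda>0 \<ge> 0" using \<kappa>_pos by (simp add: \<Lambda>0_def)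
  have "diameter e' \<le> \<Lambda>0 * (diameter e / (2 * \<kappa>))"
    using 1 2 mult_left_mono[OF 3 L0] by linarith
  then show ?thesis by (simp add: \<Lambda>1_def)
qed

lemma \<Lambda>1_ge_1: "e \<in> boundary_faces \<T> \<Longrightarrow> 1 \<le> \<Lambda>1"
  using touching_faces_comparable[of e e] boundary_face_diameter(1)[of e] boundary_face_compact_convex(3)[of e]
  by simp

end


section \<open>Growth of the boundary faces\<close>

context boundary_fitted_mesh
begin

abbreviation "R0 \<equiv> r / 200"

lemma power_card: "(x::real) ^ CARD('n) = x * x ^ (CARD('n) - 1)"
  using power_eq_if[of x "CARD('n)"] by simp

text \<open>A step along \<open>n\<close> is steep, so the chart excludes two boundary points on one
  line in direction \<open>n\<close>. Over \<open>x0 + \<tau>\<close>, the points at heights minus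
  and plus \<open>norm \<tau>\<close> are on different sides, and the line between them must meet
  the boundary.\<close>

lemma chart_graph:
  assumes x0: "x0 \<in> mesh_boundary \<T>"
  obtains n where "norm n = 1"
    "\<And>e. e \<in> boundary_faces \<T> \<Longrightarrow> e \<inter> ball x0 (r / 8) \<noteq> {} \<Longrightarrow> 9 / 10 \<le> outer_normal \<T> e \<bullet> n"
    "\<And>x y s t. x \<in> mesh_boundary \<T> \<Longrightarrow> y \<in> mesh_boundary \<T> \<Longrightarrow> x \<in> ball x0 (r / 8) \<Longrightarrow> y \<in> ball x0 (r / 8) \<Longrightarrow>
      x + s *\<^sub>R n = y + t *\<^sub>R n \<Longrightarrow> x = y"
    "\<And>\<tau>. \<tau> \<bullet> n = 0 \<Longrightarrow> 2 * norm \<tau> < r / 8 \<Longrightarrow> \<exists>t. \<bar>t\<bar> \<le> norm \<tau> \<and> x0 + \<tau> + t *\<^sub>R n \<in> mesh_boundary \<T>"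
proof (rule chart[OF x0])
  fix n assume n: "norm n = 1"
    and f: "\<And>e. e \<in> boundary_faces \<T> \<Longrightarrow> e \<inter> ball x0 (r / 8) \<noteq> {} \<Longrightarrow> 9 / 10 \<le> outer_normal \<T> e \<bullet> n"
    and down: "\<And>x y. x \<in> \<Union>\<T> \<Longrightarrow> x \<in> ball x0 (r / 8) \<Longrightarrow> y \<in> ball x0 (r / 8) \<Longrightarrow>
      (y - x) \<bullet> n < - (1 / 2) * norm (y - x) \<Longrightarrow> y \<in> mesh_domain \<T>"
    and up: "\<And>x y. x \<notin> mesh_domain \<T> \<Longrightarrow> x \<in> ball x0 (r / 8) \<Longrightarrow> y \<in> ball x0 (r / 8) \<Longrightarrow>
      (1 / 2) * norm (y - x) < (y - x) \<bullet> n \<Longrightarrow> y \<notin> \<Union>\<T>"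
  have nn: "n \<bullet> n = 1" using n by (simp add: dot_square_norm)
  have above: "t \<le> 0" if "x \<in> mesh_boundary \<T>" "x + t *\<^sub>R n \<in> mesh_boundary \<T>"
    "x \<in> ball x0 (r / 8)" "x + t *\<^sub>R n \<in> ball x0 (r / 8)" for x t
  proof (rule ccontr)
    assume "\<not> t \<le> 0"
    then have "x + t *\<^sub>R n \<notin> \<Union>\<T>"
      using up[of x "x + t *\<^sub>R n"] that n nn unfolding mesh_boundary_eq by simp
    then show False using that(2) unfolding mesh_boundary_eq by blast
  qed
  have uniq: "x = y" if *: "x \<in> mesh_boundary \<T>" "y \<in> mesh_boundary \<T>" "x \<in> ball x0 (r / 8)" "y \<in> ball x0 (r / 8)"
      "x + s *\<^sub>R n = y + t *\<^sub>R n" for x y s t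
  proof -
    have y: "y = x + (s - t) *\<^sub>R n" using *(5) by (simp add: algebra_simps)
    have x: "x = y + (t - s) *\<^sub>R n" using *(5) by (simp add: algebra_simps)
    have "s - t \<le> 0" using above[of x "s - t"] * y by simp
    moreover have "t - s \<le> 0" using above[of y "t - s"] * x by simp
    ultimately show ?thesis using y by simp
  qed
  have hit: "\<exists>t. \<bar>t\<bar> \<le> norm \<tau> \<and> x0 + \<tau> + t *\<^sub>R n \<in> mesh_boundary \<T>"
    if \<tau>: "\<tau> \<bullet> n = 0" "2 * norm \<tau> < r / 8" for \<tau>
  proof (cases "\<tau> = 0")
    case True
    then show ?thesis using x0 by (intro exI[of _ 0]) simp
  next
    case False
    let ?m = "norm \<tau>"
    have m: "?m > 0" using False by simp
    \<comment> \<open>The true length is \<open>sqrt 2 * norm \<tau>\<close>; being less than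
      \<open>2 * norm \<tau>\<close> makes the step from \<open>x0\<close> steeper than 1/2.\<close>
    have bnd: "norm (\<tau> + s *\<^sub>R n) \<le> 2 * ?m \<and> norm (\<tau> + s *\<^sub>R n) < 2 * ?m" if "\<bar>s\<bar> = ?m" for s
    proof -
      have "(norm (\<tau> + s *\<^sub>R n))\<^sup>2 = (norm \<tau>)\<^sup>2 + s\<^sup>2"
        using \<tau>(1) nn unfolding power2_norm_eq_inner
        by (simp add: inner_add_left inner_add_right inner_commute power2_eq_square)
      also have "s\<^sup>2 = ?m\<^sup>2" using that by (metis power2_abs)
      also have "(norm \<tau>)\<^sup>2 + ?m\<^sup>2 < (2 * ?m)\<^sup>2" using m by (simp add: power2_eq_square)
      finally show ?thesis using m by (meson less_imp_le mult_nonneg_nonneg norm_ge_zero power2_less_imp_less zero_le_numeral)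
    qed
    have b: "x0 + \<tau> + s *\<^sub>R n \<in> ball x0 (r / 8)" if "\<bar>s\<bar> = ?m" for s
    proof -
      have "dist x0 (x0 + \<tau> + s *\<^sub>R n) = norm (\<tau> + s *\<^sub>R n)"
        unfolding dist_norm by (subst norm_minus_commute) (simp add: add.assoc)
      then show ?thesis using bnd[OF that] \<tau>(2) by simp
    qed
    have x0b: "x0 \<in> ball x0 (r / 8)" using r_pos by simp
    have "x0 + \<tau> + (- ?m) *\<^sub>R n \<in> mesh_domain \<T>"
    proof (rule down[OF _ x0b b])
      show "x0 \<in> \<Union>\<T>" using x0 unfolding mesh_boundary_eq by blast
      have "(x0 + \<tau> + (- ?m) *\<^sub>R n - x0) \<bullet> n = - ?m" using \<tau>(1) nn by (simp add: inner_diff_left inner_add_left)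
      moreover have "norm (x0 + \<tau> + (- ?m) *\<^sub>R n - x0) < 2 * ?m" using bnd[of "- ?m"] by (simp add: algebra_simps)
      ultimately show "(x0 + \<tau> + (- ?m) *\<^sub>R n - x0) \<bullet> n < - (1 / 2) * norm (x0 + \<tau> + (- ?m) *\<^sub>R n - x0)" by linarith
    qed simp
    moreover have "x0 + \<tau> + ?m *\<^sub>R n \<notin> \<Union>\<T>"
    proof (rule up[OF _ x0b b])
      show "x0 \<notin> mesh_domain \<T>" using x0 unfolding mesh_boundary_eq by blast
      have "(x0 + \<tau> + ?m *\<^sub>R n - x0) \<bullet> n = ?m" using \<tau>(1) nn by (simp add: inner_diff_left inner_add_left)
      moreover have "norm (x0 + \<tau> + ?m *\<^sub>R n - x0) < 2 * ?m" using bnd[of ?m] by (simp add: algebra_simps)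
      ultimately show "(1 / 2) * norm (x0 + \<tau> + ?m *\<^sub>R n - x0) < (x0 + \<tau> + ?m *\<^sub>R n - x0) \<bullet> n" by linarith
    qed simp
    moreover have sub: "mesh_domain \<T> \<subseteq> \<Union>\<T>" by (simp add: mesh_domain_def interior_subset)
    moreover let ?A = "(\<lambda>t. x0 + \<tau> + t *\<^sub>R n) ` {- ?m..?m}"
    have "connected ?A" by (intro connected_continuous_image continuous_intros connected_Icc)
    moreover have "x0 + \<tau> + (- ?m) *\<^sub>R n \<in> ?A" "x0 + \<tau> + ?m *\<^sub>R n \<in> ?A" by (rule imageI, use m in simp)+
    ultimately have "?A \<inter> mesh_boundary \<T> \<noteq> {}" using mesh_connected_cases[of ?A] by blast
    then show ?thesis by auto
  qed
  show thesis by (rule that[OF n f uniq hit])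
qed

text \<open>Over each face stands a column of about \<open>R / diameter e\<close> balls of radius
  \<open>\<kappa> * diameter e / 4\<close>, with height of order \<open>R\<close> in direction
  \<open>n\<close>. By the graph property columns over different faces are disjoint, and packing
  them all into a ball of radius \<open>4 * R\<close> bounds the sum of
  \<open>R * diameter e ^ (N - 1)\<close>.\<close>

lemma boundary_face_measure_le:
  assumes x0: "x0 \<in> mesh_boundary \<T>" and R: "0 < R" "8 * R \<le> R0 * 20"
  shows "(\<Sum>e | e \<in> boundary_faces \<T> \<and> e \<subseteq> ball x0 R. diameter e ^ (CARD('n) - 1)) \<le>
    (16 / \<kappa>) ^ CARD('n) * R ^ (CARD('n) - 1)"
proof -
  let ?S = "{e. e \<in> boundary_faces \<T> \<and> e \<subseteq> ball x0 R}"
  let ?N = "CARD('n)"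
  have fin: "finite ?S" using finite_boundary_faces by simp
  have R8: "8 * R \<le> r / 10" using R(2) by simp
  obtain n where n: "norm n = 1"
    "\<And>e. e \<in> boundary_faces \<T> \<Longrightarrow> e \<inter> ball x0 (r / 8) \<noteq> {} \<Longrightarrow> 9 / 10 \<le> outer_normal \<T> e \<bullet> n"
    and uniq: "\<And>x y s t. x \<in> mesh_boundary \<T> \<Longrightarrow> y \<in> mesh_boundary \<T> \<Longrightarrow> x \<in> ball x0 (r / 8) \<Longrightarrow> y \<in> ball x0 (r / 8) \<Longrightarrow>
      x + s *\<^sub>R n = y + t *\<^sub>R n \<Longrightarrow> x = y"
  proof (rule chart_graph[OF x0])
    fix n assume "norm n = 1"
    "\<And>e. e \<in> boundary_faces \<T> \<Longrightarrow> e \<inter> ball x0 (r / 8) \<noteq> {} \<Longrightarrow> 9 / 10 \<le> outer_normal \<T> e \<bullet> n"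
    "\<And>x y s t. x \<in> mesh_boundary \<T> \<Longrightarrow> y \<in> mesh_boundary \<T> \<Longrightarrow> x \<in> ball x0 (r / 8) \<Longrightarrow> y \<in> ball x0 (r / 8) \<Longrightarrow>
      x + s *\<^sub>R n = y + t *\<^sub>R n \<Longrightarrow> x = y"
    then show thesis by (rule that)
  qed
  have "\<forall>e\<in>?S. \<exists>y. y \<in> e \<and> (\<forall>x. outer_normal \<T> e \<bullet> (x - y) = 0 \<longrightarrow> norm (x - y) < \<kappa> * diameter e \<longrightarrow> x \<in> rel_interior e)"
  proof
    fix e assume "e \<in> ?S"
    then have "e \<in> boundary_faces \<T>" by blast
    then show "\<exists>y. y \<in> e \<and> (\<forall>x. outer_normal \<T> e \<bullet> (x - y) = 0 \<longrightarrow> norm (x - y) < \<kappa> * diameter e \<longrightarrow> x \<in> rel_interior e)"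
      by (rule boundary_face_plate) blast
  qed
  from bchoice[OF this] obtain y where y0: "\<forall>e\<in>?S. y e \<in> e \<and> (\<forall>x. outer_normal \<T> e \<bullet> (x - y e) = 0 \<longrightarrow>
      norm (x - y e) < \<kappa> * diameter e \<longrightarrow> x \<in> rel_interior e)" ..
  then have y: "\<And>e. e \<in> ?S \<Longrightarrow> y e \<in> e"
    "\<And>e x. e \<in> ?S \<Longrightarrow> outer_normal \<T> e \<bullet> (x - y e) = 0 \<Longrightarrow> norm (x - y e) < \<kappa> * diameter e \<Longrightarrow> x \<in> rel_interior e"
    by blast+
  define \<rho> where "\<rho> e = \<kappa> * diameter e / 4" for e :: "(real^'n) set"
  define k where "k e = nat \<lceil>R / diameter e\<rceil>" for e :: "(real^'n) set"
  define c where "c i = y (fst i) + (4 * \<rho> (fst i) * real (snd i)) *\<^sub>R n" for i :: "(real^'n) set \<times> nat"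
  let ?I = "Sigma ?S (\<lambda>e. {..<k e})"
  have d: "0 < diameter e" "diameter e \<le> 2 * R" if "e \<in> ?S" for e
  proof -
    show "0 < diameter e" using boundary_face_diameter(1) that by blast
    have "diameter e \<le> diameter (ball x0 R)" using that by (intro diameter_subset bounded_ball) blast
    then show "diameter e \<le> 2 * R" using R(1) by (simp add: diameter_ball)
  qed
  have \<kappa>2: "2 * \<kappa> \<le> 1" if e: "e \<in> ?S" for e
  proof -
    have "e \<in> boundary_faces \<T>" using e by blast
    then obtain T where "T \<in> \<T>" by (rule boundary_face_obtain)
    then show ?thesis by (rule \<kappa>_le_half)
  qed
  have \<rho>0: "0 < \<rho> e" if "e \<in> ?S" for e using d[OF that] \<kappa>_pos by (simp add: \<rho>_def)
  have height: "4 * \<rho> e * real (k e) \<le> 3 * R / 2" if e: "e \<in> ?S" for e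
  proof -
    have "real (k e) \<le> R / diameter e + 1" using R(1) d[OF e] unfolding k_def by (simp add: ceiling_le_iff; linarith)
    then have "4 * \<rho> e * real (k e) \<le> 4 * \<rho> e * (R / diameter e + 1)" using \<rho>0[OF e] by (intro mult_left_mono) auto
    also have "\<dots> = \<kappa> * (R + diameter e)" using d[OF e] by (simp add: \<rho>_def field_simps)
    also have "\<dots> \<le> (1 / 2) * (R + 2 * R)" using d[OF e] \<kappa>2[OF e] \<kappa>_pos R(1) by (intro mult_mono) auto
    finally show ?thesis by simp
  qed
  \<comment> \<open>Moving along \<open>n\<close> into the plane of the face shifts a point of the
    small ball by at most twice its distance \<open>norm b\<close> from the centre, so it lands
    within \<open>\<kappa> * diameter e\<close> of \<open>y e\<close>.\<close>
  have proj: "\<exists>x s. x \<in> rel_interior e \<and> w = x + s *\<^sub>R n"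
    if e: "e \<in> ?S" and w: "w \<in> ball (y e + t *\<^sub>R n) (\<rho> e)" for e w t
  proof -
    let ?m = "outer_normal \<T> e"
    have "e \<inter> ball x0 (r / 8) \<noteq> {}" using e y(1)[OF e] R8 r_pos by force
    then have mn: "9 / 10 \<le> ?m \<bullet> n" using n(2) e by blast
    define b where "b = w - (y e + t *\<^sub>R n)"
    have b: "norm b < \<rho> e" using w by (simp add: b_def dist_norm norm_minus_commute)
    define s where "s = (?m \<bullet> b) / (?m \<bullet> n)"
    have m1: "norm ?m = 1" using norm_outer_normal e by blast
    have "\<bar>?m \<bullet> b\<bar> \<le> norm b" using Cauchy_Schwarz_ineq2[of ?m b] m1 by simp
    then have "\<bar>s\<bar> \<le> norm b / (9 / 10)" unfolding s_def abs_divide using mn by (intro frac_le) auto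
    also have "norm b / (9 / 10) \<le> 2 * norm b" by simp
    finally have s: "\<bar>s\<bar> \<le> 2 * norm b" .
    define x where "x = y e + (b - s *\<^sub>R n)"
    have "?m \<bullet> (x - y e) = 0" using mn by (simp add: x_def inner_diff_right s_def)
    moreover have "norm (x - y e) \<le> norm b + \<bar>s\<bar>" using norm_triangle_ineq4[of b "s *\<^sub>R n"] n(1) by (simp add: x_def)
    then have "norm (x - y e) < \<kappa> * diameter e" using s b \<rho>0[OF e] unfolding \<rho>_def by linarith
    ultimately have "x \<in> rel_interior e" by (rule y(2)[OF e])
    moreover have "w = x + (t + s) *\<^sub>R n" by (simp add: x_def b_def algebra_simps)
    ultimately show ?thesis by blast
  qed
  have pk0: "(\<Sum>i\<in>?I. \<rho> (fst i) ^ DIM(real^'n)) \<le> (4 * R) ^ DIM(real^'n)"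
  proof (rule ball_packing[where x = c and X = x0])
    show "finite ?I" using fin by auto
    show "0 \<le> 4 * R" using R by simp
    show "0 \<le> \<rho> (fst i)" if "i \<in> ?I" for i using that \<rho>0[of "fst i"] by (auto intro: less_imp_le)
    show "ball (c i) (\<rho> (fst i)) \<subseteq> ball x0 (4 * R)" if i: "i \<in> ?I" for i
    proof
      fix w assume w: "w \<in> ball (c i) (\<rho> (fst i))"
      obtain e j where ej: "i = (e, j)" "e \<in> ?S" "j < k e" using i by auto
      have "dist x0 (y e) < R" using y(1)[OF ej(2)] ej(2) by auto
      moreover have "dist (y e) (c i) \<le> 3 * R / 2"
      proof -
        have "dist (y e) (c i) = 4 * \<rho> e * real j" using n(1) \<rho>0[OF ej(2)] by (simp add: c_def ej(1) dist_norm)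
        also have "\<dots> \<le> 4 * \<rho> e * real (k e)" using ej(3) \<rho>0[OF ej(2)] by (intro mult_left_mono) auto
        finally show ?thesis using height[OF ej(2)] by linarith
      qed
      moreover have "dist (c i) w < R"
      proof -
        have "\<rho> e \<le> (1 / 2) * (2 * R) / 4" unfolding \<rho>_def
          using d[OF ej(2)] \<kappa>2[OF ej(2)] \<kappa>_pos R(1) by (intro divide_right_mono mult_mono) auto
        then show ?thesis using w R(1) by (simp add: ej(1))
      qed
      ultimately show "w \<in> ball x0 (4 * R)"
        using dist_triangle[of x0 w "y e"] dist_triangle[of "y e" w "c i"] R(1) unfolding mem_ball by linarith
    qed
    show "ball (c i) (\<rho> (fst i)) \<inter> ball (c j) (\<rho> (fst j)) = {}" if ij: "i \<in> ?I" "j \<in> ?I" "i \<noteq> j" for i j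
    proof (rule ccontr)
      assume "ball (c i) (\<rho> (fst i)) \<inter> ball (c j) (\<rho> (fst j)) \<noteq> {}"
      then obtain w where w: "w \<in> ball (c i) (\<rho> (fst i))" "w \<in> ball (c j) (\<rho> (fst j))" by blast
      have eS: "fst i \<in> ?S" "fst j \<in> ?S" using ij by auto
      have "fst i = fst j"
      proof -
        obtain x s where x: "x \<in> rel_interior (fst i)" "w = x + s *\<^sub>R n" using proj[OF eS(1)] w(1) unfolding c_def by blast
        obtain x' s' where x': "x' \<in> rel_interior (fst j)" "w = x' + s' *\<^sub>R n" using proj[OF eS(2)] w(2) unfolding c_def by blast
        have xe: "x \<in> fst i" "x' \<in> fst j" using x(1) x'(1) rel_interior_subset by blast+
        then have xb: "x \<in> ball x0 (r / 8)" "x' \<in> ball x0 (r / 8)" using eS R8 r_pos R(1) by force+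
        have "x \<in> mesh_boundary \<T>" "x' \<in> mesh_boundary \<T>"
          using xe eS boundary_face_compact_convex(6) by blast+
        moreover have "x + s *\<^sub>R n = x' + s' *\<^sub>R n" using x(2) x'(2) by (rule trans[OF sym])
        ultimately have "x = x'" by (intro uniq[OF _ _ xb])
        then show ?thesis using rel_interior_boundary_faces_disjoint[of "fst i" "fst j" x] x(1) xe(2) eS by blast
      qed
      then have "snd i \<noteq> snd j" using ij(3) by (simp add: prod_eq_iff)
      have "dist (c i) (c j) = 4 * \<rho> (fst i) * \<bar>real (snd i) - real (snd j)\<bar>"
      proof -
        have "c i - c j = (4 * \<rho> (fst i) * (real (snd i) - real (snd j))) *\<^sub>R n"
          using \<open>fst i = fst j\<close> by (simp add: c_def algebra_simps)
        then show ?thesis using n(1) \<rho>0[OF eS(1)] by (simp add: dist_norm abs_mult)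
      qed
      moreover have "\<bar>real (snd i) - real (snd j)\<bar> \<ge> 1" using \<open>snd i \<noteq> snd j\<close> by linarith
      ultimately have "4 * \<rho> (fst i) \<le> dist (c i) (c j)" using \<rho>0[OF eS(1)] by simp
      moreover have "dist (c i) (c j) < 2 * \<rho> (fst i)"
        using w dist_triangle[of "c i" "c j" w] \<open>fst i = fst j\<close> by (simp add: dist_commute)
      ultimately show False using \<rho>0[OF eS(1)] by linarith
    qed
  qed
  have pk: "(\<Sum>e\<in>?S. real (k e) * \<rho> e ^ ?N) \<le> (4 * R) ^ ?N"
  proof -
    have "(\<Sum>e\<in>?S. \<Sum>j<k e. \<rho> e ^ ?N) = (\<Sum>(e, j)\<in>?I. \<rho> e ^ ?N)"
      by (rule sum.Sigma) (use fin in auto)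
    then show ?thesis using pk0 by (simp add: split_def)
  qed
  have "R * (\<kappa> / 4) ^ ?N * (\<Sum>e\<in>?S. diameter e ^ (?N - 1)) \<le> (\<Sum>e\<in>?S. real (k e) * \<rho> e ^ ?N)"
    unfolding sum_distrib_left
  proof (rule sum_mono)
    fix e assume e: "e \<in> ?S"
    have p: "diameter e ^ ?N = diameter e * diameter e ^ (?N - 1)" by (rule power_card)
    have "R / diameter e \<le> real (k e)" unfolding k_def by linarith
    then have "R / diameter e * \<rho> e ^ ?N \<le> real (k e) * \<rho> e ^ ?N" using \<rho>0[OF e] by (intro mult_right_mono) auto
    moreover have "R / diameter e * \<rho> e ^ ?N = R * (\<kappa> / 4) ^ ?N * diameter e ^ (?N - 1)"
    proof -
      have "\<rho> e ^ ?N = (\<kappa> / 4) ^ ?N * diameter e ^ ?N"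
        unfolding \<rho>_def by (simp add: power_mult_distrib power_divide)
      then show ?thesis using d(1)[OF e] unfolding p by simp
    qed
    ultimately show "R * (\<kappa> / 4) ^ ?N * diameter e ^ (?N - 1) \<le> real (k e) * \<rho> e ^ ?N" by simp
  qed
  then have "R * (\<kappa> / 4) ^ ?N * (\<Sum>e\<in>?S. diameter e ^ (?N - 1)) \<le> 4 ^ ?N * (R * R ^ (?N - 1))"
    using pk unfolding power_mult_distrib power_card[of R, symmetric] by linarith
  then have "(\<kappa> / 4) ^ ?N * (\<Sum>e\<in>?S. diameter e ^ (?N - 1)) \<le> 4 ^ ?N * R ^ (?N - 1)"
    using R(1) by (simp add: mult.left_commute mult.assoc)
  then have "(\<Sum>e\<in>?S. diameter e ^ (?N - 1)) \<le> 4 ^ ?N * R ^ (?N - 1) / (\<kappa> / 4) ^ ?N"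
    using \<kappa>_pos by (simp add: field_simps)
  also have "\<dots> = (16 / \<kappa>) ^ ?N * R ^ (?N - 1)"
  proof -
    have "(16 / \<kappa>) ^ ?N = 4 ^ ?N / (\<kappa> / 4) ^ ?N" by (simp flip: power_divide)
    then show ?thesis by simp
  qed
  finally show ?thesis .
qed

text \<open>The product of the constants of two alternatives: a covering by small faces, or a single
  face of diameter at least \<open>R / \<Lambda>1\<close>.\<close>

definition c_low :: real where "c_low = (1 / (8 * 3 ^ CARD('n))) * (1 / \<Lambda>1) ^ (CARD('n) - 1)"

text \<open>If all nearby faces have diameter at most \<open>R\<close>, columns of balls over them
  cover a ball of radius \<open>R\<close>. Otherwise there is a larger face nearby, and on the way
  from \<open>e\<close> to it a face of diameter at most \<open>R\<close> touches one of diameter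
  above \<open>R\<close>; by comparability the smaller of the two suffices.\<close>

lemma boundary_face_measure_ge:
  assumes e: "e \<in> boundary_faces \<T>" and R: "diameter e \<le> R" "R \<le> R0"
  shows "c_low * R ^ (CARD('n) - 1) \<le>
    (\<Sum>e' | e' \<in> boundary_faces \<T> \<and> dist (barycenter e) (barycenter e') + diameter e' \<le> 10 * R. diameter e' ^ (CARD('n) - 1))"
proof -
  let ?N = "CARD('n)"
  let ?S = "{e'. e' \<in> boundary_faces \<T> \<and> dist (barycenter e) (barycenter e') + diameter e' \<le> 10 * R}"
  have fin: "finite ?S" using finite_boundary_faces by simp
  define x0 where "x0 = barycenter e"
  note ce = boundary_face_compact_convex[OF e]
  have x0: "x0 \<in> mesh_boundary \<T>" "x0 \<in> e" using ce by (auto simp: x0_def)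
  have Rp: "R > 0" using boundary_face_diameter(1)[OF e] R(1) by linarith
  have L: "1 \<le> \<Lambda>1" by (rule \<Lambda>1_ge_1[OF e])
  obtain n where n: "norm n = 1"
    "\<And>x y s t. x \<in> mesh_boundary \<T> \<Longrightarrow> y \<in> mesh_boundary \<T> \<Longrightarrow> x \<in> ball x0 (r / 8) \<Longrightarrow> y \<in> ball x0 (r / 8) \<Longrightarrow>
      x + s *\<^sub>R n = y + t *\<^sub>R n \<Longrightarrow> x = y"
    and hit: "\<And>\<tau>. \<tau> \<bullet> n = 0 \<Longrightarrow> 2 * norm \<tau> < r / 8 \<Longrightarrow> \<exists>t. \<bar>t\<bar> \<le> norm \<tau> \<and> x0 + \<tau> + t *\<^sub>R n \<in> mesh_boundary \<T>"
  proof (rule chart_graph[OF x0(1)])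
    fix n assume "norm n = 1"
     "\<And>x y s t. x \<in> mesh_boundary \<T> \<Longrightarrow> y \<in> mesh_boundary \<T> \<Longrightarrow> x \<in> ball x0 (r / 8) \<Longrightarrow> y \<in> ball x0 (r / 8) \<Longrightarrow>
      x + s *\<^sub>R n = y + t *\<^sub>R n \<Longrightarrow> x = y"
     "\<And>\<tau>. \<tau> \<bullet> n = 0 \<Longrightarrow> 2 * norm \<tau> < r / 8 \<Longrightarrow> \<exists>t. \<bar>t\<bar> \<le> norm \<tau> \<and> x0 + \<tau> + t *\<^sub>R n \<in> mesh_boundary \<T>"
    then show thesis by (rule that)
  qed
  have nn: "n \<bullet> n = 1" using n(1) by (simp add: dot_square_norm)
  have perp: "norm (v - (v \<bullet> n) *\<^sub>R n) \<le> norm v" "(v - (v \<bullet> n) *\<^sub>R n) \<bullet> n = 0" for v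
  proof -
    show "(v - (v \<bullet> n) *\<^sub>R n) \<bullet> n = 0" by (simp add: inner_diff_left nn)
    have "(norm (v - (v \<bullet> n) *\<^sub>R n))\<^sup>2 = (norm v)\<^sup>2 - (v \<bullet> n)\<^sup>2"
      unfolding power2_norm_eq_inner
      by (simp add: inner_diff_left inner_diff_right nn inner_commute power2_eq_square)
    then have "(norm (v - (v \<bullet> n) *\<^sub>R n))\<^sup>2 \<le> (norm v)\<^sup>2" by simp
    then show "norm (v - (v \<bullet> n) *\<^sub>R n) \<le> norm v" by (rule power2_le_imp_le) simp
  qed
  have inS: "e' \<in> ?S" if e': "e' \<in> boundary_faces \<T>" "z \<in> e'" "dist x0 z \<le> 8 * R" "diameter e' \<le> R" for e' z
  proof -
    have "dist z (barycenter e') \<le> R"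
      using boundary_face_dist[OF e'(1,2) boundary_face_compact_convex(5)[OF e'(1)]] e'(4) by linarith
    then have "dist x0 (barycenter e') + diameter e' \<le> 10 * R"
      using dist_triangle[of x0 "barycenter e'" z] e'(3,4) by linarith
    then show ?thesis using e'(1) by (simp add: x0_def)
  qed
  have term0: "0 \<le> diameter e' ^ (?N - 1)" if "e' \<in> ?S" for e'
    using boundary_face_diameter(1)[of e'] that by simp
  show ?thesis
  proof (cases "\<forall>e'\<in>boundary_faces \<T>. e' \<inter> ball x0 (4 * R) \<noteq> {} \<longrightarrow> diameter e' \<le> R")
    case True
    let ?S' = "{e' \<in> ?S. diameter e' \<le> R}"
    have fin': "finite ?S'" by (rule finite_subset[OF _ fin]) blast
    \<comment> \<open>Heights from \<open>- 2 * R\<close> to \<open>2 * R\<close> in units of the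
      face diameter; the extra -1 accounts for rounding down.\<close>
    define J where "J e' = {- \<lceil>2 * R / diameter e'\<rceil> - 1 .. \<lceil>2 * R / diameter e'\<rceil>}" for e' :: "(real^'n) set"
    let ?I = "Sigma ?S' J"
    define c where "c i = barycenter (fst i) + (real_of_int (snd i) * diameter (fst i)) *\<^sub>R n" for i :: "(real^'n) set \<times> int"
    have d: "0 < diameter e'" if "e' \<in> ?S'" for e' using that boundary_face_diameter(1) by blast
    have "R ^ DIM(real^'n) \<le> (\<Sum>i\<in>?I. (3 * diameter (fst i)) ^ DIM(real^'n))"
    proof (rule ball_covering[where x = c and X = x0])
      show "finite ?I" by (intro finite_SigmaI fin') (simp add: J_def)
      show "0 \<le> R" using Rp by simp
      show "0 \<le> 3 * diameter (fst i)" if "i \<in> ?I" for i using d[of "fst i"] that by auto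
      show "ball x0 R \<subseteq> (\<Union>i\<in>?I. ball (c i) (3 * diameter (fst i)))"
      proof
        fix w assume w: "w \<in> ball x0 R"
        define v where "v = w - x0"
        have v: "norm v < R" using w by (simp add: v_def dist_norm norm_minus_commute)
        define \<tau> where "\<tau> = v - (v \<bullet> n) *\<^sub>R n"
        have \<tau>: "norm \<tau> < R" "\<tau> \<bullet> n = 0" using perp[of v] v by (auto simp: \<tau>_def)
        obtain t where t: "\<bar>t\<bar> \<le> norm \<tau>" "x0 + \<tau> + t *\<^sub>R n \<in> mesh_boundary \<T>"
          using hit[OF \<tau>(2)] \<tau>(1) R(2) r_pos by auto
        let ?z = "x0 + \<tau> + t *\<^sub>R n"
        obtain e' where e': "e' \<in> boundary_faces \<T>" "?z \<in> e'" using t(2) unfolding mesh_boundary_eq_Union by blast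
        have "norm (\<tau> + t *\<^sub>R n) \<le> norm \<tau> + \<bar>t\<bar>" using norm_triangle_ineq[of \<tau> "t *\<^sub>R n"] n(1) by simp
        moreover have "dist x0 ?z = norm (\<tau> + t *\<^sub>R n)"
          unfolding dist_norm by (subst norm_minus_commute) (simp add: add.assoc)
        ultimately have zd: "dist x0 ?z < 2 * R" using t(1) \<tau>(1) by linarith
        then have "?z \<in> ball x0 (4 * R)" using Rp by simp
        then have dR: "diameter e' \<le> R" using True e' by blast
        then have eS: "e' \<in> ?S'" using inS[OF e'(1,2)] zd Rp by simp
        define s where "s = v \<bullet> n - t"
        have wz: "w = ?z + s *\<^sub>R n" by (simp add: s_def \<tau>_def v_def algebra_simps)
        have "\<bar>v \<bullet> n\<bar> \<le> norm v" using Cauchy_Schwarz_ineq2[of v n] n(1) by simp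
        then have s: "\<bar>s\<bar> \<le> 2 * R" using t(1) \<tau>(1) v by (simp add: s_def)
        define i where "i = \<lfloor>s / diameter e'\<rfloor>"
        have "\<bar>s / diameter e'\<bar> \<le> 2 * R / diameter e'" using s d[OF eS] by (simp add: divide_right_mono)
        moreover have "- \<lceil>q\<rceil> - 1 \<le> \<lfloor>x\<rfloor>" "\<lfloor>x\<rfloor> \<le> \<lceil>q\<rceil>" if "\<bar>x\<bar> \<le> q" for x q :: real
          using that by linarith+
        ultimately have "i \<in> J e'" unfolding J_def i_def by (simp only: atLeastAtMost_iff)
        moreover have "w \<in> ball (c (e', i)) (3 * diameter e')"
        proof -
          have "\<bar>s / diameter e' - i\<bar> \<le> 1" unfolding i_def by linarith
          then have "\<bar>s / diameter e' - i\<bar> * diameter e' \<le> 1 * diameter e'" using d[OF eS] by (intro mult_right_mono) auto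
          moreover have "\<bar>s / diameter e' - i\<bar> * diameter e' = \<bar>s - i * diameter e'\<bar>"
            using d[OF eS] by (metis abs_mult abs_of_pos left_diff_distrib nonzero_eq_divide_eq less_irrefl)
          ultimately have 1: "\<bar>s - i * diameter e'\<bar> \<le> diameter e'" by simp
          have 2: "norm (?z - barycenter e') \<le> diameter e'"
            using boundary_face_dist[OF e' boundary_face_compact_convex(5)[OF e'(1)]] by (simp add: dist_norm)
          have "w - c (e', i) = (?z - barycenter e') + (s - i * diameter e') *\<^sub>R n"
            by (simp add: wz c_def algebra_simps)
          then have "norm (w - c (e', i)) \<le> norm (?z - barycenter e') + \<bar>s - i * diameter e'\<bar>"
            using norm_triangle_ineq[of "?z - barycenter e'" "(s - i * diameter e') *\<^sub>R n"] n(1) by simp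
          then have "norm (w - c (e', i)) < 3 * diameter e'" using 1 2 d[OF eS] by linarith
          then show ?thesis by (simp add: dist_norm norm_minus_commute)
        qed
        ultimately show "w \<in> (\<Union>i\<in>?I. ball (c i) (3 * diameter (fst i)))" using eS by force
      qed
    qed
    also have "\<dots> = (\<Sum>e'\<in>?S'. real (card (J e')) * (3 * diameter e') ^ ?N)"
    proof -
      have "(\<Sum>e'\<in>?S'. \<Sum>j\<in>J e'. (3 * diameter e') ^ ?N) = (\<Sum>(e', j)\<in>?I. (3 * diameter e') ^ ?N)"
        by (rule sum.Sigma) (use fin' in \<open>auto simp: J_def\<close>)
      then show ?thesis by (simp add: split_def)
    qed
    also have "\<dots> \<le> (\<Sum>e'\<in>?S'. 8 * 3 ^ ?N * R * diameter e' ^ (?N - 1))"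
    proof (rule sum_mono)
      fix e' assume e': "e' \<in> ?S'"
      define q where "q = R / diameter e'"
      have q: "1 \<le> q" using e' d[OF e'] by (simp add: q_def)
      have "real (card (J e')) \<le> 8 * q"
      proof -
        have "card (J e') = nat (2 * \<lceil>2 * q\<rceil> + 2)" by (simp add: J_def q_def)
        moreover have "0 \<le> 2 * \<lceil>2 * q\<rceil> + 2" using q by linarith
        ultimately have "real (card (J e')) = real_of_int (2 * \<lceil>2 * q\<rceil> + 2)" by simp
        also have "\<dots> \<le> 2 * (2 * q + 1) + 2"
          unfolding of_int_add of_int_mult of_int_numeral
          by (intro add_right_mono mult_left_mono of_int_ceiling_le_add_one) simp
        finally show ?thesis using q by simp
      qed
      then have "real (card (J e')) * (3 * diameter e') ^ ?N \<le> 8 * q * (3 * diameter e') ^ ?N"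
        using d[OF e'] by (intro mult_right_mono) auto
      also have "(3 * diameter e') ^ ?N = 3 ^ ?N * (diameter e' * diameter e' ^ (?N - 1))"
        unfolding power_mult_distrib power_card[of "diameter e'"] ..
      also have "8 * q * (3 ^ ?N * (diameter e' * diameter e' ^ (?N - 1))) =
          8 * 3 ^ ?N * (q * diameter e') * diameter e' ^ (?N - 1)" by (simp only: mult_ac)
      also have "q * diameter e' = R" using d[OF e'] by (simp add: q_def)
      finally show "real (card (J e')) * (3 * diameter e') ^ ?N \<le> 8 * 3 ^ ?N * R * diameter e' ^ (?N - 1)"
        unfolding power_mult_distrib power_card[of "diameter e'"] .
    qed
    also have "\<dots> \<le> 8 * 3 ^ ?N * R * (\<Sum>e'\<in>?S. diameter e' ^ (?N - 1))"
      unfolding sum_distrib_left[symmetric] using fin Rp term0 by (intro mult_left_mono sum_mono2) auto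
    finally have "R * R ^ (?N - 1) \<le> R * (8 * 3 ^ ?N * (\<Sum>e'\<in>?S. diameter e' ^ (?N - 1)))"
      unfolding power_card[of R, symmetric] by (simp add: mult.left_commute mult.assoc)
    then have 1: "R ^ (?N - 1) \<le> 8 * 3 ^ ?N * (\<Sum>e'\<in>?S. diameter e' ^ (?N - 1))" using Rp by simp
    have "c_low * R ^ (?N - 1) \<le> (1 / (8 * 3 ^ ?N)) * R ^ (?N - 1)"
    proof (rule mult_right_mono)
      have "(1 / \<Lambda>1) ^ (?N - 1) \<le> 1" using L by (intro power_le_one) auto
      then show "c_low \<le> 1 / (8 * 3 ^ ?N)" unfolding c_low_def by (intro mult_left_le) auto
    qed (use Rp in simp)
    also have "\<dots> \<le> (\<Sum>e'\<in>?S. diameter e' ^ (?N - 1))" using 1 by (simp add: field_simps)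
    finally show ?thesis .
  next
    case False
    then obtain e2 where "e2 \<in> boundary_faces \<T>" "e2 \<inter> ball x0 (4 * R) \<noteq> {}" "\<not> diameter e2 \<le> R" by blast
    then obtain y2 where e2: "e2 \<in> boundary_faces \<T>" "y2 \<in> e2" "y2 \<in> ball x0 (4 * R)" "R < diameter e2"
      unfolding not_le by blast
    define P where "P x = x - (x \<bullet> n) *\<^sub>R n" for x
    have contP: "continuous_on A P" for A unfolding P_def by (intro continuous_intros)
    let ?F1 = "\<Union>{e' \<in> boundary_faces \<T>. diameter e' \<le> R} \<inter> cball x0 (8 * R)"
    let ?F2 = "\<Union>{e' \<in> boundary_faces \<T>. R < diameter e'} \<inter> cball x0 (8 * R)"
    have cU: "compact (\<Union>F)" if "F \<subseteq> boundary_faces \<T>" for F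
      using that finite_boundary_faces boundary_face_compact_convex(1) finite_subset by (intro compact_Union) blast+
    have "compact ?F1" "compact ?F2" by (intro compact_Int_closed cU closed_cball, blast)+
    then have cl: "closed (P ` ?F1)" "closed (P ` ?F2)"
      using compact_continuous_image[OF contP] compact_imp_closed by blast+
    \<comment> \<open>This segment is covered by the shadows of the small and of the large faces,
      two closed sets that both meet it. A common shadow point comes from a single point of the
      graph, and there a small face touches a large one.\<close>
    let ?seg = "closed_segment (P x0) (P y2)"
    have cov: "?seg \<subseteq> P ` ?F1 \<union> P ` ?F2"
    proof
      fix p assume "p \<in> ?seg"
      then obtain u where u: "0 \<le> u" "u \<le> 1" "p = P x0 + u *\<^sub>R (P y2 - P x0)"
        by (auto simp: in_segment algebra_simps)
      define v where "v = u *\<^sub>R (y2 - x0)"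
      define \<tau> where "\<tau> = v - (v \<bullet> n) *\<^sub>R n"
      have "norm (y2 - x0) < 4 * R" using e2(3) by (simp add: dist_norm norm_minus_commute)
      then have "norm v < 4 * R" using u(1,2) by (simp add: v_def) (smt (verit) mult_left_le_one_le norm_ge_zero)
      then have \<tau>: "norm \<tau> < 4 * R" "\<tau> \<bullet> n = 0" using perp[of v] by (auto simp: \<tau>_def)
      obtain t where t: "\<bar>t\<bar> \<le> norm \<tau>" "x0 + \<tau> + t *\<^sub>R n \<in> mesh_boundary \<T>"
        using hit[OF \<tau>(2)] \<tau>(1) R(2) r_pos by auto
      let ?z = "x0 + \<tau> + t *\<^sub>R n"
      have "norm (\<tau> + t *\<^sub>R n) \<le> norm \<tau> + \<bar>t\<bar>" using norm_triangle_ineq[of \<tau> "t *\<^sub>R n"] n(1) by simp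
      moreover have "dist x0 ?z = norm (\<tau> + t *\<^sub>R n)" unfolding dist_norm by (subst norm_minus_commute) (simp add: add.assoc)
      ultimately have "dist x0 ?z \<le> 8 * R" using t(1) \<tau>(1) by linarith
      moreover have "P ?z = p"
        unfolding u(3) by (simp add: P_def \<tau>_def v_def inner_add_left inner_diff_left nn algebra_simps)
      moreover obtain e' where "e' \<in> boundary_faces \<T>" "?z \<in> e'" using t(2) unfolding mesh_boundary_eq_Union by blast
      ultimately show "p \<in> P ` ?F1 \<union> P ` ?F2" by (cases "diameter e' \<le> R") force+
    qed
    have "P x0 \<in> ?seg" "P y2 \<in> ?seg" by auto
    moreover have "x0 \<in> ?F1" using e R(1) x0(2) Rp by auto
    moreover have "y2 \<in> ?F2" using e2 Rp by auto
    ultimately have ne: "P ` ?F1 \<inter> ?seg \<noteq> {}" "P ` ?F2 \<inter> ?seg \<noteq> {}" by blast+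
    have "P ` ?F1 \<inter> P ` ?F2 \<inter> ?seg \<noteq> {}"
    proof
      assume "P ` ?F1 \<inter> P ` ?F2 \<inter> ?seg = {}"
      from connected_closedD[OF connected_segment(1) this cov cl] show False using ne by (elim disjE) simp_all
    qed
    then obtain z1 z2 where z: "z1 \<in> ?F1" "z2 \<in> ?F2" "P z1 = P z2" by blast
    obtain e1 e3 where e13: "e1 \<in> boundary_faces \<T>" "diameter e1 \<le> R" "z1 \<in> e1"
      "e3 \<in> boundary_faces \<T>" "R < diameter e3" "z2 \<in> e3" using z by blast
    have zb: "z1 \<in> ball x0 (r / 8)" "z2 \<in> ball x0 (r / 8)" using z R(2) r_pos Rp by auto
    have "z1 + (- (z1 \<bullet> n)) *\<^sub>R n = z2 + (- (z2 \<bullet> n)) *\<^sub>R n" using z(3) by (simp add: P_def)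
    then have "z1 = z2" by (rule n(2)[OF _ _ zb, rotated 2]) (use e13 boundary_face_compact_convex(6) in blast)+
    then have "diameter e3 \<le> \<Lambda>1 * diameter e1"
      using touching_faces_comparable[of e1 e3] e13 by blast
    then have "R / \<Lambda>1 \<le> diameter e1" using e13(5) L by (simp add: field_simps)
    then have "(R / \<Lambda>1) ^ (?N - 1) \<le> diameter e1 ^ (?N - 1)" using Rp L by (intro power_mono) auto
    also have "\<dots> \<le> (\<Sum>e'\<in>?S. diameter e' ^ (?N - 1))"
    proof (rule member_le_sum)
      show "e1 \<in> ?S" using inS[OF e13(1,3) _ e13(2)] z(1) by auto
    qed (use fin term0 in auto)
    finally have 1: "(R / \<Lambda>1) ^ (?N - 1) \<le> (\<Sum>e'\<in>?S. diameter e' ^ (?N - 1))" .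
    have "c_low * R ^ (?N - 1) \<le> (1 * (1 / \<Lambda>1) ^ (?N - 1)) * R ^ (?N - 1)"
    proof (rule mult_right_mono)
      have "(1::real) \<le> 3 ^ ?N" by (rule one_le_power) simp
      then have "(1::real) \<le> 8 * 3 ^ ?N" by linarith
      then have "1 / (8 * 3 ^ ?N) \<le> (1::real)" by simp
      then show "c_low \<le> 1 * (1 / \<Lambda>1) ^ (?N - 1)" unfolding c_low_def using L by (intro mult_right_mono) auto
    qed (use Rp in simp)
    also have "\<dots> = (R / \<Lambda>1) ^ (?N - 1)" by (simp add: power_divide)
    finally show ?thesis using 1 by linarith
  qed
qed

end


section \<open>Dyadic sums and integrals over faces\<close>

lemma sum_half_powers_le: "finite J \<Longrightarrow> (\<Sum>j\<in>J. (1 / 2 :: real) ^ j) \<le> 2"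
  using sum_le_suminf[of "\<lambda>j. (1 / 2 :: real) ^ j" J] suminf_geometric[of "1 / 2 :: real"]
  by (simp add: summable_geometric)

lemma dyadic_sum_le:
  fixes w d F :: "'i \<Rightarrow> real" and l :: "'i \<Rightarrow> nat"
  assumes fin: "finite I" and w: "\<And>j. (\<Sum>i | i \<in> I \<and> l i = j. F i) \<le> B * (1 / 2) ^ j" and B: "0 \<le> B"
  shows "(\<Sum>i\<in>I. F i) \<le> 2 * B"
proof -
  have "(\<Sum>i\<in>I. F i) = (\<Sum>j\<in>l ` I. \<Sum>i | i \<in> I \<and> l i = j. F i)"
    by (rule sum.group[symmetric]) (use fin in auto)
  also have "\<dots> \<le> (\<Sum>j\<in>l ` I. B * (1 / 2) ^ j)" by (intro sum_mono w)
  also have "\<dots> = B * (\<Sum>j\<in>l ` I. (1 / 2) ^ j)" by (simp add: sum_distrib_left)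
  also have "\<dots> \<le> B * 2" using B fin by (intro mult_left_mono sum_half_powers_le) auto
  finally show ?thesis by simp
qed

text \<open>On the shell where \<open>d\<close> is about \<open>2 ^ j * \<delta>\<close>, growth of
  order \<open>\<alpha>\<close> against the power \<open>\<alpha> + \<gamma>\<close> leaves
  \<open>1 / (2 ^ j * \<delta>) ^ \<gamma>\<close>, and \<open>1 \<le> \<gamma>\<close> makes the
  series geometric.\<close>

lemma sum_inverse_power_upper_tail:
  fixes w d :: "'i \<Rightarrow> real"
  assumes fin: "finite I" and w: "\<And>i. i \<in> I \<Longrightarrow> 0 \<le> w i" and \<delta>: "0 < \<delta>"
    and d: "\<And>i. i \<in> I \<Longrightarrow> \<delta> \<le> d i" "\<And>i. i \<in> I \<Longrightarrow> d i \<le> \<rho>" and C: "0 \<le> C"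
    and growth: "\<And>R. 0 < R \<Longrightarrow> R \<le> \<rho> \<Longrightarrow> (\<Sum>i | i \<in> I \<and> d i \<le> R. w i) \<le> C * R ^ \<alpha>" and \<gamma>: "1 \<le> \<gamma>"
  shows "(\<Sum>i\<in>I. w i / d i ^ (\<alpha> + \<gamma>)) \<le> 2 * (C * 2 ^ \<alpha> / \<delta> ^ \<gamma>)"
proof (rule dyadic_sum_le[OF fin])
  define l where "l i = nat \<lfloor>log 2 (d i / \<delta>)\<rfloor>" for i
  have l: "2 ^ l i * \<delta> \<le> d i" "d i \<le> 2 * (2 ^ l i * \<delta>)" if i: "i \<in> I" for i
  proof -
    have q: "1 \<le> d i / \<delta>" using d(1)[OF i] \<delta> by simp
    then have nn: "0 \<le> log 2 (d i / \<delta>)" by (simp add: zero_le_log_cancel_iff)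
    have 1: "real (l i) \<le> log 2 (d i / \<delta>)" and 2: "log 2 (d i / \<delta>) \<le> real (l i) + 1"
      using nn unfolding l_def by linarith+
    have "2 powr real (l i) \<le> d i / \<delta>" using 1 q by (subst (asm) le_log_iff) auto
    then show "2 ^ l i * \<delta> \<le> d i" using \<delta> by (simp add: powr_realpow field_simps)
    have "d i / \<delta> \<le> 2 powr (real (l i) + 1)" using 2 q by (subst (asm) log_le_iff) auto
    then show "d i \<le> 2 * (2 ^ l i * \<delta>)" using \<delta> by (simp add: powr_add powr_realpow field_simps)
  qed
  show "0 \<le> C * 2 ^ \<alpha> / \<delta> ^ \<gamma>" using C \<delta> by simp
  fix j
  let ?s = "2 ^ j * \<delta>"
  have s: "0 < ?s" using \<delta> by simp
  let ?I = "{i \<in> I. l i = j}"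
  show "(\<Sum>i | i \<in> I \<and> l i = j. w i / d i ^ (\<alpha> + \<gamma>)) \<le> C * 2 ^ \<alpha> / \<delta> ^ \<gamma> * (1 / 2) ^ j"
  proof (cases "?I = {}")
    case True
    show ?thesis unfolding True using C \<delta> by simp
  next
    case False
    then obtain i0 where i0: "i0 \<in> I" "l i0 = j" by blast
    \<comment> \<open>The growth bound is available only up to \<open>\<rho>\<close>, which the
      outermost shell may exceed.\<close>
    define R where "R = min \<rho> (2 * ?s)"
    have R: "0 < R" "R \<le> \<rho>" "R \<le> 2 * ?s" using s \<delta> d[OF i0(1)] by (auto simp: R_def)
    have "(\<Sum>i\<in>?I. w i / d i ^ (\<alpha> + \<gamma>)) \<le> (\<Sum>i\<in>?I. w i / ?s ^ (\<alpha> + \<gamma>))"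
      using l w s \<delta> by (intro sum_mono divide_left_mono power_mono mult_pos_pos zero_less_power) (auto intro: less_le_trans[OF s])
    also have "\<dots> = (\<Sum>i\<in>?I. w i) / ?s ^ (\<alpha> + \<gamma>)" by (simp add: sum_divide_distrib)
    also have "\<dots> \<le> (C * R ^ \<alpha>) / ?s ^ (\<alpha> + \<gamma>)"
    proof (rule divide_right_mono)
      have "(\<Sum>i\<in>?I. w i) \<le> (\<Sum>i | i \<in> I \<and> d i \<le> R. w i)"
        using fin w l(2) d(2) by (intro sum_mono2) (auto simp: R_def)
      then show "(\<Sum>i\<in>?I. w i) \<le> C * R ^ \<alpha>" using growth[OF R(1,2)] by linarith
    qed (use s in simp)
    also have "\<dots> \<le> (C * (2 * ?s) ^ \<alpha>) / ?s ^ (\<alpha> + \<gamma>)"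
      using R C s by (intro divide_right_mono mult_left_mono power_mono) auto
    also have "\<dots> = C * 2 ^ \<alpha> / ?s ^ \<gamma>" using \<delta> by (simp add: power_mult_distrib power_add)
    also have "\<dots> = C * 2 ^ \<alpha> / \<delta> ^ \<gamma> * (1 / 2 ^ j) ^ \<gamma>" by (simp add: power_mult_distrib power_divide)
    also have "\<dots> \<le> C * 2 ^ \<alpha> / \<delta> ^ \<gamma> * (1 / 2 ^ j) ^ 1"
      using C \<delta> \<gamma> by (intro mult_left_mono power_decreasing) auto
    finally show ?thesis by (simp add: power_divide)
  qed
qed

text \<open>Here the shells shrink towards 0. Growth exceeds the singularity by one power, so shell
  \<open>j\<close> contributes a multiple of \<open>\<rho> / 2 ^ j\<close>.\<close>

lemma sum_inverse_power_lower_tail: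
  fixes w d :: "'i \<Rightarrow> real"
  assumes fin: "finite I" and w: "\<And>i. i \<in> I \<Longrightarrow> 0 \<le> w i" and \<rho>: "0 < \<rho>"
    and d: "\<And>i. i \<in> I \<Longrightarrow> 0 < d i" "\<And>i. i \<in> I \<Longrightarrow> d i \<le> \<rho>" and C: "0 \<le> C"
    and growth: "\<And>R. 0 < R \<Longrightarrow> R \<le> \<rho> \<Longrightarrow> (\<Sum>i | i \<in> I \<and> d i \<le> R. w i) \<le> C * R ^ (\<beta> + 1)"
  shows "(\<Sum>i\<in>I. w i / d i ^ \<beta>) \<le> 2 * (C * 2 ^ \<beta> * \<rho>)"
proof (rule dyadic_sum_le[OF fin])
  define l where "l i = nat \<lfloor>log 2 (\<rho> / d i)\<rfloor>" for i
  have l: "d i \<le> \<rho> / 2 ^ l i" "\<rho> / 2 ^ l i / 2 \<le> d i" if i: "i \<in> I" for i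
  proof -
    have q: "1 \<le> \<rho> / d i" using d[OF i] by simp
    then have nn: "0 \<le> log 2 (\<rho> / d i)" by (simp add: zero_le_log_cancel_iff)
    have 1: "real (l i) \<le> log 2 (\<rho> / d i)" and 2: "log 2 (\<rho> / d i) \<le> real (l i) + 1"
      using nn unfolding l_def by linarith+
    have "2 powr real (l i) \<le> \<rho> / d i" using 1 q by (subst (asm) le_log_iff) auto
    then show "d i \<le> \<rho> / 2 ^ l i" using d(1)[OF i] by (simp add: powr_realpow field_simps)
    have "\<rho> / d i \<le> 2 powr (real (l i) + 1)" using 2 q by (subst (asm) log_le_iff) auto
    then show "\<rho> / 2 ^ l i / 2 \<le> d i" using d(1)[OF i] by (simp add: powr_add powr_realpow field_simps)
  qed
  show "0 \<le> C * 2 ^ \<beta> * \<rho>" using C \<rho> by simp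
  fix j
  let ?s = "\<rho> / 2 ^ j"
  have s: "0 < ?s" "?s \<le> \<rho>" using \<rho> by (auto simp: field_simps)
  let ?I = "{i \<in> I. l i = j}"
  have "(\<Sum>i\<in>?I. w i / d i ^ \<beta>) \<le> (\<Sum>i\<in>?I. w i / (?s / 2) ^ \<beta>)"
    using l w s d by (intro sum_mono divide_left_mono power_mono mult_pos_pos zero_less_power) auto
  also have "\<dots> = (\<Sum>i\<in>?I. w i) / (?s / 2) ^ \<beta>" by (simp add: sum_divide_distrib)
  also have "\<dots> \<le> (C * ?s ^ (\<beta> + 1)) / (?s / 2) ^ \<beta>"
  proof (rule divide_right_mono)
    have "(\<Sum>i\<in>?I. w i) \<le> (\<Sum>i | i \<in> I \<and> d i \<le> ?s. w i)"
      using fin w l(1) by (intro sum_mono2) auto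
    then show "(\<Sum>i\<in>?I. w i) \<le> C * ?s ^ (\<beta> + 1)" using growth[OF s] by linarith
  qed (use s in simp)
  also have "\<dots> = C * 2 ^ \<beta> * \<rho> * (1 / 2) ^ j" using s by (simp add: power_divide power_add field_simps)
  finally show "(\<Sum>i | i \<in> I \<and> l i = j. w i / d i ^ \<beta>) \<le> C * 2 ^ \<beta> * \<rho> * (1 / 2) ^ j"
    .
qed

text \<open>\<open>face_measure\<close> is a completion, and the functions to be integrated are
  known to be affine only on the face. Agreement almost everywhere with a Borel function is then
  enough.\<close>

lemma AE_eq_borel_imp_measurable_completion:
  fixes f g :: "'a::topological_space \<Rightarrow> real"
  assumes g: "g \<in> borel_measurable borel" and M: "sets M = sets borel" and ae: "AE x in completion M. f x = g x"
  shows "f \<in> borel_measurable (completion M)"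
proof (rule measurableI)
  fix A :: "real set" assume A: "A \<in> sets borel"
  have g': "g \<in> borel_measurable (completion M)"
    by (rule measurable_completion) (use g in \<open>simp add: measurable_cong_sets[OF M refl]\<close>)
  have sp: "space (completion M) = UNIV" using sets_eq_imp_space_eq[OF M] by simp
  have "g -` A \<inter> space (completion M) \<in> sets (completion M)" using g' A by (rule measurable_sets)
  then show "f -` A \<inter> space (completion M) \<in> sets (completion M)"
    by (rule completion.in_sets_AE[rotated]) (use ae in \<open>auto elim!: eventually_mono simp: sp\<close>)
qed simp

section \<open>Surface measure on a boundary face\<close>

context boundary_fitted_mesh
begin

definition area :: "(real^'n) set \<Rightarrow> real" where
  "area e = measure lborel (face_prism e)"

text \<open>\<open>face_normal\<close> is an arbitrary choice. As the face contains a disc of its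
  hyperplane, this choice is the outer normal up to sign.\<close>

lemma face_normal_props:
  assumes e: "e \<in> boundary_faces \<T>"
  shows "norm (face_normal e) = 1" "\<And>x y. x \<in> e \<Longrightarrow> y \<in> e \<Longrightarrow> face_normal e \<bullet> (x - y) = 0"
    "\<And>\<tau>. face_normal e \<bullet> \<tau> = 0 \<longleftrightarrow> outer_normal \<T> e \<bullet> \<tau> = 0"
proof -
  obtain T a where T: "T \<in> \<T>" "a \<in> vertices T" "e = convex hull (vertices T - {a})"
    by (rule boundary_face_obtain[OF e])
  have "\<exists>n. norm n = 1 \<and> (\<forall>x\<in>e. \<forall>y\<in>e. n \<bullet> (x - y) = 0)"
    using norm_outer_normal[OF e] face_orthogonal[OF T e] by blast
  then have fn: "norm (face_normal e) = 1 \<and> (\<forall>x\<in>e. \<forall>y\<in>e. face_normal e \<bullet> (x - y) = 0)"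
    unfolding face_normal_def by (rule someI_ex)
  then show "norm (face_normal e) = 1" "\<And>x y. x \<in> e \<Longrightarrow> y \<in> e \<Longrightarrow> face_normal e \<bullet> (x - y) = 0" by blast+
  let ?m = "face_normal e" and ?n = "outer_normal \<T> e"
  obtain S y where S: "S \<in> \<T>" "y \<in> e" "\<And>\<tau>. ?n \<bullet> \<tau> = 0 \<Longrightarrow> norm \<tau> \<le> \<kappa> * diameter S \<Longrightarrow> y + \<tau> \<in> e"
    using boundary_face_inball[OF e] by metis
  define \<rho> where "\<rho> = \<kappa> * diameter S"
  have \<rho>: "\<rho> > 0" using \<kappa>_pos diameter_simplex_pos[OF S(1)] by (simp add: \<rho>_def)
  have m0: "?m \<bullet> \<tau> = 0" if "?n \<bullet> \<tau> = 0" for \<tau>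
  proof (cases "\<tau> = 0")
    case False
    have "y + (\<rho> / norm \<tau>) *\<^sub>R \<tau> \<in> e" using S(3)[of "(\<rho> / norm \<tau>) *\<^sub>R \<tau>"] that False \<rho> by (simp add: \<rho>_def)
    then have "?m \<bullet> (y + (\<rho> / norm \<tau>) *\<^sub>R \<tau> - y) = 0" using fn S(2) by blast
    then show ?thesis using False \<rho> by simp
  qed simp
  define p where "p = ?m - (?m \<bullet> ?n) *\<^sub>R ?n"
  have nn: "?n \<bullet> ?n = 1" using norm_outer_normal[OF e] by (simp add: dot_square_norm)
  have np: "?n \<bullet> p = 0" by (simp add: p_def inner_diff_right nn inner_commute)
  have "?m \<bullet> p = 0" by (rule m0[OF np])
  moreover have "p \<bullet> p = ?m \<bullet> p - (?m \<bullet> ?n) * (?n \<bullet> p)"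
    by (subst (1) p_def) (simp add: inner_diff_left)
  ultimately have "p \<bullet> p = 0" using np by simp
  then have m: "?m = (?m \<bullet> ?n) *\<^sub>R ?n" by (simp add: p_def)
  have "?m \<bullet> ?n \<noteq> 0" using m fn by (metis norm_zero scaleR_zero_left zero_neq_one)
  then show "face_normal e \<bullet> \<tau> = 0 \<longleftrightarrow> outer_normal \<T> e \<bullet> \<tau> = 0" for \<tau>
    by (subst m) simp
qed

lemma compact_face_prism: "e \<in> boundary_faces \<T> \<Longrightarrow> compact (face_prism e)"
proof -
  assume e: "e \<in> boundary_faces \<T>"
  have "face_prism e = (\<lambda>z. fst z + snd z *\<^sub>R face_normal e) ` (e \<times> {0..1})"
    by (force simp: face_prism_def)
  moreover have "compact ((\<lambda>z. fst z + snd z *\<^sub>R face_normal e) ` (e \<times> {0..1}))"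
    by (intro compact_continuous_image continuous_intros compact_Times boundary_face_compact_convex(1)[OF e] compact_Icc)
  ultimately show ?thesis by simp
qed

lemma face_projection_prism:
  assumes e: "e \<in> boundary_faces \<T>" and x: "x \<in> face_prism e"
  shows "face_projection e x \<in> e"
proof -
  obtain y t where y: "x = y + t *\<^sub>R face_normal e" "y \<in> e" using x by (auto simp: face_prism_def)
  have nn: "face_normal e \<bullet> face_normal e = 1" using face_normal_props(1)[OF e] by (simp add: dot_square_norm)
  have "face_normal e \<bullet> (y - barycenter e) = 0"
    by (rule face_normal_props(2)[OF e y(2) boundary_face_compact_convex(5)[OF e]])
  then have "face_normal e \<bullet> (x - barycenter e) = t" by (simp add: y(1) inner_diff_right inner_add_right nn)
  then show ?thesis using y by (simp add: face_projection_def)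
qed

lemma
  assumes e: "e \<in> boundary_faces \<T>"
  shows space_face_measure: "space (face_measure e) = UNIV"
    and sets_face_measure: "sets borel \<subseteq> sets (face_measure e)"
    and measure_face_measure: "measure (face_measure e) UNIV = area e"
    and finite_face_measure: "finite_measure (face_measure e)"
    and AE_face_measure: "AE x in face_measure e. x \<in> e"
    and affine_measurable_face_measure:
      "\<And>f g b. (\<And>x. x \<in> e \<Longrightarrow> f x = g \<bullet> x + b) \<Longrightarrow> f \<in> borel_measurable (face_measure e)"
proof -
  let ?P = "face_prism e" and ?pr = "face_projection e"
  let ?R = "restrict_space lborel ?P"
  let ?M = "distr ?R borel ?pr"
  have P: "?P \<in> sets lborel" using compact_face_prism[OF e] by (simp add: borel_compact)
  have prm: "?pr \<in> ?R \<rightarrow>\<^sub>M borel"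
  proof (rule measurable_restrict_space1)
    have "continuous_on UNIV ?pr" unfolding face_projection_def by (intro continuous_intros)
    then show "?pr \<in> lborel \<rightarrow>\<^sub>M borel" by (simp add: borel_measurable_continuous_onI)
  qed
  have fm: "face_measure e = completion ?M" by (simp add: face_measure_def)
  show sp: "space (face_measure e) = UNIV" by (simp add: fm)
  show "sets borel \<subseteq> sets (face_measure e)" by (auto simp: fm intro: sets_completionI_sets)
  have spR: "space ?R = ?P" using P by (simp add: space_restrict_space)
  have em: "emeasure (face_measure e) UNIV = emeasure lborel ?P"
  proof -
    have "emeasure (face_measure e) UNIV = emeasure ?M UNIV" by (simp add: fm)
    also have "\<dots> = emeasure ?R (?pr -` UNIV \<inter> space ?R)" by (rule emeasure_distr[OF prm]) simp
    also have "\<dots> = emeasure lborel ?P" using P by (simp add: spR emeasure_restrict_space)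
    finally show ?thesis .
  qed
  then show "measure (face_measure e) UNIV = area e" by (simp add: area_def measure_def)
  have "emeasure lborel ?P < \<infinity>"
    using compact_face_prism[OF e] compact_imp_bounded emeasure_bounded_finite by blast
  then show "finite_measure (face_measure e)" using em sp by (intro finite_measureI) simp
  have closed_e: "closed e" using boundary_face_compact_convex(1)[OF e] compact_imp_closed by blast
  have "AE x in ?R. ?pr x \<in> e" using face_projection_prism[OF e] by (intro AE_I2) (simp add: spR)
  then have "AE x in ?M. x \<in> e" using closed_e by (subst AE_distr_iff[OF prm]) auto
  then show ae: "AE x in face_measure e. x \<in> e" unfolding fm by (rule AE_completion)
  show "f \<in> borel_measurable (face_measure e)" if f: "\<And>x. x \<in> e \<Longrightarrow> f x = g \<bullet> x + b" for f g b
    unfolding fm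
  proof (rule AE_eq_borel_imp_measurable_completion)
    show "(\<lambda>x. g \<bullet> x + b) \<in> borel_measurable borel" by measurable
    show "AE x in completion ?M. f x = g \<bullet> x + b" using ae unfolding fm by (rule eventually_mono) (rule f)
  qed simp
qed

definition a_low :: real where "a_low = unit_ball_vol (real CARD('n)) * (\<kappa> / 2) ^ (CARD('n) - 1) / 4"
definition a_up :: real where "a_up = unit_ball_vol (real CARD('n)) * 2 * 3 ^ CARD('n)"

lemma a_low_pos: "0 < a_low" and a_up_pos: "0 < a_up"
  using \<kappa>_pos by (auto simp: a_low_def a_up_def)

text \<open>Area is the volume of a prism of height 1. About \<open>1 / diameter e\<close> balls of
  radius \<open>3 * diameter e\<close>, stacked along the height, cover the prism, and about
  \<open>1 / (\<kappa> * diameter e)\<close> disjoint balls of radius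
  \<open>\<kappa> * diameter e / 2\<close> fit into it; both counts rely on
  \<open>diameter e \<le> 1\<close>.\<close>

lemma area_bounds:
  assumes e: "e \<in> boundary_faces \<T>"
  shows "a_low * diameter e ^ (CARD('n) - 1) \<le> area e" "area e \<le> a_up * diameter e ^ (CARD('n) - 1)"
proof -
  let ?N = "CARD('n)" and ?d = "diameter e" and ?m = "face_normal e" and ?P = "face_prism e"
  let ?v = "unit_ball_vol (real CARD('n))"
  have v: "?v > 0" by simp
  have d: "0 < ?d" "?d \<le> 1" using boundary_face_diameter[OF e] h_small(1) r_le_1 by linarith+
  note m = face_normal_props[OF e]
  have mm: "?m \<bullet> ?m = 1" using m(1) by (simp add: dot_square_norm)
  have Pfm: "?P \<in> fmeasurable lborel"
    using compact_face_prism[OF e] by (intro fmeasurableI emeasure_bounded_finite compact_imp_bounded) (auto simp: borel_compact)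
  obtain y where y: "y \<in> e" "\<And>x. outer_normal \<T> e \<bullet> (x - y) = 0 \<Longrightarrow> norm (x - y) < \<kappa> * ?d \<Longrightarrow> x \<in> rel_interior e"
  proof (rule boundary_face_plate[OF e])
    fix y assume "y \<in> e" "\<And>x. outer_normal \<T> e \<bullet> (x - y) = 0 \<Longrightarrow> norm (x - y) < \<kappa> * ?d \<Longrightarrow> x \<in> rel_interior e"
    then show thesis by (rule that)
  qed
  have cball: "measure lborel (ball (z::real^'n) s) = ?v * s ^ ?N" if "0 \<le> s" for z s
    using that by (simp add: content_ball)
  show "area e \<le> a_up * ?d ^ (?N - 1)"
  proof -
    define k where "k = nat \<lfloor>1 / ?d\<rfloor>"
    have q: "1 \<le> 1 / ?d" using d by simp
    have "?P \<subseteq> (\<Union>i\<in>{..k}. ball (y + (real i * ?d) *\<^sub>R ?m) (3 * ?d))"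
    proof
      fix w assume "w \<in> ?P"
      then obtain x t where x: "w = x + t *\<^sub>R ?m" "x \<in> e" "0 \<le> t" "t \<le> 1" by (auto simp: face_prism_def)
      define i where "i = nat \<lfloor>t / ?d\<rfloor>"
      have t0: "0 \<le> t / ?d" using x(3) d by simp
      have "t / ?d \<le> 1 / ?d" using x(4) d by (simp add: divide_right_mono)
      then have "i \<le> k" unfolding i_def k_def by (intro nat_mono floor_mono)
      have "\<bar>t / ?d - real i\<bar> \<le> 1" using t0 unfolding i_def by linarith
      then have "\<bar>t / ?d - real i\<bar> * ?d \<le> 1 * ?d" using d by (intro mult_right_mono) auto
      moreover have "\<bar>t / ?d - real i\<bar> * ?d = \<bar>(t / ?d - real i) * ?d\<bar>" using d by (simp add: abs_mult)
      moreover have "(t / ?d - real i) * ?d = t - real i * ?d" using d by (simp add: left_diff_distrib)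
      ultimately have 1: "\<bar>t - real i * ?d\<bar> \<le> ?d" by simp
      have "norm (x - y) \<le> ?d" using boundary_face_dist[OF e x(2) y(1)] by (simp add: dist_norm)
      moreover have "w - (y + (real i * ?d) *\<^sub>R ?m) = (x - y) + (t - real i * ?d) *\<^sub>R ?m" by (simp add: x(1) algebra_simps)
      then have "norm (w - (y + (real i * ?d) *\<^sub>R ?m)) = norm ((x - y) + (t - real i * ?d) *\<^sub>R ?m)"
        by (rule arg_cong)
      moreover have "\<dots> \<le> norm (x - y) + \<bar>t - real i * ?d\<bar>"
        using norm_triangle_ineq[of "x - y" "(t - real i * ?d) *\<^sub>R ?m"] m(1) by simp
      ultimately have "norm (w - (y + (real i * ?d) *\<^sub>R ?m)) < 3 * ?d" using 1 d by linarith
      then have "w \<in> ball (y + (real i * ?d) *\<^sub>R ?m) (3 * ?d)" by (simp add: dist_norm norm_minus_commute)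
      then show "w \<in> (\<Union>i\<in>{..k}. ball (y + (real i * ?d) *\<^sub>R ?m) (3 * ?d))" using \<open>i \<le> k\<close> by blast
    qed
    then have "area e \<le> measure lborel (\<Union>i\<in>{..k}. ball (y + (real i * ?d) *\<^sub>R ?m) (3 * ?d))"
      unfolding area_def using Pfm ball_fmeasurable by (intro measure_mono_fmeasurable fmeasurable.finite_UN) auto
    also have "\<dots> \<le> (\<Sum>i\<in>{..k}. measure lborel (ball (y + (real i * ?d) *\<^sub>R ?m) (3 * ?d)))"
      using ball_fmeasurable by (intro measure_UNION_le) auto
    also have "\<dots> = (real k + 1) * (?v * (3 * ?d) ^ ?N)" using d by (simp add: cball)
    also have "\<dots> \<le> (2 / ?d) * (?v * (3 * ?d) ^ ?N)"
    proof (rule mult_right_mono)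
      have "real k \<le> 1 / ?d" using q unfolding k_def by linarith
      then show "real k + 1 \<le> 2 / ?d" using q by simp
    qed (use v d in simp)
    also have "\<dots> = a_up * ?d ^ (?N - 1)"
      unfolding power_mult_distrib power_card[of ?d] a_up_def using d by simp
    finally show ?thesis .
  qed
  show "a_low * ?d ^ (?N - 1) \<le> area e"
  proof -
    define \<rho> where "\<rho> = \<kappa> * ?d / 2"
    obtain T where T: "T \<in> \<T>" by (rule boundary_face_obtain[OF e])
    have "\<kappa> * ?d \<le> (1 / 2) * 1" using \<kappa>_le_half[OF T] \<kappa>_pos d by (intro mult_mono) auto
    then have \<rho>: "0 < \<rho>" "4 * \<rho> \<le> 1" using \<kappa>_pos d by (auto simp: \<rho>_def)
    define k where "k = nat \<lfloor>1 / (2 * \<rho>)\<rfloor>"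
    define c where "c i = y + ((2 * real i + 1) * \<rho>) *\<^sub>R ?m" for i :: nat
    have q: "2 \<le> 1 / (2 * \<rho>)" using \<rho> by (simp add: field_simps)
    have k1: "real k \<le> 1 / (2 * \<rho>)" "1 / (2 * \<rho>) - 1 \<le> real k" using q unfolding k_def by linarith+
    have k2: "real k * (2 * \<rho>) \<le> 1" using k1(1) \<rho> by (simp add: field_simps)
    have k3: "1 / (4 * \<rho>) \<le> real k"
    proof -
      have "1 / (4 * \<rho>) = (1 / (2 * \<rho>)) / 2" by simp
      then show ?thesis using k1(2) q by linarith
    qed
    have sub: "ball (c i) \<rho> \<subseteq> ?P" if i: "i < k" for i
    proof
      fix w assume w: "w \<in> ball (c i) \<rho>"
      define b where "b = w - c i"
      have b: "norm b < \<rho>" using w by (simp add: b_def dist_norm norm_minus_commute)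
      have mb: "\<bar>?m \<bullet> b\<bar> \<le> norm b" using Cauchy_Schwarz_ineq2[of ?m b] m(1) by simp
      define x where "x = y + (b - (?m \<bullet> b) *\<^sub>R ?m)"
      have "?m \<bullet> (x - y) = 0" by (simp add: x_def inner_diff_right mm)
      then have o: "outer_normal \<T> e \<bullet> (x - y) = 0" using m(3) by blast
      have "norm (x - y) \<le> norm b + \<bar>?m \<bullet> b\<bar>" using norm_triangle_ineq4[of b "(?m \<bullet> b) *\<^sub>R ?m"] m(1) by (simp add: x_def)
      then have "norm (x - y) < \<kappa> * ?d" using b mb by (simp add: \<rho>_def)
      then have "x \<in> e" using y(2)[OF o] rel_interior_subset by blast
      moreover have "w = x + ((2 * real i + 1) * \<rho> + ?m \<bullet> b) *\<^sub>R ?m" by (simp add: x_def b_def c_def algebra_simps)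
      moreover have "0 \<le> (2 * real i + 1) * \<rho> + ?m \<bullet> b"
      proof -
        have "1 * \<rho> \<le> (2 * real i + 1) * \<rho>" using \<rho> by (intro mult_right_mono) auto
        then show ?thesis using mb b by linarith
      qed
      moreover have "(2 * real i + 1) * \<rho> + ?m \<bullet> b \<le> 1"
      proof -
        have "(2 * real i + 2) * \<rho> \<le> (2 * real k) * \<rho>" using i \<rho> by (intro mult_right_mono) auto
        then show ?thesis using mb b k2 by (simp add: algebra_simps)
      qed
      ultimately show "w \<in> ?P" unfolding face_prism_def by blast
    qed
    have "a_low * ?d ^ (?N - 1) = (1 / (4 * \<rho>)) * (?v * \<rho> ^ ?N)"
      unfolding power_card[of \<rho>] a_low_def using \<kappa>_pos d by (simp add: \<rho>_def power_mult_distrib power_divide)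
    also have "\<dots> \<le> real k * (?v * \<rho> ^ ?N)" using k3 v \<rho> by (intro mult_right_mono) auto
    also have "\<dots> = (\<Sum>i<k. measure lborel (ball (c i) \<rho>))" using \<rho> by (simp add: cball)
    also have "\<dots> = measure lborel (\<Union>i<k. ball (c i) \<rho>)"
    proof (rule measure_finite_Union[symmetric])
      show "disjoint_family_on (\<lambda>i. ball (c i) \<rho>) {..<k}"
        unfolding disjoint_family_on_def
      proof (intro ballI impI)
        fix i j assume ij: "i \<noteq> (j::nat)"
        show "ball (c i) \<rho> \<inter> ball (c j) \<rho> = {}"
        proof (rule ccontr)
          assume "ball (c i) \<rho> \<inter> ball (c j) \<rho> \<noteq> {}"
          then obtain w where "dist (c i) w < \<rho>" "dist (c j) w < \<rho>" by auto
          then have lt: "dist (c i) (c j) < 2 * \<rho>" using dist_triangle[of "c i" "c j" w] by (simp add: dist_commute)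
          have "c i - c j = (2 * \<rho> * (real i - real j)) *\<^sub>R ?m" by (simp add: c_def algebra_simps)
          then have "dist (c i) (c j) = 2 * \<rho> * \<bar>real i - real j\<bar>" using m(1) \<rho> by (simp add: dist_norm abs_mult)
          moreover have "1 \<le> \<bar>real i - real j\<bar>" using ij by linarith
          then have "2 * \<rho> * 1 \<le> 2 * \<rho> * \<bar>real i - real j\<bar>" using \<rho> by (intro mult_left_mono) auto
          ultimately show False using lt by linarith
        qed
      qed
      show "emeasure lborel (ball (c i) \<rho>) \<noteq> \<infinity>" for i
        using emeasure_bounded_finite[OF bounded_ball] by (simp add: less_top)
    qed auto
    also have "\<dots> \<le> area e"
      unfolding area_def using sub Pfm by (intro measure_mono_fmeasurable) auto
    finally show ?thesis .
  qed
qed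

end


section \<open>Lower bounds for the discrete half norm\<close>

context boundary_fitted_mesh
begin

lemma power_card_minus_1: "(x::real) ^ (CARD('n) - 1) = x * x ^ (CARD('n) - 2)"
proof -
  have "CARD('n) - 1 = Suc (CARD('n) - 2)" using dim_ge_2 by simp
  then show ?thesis by simp
qed

lemma bounded_affine_on_face:
  assumes e: "e \<in> boundary_faces \<T>" and f: "\<And>x. x \<in> e \<Longrightarrow> f x = g \<bullet> x + b"
  shows "\<exists>B\<ge>0. \<forall>x\<in>e. \<bar>f x\<bar> \<le> B"
proof -
  have "bounded ((\<lambda>x. g \<bullet> x + b) ` e)"
    by (intro compact_imp_bounded compact_continuous_image continuous_intros boundary_face_compact_convex(1)[OF e])
  then obtain B where B: "\<And>x. x \<in> e \<Longrightarrow> \<bar>g \<bullet> x + b\<bar> \<le> B" unfolding bounded_iff by auto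
  then show ?thesis using f by (intro exI[of _ "max B 0"]) (simp add: le_max_iff_disj)
qed

lemma face_integral_square_ge:
  assumes e: "e \<in> boundary_faces \<T>" and f: "\<And>x. x \<in> e \<Longrightarrow> f x = g \<bullet> x + b"
    and L: "\<And>x. x \<in> e \<Longrightarrow> L \<le> (f x)\<^sup>2"
  shows "L * area e \<le> (LINT x|face_measure e. (f x)\<^sup>2)"
proof -
  interpret finite_measure "face_measure e" by (rule finite_face_measure[OF e])
  have fm: "f \<in> borel_measurable (face_measure e)" by (rule affine_measurable_face_measure[OF e f])
  obtain B where B: "\<And>x. x \<in> e \<Longrightarrow> \<bar>f x\<bar> \<le> B" using bounded_affine_on_face[OF e f] by blast
  have "AE x in face_measure e. norm ((f x)\<^sup>2) \<le> B\<^sup>2"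
    using AE_face_measure[OF e]
  proof eventually_elim
    case (elim x)
    then show ?case using power_mono[OF B[OF elim], of 2] by simp
  qed
  then have "integrable (face_measure e) (\<lambda>x. (f x)\<^sup>2)" using fm by (intro integrable_const_bound) auto
  moreover have "AE x in face_measure e. L \<le> (f x)\<^sup>2"
    using AE_face_measure[OF e] by eventually_elim (rule L)
  ultimately have "(LINT x|face_measure e. L) \<le> (LINT x|face_measure e. (f x)\<^sup>2)"
    by (intro integral_mono_AE) auto
  then show ?thesis by (simp add: space_face_measure[OF e] measure_face_measure[OF e] mult.commute)
qed

text \<open>Disjoint compact faces have positive distance, so the kernel is bounded and integrable
  and the pointwise bound can be integrated. The bound \<open>L\<close> may be negative.\<close>

lemma face_double_integral_ge:
  assumes e: "e \<in> boundary_faces \<T>" and e': "e' \<in> boundary_faces \<T>" and disj: "e \<inter> e' = {}"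
    and f: "\<And>x. x \<in> e \<Longrightarrow> f x = g \<bullet> x + b" and f': "\<And>x. x \<in> e' \<Longrightarrow> f x = g' \<bullet> x + b'"
    and L: "\<And>x y. x \<in> e \<Longrightarrow> y \<in> e' \<Longrightarrow> L \<le> (f x - f y)\<^sup>2 / norm (x - y) ^ CARD('n)"
  shows "L * (area e * area e') \<le>
    (LINT z|(face_measure e \<Otimes>\<^sub>M face_measure e'). (f (fst z) - f (snd z))\<^sup>2 / norm (fst z - snd z) ^ CARD('n))"
proof -
  let ?M = "face_measure e" and ?M' = "face_measure e'"
  let ?F = "\<lambda>z. (f (fst z) - f (snd z))\<^sup>2 / norm (fst z - snd z) ^ CARD('n)"
  interpret M: finite_measure ?M by (rule finite_face_measure[OF e])
  interpret M': finite_measure ?M' by (rule finite_face_measure[OF e'])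
  interpret P: pair_sigma_finite ?M ?M' ..
  note ce = boundary_face_compact_convex[OF e] and ce' = boundary_face_compact_convex[OF e']
  have fst_b: "fst \<in> ?M \<Otimes>\<^sub>M ?M' \<rightarrow>\<^sub>M borel" and snd_b: "snd \<in> ?M \<Otimes>\<^sub>M ?M' \<rightarrow>\<^sub>M borel"
  proof -
    have "(\<lambda>x. x) \<in> ?M \<rightarrow>\<^sub>M borel" "(\<lambda>x. x) \<in> ?M' \<rightarrow>\<^sub>M borel"
      using sets_face_measure[OF e] sets_face_measure[OF e'] space_face_measure[OF e] space_face_measure[OF e']
      by (auto intro!: measurableI)
    from measurable_compose[OF measurable_fst this(1)] measurable_compose[OF measurable_snd this(2)]
    show "fst \<in> ?M \<Otimes>\<^sub>M ?M' \<rightarrow>\<^sub>M borel" "snd \<in> ?M \<Otimes>\<^sub>M ?M' \<rightarrow>\<^sub>M borel" by auto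
  qed
  have f1: "(\<lambda>z. f (fst z)) \<in> borel_measurable (?M \<Otimes>\<^sub>M ?M')"
    by (rule measurable_compose[OF measurable_fst affine_measurable_face_measure[OF e f]])
  have f2: "(\<lambda>z. f (snd z)) \<in> borel_measurable (?M \<Otimes>\<^sub>M ?M')"
    by (rule measurable_compose[OF measurable_snd affine_measurable_face_measure[OF e' f']])
  have Fm: "?F \<in> borel_measurable (?M \<Otimes>\<^sub>M ?M')"
    using f1 f2 fst_b snd_b by measurable
  have sp: "space (?M \<Otimes>\<^sub>M ?M') = UNIV" by (simp add: space_pair_measure space_face_measure[OF e] space_face_measure[OF e'])
  have ee': "e \<times> e' \<in> sets (?M \<Otimes>\<^sub>M ?M')"
    using sets_face_measure[OF e] sets_face_measure[OF e'] ce(1) ce'(1) by (intro pair_measureI) (auto simp: borel_compact)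
  have ae: "AE z in ?M \<Otimes>\<^sub>M ?M'. z \<in> e \<times> e'"
  proof (rule P.AE_pair_measure)
    show "{x \<in> space (?M \<Otimes>\<^sub>M ?M'). x \<in> e \<times> e'} \<in> sets (?M \<Otimes>\<^sub>M ?M')" using ee' by (simp add: sp)
    show "AE x in ?M. AE y in ?M'. (x, y) \<in> e \<times> e'"
      using AE_face_measure[OF e]
    proof eventually_elim
      case (elim x)
      show ?case using AE_face_measure[OF e'] by eventually_elim (use elim in simp)
    qed
  qed
  have em: "emeasure (?M \<Otimes>\<^sub>M ?M') UNIV = emeasure ?M UNIV * emeasure ?M' UNIV"
    using M'.emeasure_pair_measure_Times[of UNIV ?M UNIV] sets.top[of ?M] sets.top[of ?M']
    by (simp add: space_face_measure[OF e] space_face_measure[OF e'])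
  then have meas: "measure (?M \<Otimes>\<^sub>M ?M') UNIV = area e * area e'"
    by (simp add: measure_def enn2real_mult measure_face_measure[OF e, unfolded measure_def, symmetric]
        measure_face_measure[OF e', unfolded measure_def, symmetric])
  interpret PM: finite_measure "?M \<Otimes>\<^sub>M ?M'"
  proof
    show "emeasure (?M \<Otimes>\<^sub>M ?M') (space (?M \<Otimes>\<^sub>M ?M')) \<noteq> \<infinity>"
      unfolding sp em using M.emeasure_finite[of UNIV] M'.emeasure_finite[of UNIV]
      by (simp add: ennreal_mult_eq_top_iff)
  qed
  obtain B where B: "B \<ge> 0" "\<And>x. x \<in> e \<Longrightarrow> \<bar>f x\<bar> \<le> B" using bounded_affine_on_face[OF e f] by blast
  obtain B' where B': "B' \<ge> 0" "\<And>x. x \<in> e' \<Longrightarrow> \<bar>f x\<bar> \<le> B'" using bounded_affine_on_face[OF e' f'] by blast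
  obtain \<delta> where \<delta>: "\<delta> > 0" "\<And>x y. x \<in> e \<Longrightarrow> y \<in> e' \<Longrightarrow> \<delta> \<le> dist x y"
    using separate_compact_closed[OF ce(1) compact_imp_closed[OF ce'(1)] disj] by blast
  have "AE z in ?M \<Otimes>\<^sub>M ?M'. norm (?F z) \<le> (B + B')\<^sup>2 / \<delta> ^ CARD('n)"
    using ae
  proof eventually_elim
    case (elim z)
    then have z: "fst z \<in> e" "snd z \<in> e'" by auto
    have "\<bar>f (fst z) - f (snd z)\<bar> \<le> B + B'" using B(2)[OF z(1)] B'(2)[OF z(2)] by linarith
    then have "(f (fst z) - f (snd z))\<^sup>2 \<le> (B + B')\<^sup>2" using power_mono[of "\<bar>f (fst z) - f (snd z)\<bar>" "B + B'" 2] by simp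
    moreover have "\<delta> ^ CARD('n) \<le> norm (fst z - snd z) ^ CARD('n)"
      using \<delta>(2)[OF z] \<delta>(1) by (intro power_mono) (auto simp: dist_norm)
    ultimately have "?F z \<le> (B + B')\<^sup>2 / \<delta> ^ CARD('n)" using \<delta>(1) by (intro frac_le) auto
    then show ?case by simp
  qed
  then have int: "integrable (?M \<Otimes>\<^sub>M ?M') ?F" by (intro PM.integrable_const_bound Fm)
  have "AE z in ?M \<Otimes>\<^sub>M ?M'. L \<le> ?F z" using ae by eventually_elim (use L in force)
  then have "(LINT z|(?M \<Otimes>\<^sub>M ?M'). L) \<le> (LINT z|(?M \<Otimes>\<^sub>M ?M'). ?F z)"
    using int by (intro integral_mono_AE) auto
  then show ?thesis by (simp add: sp meas mult.commute)
qed

text \<open>Adding the diameters dominates the distance between any two points of the faces and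
  keeps the quantity positive even for \<open>e = e'\<close>, so that it may stand in
  denominators.\<close>

definition fdist :: "(real^'n) set \<Rightarrow> (real^'n) set \<Rightarrow> real" where
  "fdist e e' = dist (barycenter e) (barycenter e') + diameter e + diameter e'"

definition wt :: "(real^'n) set \<Rightarrow> real" where "wt e = diameter e ^ (CARD('n) - 1)"

definition C_up :: real where "C_up = (16 / \<kappa>) ^ CARD('n)"

lemma fdist_commute: "fdist e e' = fdist e' e" by (simp add: fdist_def dist_commute)

lemma wt_pos: "e \<in> boundary_faces \<T> \<Longrightarrow> 0 < wt e"
  using boundary_face_diameter(1) by (simp add: wt_def)

lemma fdist_bounds:
  assumes "e \<in> boundary_faces \<T>" "e' \<in> boundary_faces \<T>"
  shows "diameter e \<le> fdist e e'" "diameter e' \<le> fdist e e'" "0 < fdist e e'"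
  using boundary_face_diameter(1)[OF assms(1)] boundary_face_diameter(1)[OF assms(2)] zero_le_dist[of "barycenter e" "barycenter e'"]
  unfolding fdist_def by linarith+

lemma C_up_pos: "0 < C_up" using \<kappa>_pos by (simp add: C_up_def)

lemma wt_growth:
  assumes e: "e \<in> boundary_faces \<T>" and R: "0 < R" "R \<le> R0"
  shows "(\<Sum>e' | e' \<in> boundary_faces \<T> \<and> fdist e e' \<le> R. wt e') \<le> C_up * R ^ (CARD('n) - 1)"
proof -
  note ce = boundary_face_compact_convex[OF e]
  have "(\<Sum>e' | e' \<in> boundary_faces \<T> \<and> fdist e e' \<le> R. wt e') \<le>
      (\<Sum>e' | e' \<in> boundary_faces \<T> \<and> e' \<subseteq> ball (barycenter e) R. wt e')"
  proof (rule sum_mono2)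
    show "{e'. e' \<in> boundary_faces \<T> \<and> fdist e e' \<le> R} \<subseteq> {e'. e' \<in> boundary_faces \<T> \<and> e' \<subseteq> ball (barycenter e) R}"
    proof safe
      fix e' x assume e': "e' \<in> boundary_faces \<T>" "fdist e e' \<le> R" "x \<in> e'"
      have "dist (barycenter e') x \<le> diameter e'"
        using boundary_face_dist[OF e'(1) boundary_face_compact_convex(5)[OF e'(1)] e'(3)] .
      then show "x \<in> ball (barycenter e) R"
        using dist_triangle[of "barycenter e" x "barycenter e'"] e'(2) boundary_face_diameter(1)[OF e]
        unfolding fdist_def mem_ball by linarith
    qed
  qed (use finite_boundary_faces wt_pos in \<open>auto intro: less_imp_le\<close>)
  also have "\<dots> \<le> C_up * R ^ (CARD('n) - 1)"
    unfolding wt_def C_up_def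
    by (rule boundary_face_measure_le) (use R ce in auto)
  finally show ?thesis .
qed

text \<open>The discrete form of a surface integral: the power \<open>- N\<close> of the distance,
  integrated over distances at least \<open>diameter e\<close>, is of order
  \<open>1 / diameter e\<close>.\<close>

lemma wt_upper_tail:
  assumes e: "e \<in> boundary_faces \<T>"
  shows "(\<Sum>e' | e' \<in> boundary_faces \<T> \<and> fdist e e' \<le> R0. wt e' / fdist e e' ^ CARD('n)) \<le>
    C_up * 2 ^ CARD('n) / diameter e"
proof -
  let ?I = "{e'. e' \<in> boundary_faces \<T> \<and> fdist e e' \<le> R0}"
  have N: "CARD('n) = (CARD('n) - 1) + 1" using dim_ge_2 by simp
  have "(\<Sum>e'\<in>?I. wt e' / fdist e e' ^ ((CARD('n) - 1) + 1)) \<le> 2 * (C_up * 2 ^ (CARD('n) - 1) / diameter e ^ 1)"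
  proof (rule sum_inverse_power_upper_tail[where \<rho> = R0])
    fix R :: real assume R: "0 < R" "R \<le> R0"
    have "{e' \<in> ?I. fdist e e' \<le> R} = {e'. e' \<in> boundary_faces \<T> \<and> fdist e e' \<le> R}" using R by auto
    then show "(\<Sum>e' | e' \<in> ?I \<and> fdist e e' \<le> R. wt e') \<le> C_up * R ^ (CARD('n) - 1)"
      using wt_growth[OF e R] by (simp only:)
  qed (use finite_boundary_faces wt_pos fdist_bounds(1)[OF e] boundary_face_diameter(1)[OF e] C_up_pos in \<open>auto intro: less_imp_le\<close>)
  also have "2 * (C_up * 2 ^ (CARD('n) - 1) / diameter e ^ 1) = C_up * 2 ^ CARD('n) / diameter e"
    unfolding power_card[of 2] by simp
  finally show ?thesis using N by simp
qed

text \<open>The discrete form of a weakly singular surface integral: the power \<open>2 - N\<close>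
  of the distance, integrated up to distance \<open>R0\<close>, is of order
  \<open>R0\<close>.\<close>

lemma wt_lower_tail:
  assumes e: "e \<in> boundary_faces \<T>"
  shows "(\<Sum>e' | e' \<in> boundary_faces \<T> \<and> fdist e e' \<le> R0. wt e' / fdist e e' ^ (CARD('n) - 2)) \<le> C_up * 2 ^ CARD('n) * R0"
proof -
  let ?I = "{e'. e' \<in> boundary_faces \<T> \<and> fdist e e' \<le> R0}"
  have N: "CARD('n) - 2 + 1 = CARD('n) - 1" using dim_ge_2 by simp
  have "(\<Sum>e'\<in>?I. wt e' / fdist e e' ^ (CARD('n) - 2)) \<le> 2 * (C_up * 2 ^ (CARD('n) - 2) * R0)"
  proof (rule sum_inverse_power_lower_tail)
    fix R :: real assume R: "0 < R" "R \<le> R0"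
    have "{e' \<in> ?I. fdist e e' \<le> R} = {e'. e' \<in> boundary_faces \<T> \<and> fdist e e' \<le> R}" using R by auto
    then show "(\<Sum>e' | e' \<in> ?I \<and> fdist e e' \<le> R. wt e') \<le> C_up * R ^ (CARD('n) - 2 + 1)"
      using wt_growth[OF e R] unfolding N by (simp only:)
  qed (use finite_boundary_faces wt_pos fdist_bounds(3)[OF e] C_up_pos r_pos in \<open>auto intro: less_imp_le\<close>)
  also have "\<dots> \<le> C_up * 2 ^ CARD('n) * R0"
    unfolding power_card[of 2] power_card_minus_1[of 2] using C_up_pos r_pos by simp
  finally show ?thesis .
qed

definition jump :: "(real^'n \<Rightarrow> real) \<Rightarrow> (real^'n) set \<Rightarrow> real" where
  "jump \<mu> e = (\<Sum>e' | e' \<in> boundary_faces \<T> \<and> e \<inter> e' \<noteq> {}. \<bar>\<mu> (barycenter e) - \<mu> (barycenter e')\<bar>\<^sup>2)"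

lemma jump_nonneg: "0 \<le> jump \<mu> e" by (simp add: jump_def sum_nonneg)

lemma half_norm_square:
  fixes \<mu> :: "real^'n \<Rightarrow> real"
  defines "E \<equiv> boundary_averaging \<T> \<mu>"
  shows "(\<Sum>e\<in>boundary_faces \<T>. LINT x|face_measure e. (E x)\<^sup>2) \<le> (Lambda_half_norm h \<T> \<mu>)\<^sup>2"
    "(\<Sum>e\<in>boundary_faces \<T>. \<Sum>e'\<in>boundary_faces \<T>. LINT z|(face_measure e \<Otimes>\<^sub>M face_measure e').
          (E (fst z) - E (snd z))\<^sup>2 / norm (fst z - snd z) ^ CARD('n)) \<le> (Lambda_half_norm h \<T> \<mu>)\<^sup>2"
    "(\<Sum>e\<in>boundary_faces \<T>. diameter e ^ (CARD('n) - 2) * jump \<mu> e) \<le> (Lambda_half_norm h \<T> \<mu>)\<^sup>2"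
    "0 \<le> Lambda_half_norm h \<T> \<mu>"
proof -
  let ?B = "boundary_faces \<T>"
  let ?L = "\<Sum>e\<in>?B. LINT x|face_measure e. (E x)\<^sup>2"
  let ?G = "\<Sum>e\<in>?B. \<Sum>e'\<in>?B. LINT z|(face_measure e \<Otimes>\<^sub>M face_measure e').
          (E (fst z) - E (snd z))\<^sup>2 / norm (fst z - snd z) ^ CARD('n)"
  let ?J = "\<Sum>e\<in>?B. diameter e ^ (CARD('n) - 2) * jump \<mu> e"
  have L: "0 \<le> ?L" by (intro sum_nonneg Bochner_Integration.integral_nonneg) simp
  have G: "0 \<le> ?G" by (intro sum_nonneg Bochner_Integration.integral_nonneg) simp
  have J: "0 \<le> ?J" using boundary_face_diameter(1) jump_nonneg by (intro sum_nonneg mult_nonneg_nonneg) (auto intro: less_imp_le)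
  have h: "0 \<le> h * (L2_norm_boundary \<T> \<mu>)\<^sup>2"
  proof (cases "?B = {}")
    case True
    then show ?thesis by (simp add: L2_norm_boundary_def)
  next
    case False
    then obtain e where "e \<in> ?B" by blast
    then have "0 \<le> h" using boundary_face_diameter[of e] by linarith
    then show ?thesis by simp
  qed
  have H: "(H_half_norm_boundary \<T> E)\<^sup>2 = ?L + ?G"
    unfolding H_half_norm_boundary_def L2_norm_boundary_def using L G by simp
  have "(\<Sum>e\<in>?B. \<Sum>e' | e' \<in> ?B \<and> e \<inter> e' \<noteq> {}.
        diameter e ^ (CARD('n) - 2) * \<bar>\<mu> (barycenter e) - \<mu> (barycenter e')\<bar>\<^sup>2) = ?J"
    by (simp add: jump_def sum_distrib_left)
  then have \<Lambda>: "Lambda_half_norm h \<T> \<mu> = sqrt ((?L + ?G) + ?J + h * (L2_norm_boundary \<T> \<mu>)\<^sup>2)"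
    unfolding Lambda_half_norm_def E_def[symmetric] H by simp
  show "0 \<le> Lambda_half_norm h \<T> \<mu>" unfolding \<Lambda> using L G J h by simp
  have "(Lambda_half_norm h \<T> \<mu>)\<^sup>2 = (?L + ?G) + ?J + h * (L2_norm_boundary \<T> \<mu>)\<^sup>2"
    unfolding \<Lambda> using L G J h by simp
  then show "?L \<le> (Lambda_half_norm h \<T> \<mu>)\<^sup>2" "?G \<le> (Lambda_half_norm h \<T> \<mu>)\<^sup>2" "?J \<le> (Lambda_half_norm h \<T> \<mu>)\<^sup>2"
    using L G J h by linarith+
qed

definition C_L2 :: real where "C_L2 = 2 * (1 + a_up) / a_low"
definition C_G :: real where "C_G = 1 + 3 / a_low\<^sup>2 * (1 + a_up\<^sup>2 * (2 * (C_up * 2 ^ CARD('n))))"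
definition C_n :: real where "C_n = 4 * K / \<kappa> + 10 * K"
definition C_V :: real where "C_V = 2 * C_G + 2 * C_n\<^sup>2 * (C_up * 2 ^ CARD('n) * R0) * C_L2"

text \<open>On \<open>e\<close> the averaged function differs from the face value by at most the
  root of the jump, so its square is at least half the squared face value minus the jump.
  Integration gives the jump the factor \<open>diameter e ^ (N - 1)\<close>, and
  \<open>diameter e \<le> 1\<close> turns this into the weight \<open>diameter e ^ (N - 2)\<close>
  of the norm.\<close>

lemma discrete_L2_bound:
  "(\<Sum>e\<in>boundary_faces \<T>. wt e * (\<mu> (barycenter e))\<^sup>2) \<le> C_L2 * (Lambda_half_norm h \<T> \<mu>)\<^sup>2"
proof -
  let ?B = "boundary_faces \<T>" and ?E = "boundary_averaging \<T> \<mu>"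
  let ?X = "(Lambda_half_norm h \<T> \<mu>)\<^sup>2"
  have one: "(a_low / 2) * (wt e * (\<mu> (barycenter e))\<^sup>2) \<le>
      (LINT x|face_measure e. (?E x)\<^sup>2) + a_up * (diameter e ^ (CARD('n) - 2) * jump \<mu> e)" if e: "e \<in> ?B" for e
  proof -
    obtain g b where gb: "\<forall>x\<in>e. ?E x = g \<bullet> x + b" using boundary_averaging_affine[OF e] by blast
    let ?m = "\<mu> (barycenter e)"
    have "((1 / 2) * ?m\<^sup>2 - jump \<mu> e) * area e \<le> (LINT x|face_measure e. (?E x)\<^sup>2)"
    proof (rule face_integral_square_ge[OF e])
      fix x assume x: "x \<in> e"
      show "?E x = g \<bullet> x + b" using gb x by blast
      have "(?E x - ?m)\<^sup>2 \<le> jump \<mu> e" unfolding jump_def by (rule boundary_averaging_deviation[OF e x])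
      moreover have "0 \<le> (2 * ?E x - ?m)\<^sup>2" by simp
      ultimately show "(1 / 2) * ?m\<^sup>2 - jump \<mu> e \<le> (?E x)\<^sup>2" by (simp add: power2_eq_square algebra_simps)
    qed
    then have "(1 / 2) * ?m\<^sup>2 * area e \<le> (LINT x|face_measure e. (?E x)\<^sup>2) + jump \<mu> e * area e" by (simp add: algebra_simps)
    moreover have "(1 / 2) * ?m\<^sup>2 * (a_low * wt e) \<le> (1 / 2) * ?m\<^sup>2 * area e"
      unfolding wt_def by (intro mult_left_mono area_bounds[OF e]) simp
    moreover have "jump \<mu> e * area e \<le> jump \<mu> e * (a_up * diameter e ^ (CARD('n) - 2))"
    proof (rule mult_left_mono[OF _ jump_nonneg])
      have "diameter e * diameter e ^ (CARD('n) - 2) \<le> 1 * diameter e ^ (CARD('n) - 2)"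
        using boundary_face_diameter[OF e] h_small(1) r_le_1 by (intro mult_right_mono) auto
      then have "a_up * diameter e ^ (CARD('n) - 1) \<le> a_up * diameter e ^ (CARD('n) - 2)"
        unfolding power_card_minus_1[of "diameter e"] using a_up_pos by (intro mult_left_mono) auto
      then show "area e \<le> a_up * diameter e ^ (CARD('n) - 2)" using area_bounds(2)[OF e] by linarith
    qed
    ultimately show ?thesis by (simp add: algebra_simps)
  qed
  have "(a_low / 2) * (\<Sum>e\<in>?B. wt e * (\<mu> (barycenter e))\<^sup>2) \<le>
      (\<Sum>e\<in>?B. LINT x|face_measure e. (?E x)\<^sup>2) + a_up * (\<Sum>e\<in>?B. diameter e ^ (CARD('n) - 2) * jump \<mu> e)"
    unfolding sum_distrib_left sum.distrib[symmetric] by (rule sum_mono) (rule one)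
  also have "\<dots> \<le> ?X + a_up * ?X"
    using half_norm_square(1,3)[of \<mu>] a_up_pos by (intro add_mono mult_left_mono) auto
  finally have "(a_low / 2) * (\<Sum>e\<in>?B. wt e * (\<mu> (barycenter e))\<^sup>2) \<le> (1 + a_up) * ?X" by (simp add: algebra_simps)
  then show ?thesis using a_low_pos by (simp add: C_L2_def field_simps)
qed

text \<open>In the Gagliardo sum a touching pair has at most the weight that the discrete norm gives
  to its jump.\<close>

lemma touching_weight:
  assumes e: "e \<in> boundary_faces \<T>" "e' \<in> boundary_faces \<T>"
  shows "wt e * wt e' / fdist e e' ^ CARD('n) \<le> diameter e ^ (CARD('n) - 2)"
proof -
  note b = fdist_bounds[OF e] and d = boundary_face_diameter(1)[OF e(1)] boundary_face_diameter(1)[OF e(2)]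
  have "diameter e * diameter e' ^ (CARD('n) - 1) \<le> fdist e e' * fdist e e' ^ (CARD('n) - 1)"
    using b d by (intro mult_mono power_mono) auto
  then have "diameter e * diameter e' ^ (CARD('n) - 1) \<le> fdist e e' ^ CARD('n)" unfolding power_card[of "fdist e e'"] .
  then have "diameter e ^ (CARD('n) - 2) * (diameter e * diameter e' ^ (CARD('n) - 1)) \<le>
      diameter e ^ (CARD('n) - 2) * fdist e e' ^ CARD('n)" using d by (intro mult_left_mono) auto
  then have "wt e * wt e' \<le> diameter e ^ (CARD('n) - 2) * fdist e e' ^ CARD('n)"
    unfolding wt_def power_card_minus_1[of "diameter e"] by (simp add: algebra_simps)
  then show ?thesis using b(3) by (simp add: divide_le_eq)
qed

text \<open>For touching faces only the nonnegativity of the double integral is used (it would be the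
  junk value 0 if the kernel were not integrable); those pairs are controlled by the jump term.\<close>

lemma discrete_Gagliardo_bound:
  "(\<Sum>e\<in>boundary_faces \<T>. \<Sum>e' | e' \<in> boundary_faces \<T> \<and> fdist e e' \<le> R0.
      wt e * wt e' * (\<mu> (barycenter e) - \<mu> (barycenter e'))\<^sup>2 / fdist e e' ^ CARD('n)) \<le> C_G * (Lambda_half_norm h \<T> \<mu>)\<^sup>2"
proof -
  let ?B = "boundary_faces \<T>" and ?E = "boundary_averaging \<T> \<mu>" and ?N = "CARD('n)"
  let ?X = "(Lambda_half_norm h \<T> \<mu>)\<^sup>2"
  let ?S = "\<lambda>e. {e'. e' \<in> ?B \<and> fdist e e' \<le> R0}"
  let ?m = "\<lambda>e. \<mu> (barycenter e)"
  let ?I = "\<lambda>e e'. LINT z|(face_measure e \<Otimes>\<^sub>M face_measure e').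
          (?E (fst z) - ?E (snd z))\<^sup>2 / norm (fst z - snd z) ^ ?N"
  let ?W = "\<lambda>e e'. wt e * wt e' / fdist e e' ^ ?N"
  let ?t = "\<lambda>e e'. if e \<inter> e' \<noteq> {} then diameter e ^ (?N - 2) * \<bar>?m e - ?m e'\<bar>\<^sup>2 else 0"
  have I0: "0 \<le> ?I e e'" for e e' by (intro Bochner_Integration.integral_nonneg) simp
  have fin: "finite (?S e)" for e using finite_boundary_faces by simp
  have W0: "0 \<le> ?W e e'" if "e \<in> ?B" "e' \<in> ?B" for e e'
    using wt_pos[OF that(1)] wt_pos[OF that(2)] fdist_bounds(3)[OF that] by simp
  have t0: "0 \<le> ?t e e'" if "e \<in> ?B" for e e' using boundary_face_diameter(1)[OF that] by simp
  have one: "wt e * wt e' * (?m e - ?m e')\<^sup>2 / fdist e e' ^ ?N \<le>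
      ?t e e' + 3 / a_low\<^sup>2 * (?I e e' + a_up\<^sup>2 * (jump \<mu> e * ?W e e' + jump \<mu> e' * ?W e e'))"
    if e: "e \<in> ?B" and e': "e' \<in> ?B" for e e'
  proof -
    have rest0: "0 \<le> 3 / a_low\<^sup>2 * (?I e e' + a_up\<^sup>2 * (jump \<mu> e * ?W e e' + jump \<mu> e' * ?W e e'))"
      by (intro mult_nonneg_nonneg add_nonneg_nonneg I0 W0[OF e e'] jump_nonneg) auto
    show ?thesis
    proof (cases "e \<inter> e' = {}")
      case False
      have "wt e * wt e' * (?m e - ?m e')\<^sup>2 / fdist e e' ^ ?N = ?W e e' * (?m e - ?m e')\<^sup>2" by simp
      also have "\<dots> \<le> diameter e ^ (?N - 2) * (?m e - ?m e')\<^sup>2"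
        by (intro mult_right_mono touching_weight[OF e e']) simp
      also have "\<dots> = ?t e e'" using False by simp
      finally show ?thesis using rest0 by linarith
    next
      case True
      obtain g b where gb: "\<forall>x\<in>e. ?E x = g \<bullet> x + b" using boundary_averaging_affine[OF e] by blast
      obtain g' b' where gb': "\<forall>x\<in>e'. ?E x = g' \<bullet> x + b'" using boundary_averaging_affine[OF e'] by blast
      let ?D = "fdist e e' ^ ?N"
      have D: "0 < ?D" using fdist_bounds(3)[OF e e'] by simp
      \<comment> \<open>The difference of the face values is a sum of three terms, two of them
        bounded by roots of jumps; squaring costs the factor 3. \<open>L\<close> is negative where
        the jumps dominate, which the integral bound permits.\<close>
      define L where "L = ((1 / 3) * (?m e - ?m e')\<^sup>2 - jump \<mu> e - jump \<mu> e') / ?D"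
      have "L * (area e * area e') \<le> ?I e e'"
      proof (rule face_double_integral_ge[OF e e' True])
        show "\<And>x. x \<in> e \<Longrightarrow> ?E x = g \<bullet> x + b" "\<And>x. x \<in> e' \<Longrightarrow> ?E x = g' \<bullet> x + b'" using gb gb' by blast+
        fix x y assume xy: "x \<in> e" "y \<in> e'"
        have jx: "(?E x - ?m e)\<^sup>2 \<le> jump \<mu> e" unfolding jump_def by (rule boundary_averaging_deviation[OF e xy(1)])
        have jy: "(?E y - ?m e')\<^sup>2 \<le> jump \<mu> e'" unfolding jump_def by (rule boundary_averaging_deviation[OF e' xy(2)])
        have three: "(a + b + c)\<^sup>2 \<le> 3 * (a\<^sup>2 + b\<^sup>2 + c\<^sup>2)" for a b c :: real
          using zero_le_power2[of "a - b"] zero_le_power2[of "b - c"] zero_le_power2[of "a - c"]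
          by (simp add: power2_eq_square algebra_simps)
        have "(?m e - ?m e')\<^sup>2 \<le> 3 * ((?E x - ?m e)\<^sup>2 + (?E x - ?E y)\<^sup>2 + (?E y - ?m e')\<^sup>2)"
          using three[of "- (?E x - ?m e)" "?E x - ?E y" "?E y - ?m e'"] unfolding power2_minus by simp
        then have num: "(1 / 3) * (?m e - ?m e')\<^sup>2 - jump \<mu> e - jump \<mu> e' \<le> (?E x - ?E y)\<^sup>2" using jx jy by simp
        have xyne: "x \<noteq> y" using xy True by blast
        have "dist x y \<le> fdist e e'"
          using boundary_face_dist[OF e xy(1) boundary_face_compact_convex(5)[OF e]]
            boundary_face_dist[OF e' boundary_face_compact_convex(5)[OF e'] xy(2)]
            dist_triangle[of x y "barycenter e"] dist_triangle[of "barycenter e" y "barycenter e'"] unfolding fdist_def by linarith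
        then have "norm (x - y) ^ ?N \<le> ?D" by (intro power_mono) (auto simp: dist_norm)
        then have "(?E x - ?E y)\<^sup>2 / ?D \<le> (?E x - ?E y)\<^sup>2 / norm (x - y) ^ ?N"
          using xyne D by (intro divide_left_mono) auto
        moreover have "L \<le> (?E x - ?E y)\<^sup>2 / ?D" unfolding L_def using num D by (intro divide_right_mono) auto
        ultimately show "L \<le> (?E x - ?E y)\<^sup>2 / norm (x - y) ^ ?N" by linarith
      qed
      then have 1: "(1 / 3) * (?m e - ?m e')\<^sup>2 / ?D * (area e * area e') \<le>
          ?I e e' + (jump \<mu> e + jump \<mu> e') / ?D * (area e * area e')"
        unfolding L_def by (simp add: diff_divide_distrib add_divide_distrib algebra_simps)
      have A: "a_low\<^sup>2 * (wt e * wt e') \<le> area e * area e'"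
      proof -
        have "(a_low * wt e) * (a_low * wt e') \<le> area e * area e'"
          using area_bounds(1)[OF e] area_bounds(1)[OF e'] a_low_pos wt_pos[OF e] wt_pos[OF e'] unfolding wt_def
          by (intro mult_mono) (auto simp: area_def)
        then show ?thesis by (simp add: power2_eq_square algebra_simps)
      qed
      have A': "area e * area e' \<le> a_up\<^sup>2 * (wt e * wt e')"
      proof -
        have "area e * area e' \<le> (a_up * wt e) * (a_up * wt e')"
          using area_bounds(2)[OF e] area_bounds(2)[OF e'] a_up_pos wt_pos[OF e] wt_pos[OF e'] unfolding wt_def
          by (intro mult_mono) (auto simp: area_def)
        then show ?thesis by (simp add: power2_eq_square algebra_simps)
      qed
      have "(1 / 3) * (?m e - ?m e')\<^sup>2 / ?D * (a_low\<^sup>2 * (wt e * wt e')) \<le> (1 / 3) * (?m e - ?m e')\<^sup>2 / ?D * (area e * area e')"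
        using D by (intro mult_left_mono A) auto
      also have "\<dots> \<le> ?I e e' + (jump \<mu> e + jump \<mu> e') / ?D * (area e * area e')" by (rule 1)
      also have "\<dots> \<le> ?I e e' + (jump \<mu> e + jump \<mu> e') / ?D * (a_up\<^sup>2 * (wt e * wt e'))"
        using D jump_nonneg[of \<mu> e] jump_nonneg[of \<mu> e'] by (intro add_left_mono mult_left_mono A') auto
      also have "\<dots> = ?I e e' + a_up\<^sup>2 * (jump \<mu> e * ?W e e' + jump \<mu> e' * ?W e e')"
        by (simp add: add_divide_distrib algebra_simps)
      finally have "(a_low\<^sup>2 / 3) * (wt e * wt e' * (?m e - ?m e')\<^sup>2 / ?D) \<le>
          ?I e e' + a_up\<^sup>2 * (jump \<mu> e * ?W e e' + jump \<mu> e' * ?W e e')" by (simp add: algebra_simps)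
      moreover have "A \<le> 3 / c * B" if "(c / 3) * A \<le> B" "0 < c" for A B c :: real
        using that by (simp add: field_simps)
      moreover have "0 < a_low\<^sup>2" using a_low_pos by simp
      ultimately have "wt e * wt e' * (?m e - ?m e')\<^sup>2 / ?D \<le>
          3 / a_low\<^sup>2 * (?I e e' + a_up\<^sup>2 * (jump \<mu> e * ?W e e' + jump \<mu> e' * ?W e e'))" by blast
      then show ?thesis using t0[OF e, of e'] by linarith
    qed
  qed
  \<comment> \<open>Summing the kernel over \<open>e'\<close> gives order
    \<open>1 / diameter e\<close>, and \<open>wt e / diameter e\<close> is exactly the weight
    \<open>diameter e ^ (N - 2)\<close> of the jump.\<close>
  have JJ: "(\<Sum>e\<in>?B. \<Sum>e'\<in>?S e. jump \<mu> e * ?W e e') \<le> C_up * 2 ^ ?N * ?X"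
  proof -
    have "(\<Sum>e\<in>?B. \<Sum>e'\<in>?S e. jump \<mu> e * ?W e e') \<le> (\<Sum>e\<in>?B. C_up * 2 ^ ?N * (diameter e ^ (?N - 2) * jump \<mu> e))"
    proof (rule sum_mono)
      fix e assume e: "e \<in> ?B"
      have "(\<Sum>e'\<in>?S e. jump \<mu> e * ?W e e') = jump \<mu> e * wt e * (\<Sum>e'\<in>?S e. wt e' / fdist e e' ^ ?N)"
        by (simp add: sum_distrib_left algebra_simps)
      also have "\<dots> \<le> jump \<mu> e * wt e * (C_up * 2 ^ ?N / diameter e)"
        using wt_pos[OF e] jump_nonneg by (intro mult_left_mono wt_upper_tail[OF e]) auto
      also have "\<dots> = C_up * 2 ^ ?N * (diameter e ^ (?N - 2) * jump \<mu> e)"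
        unfolding wt_def power_card_minus_1[of "diameter e"] using boundary_face_diameter(1)[OF e] by simp
      finally show "(\<Sum>e'\<in>?S e. jump \<mu> e * ?W e e') \<le> C_up * 2 ^ ?N * (diameter e ^ (?N - 2) * jump \<mu> e)" .
    qed
    also have "\<dots> = C_up * 2 ^ ?N * (\<Sum>e\<in>?B. diameter e ^ (?N - 2) * jump \<mu> e)" by (simp add: sum_distrib_left)
    also have "\<dots> \<le> C_up * 2 ^ ?N * ?X" using C_up_pos by (intro mult_left_mono half_norm_square(3)) auto
    finally show ?thesis .
  qed
  have JJ': "(\<Sum>e\<in>?B. \<Sum>e'\<in>?S e. jump \<mu> e' * ?W e e') \<le> C_up * 2 ^ ?N * ?X"
  proof -
    have "(\<Sum>e\<in>?B. \<Sum>e'\<in>?S e. jump \<mu> e' * ?W e e') = (\<Sum>e'\<in>?B. \<Sum>e | e \<in> ?B \<and> fdist e e' \<le> R0. jump \<mu> e' * ?W e e')"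
      by (rule sum.swap_restrict) (use finite_boundary_faces in auto)
    also have "\<dots> = (\<Sum>e\<in>?B. \<Sum>e'\<in>?S e. jump \<mu> e * ?W e e')"
      by (simp add: fdist_commute mult.commute)
    finally show ?thesis using JJ by simp
  qed
  have TT: "(\<Sum>e\<in>?B. \<Sum>e'\<in>?S e. ?t e e') \<le> ?X"
  proof -
    have "(\<Sum>e\<in>?B. \<Sum>e'\<in>?S e. ?t e e') \<le> (\<Sum>e\<in>?B. \<Sum>e'\<in>?B. ?t e e')"
      by (intro sum_mono sum_mono2 finite_boundary_faces) (use t0 in auto)
    also have "\<dots> = (\<Sum>e\<in>?B. diameter e ^ (?N - 2) * jump \<mu> e)"
    proof (rule sum.cong[OF refl])
      fix e
      have "(\<Sum>e'\<in>?B. ?t e e') = (\<Sum>e' | e' \<in> ?B \<and> e \<inter> e' \<noteq> {}. diameter e ^ (?N - 2) * \<bar>?m e - ?m e'\<bar>\<^sup>2)"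
        by (rule sum.inter_filter[symmetric, OF finite_boundary_faces])
      then show "(\<Sum>e'\<in>?B. ?t e e') = diameter e ^ (?N - 2) * jump \<mu> e" by (simp only: jump_def sum_distrib_left)
    qed
    also have "\<dots> \<le> ?X" by (rule half_norm_square(3))
    finally show ?thesis .
  qed
  have sites: "(\<Sum>e\<in>?B. \<Sum>e'\<in>?S e. ?I e e') \<le> ?X"
  proof -
    have "(\<Sum>e\<in>?B. \<Sum>e'\<in>?S e. ?I e e') \<le> (\<Sum>e\<in>?B. \<Sum>e'\<in>?B. ?I e e')"
      by (intro sum_mono sum_mono2 finite_boundary_faces) (use I0 in auto)
    also have "\<dots> \<le> ?X" by (rule half_norm_square(2))
    finally show ?thesis .
  qed
  have "(\<Sum>e\<in>?B. \<Sum>e'\<in>?S e. wt e * wt e' * (?m e - ?m e')\<^sup>2 / fdist e e' ^ ?N) \<le>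
    (\<Sum>e\<in>?B. \<Sum>e'\<in>?S e. ?t e e' + 3 / a_low\<^sup>2 * (?I e e' + a_up\<^sup>2 * (jump \<mu> e * ?W e e' + jump \<mu> e' * ?W e e')))"
    by (intro sum_mono) (use one in auto)
  also have "\<dots> = (\<Sum>e\<in>?B. \<Sum>e'\<in>?S e. ?t e e') + 3 / a_low\<^sup>2 * ((\<Sum>e\<in>?B. \<Sum>e'\<in>?S e. ?I e e') + a_up\<^sup>2 *
      ((\<Sum>e\<in>?B. \<Sum>e'\<in>?S e. jump \<mu> e * ?W e e') + (\<Sum>e\<in>?B. \<Sum>e'\<in>?S e. jump \<mu> e' * ?W e e')))"
    by (simp only: sum.distrib sum_distrib_left distrib_left)
  also have "\<dots> \<le> ?X + 3 / a_low\<^sup>2 * (?X + a_up\<^sup>2 * (C_up * 2 ^ ?N * ?X + C_up * 2 ^ ?N * ?X))"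
    by (intro add_mono mult_left_mono TT sites JJ JJ') auto
  also have "\<dots> = C_G * ?X" by (simp add: C_G_def algebra_simps)
  finally show ?thesis .
qed

text \<open>In the product rule for the face value times the normal, the normals differ by at most
  \<open>C_n * fdist e e'\<close>. This removes two powers from the kernel, and the weakly singular
  remainder sums to a constant, leaving an L2 term.\<close>

lemma discrete_vector_bound:
  "(\<Sum>e\<in>boundary_faces \<T>. \<Sum>e' | e' \<in> boundary_faces \<T> \<and> fdist e e' \<le> R0.
      wt e * wt e' * (norm (\<mu> (barycenter e) *\<^sub>R outer_normal \<T> e - \<mu> (barycenter e') *\<^sub>R outer_normal \<T> e'))\<^sup>2 / fdist e e' ^ CARD('n))
    \<le> C_V * (Lambda_half_norm h \<T> \<mu>)\<^sup>2"
proof -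
  let ?B = "boundary_faces \<T>" and ?N = "CARD('n)"
  let ?X = "(Lambda_half_norm h \<T> \<mu>)\<^sup>2"
  let ?S = "\<lambda>e. {e'. e' \<in> ?B \<and> fdist e e' \<le> R0}"
  let ?m = "\<lambda>e. \<mu> (barycenter e)" and ?n = "outer_normal \<T>"
  let ?v = "\<lambda>e. ?m e *\<^sub>R ?n e"
  have Cn: "0 < C_n" using K_pos \<kappa>_pos by (simp add: C_n_def add_pos_pos)
  have one: "wt e * wt e' * (norm (?v e - ?v e'))\<^sup>2 / fdist e e' ^ ?N \<le>
      2 * (wt e * wt e' * (?m e - ?m e')\<^sup>2 / fdist e e' ^ ?N) + 2 * C_n\<^sup>2 * (wt e * (?m e)\<^sup>2) * (wt e' / fdist e e' ^ (?N - 2))"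
    if e: "e \<in> ?B" and e': "e' \<in> ?B" "fdist e e' \<le> R0" for e e'
  proof -
    have fp: "0 < fdist e e'" by (rule fdist_bounds(3)[OF e e'(1)])
    have "dist (barycenter e) (barycenter e') < r / 8"
      using e'(2) boundary_face_diameter(1)[OF e] boundary_face_diameter(1)[OF e'(1)] r_pos unfolding fdist_def by linarith
    then have nn: "norm (?n e - ?n e') \<le> C_n * fdist e e'"
      using outer_normal_lipschitz[OF e e'(1)] by (simp add: C_n_def fdist_def)
    have "?v e - ?v e' = (?m e - ?m e') *\<^sub>R ?n e' + ?m e *\<^sub>R (?n e - ?n e')" by (simp add: algebra_simps)
    then have "norm (?v e - ?v e') \<le> \<bar>?m e - ?m e'\<bar> + \<bar>?m e\<bar> * norm (?n e - ?n e')"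
      using norm_triangle_ineq[of "(?m e - ?m e') *\<^sub>R ?n e'" "?m e *\<^sub>R (?n e - ?n e')"] norm_outer_normal[OF e'(1)] by simp
    also have "\<dots> \<le> \<bar>?m e - ?m e'\<bar> + \<bar>?m e\<bar> * (C_n * fdist e e')" using nn by (intro add_left_mono mult_left_mono) auto
    finally have "(norm (?v e - ?v e'))\<^sup>2 \<le> (\<bar>?m e - ?m e'\<bar> + \<bar>?m e\<bar> * (C_n * fdist e e'))\<^sup>2" by (intro power_mono) auto
    also have "\<dots> \<le> 2 * \<bar>?m e - ?m e'\<bar>\<^sup>2 + 2 * (\<bar>?m e\<bar> * (C_n * fdist e e'))\<^sup>2"
      using zero_le_power2[of "\<bar>?m e - ?m e'\<bar> - \<bar>?m e\<bar> * (C_n * fdist e e')"] unfolding power2_sum power2_diff by linarith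
    also have "\<dots> = 2 * (?m e - ?m e')\<^sup>2 + 2 * C_n\<^sup>2 * (?m e)\<^sup>2 * (fdist e e')\<^sup>2" by (simp add: power_mult_distrib)
    finally have "(wt e * wt e' / fdist e e' ^ ?N) * (norm (?v e - ?v e'))\<^sup>2 \<le>
       (wt e * wt e' / fdist e e' ^ ?N) * (2 * (?m e - ?m e')\<^sup>2 + 2 * C_n\<^sup>2 * (?m e)\<^sup>2 * (fdist e e')\<^sup>2)"
      using wt_pos[OF e] wt_pos[OF e'(1)] fp by (intro mult_left_mono) auto
    moreover have "fdist e e' ^ ?N = (fdist e e')\<^sup>2 * fdist e e' ^ (?N - 2)"
      unfolding power_card[of "fdist e e'"] power_card_minus_1[of "fdist e e'"] by (simp add: power2_eq_square)
    then have "(fdist e e')\<^sup>2 / fdist e e' ^ ?N = 1 / fdist e e' ^ (?N - 2)" using fp by simp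
    moreover have "(wt e * wt e' / fdist e e' ^ ?N) * (2 * C_n\<^sup>2 * (?m e)\<^sup>2 * (fdist e e')\<^sup>2) =
        2 * C_n\<^sup>2 * (wt e * (?m e)\<^sup>2) * (wt e' * ((fdist e e')\<^sup>2 / fdist e e' ^ ?N))" by (simp add: mult_ac)
    ultimately have "(wt e * wt e' / fdist e e' ^ ?N) * (norm (?v e - ?v e'))\<^sup>2 \<le>
      (wt e * wt e' / fdist e e' ^ ?N) * (2 * (?m e - ?m e')\<^sup>2) +
      2 * C_n\<^sup>2 * (wt e * (?m e)\<^sup>2) * (wt e' * (1 / fdist e e' ^ (?N - 2)))"
      unfolding distrib_left by simp
    then show ?thesis by (simp add: mult_ac)
  qed
  have "(\<Sum>e\<in>?B. \<Sum>e'\<in>?S e. wt e * wt e' * (norm (?v e - ?v e'))\<^sup>2 / fdist e e' ^ ?N) \<le>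
     (\<Sum>e\<in>?B. \<Sum>e'\<in>?S e. 2 * (wt e * wt e' * (?m e - ?m e')\<^sup>2 / fdist e e' ^ ?N) + 2 * C_n\<^sup>2 * (wt e * (?m e)\<^sup>2) * (wt e' / fdist e e' ^ (?N - 2)))"
    by (intro sum_mono) (use one in auto)
  also have "\<dots> = 2 * (\<Sum>e\<in>?B. \<Sum>e'\<in>?S e. wt e * wt e' * (?m e - ?m e')\<^sup>2 / fdist e e' ^ ?N) +
     2 * C_n\<^sup>2 * (\<Sum>e\<in>?B. (wt e * (?m e)\<^sup>2) * (\<Sum>e'\<in>?S e. wt e' / fdist e e' ^ (?N - 2)))"
    by (simp only: sum.distrib sum_distrib_left mult.assoc)
  also have "\<dots> \<le> 2 * (C_G * ?X) + 2 * C_n\<^sup>2 * (\<Sum>e\<in>?B. (wt e * (?m e)\<^sup>2) * (C_up * 2 ^ ?N * R0))"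
    using wt_pos by (intro add_mono mult_left_mono discrete_Gagliardo_bound sum_mono wt_lower_tail) (auto intro!: mult_nonneg_nonneg intro: less_imp_le)
  also have "\<dots> = 2 * (C_G * ?X) + 2 * C_n\<^sup>2 * (C_up * 2 ^ ?N * R0) * (\<Sum>e\<in>?B. wt e * (?m e)\<^sup>2)"
    by (simp add: sum_distrib_left algebra_simps)
  also have "\<dots> \<le> 2 * (C_G * ?X) + 2 * C_n\<^sup>2 * (C_up * 2 ^ ?N * R0) * (C_L2 * ?X)"
    using C_up_pos r_pos by (intro add_left_mono mult_left_mono discrete_L2_bound) auto
  also have "\<dots> = C_V * ?X" by (simp add: C_V_def algebra_simps)
  finally show ?thesis .
qed

end


section \<open>A discrete Whitney extension\<close>

lemma sum_square_le_weighted: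
  fixes w f :: "'i \<Rightarrow> real"
  assumes "\<And>i. i \<in> A \<Longrightarrow> 0 \<le> w i"
  shows "(\<Sum>i\<in>A. w i * f i)\<^sup>2 \<le> (\<Sum>i\<in>A. w i) * (\<Sum>i\<in>A. w i * (f i)\<^sup>2)"
proof -
  have "(\<Sum>i\<in>A. w i * f i)\<^sup>2 = (\<Sum>i\<in>A. sqrt (w i) * (sqrt (w i) * f i))\<^sup>2"
    by (rule arg_cong[where f = "\<lambda>x. x\<^sup>2"], rule sum.cong) (use assms in \<open>auto simp flip: mult.assoc\<close>)
  also have "\<dots> \<le> (\<Sum>i\<in>A. (sqrt (w i))\<^sup>2) * (\<Sum>i\<in>A. (sqrt (w i) * f i)\<^sup>2)" by (rule Cauchy_Schwarz_ineq_sum)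
  also have "\<dots> = (\<Sum>i\<in>A. w i) * (\<Sum>i\<in>A. w i * (f i)\<^sup>2)"
    using assms by (simp add: power_mult_distrib)
  finally show ?thesis .
qed

context boundary_fitted_mesh
begin

text \<open>The tents of the extension reach 24 scales. Passing to a point at most
  \<open>1 / \<kappa>^2\<close> scales away enlarges this to no more than
  \<open>25 * (1 + 1 / \<kappa>^2)\<close> scales.\<close>

definition aspect :: real where "aspect = 25 * (1 + 1 / \<kappa>\<^sup>2)"
text \<open>With this cut-off two faces active at a common point are at most \<open>R0\<close>
  apart, the range in which the growth bounds hold.\<close>

definition r2 :: real where "r2 = R0 / (2 * aspect)"

lemma aspect_ge: "25 \<le> aspect" "1 / \<kappa>\<^sup>2 \<le> aspect" "0 < aspect"
proof -
  have "25 \<le> 25 * (1 + x) \<and> x \<le> 25 * (1 + x) \<and> 0 < 25 * (1 + x)" if "0 \<le> x" for x :: real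
    using that by simp
  from this[of "1 / \<kappa>\<^sup>2"] show "25 \<le> aspect" "1 / \<kappa>\<^sup>2 \<le> aspect" "0 < aspect" unfolding aspect_def by simp_all
qed

lemma r2_bounds: "0 < r2" "2 * aspect * r2 = R0" "r2 \<le> R0" "h \<le> r2" "r2 \<le> 1"
proof -
  show p: "0 < r2" using r_pos aspect_ge by (simp add: r2_def)
  show eq: "2 * aspect * r2 = R0" using aspect_ge by (simp add: r2_def)
  have "1 * r2 \<le> (2 * aspect) * r2" using p aspect_ge by (intro mult_right_mono) auto
  then show R: "r2 \<le> R0" using eq by simp
  have "2 * (25 * x) * h \<le> r / 200" if "10000 * x * h \<le> r" for x using that by simp
  from this[OF h_tiny] have "2 * aspect * h \<le> R0" unfolding aspect_def .
  then show "h \<le> r2" using aspect_ge unfolding r2_def by (simp add: field_simps)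
  show "r2 \<le> 1" using R r_le_1 r_pos by simp
qed

text \<open>The index \<open>None\<close> stands for a fictitious far face carrying the value 0; it cuts the extension
  off at distance \<open>r2\<close> from the boundary.\<close>

definition sites :: "(real^'n) set option set" where "sites = insert None (Some ` boundary_faces \<T>)"

definition sdist :: "real^'n \<Rightarrow> (real^'n) set option \<Rightarrow> real" where
  "sdist X i = (case i of None \<Rightarrow> r2 | Some e \<Rightarrow> dist X (barycenter e) + diameter e)"

definition mass :: "(real^'n) set option \<Rightarrow> real" where
  "mass i = (case i of None \<Rightarrow> r2 ^ (CARD('n) - 1) | Some e \<Rightarrow> wt e)"

text \<open>A Lipschitz substitute for the distance to the boundary that also sees the local face
  size and is capped at \<open>r2\<close>; it plays the role of the side length of a Whitney
  cube.\<close>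

definition scale :: "real^'n \<Rightarrow> real" where "scale X = Min (sdist X ` sites)"

text \<open>Lipschitz tents in place of a smooth partition of unity. The reach 24 leaves ample room
  for the faces of the lower area bound, which lie within 11 scales of \<open>X\<close>.\<close>

definition bump :: "real^'n \<Rightarrow> (real^'n) set option \<Rightarrow> real" where
  "bump X i = mass i * max 0 (24 * scale X - sdist X i)"

definition bump_sum :: "real^'n \<Rightarrow> real" where "bump_sum X = (\<Sum>i\<in>sites. bump X i)"

definition active :: "real^'n \<Rightarrow> (real^'n) set option set" where "active X = {i \<in> sites. sdist X i \<le> aspect * scale X}"

definition ext :: "((real^'n) set option \<Rightarrow> real^'n) \<Rightarrow> real^'n \<Rightarrow> real^'n" where
  "ext g X = (1 / bump_sum X) *\<^sub>R (\<Sum>i\<in>sites. bump X i *\<^sub>R g i)"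

definition c_W :: real where "c_W = min 1 c_low"
definition C_A :: real where "C_A = (C_up + 1) * (2 * aspect) ^ (CARD('n) - 1)"

lemma finite_sites: "finite sites" using finite_boundary_faces by (simp add: sites_def)

lemma sites_cases: "i \<in> sites \<Longrightarrow> i = None \<or> (\<exists>e\<in>boundary_faces \<T>. i = Some e)" by (auto simp: sites_def)

lemma mass_pos: "i \<in> sites \<Longrightarrow> 0 < mass i"
  using sites_cases[of i] wt_pos r2_bounds(1) by (auto simp: mass_def)

lemma sdist_pos: "i \<in> sites \<Longrightarrow> 0 < sdist X i"
  using sites_cases[of i] boundary_face_diameter(1) r2_bounds(1) by (auto simp: sdist_def add_nonneg_pos)

lemma sdist_lipschitz: "sdist X i \<le> sdist Y i + dist X Y"
proof (cases i)
  case (Some e)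
  then show ?thesis using dist_triangle[of X "barycenter e" Y] by (simp add: sdist_def)
qed (simp add: sdist_def)

lemma scale_le: "i \<in> sites \<Longrightarrow> scale X \<le> sdist X i" using finite_sites by (simp add: scale_def)

lemma scale_attained: "\<exists>i\<in>sites. scale X = sdist X i"
proof -
  have "Min (sdist X ` sites) \<in> sdist X ` sites" using finite_sites by (intro Min_in) (auto simp: sites_def)
  then show ?thesis by (auto simp: scale_def)
qed

lemma scale_pos: "0 < scale X" using scale_attained[of X] sdist_pos by auto

lemma scale_le_r2: "scale X \<le> r2" using scale_le[of None X] by (simp add: sites_def sdist_def)

lemma scale_lipschitz: "scale X \<le> scale Y + dist X Y"
proof -
  obtain i where "i \<in> sites" "scale Y = sdist Y i" using scale_attained by blast
  then show ?thesis using scale_le[of i X] sdist_lipschitz[of X i Y] by simp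
qed

lemma bump_nonneg: "i \<in> sites \<Longrightarrow> 0 \<le> bump X i"
  using mass_pos by (simp add: bump_def less_imp_le)

lemma bump_le: "i \<in> sites \<Longrightarrow> bump X i \<le> mass i * (24 * scale X)"
  unfolding bump_def using mass_pos[of i] sdist_pos[of i X] scale_pos[of X] by (intro mult_left_mono) auto

lemma bump_support: "bump X i \<noteq> 0 \<Longrightarrow> i \<in> sites \<Longrightarrow> i \<in> active X"
proof -
  assume "bump X i \<noteq> 0" "i \<in> sites"
  then have "sdist X i < 24 * scale X" by (auto simp: bump_def max_def split: if_splits)
  also have "\<dots> \<le> aspect * scale X" using aspect_ge scale_pos[of X] by (intro mult_right_mono) auto
  finally show ?thesis using \<open>i \<in> sites\<close> by (simp add: active_def)
qed

text \<open>The site attaining the scale is either the far one, whose own tent suffices, or a face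
  \<open>e\<close>. In the second case the faces counted by \<open>boundary_face_measure_ge\<close>
  with radius \<open>scale X\<close> are within 11 scales of \<open>X\<close>, and their tents are
  at least as high as the scale.\<close>

lemma bump_sum_ge: "c_W * scale X ^ CARD('n) \<le> bump_sum X"
proof -
  obtain i where i: "i \<in> sites" "scale X = sdist X i" using scale_attained by blast
  have D: "0 < scale X" by (rule scale_pos)
  show ?thesis
  proof (cases i)
    case None
    then have Dr: "scale X = r2" using i by (simp add: sdist_def)
    have "bump X None \<le> bump_sum X" unfolding bump_sum_def
      by (rule member_le_sum) (use bump_nonneg finite_sites in \<open>auto simp: sites_def\<close>)
    moreover have "bump X None = 23 * (r2 * r2 ^ (CARD('n) - 1))" using r2_bounds(1) by (simp add: bump_def mass_def sdist_def Dr)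
    moreover have "r2 * r2 ^ (CARD('n) - 1) = scale X ^ CARD('n)" by (simp add: Dr power_card[of r2])
    moreover have "c_W * scale X ^ CARD('n) \<le> 1 * scale X ^ CARD('n)" using D by (intro mult_right_mono) (auto simp: c_W_def)
    moreover have "0 \<le> scale X ^ CARD('n)" using D by simp
    ultimately show ?thesis by linarith
  next
    case (Some e)
    then have e: "e \<in> boundary_faces \<T>" and De: "scale X = dist X (barycenter e) + diameter e"
      using i by (auto simp: sites_def sdist_def)
    let ?S = "{e'. e' \<in> boundary_faces \<T> \<and> dist (barycenter e) (barycenter e') + diameter e' \<le> 10 * scale X}"
    have "c_low * scale X ^ (CARD('n) - 1) \<le> (\<Sum>e'\<in>?S. wt e')"
      unfolding wt_def using scale_le_r2[of X] r2_bounds(3)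
      by (intro boundary_face_measure_ge[OF e]) (auto simp: De)
    then have "scale X * (c_low * scale X ^ (CARD('n) - 1)) \<le> scale X * (\<Sum>e'\<in>?S. wt e')" using D by simp
    also have "\<dots> \<le> (\<Sum>e'\<in>?S. bump X (Some e'))"
      unfolding sum_distrib_left
    proof (rule sum_mono)
      fix e' assume e': "e' \<in> ?S"
      have "sdist X (Some e') \<le> 11 * scale X"
        using e' dist_triangle[of X "barycenter e'" "barycenter e"] boundary_face_diameter(1)[OF e] by (simp add: sdist_def De)
      then have "scale X \<le> max 0 (24 * scale X - sdist X (Some e'))" using D by simp
      then show "scale X * wt e' \<le> bump X (Some e')"
        using wt_pos[of e'] e' by (simp add: bump_def mass_def mult.commute)
    qed
    also have "\<dots> = (\<Sum>i\<in>Some ` ?S. bump X i)" by (simp add: sum.reindex)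
    also have "\<dots> \<le> bump_sum X" unfolding bump_sum_def
      by (intro sum_mono2 finite_sites) (use bump_nonneg in \<open>auto simp: sites_def\<close>)
    finally have "c_low * scale X ^ CARD('n) \<le> bump_sum X" unfolding power_card[of "scale X"] by (simp add: mult.left_commute)
    moreover have "c_W * scale X ^ CARD('n) \<le> c_low * scale X ^ CARD('n)" using D by (intro mult_right_mono) (auto simp: c_W_def)
    ultimately show ?thesis by linarith
  qed
qed

lemma c_W_pos: "0 < c_W"
proof -
  have "0 < \<Lambda>1" using \<kappa>_pos by (simp add: \<Lambda>1_def \<Lambda>0_def)
  then show ?thesis by (simp add: c_W_def c_low_def)
qed

lemma bump_sum_pos: "0 < bump_sum X"
proof -
  have "0 < c_W * scale X ^ CARD('n)" using c_W_pos scale_pos[of X] by simp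
  then show ?thesis using bump_sum_ge[of X] by linarith
qed

lemma finite_active: "finite (active X)" using finite_sites by (simp add: active_def)

lemma active_subset: "active X \<subseteq> sites" by (auto simp: active_def)

lemma fdist_le_active:
  assumes "Some e \<in> active X" "Some e' \<in> active X" shows "fdist e e' \<le> 2 * aspect * scale X"
  using assms dist_triangle[of "barycenter e" "barycenter e'" X] by (simp add: active_def sdist_def fdist_def dist_commute)

text \<open>All active faces are within \<open>2 * aspect * scale X\<close> of any one of them, a
  radius of at most \<open>R0\<close>, so the area growth applies. The far site is active only where
  the scale is comparable to \<open>r2\<close>, and then its mass has the same order.\<close>

lemma active_weight: "(\<Sum>i\<in>active X. mass i) \<le> C_A * scale X ^ (CARD('n) - 1)"
proof -
  let ?M = "CARD('n) - 1"
  have D: "0 < scale X" by (rule scale_pos)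
  have k: "0 < aspect" by (rule aspect_ge)
  let ?S = "{e. Some e \<in> active X}"
  have S: "?S \<subseteq> boundary_faces \<T>" by (auto simp: active_def sites_def)
  have some: "(\<Sum>e\<in>?S. wt e) \<le> C_up * (2 * aspect * scale X) ^ ?M"
  proof (cases "?S = {}")
    case True
    then show ?thesis unfolding True using C_up_pos D k by simp
  next
    case False
    then obtain e where e: "e \<in> ?S" by blast
    have R: "0 < 2 * aspect * scale X" "2 * aspect * scale X \<le> R0"
      using D k mult_left_mono[OF scale_le_r2[of X], of "2 * aspect"] r2_bounds(2) by auto
    have "(\<Sum>e\<in>?S. wt e) \<le> (\<Sum>e' | e' \<in> boundary_faces \<T> \<and> fdist e e' \<le> 2 * aspect * scale X. wt e')"
    proof (rule sum_mono2)
      show "?S \<subseteq> {e'. e' \<in> boundary_faces \<T> \<and> fdist e e' \<le> 2 * aspect * scale X}" using S e fdist_le_active by blast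
    qed (use finite_boundary_faces wt_pos in \<open>auto intro: less_imp_le\<close>)
    also have "\<dots> \<le> C_up * (2 * aspect * scale X) ^ ?M" using e S R by (intro wt_growth) auto
    finally show ?thesis .
  qed
  have sub: "active X \<subseteq> {i. i = None \<and> None \<in> active X} \<union> Some ` ?S"
  proof
    fix i assume i: "i \<in> active X"
    show "i \<in> {i. i = None \<and> None \<in> active X} \<union> Some ` ?S" using i by (cases i) auto
  qed
  have finS: "finite ?S" using S finite_boundary_faces finite_subset by blast
  have fin: "finite ({i. i = None \<and> None \<in> active X} \<union> Some ` ?S)" using finS by (auto intro: finite_subset[of _ "{None}"])
  have none: "(\<Sum>i\<in>{i. i = None \<and> None \<in> active X}. mass i) \<le> (2 * aspect * scale X) ^ ?M"
  proof (cases "None \<in> active X")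
    case True
    then have "r2 \<le> aspect * scale X" by (simp add: active_def sdist_def)
    also have "\<dots> \<le> 2 * aspect * scale X" using D k by simp
    finally have "r2 \<le> 2 * aspect * scale X" .
    then have "r2 ^ ?M \<le> (2 * aspect * scale X) ^ ?M" using r2_bounds(1) by (intro power_mono) auto
    have "{i. i = None \<and> None \<in> active X} = {None}" using True by auto
    then have "(\<Sum>i\<in>{i. i = None \<and> None \<in> active X}. mass i) = (\<Sum>i\<in>{None}. mass i)" by (rule arg_cong)
    then have "(\<Sum>i\<in>{i. i = None \<and> None \<in> active X}. mass i) = r2 ^ ?M" by (simp add: mass_def)
    then show ?thesis using \<open>r2 ^ ?M \<le> (2 * aspect * scale X) ^ ?M\<close> by simp
  next
    case False
    then show ?thesis using D k by simp
  qed
  have "(\<Sum>i\<in>active X. mass i) \<le> (\<Sum>i\<in>{i. i = None \<and> None \<in> active X} \<union> Some ` ?S. mass i)"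
  proof (rule sum_mono2[OF fin sub])
    fix i assume "i \<in> {i. i = None \<and> None \<in> active X} \<union> Some ` ?S - active X"
    then show "0 \<le> mass i" using active_subset mass_pos by (auto intro: less_imp_le)
  qed
  also have "\<dots> = (\<Sum>i\<in>{i. i = None \<and> None \<in> active X}. mass i) + (\<Sum>i\<in>Some ` ?S. mass i)"
    using fin by (intro sum.union_disjoint) auto
  also have "(\<Sum>i\<in>Some ` ?S. mass i) = (\<Sum>e\<in>?S. wt e)" by (simp add: sum.reindex mass_def)
  finally have "(\<Sum>i\<in>active X. mass i) \<le> (C_up + 1) * (2 * aspect * scale X) ^ ?M" using some none by (simp add: distrib_right)
  then show ?thesis by (simp add: C_A_def power_mult_distrib mult.assoc)
qed

text \<open>The extension is a weighted average, so its deviation from \<open>u\<close> is the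
  average of the deviations of the site values; each tent is at most 24 scales high.\<close>

lemma ext_deviation:
  shows "norm (u - ext g X) \<le> (24 * scale X / bump_sum X) * (\<Sum>j\<in>active X. mass j * norm (u - g j))"
proof -
  have W: "0 < bump_sum X" by (rule bump_sum_pos)
  have "u - ext g X = (1 / bump_sum X) *\<^sub>R (\<Sum>j\<in>sites. bump X j *\<^sub>R (u - g j))"
  proof -
    have "(\<Sum>j\<in>sites. bump X j *\<^sub>R (u - g j)) = bump_sum X *\<^sub>R u - (\<Sum>j\<in>sites. bump X j *\<^sub>R g j)"
      by (simp add: scaleR_diff_right sum_subtractf bump_sum_def flip: scaleR_sum_left)
    then show ?thesis using W by (simp add: ext_def scaleR_diff_right)
  qed
  also have "(\<Sum>j\<in>sites. bump X j *\<^sub>R (u - g j)) = (\<Sum>j\<in>active X. bump X j *\<^sub>R (u - g j))"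
    by (rule sum.mono_neutral_right[OF finite_sites active_subset]) (use bump_support in auto)
  finally have "norm (u - ext g X) = (1 / bump_sum X) * norm (\<Sum>j\<in>active X. bump X j *\<^sub>R (u - g j))" using W by simp
  also have "\<dots> \<le> (1 / bump_sum X) * (\<Sum>j\<in>active X. (mass j * (24 * scale X)) * norm (u - g j))"
  proof (intro mult_left_mono order_trans[OF norm_sum] sum_mono)
    fix j assume "j \<in> active X"
    then have j: "j \<in> sites" using active_subset by blast
    show "norm (bump X j *\<^sub>R (u - g j)) \<le> (mass j * (24 * scale X)) * norm (u - g j)"
      using bump_nonneg[OF j] bump_le[OF j] by (simp add: mult_right_mono)
  qed (use W in simp)
  also have "(\<Sum>j\<in>active X. (mass j * (24 * scale X)) * norm (u - g j)) = 24 * scale X * (\<Sum>j\<in>active X. mass j * norm (u - g j))"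
    by (simp add: sum_distrib_left mult_ac)
  also have "(1 / bump_sum X) * \<dots> = (24 * scale X / bump_sum X) * (\<Sum>j\<in>active X. mass j * norm (u - g j))" by simp
  finally show ?thesis .
qed

text \<open>The local oscillation of the boundary values: an unnormalised variance over the active
  sites.\<close>

definition spread :: "((real^'n) set option \<Rightarrow> real^'n) \<Rightarrow> real^'n \<Rightarrow> real" where
  "spread g X = (\<Sum>i\<in>active X. \<Sum>j\<in>active X. mass i * mass j * (norm (g i - g j))\<^sup>2)"

lemma S1_square:
  "(\<Sum>i\<in>active X. mass i * (\<Sum>j\<in>active X. mass j * norm (g i - g j)))\<^sup>2 \<le> (C_A * scale X ^ (CARD('n) - 1))\<^sup>2 * spread g X"
proof -
  let ?A = "\<Sum>i\<in>active X. mass i"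
  have w0: "0 \<le> mass i" if "i \<in> active X" for i using that active_subset mass_pos by (meson less_imp_le subsetD)
  have A0: "0 \<le> ?A" using w0 by (intro sum_nonneg) auto
  have S0: "0 \<le> spread g X" unfolding spread_def using w0 by (intro sum_nonneg mult_nonneg_nonneg) auto
  have "(\<Sum>i\<in>active X. mass i * (\<Sum>j\<in>active X. mass j * norm (g i - g j)))\<^sup>2 \<le>
      ?A * (\<Sum>i\<in>active X. mass i * (\<Sum>j\<in>active X. mass j * norm (g i - g j))\<^sup>2)"
    by (rule sum_square_le_weighted) (rule w0)
  also have "\<dots> \<le> ?A * (\<Sum>i\<in>active X. mass i * (?A * (\<Sum>j\<in>active X. mass j * (norm (g i - g j))\<^sup>2)))"
    using w0 A0 by (intro mult_left_mono sum_mono sum_square_le_weighted) auto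
  also have "\<dots> = ?A\<^sup>2 * spread g X"
  proof -
    have "(\<Sum>i\<in>active X. mass i * (a * (\<Sum>j\<in>active X. mass j * f i j))) = a * (\<Sum>i\<in>active X. \<Sum>j\<in>active X. mass i * mass j * f i j)"
      for a :: real and f by (simp add: sum_distrib_left mult_ac)
    from this[of ?A "\<lambda>i j. (norm (g i - g j))\<^sup>2"] show ?thesis
      unfolding spread_def power2_eq_square[of ?A] by (simp only: mult.assoc)
  qed
  also have "\<dots> \<le> (C_A * scale X ^ (CARD('n) - 1))\<^sup>2 * spread g X"
    using A0 S0 by (intro mult_right_mono power_mono active_weight) auto
  finally show ?thesis .
qed

definition C_ext :: real where "C_ext = (600 * (1 + 1 / \<kappa>\<^sup>2) ^ CARD('n) * C_A / c_W\<^sup>2)\<^sup>2"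

text \<open>Weighted averages respect constants. With \<open>ext g X\<close> subtracted from all
  site values the average at \<open>X\<close> vanishes, and only differences of tents between
  \<open>X\<close> and \<open>Y\<close> remain. These are Lipschitz with constant 25 times the mass,
  24 from the scale and 1 from the site distance.\<close>

lemma ext_difference:
  assumes XY: "dist X Y \<le> (1 / \<kappa>\<^sup>2) * scale X" "dist X Y \<le> (1 / \<kappa>\<^sup>2) * scale Y"
  shows "(norm (ext g Y - ext g X))\<^sup>2 \<le> C_ext * (dist X Y)\<^sup>2 / scale X ^ (2 * CARD('n)) * spread g X"
proof -
  let ?l = "1 / \<kappa>\<^sup>2" and ?N = "CARD('n)"
  let ?S1 = "\<Sum>i\<in>active X. mass i * (\<Sum>j\<in>active X. mass j * norm (g i - g j))"
  have l: "0 \<le> ?l" by simp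
  have W: "0 < bump_sum X" "0 < bump_sum Y" and D: "0 < scale X" "0 < scale Y" using bump_sum_pos scale_pos by auto
  have w0: "0 \<le> mass i" if "i \<in> sites" for i using that mass_pos by (meson less_imp_le)
  have XlY: "scale X \<le> (1 + ?l) * scale Y" using scale_lipschitz[of X Y] XY(2) by (simp add: distrib_right)
  have YlX: "scale Y \<le> (1 + ?l) * scale X" using scale_lipschitz[of Y X] XY(1) by (simp add: distrib_right dist_commute)
  have diff: "\<bar>bump Y i - bump X i\<bar> \<le> mass i * (25 * dist X Y)" if i: "i \<in> sites" for i
  proof -
    have "\<bar>max 0 (24 * scale Y - sdist Y i) - max 0 (24 * scale X - sdist X i)\<bar> \<le> \<bar>(24 * scale Y - sdist Y i) - (24 * scale X - sdist X i)\<bar>"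
      by linarith
    also have "\<dots> \<le> 25 * dist X Y"
      using scale_lipschitz[of X Y] scale_lipschitz[of Y X] sdist_lipschitz[of X i Y] sdist_lipschitz[of Y i X]
      unfolding dist_commute[of Y X] by linarith
    finally have "mass i * \<bar>max 0 (24 * scale Y - sdist Y i) - max 0 (24 * scale X - sdist X i)\<bar> \<le> mass i * (25 * dist X Y)"
      using w0[OF i] by (intro mult_left_mono)
    then show ?thesis using w0[OF i] unfolding bump_def right_diff_distrib[symmetric] by (simp add: abs_mult)
  qed
  \<comment> \<open>Every site whose tent changes is active at \<open>X\<close>; this requirement
    determines the size of \<open>aspect\<close>.\<close>
  have supp: "i \<in> active X" if i: "i \<in> sites" and ne: "bump Y i \<noteq> bump X i" for i
  proof (cases "bump X i = 0")
    case False
    then show ?thesis using bump_support i by blast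
  next
    case True
    then have "bump Y i \<noteq> 0" using ne by simp
    then have "sdist Y i < 24 * scale Y" by (auto simp: bump_def max_def split: if_splits)
    also have "\<dots> \<le> 24 * ((1 + ?l) * scale X)" using YlX by simp
    finally have "sdist X i \<le> 24 * ((1 + ?l) * scale X) + ?l * scale X"
      using sdist_lipschitz[of X i Y] XY(1) by linarith
    also have "\<dots> \<le> 25 * (1 + ?l) * scale X"
    proof -
      have "24 * ((1 + a) * x) + a * x \<le> 25 * (1 + a) * x" if "0 \<le> x" for a x :: real
        using that by (simp add: algebra_simps)
      from this[of "scale X" ?l] show ?thesis using D by simp
    qed
    finally show ?thesis using i by (simp add: active_def aspect_def)
  qed
  have "(\<Sum>i\<in>sites. bump X i *\<^sub>R (g i - ext g X)) = 0"
  proof -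
    have "(\<Sum>i\<in>sites. bump X i *\<^sub>R (g i - ext g X)) = (\<Sum>i\<in>sites. bump X i *\<^sub>R g i) - bump_sum X *\<^sub>R ext g X"
      by (simp add: scaleR_diff_right sum_subtractf bump_sum_def scaleR_sum_left)
    then show ?thesis using W by (simp add: ext_def)
  qed
  moreover have "ext g Y - ext g X = (1 / bump_sum Y) *\<^sub>R (\<Sum>i\<in>sites. bump Y i *\<^sub>R (g i - ext g X))"
  proof -
    have "(\<Sum>i\<in>sites. bump Y i *\<^sub>R (g i - ext g X)) = (\<Sum>i\<in>sites. bump Y i *\<^sub>R g i) - bump_sum Y *\<^sub>R ext g X"
      by (simp add: scaleR_diff_right sum_subtractf bump_sum_def scaleR_sum_left)
    then show ?thesis using W by (simp add: ext_def scaleR_diff_right)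
  qed
  ultimately have "ext g Y - ext g X = (1 / bump_sum Y) *\<^sub>R (\<Sum>i\<in>sites. (bump Y i - bump X i) *\<^sub>R (g i - ext g X))"
    by (simp add: scaleR_diff_left sum_subtractf)
  also have "(\<Sum>i\<in>sites. (bump Y i - bump X i) *\<^sub>R (g i - ext g X)) = (\<Sum>i\<in>active X. (bump Y i - bump X i) *\<^sub>R (g i - ext g X))"
    by (rule sum.mono_neutral_right[OF finite_sites active_subset]) (use supp in auto)
  finally have "norm (ext g Y - ext g X) = (1 / bump_sum Y) * norm (\<Sum>i\<in>active X. (bump Y i - bump X i) *\<^sub>R (g i - ext g X))" using W by simp
  also have "\<dots> \<le> (1 / bump_sum Y) * (\<Sum>i\<in>active X. (mass i * (25 * dist X Y)) * ((24 * scale X / bump_sum X) * (\<Sum>j\<in>active X. mass j * norm (g i - g j))))"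
  proof (intro mult_left_mono order_trans[OF norm_sum] sum_mono)
    fix i assume "i \<in> active X"
    then have i: "i \<in> sites" using active_subset by blast
    show "norm ((bump Y i - bump X i) *\<^sub>R (g i - ext g X)) \<le>
      (mass i * (25 * dist X Y)) * ((24 * scale X / bump_sum X) * (\<Sum>j\<in>active X. mass j * norm (g i - g j)))"
      unfolding norm_scaleR using diff[OF i] ext_deviation[of "g i" g X] w0[OF i] by (intro mult_mono) auto
  qed (use W in simp)
  also have "(\<Sum>i\<in>active X. (mass i * (25 * dist X Y)) * ((24 * scale X / bump_sum X) * (\<Sum>j\<in>active X. mass j * norm (g i - g j)))) =
      25 * dist X Y * (24 * scale X / bump_sum X) * ?S1"
  proof -
    have "(\<Sum>i\<in>active X. (mass i * a) * (b * f i)) = a * b * (\<Sum>i\<in>active X. mass i * f i)" for a b :: real and f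
      by (simp add: sum_distrib_left mult_ac)
    then show ?thesis .
  qed
  also have "(1 / bump_sum Y) * \<dots> = (600 * dist X Y * scale X / (bump_sum X * bump_sum Y)) * ?S1" by (simp add: mult_ac)
  finally have main: "norm (ext g Y - ext g X) \<le> (600 * dist X Y * scale X / (bump_sum X * bump_sum Y)) * ?S1" .
  have S10: "0 \<le> ?S1" using w0 active_subset by (intro sum_nonneg mult_nonneg_nonneg) auto
  \<comment> \<open>The scales at \<open>X\<close> and \<open>Y\<close> are comparable, so the
    denominator can be expressed by \<open>scale X\<close> alone.\<close>
  have Wprod: "c_W\<^sup>2 * scale X ^ (2 * ?N) / (1 + ?l) ^ ?N \<le> bump_sum X * bump_sum Y"
  proof -
    have "scale X / (1 + ?l) \<le> scale Y" using XlY l by (simp add: divide_le_eq mult.commute add_pos_nonneg)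
    then have "(scale X / (1 + ?l)) ^ ?N \<le> scale Y ^ ?N" using D l by (intro power_mono) auto
    then have "c_W * (scale X / (1 + ?l)) ^ ?N \<le> bump_sum Y"
      using bump_sum_ge[of Y] c_W_pos by (meson mult_left_mono less_imp_le order_trans)
    then have "(c_W * scale X ^ ?N) * (c_W * (scale X / (1 + ?l)) ^ ?N) \<le> bump_sum X * bump_sum Y"
      using bump_sum_ge[of X] c_W_pos D l W by (intro mult_mono) auto
    moreover have "(c_W * scale X ^ ?N) * (c_W * (scale X / (1 + ?l)) ^ ?N) = c_W\<^sup>2 * scale X ^ (2 * ?N) / (1 + ?l) ^ ?N"
      by (simp add: power2_eq_square power_divide mult_2 power_add)
    ultimately show ?thesis by simp
  qed
  have Lp: "0 < (1 + ?l) ^ ?N" using l by (intro zero_less_power) linarith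
  have bp: "0 < c_W\<^sup>2 * scale X ^ (2 * ?N) / (1 + ?l) ^ ?N" using c_W_pos D Lp by simp
  let ?q = "600 * dist X Y * scale X / (c_W\<^sup>2 * scale X ^ (2 * ?N) / (1 + ?l) ^ ?N)"
  have "600 * dist X Y * scale X / (bump_sum X * bump_sum Y) \<le> ?q"
    by (rule frac_le[OF _ order_refl bp Wprod]) (use D in simp)
  then have "norm (ext g Y - ext g X) \<le> ?q * ?S1" using main S10 by (meson mult_right_mono order_trans)
  then have "(norm (ext g Y - ext g X))\<^sup>2 \<le> (?q * ?S1)\<^sup>2" by (intro power_mono) auto
  also have "\<dots> \<le> ?q\<^sup>2 * ((C_A * scale X ^ (?N - 1))\<^sup>2 * spread g X)"
    unfolding power_mult_distrib[of ?q] by (intro mult_left_mono S1_square) simp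
  also have "\<dots> = C_ext * (dist X Y)\<^sup>2 / scale X ^ (2 * ?N) * spread g X"
  proof -
    have "?q * (C_A * scale X ^ (?N - 1)) = (600 * (1 + ?l) ^ ?N * C_A / c_W\<^sup>2) * dist X Y / scale X ^ ?N"
    proof -
      have p: "scale X ^ (2 * ?N) = scale X ^ ?N * (scale X * scale X ^ (?N - 1))"
        unfolding power_card[of "scale X", symmetric] by (simp add: mult_2 power_add)
      show ?thesis unfolding p using D Lp c_W_pos by (simp add: field_simps)
    qed
    then have "?q\<^sup>2 * (C_A * scale X ^ (?N - 1))\<^sup>2 = C_ext * (dist X Y)\<^sup>2 / (scale X ^ ?N)\<^sup>2"
      unfolding power_mult_distrib[symmetric] C_ext_def by (simp only: power_mult_distrib power_divide)
    moreover have "(scale X ^ ?N)\<^sup>2 = scale X ^ (2 * ?N)" by (simp add: power_mult[symmetric] mult.commute)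
    ultimately show ?thesis by (simp only: mult.assoc[symmetric])
  qed
  finally show ?thesis .
qed

end


section \<open>Energy of the facet values\<close>

context boundary_fitted_mesh
begin

definition center :: "(real^'n) set \<Rightarrow> real^'n" where "center T = (SOME x. cball x (\<kappa> * diameter T) \<subseteq> T)"

lemma center:
  assumes "T \<in> \<T>"
  shows "cball (center T) (\<kappa> * diameter T) \<subseteq> T" "ball (center T) (\<kappa> * diameter T) \<subseteq> interior T" "center T \<in> T"
proof -
  show c: "cball (center T) (\<kappa> * diameter T) \<subseteq> T" unfolding center_def by (rule someI_ex[OF inball[OF assms]])
  then show "ball (center T) (\<kappa> * diameter T) \<subseteq> interior T"
    using ball_subset_cball by (intro interior_maximal) (blast, simp)
  show "center T \<in> T" using c \<kappa>_pos diameter_simplex_pos[OF assms] by (auto simp: subset_iff)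
qed

lemma diameter_le_1: "T \<in> \<T> \<Longrightarrow> diameter T \<le> 1"
  using diameter_le[of T] h_small(1) r_le_1 diameter_simplex_pos[of T] by linarith

text \<open>The open ball inside \<open>T\<close> contains no boundary point, so barycenters of
  boundary faces keep the distance \<open>\<kappa> * diameter T\<close> from the centre. For the far
  site the bound comes from \<open>h \<le> r2\<close>.\<close>

lemma scale_center: assumes T: "T \<in> \<T>" shows "\<kappa> * diameter T \<le> scale (center T)"
proof -
  obtain i where i: "i \<in> sites" "scale (center T) = sdist (center T) i" using scale_attained by blast
  have d: "0 < diameter T" by (rule diameter_simplex_pos[OF T])
  show ?thesis
  proof (cases i)
    case None
    have "\<kappa> * diameter T \<le> 1 * diameter T" using \<kappa>_le_half[OF T] \<kappa>_pos d by (intro mult_right_mono) auto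
    then show ?thesis using None i(2) diameter_le[OF T] r2_bounds(4) by (simp add: sdist_def)
  next
    case (Some e)
    then have e: "e \<in> boundary_faces \<T>" using i(1) by (auto simp: sites_def)
    have "barycenter e \<notin> mesh_domain \<T>"
      using boundary_face_compact_convex(5,6)[OF e] unfolding mesh_boundary_eq by blast
    then have "barycenter e \<notin> ball (center T) (\<kappa> * diameter T)"
      using center(2)[OF T] interior_subset_mesh_domain[OF T] by blast
    then show ?thesis using Some i(2) boundary_face_diameter(1)[OF e] by (simp add: sdist_def)
  qed
qed

definition site_val :: "((real^'n) set \<Rightarrow> real^'n) \<Rightarrow> (real^'n) set option \<Rightarrow> real^'n" where
  "site_val v i = (case i of None \<Rightarrow> 0 | Some e \<Rightarrow> v e)"

definition facet_elem :: "(real^'n) set \<Rightarrow> (real^'n) set" where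
  "facet_elem f = (SOME T. T \<in> \<T> \<and> f facet_of T)"

text \<open>For an interior facet one adjacent element is chosen. The value then depends on the
  facet alone and is the same from both sides, which makes the jump condition automatic.\<close>

definition facet_val :: "((real^'n) set \<Rightarrow> real^'n) \<Rightarrow> (real^'n) set \<Rightarrow> real^'n" where
  "facet_val v f = (if f \<in> boundary_faces \<T> then v f else ext (site_val v) (center (facet_elem f)))"

definition C_3 :: real where
  "C_3 = C_ext / \<kappa>\<^sup>2 + (48 / c_W)\<^sup>2 * C_A * (1 / \<kappa>) ^ (CARD('n) - 1)"

definition C_4 :: real where "C_4 = (24 / c_W)\<^sup>2 * C_A"

lemma C_A_pos: "0 < C_A" using C_up_pos aspect_ge by (simp add: C_A_def add_pos_pos)

lemma spread_nonneg: "0 \<le> spread g X"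
  unfolding spread_def using active_subset mass_pos by (intro sum_nonneg mult_nonneg_nonneg) (auto intro: less_imp_le)

lemma ext_deviation_square:
  "(norm (u - ext g X))\<^sup>2 \<le> (24 / c_W)\<^sup>2 * C_A * (scale X)\<^sup>2 * scale X ^ (CARD('n) - 1) / scale X ^ (2 * CARD('n)) *
     (\<Sum>j\<in>active X. mass j * (norm (u - g j))\<^sup>2)"
proof -
  let ?N = "CARD('n)"
  have D: "0 < scale X" by (rule scale_pos)
  have w0: "0 \<le> mass i" if "i \<in> active X" for i using that active_subset mass_pos by (meson less_imp_le subsetD)
  have cp: "0 < c_W * scale X ^ ?N" using c_W_pos D by simp
  have "24 * scale X / bump_sum X \<le> 24 * scale X / (c_W * scale X ^ ?N)"
    by (rule frac_le[OF _ order_refl cp bump_sum_ge]) (use D in simp)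
  then have "norm (u - ext g X) \<le> 24 * scale X / (c_W * scale X ^ ?N) * (\<Sum>j\<in>active X. mass j * norm (u - g j))"
    using ext_deviation[of u g X] w0 by (meson mult_nonneg_nonneg mult_right_mono norm_ge_zero order_trans sum_nonneg)
  then have "(norm (u - ext g X))\<^sup>2 \<le> (24 * scale X / (c_W * scale X ^ ?N) * (\<Sum>j\<in>active X. mass j * norm (u - g j)))\<^sup>2"
    by (intro power_mono) auto
  also have "\<dots> = (24 * scale X / (c_W * scale X ^ ?N))\<^sup>2 * (\<Sum>j\<in>active X. mass j * norm (u - g j))\<^sup>2" by (rule power_mult_distrib)
  also have "\<dots> \<le> (24 * scale X / (c_W * scale X ^ ?N))\<^sup>2 * ((\<Sum>j\<in>active X. mass j) * (\<Sum>j\<in>active X. mass j * (norm (u - g j))\<^sup>2))"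
    by (intro mult_left_mono sum_square_le_weighted w0) auto
  also have "\<dots> \<le> (24 * scale X / (c_W * scale X ^ ?N))\<^sup>2 * ((C_A * scale X ^ (?N - 1)) * (\<Sum>j\<in>active X. mass j * (norm (u - g j))\<^sup>2))"
    using w0 by (intro mult_left_mono mult_right_mono active_weight sum_nonneg mult_nonneg_nonneg) auto
  also have "(24 * scale X / (c_W * scale X ^ ?N))\<^sup>2 = (24 / c_W)\<^sup>2 * (scale X)\<^sup>2 / scale X ^ (2 * ?N)"
    by (simp add: power_divide power_mult_distrib power_mult[symmetric] mult.commute)
  finally show ?thesis by (simp add: mult_ac)
qed

text \<open>A boundary facet is itself an active site at the centre, where the scale is comparable
  to the element, so its own row of the double sum \<open>spread\<close> bounds the deviation. At an
  interior facet the adjacent elements share an edge and have comparable sizes, and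
  \<open>ext_difference\<close> applies to their centres.\<close>

lemma facet_value_deviation:
  assumes T: "T \<in> \<T>" and f: "f facet_of T"
  shows "(norm (facet_val v f - ext (site_val v) (center T)))\<^sup>2 \<le>
    C_3 * (diameter T)\<^sup>2 / scale (center T) ^ (2 * CARD('n)) * spread (site_val v) (center T)"
proof -
  let ?X = "center T" and ?N = "CARD('n)" and ?d = "diameter T"
  let ?g = "site_val v"
  have d: "0 < ?d" by (rule diameter_simplex_pos[OF T])
  have D: "0 < scale ?X" by (rule scale_pos)
  have \<kappa>D: "?d \<le> scale ?X / \<kappa>" using scale_center[OF T] \<kappa>_pos by (simp add: field_simps)
  have S: "0 \<le> spread ?g ?X" by (rule spread_nonneg)
  have pD: "0 < scale ?X ^ (2 * ?N)" using D by simp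
  obtain a where a: "a \<in> vertices T" "f = convex hull (vertices T - {a})" "vertices f = vertices T - {a}"
    by (rule facet_opposite[OF T f])
  note ff = facet_diameter[OF T f]
  show ?thesis
  proof (cases "f \<in> boundary_faces \<T>")
    case True
    let ?Q = "\<Sum>j\<in>active ?X. mass j * (norm (v f - ?g j))\<^sup>2"
    have w0: "0 \<le> mass i" if "i \<in> active ?X" for i using that active_subset mass_pos by (meson less_imp_le subsetD)
    have vff: "facet_val v f = v f" "?g (Some f) = v f" using True by (auto simp: facet_val_def site_val_def)
    have bf: "barycenter f \<in> T" using boundary_face_compact_convex(5)[OF True] facet_subset[OF T f] by blast
    have dX: "dist ?X (barycenter f) \<le> ?d" using diameter_bounded_bound[OF bounded_simplex[OF T] center(3)[OF T] bf] .
    have fII: "Some f \<in> sites" using True by (simp add: sites_def)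
    have ddf: "sdist ?X (Some f) \<le> 2 * ?d" using dX ff(2) by (simp add: sdist_def)
    have DT: "scale ?X \<le> 2 * ?d" using scale_le[OF fII, of ?X] ddf by linarith
    have fNN: "Some f \<in> active ?X"
    proof -
      have "2 / \<kappa> \<le> aspect"
      proof -
        have "0 \<le> (1 - 1 / \<kappa>)\<^sup>2" by simp
        then have "2 / \<kappa> \<le> 1 + 1 / \<kappa>\<^sup>2" by (simp add: power2_diff power_divide)
        also have "\<dots> \<le> 25 * (1 + 1 / \<kappa>\<^sup>2)"
        proof -
          have "1 + x \<le> 25 * (1 + x)" if "0 \<le> x" for x :: real using that by simp
          from this[of "1 / \<kappa>\<^sup>2"] show ?thesis by simp
        qed
        finally show ?thesis by (simp add: aspect_def)
      qed
      then have "2 / \<kappa> * scale ?X \<le> aspect * scale ?X" using D by (intro mult_right_mono) auto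
      moreover have "2 * ?d \<le> 2 / \<kappa> * scale ?X" using \<kappa>D by simp
      ultimately show ?thesis using ddf fII by (simp add: active_def)
    qed
    have wQ: "wt f * ?Q \<le> spread ?g ?X"
    proof -
      have "wt f * ?Q = (\<Sum>j\<in>active ?X. mass (Some f) * mass j * (norm (?g (Some f) - ?g j))\<^sup>2)"
        by (simp add: sum_distrib_left mass_def vff mult_ac)
      also have "\<dots> \<le> spread ?g ?X"
        unfolding spread_def using fNN finite_active w0
        by (intro member_le_sum[where f = "\<lambda>i. \<Sum>j\<in>active ?X. mass i * mass j * (norm (?g i - ?g j))\<^sup>2"])
          (auto intro!: sum_nonneg mult_nonneg_nonneg)
      finally show ?thesis .
    qed
    have wf: "(\<kappa> * scale ?X) ^ (?N - 1) \<le> wt f"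
      unfolding wt_def
    proof (rule power_mono)
      have "\<kappa> * scale ?X \<le> \<kappa> * (2 * ?d)" using DT \<kappa>_pos by simp
      then show "\<kappa> * scale ?X \<le> diameter f" using ff(1) by simp
    qed (use \<kappa>_pos D in simp)
    have Q0: "0 \<le> ?Q" using w0 by (intro sum_nonneg mult_nonneg_nonneg) auto
    have DQ: "scale ?X ^ (?N - 1) * ?Q \<le> (1 / \<kappa>) ^ (?N - 1) * spread ?g ?X"
    proof -
      have "(\<kappa> * scale ?X) ^ (?N - 1) * ?Q \<le> spread ?g ?X" using mult_right_mono[OF wf Q0] wQ by linarith
      then have "(1 / \<kappa>) ^ (?N - 1) * ((\<kappa> * scale ?X) ^ (?N - 1) * ?Q) \<le> (1 / \<kappa>) ^ (?N - 1) * spread ?g ?X"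
        using \<kappa>_pos by (intro mult_left_mono) auto
      moreover have "(1 / \<kappa>) ^ (?N - 1) * (\<kappa> * scale ?X) ^ (?N - 1) = scale ?X ^ (?N - 1)"
        using \<kappa>_pos by (simp add: power_mult_distrib power_divide)
      ultimately show ?thesis by (simp only: mult.assoc[symmetric])
    qed
    have D2: "(scale ?X)\<^sup>2 \<le> 4 * ?d\<^sup>2" using power_mono[OF DT, of 2] D by (simp add: power_mult_distrib)
    have "(norm (v f - ext ?g ?X))\<^sup>2 \<le> (24 / c_W)\<^sup>2 * C_A * (scale ?X)\<^sup>2 * scale ?X ^ (?N - 1) / scale ?X ^ (2 * ?N) * ?Q"
      by (rule ext_deviation_square)
    also have "\<dots> = ((24 / c_W)\<^sup>2 * C_A / scale ?X ^ (2 * ?N)) * ((scale ?X)\<^sup>2 * (scale ?X ^ (?N - 1) * ?Q))" by simp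
    also have "\<dots> \<le> ((24 / c_W)\<^sup>2 * C_A / scale ?X ^ (2 * ?N)) * (4 * ?d\<^sup>2 * ((1 / \<kappa>) ^ (?N - 1) * spread ?g ?X))"
      using C_A_pos pD D Q0 by (intro mult_left_mono mult_mono D2 DQ) auto
    also have "\<dots> = ((48 / c_W)\<^sup>2 * C_A * (1 / \<kappa>) ^ (?N - 1)) * (?d\<^sup>2 / scale ?X ^ (2 * ?N) * spread ?g ?X)"
      by (simp add: power_divide mult_ac)
    also have "\<dots> \<le> C_3 * (?d\<^sup>2 / scale ?X ^ (2 * ?N) * spread ?g ?X)"
      using S pD by (intro mult_right_mono) (auto simp: C_3_def C_ext_def)
    finally show ?thesis by (simp add: vff)
  next
    case False
    define T' where "T' = facet_elem f"
    have "T' \<in> \<T> \<and> f facet_of T'" unfolding T'_def facet_elem_def by (rule someI[of _ T]) (use T f in blast)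
    then have T': "T' \<in> \<T>" "f facet_of T'" by auto
    have fin: "finite (vertices T - {a})" using finite_vertices[OF full_simplex[OF T]] by blast
    have "card (vertices T - {a}) > 1"
      using a(1) simplex_hull_vertices(2)[OF full_simplex[OF T]] dim_ge_2 finite_vertices[OF full_simplex[OF T]] by simp
    \<comment> \<open>A facet has at least two vertices because the dimension is at least 2; they
      span the shared edge.\<close>
    then obtain p q where pq: "p \<in> vertices T - {a}" "q \<in> vertices T - {a}" "p \<noteq> q"
      by (metis One_nat_def card_le_Suc0_iff_eq fin not_less)
    have "p \<in> f" "q \<in> f" using pq hull_inc unfolding a(2) by metis+
    then have pqT: "p \<in> T" "p \<in> T'" "q \<in> T" "q \<in> T'" using facet_subset[OF T f] facet_subset[OF T'] by blast+
    have s1: "2 * \<kappa> * diameter T \<le> diameter T'" and s2: "2 * \<kappa> * diameter T' \<le> diameter T"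
      using shared_edge[OF T T'(1), of p q] shared_edge[OF T'(1) T, of p q] pqT pq(3) by auto
    let ?Y = "center T'"
    have dXY: "dist ?X ?Y \<le> ?d + diameter T'"
      using dist_triangle[of ?X ?Y p]
        diameter_bounded_bound[OF bounded_simplex[OF T] center(3)[OF T] pqT(1)]
        diameter_bounded_bound[OF bounded_simplex[OF T'(1)] pqT(2) center(3)[OF T'(1)]] by linarith
    have \<kappa>2: "2 * \<kappa> \<le> 1" by (rule \<kappa>_le_half[OF T])
    have key: "A + B \<le> A / \<kappa>" if "2 * \<kappa> * B \<le> A" "0 < A" for A B :: real
    proof -
      have "\<kappa> * (A + B) \<le> (1 / 2) * A + (1 / 2) * A"
        using that \<kappa>2 mult_right_mono[of \<kappa> "1 / 2" A] unfolding distrib_left by linarith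
      then show ?thesis using \<kappa>_pos by (simp add: field_simps)
    qed
    have d': "0 < diameter T'" by (rule diameter_simplex_pos[OF T'(1)])
    have XY1: "dist ?X ?Y \<le> ?d / \<kappa>" using dXY key[OF s2 d] by linarith
    have XY2: "dist ?X ?Y \<le> diameter T' / \<kappa>" using dXY key[OF s1 d'] by linarith
    have k2: "t / \<kappa> \<le> (1 / \<kappa>\<^sup>2) * E" if "\<kappa> * t \<le> E" for t E :: real
    proof -
      have "(1 / \<kappa>\<^sup>2) * (\<kappa> * t) \<le> (1 / \<kappa>\<^sup>2) * E" using that by (intro mult_left_mono) auto
      then show ?thesis using \<kappa>_pos by (simp add: power2_eq_square)
    qed
    have "(norm (ext ?g ?Y - ext ?g ?X))\<^sup>2 \<le> C_ext * (dist ?X ?Y)\<^sup>2 / scale ?X ^ (2 * ?N) * spread ?g ?X"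
      by (rule ext_difference) (use XY1 XY2 k2[OF scale_center[OF T]] k2[OF scale_center[OF T'(1)]] in auto)
    also have "\<dots> = C_ext / scale ?X ^ (2 * ?N) * spread ?g ?X * (dist ?X ?Y)\<^sup>2" by simp
    also have "\<dots> \<le> C_ext / scale ?X ^ (2 * ?N) * spread ?g ?X * (?d / \<kappa>)\<^sup>2"
      using XY1 S pD by (intro mult_left_mono power_mono) (auto simp: C_ext_def)
    also have "\<dots> = C_ext / \<kappa>\<^sup>2 * (?d\<^sup>2 / scale ?X ^ (2 * ?N) * spread ?g ?X)" by (simp add: power_divide mult_ac)
    also have "\<dots> \<le> C_3 * (?d\<^sup>2 / scale ?X ^ (2 * ?N) * spread ?g ?X)"
      using S pD C_A_pos \<kappa>_pos by (intro mult_right_mono) (auto simp: C_3_def)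
    finally show ?thesis using False by (simp add: facet_val_def T'_def)
  qed
qed

text \<open>The deviation of the extension from 0; the far site contributes nothing, since its value
  is 0.\<close>

lemma ext_square_le:
  "(norm (ext (site_val v) X))\<^sup>2 \<le> C_4 / scale X ^ (CARD('n) - 1) * (\<Sum>e | e \<in> boundary_faces \<T> \<and> Some e \<in> active X. wt e * (norm (v e))\<^sup>2)"
proof -
  let ?N = "CARD('n)"
  have D: "0 < scale X" by (rule scale_pos)
  have "(norm (ext (site_val v) X))\<^sup>2 = (norm (0 - ext (site_val v) X))\<^sup>2" by simp
  also have "\<dots> \<le> (24 / c_W)\<^sup>2 * C_A * (scale X)\<^sup>2 * scale X ^ (?N - 1) / scale X ^ (2 * ?N) * (\<Sum>j\<in>active X. mass j * (norm (0 - site_val v j))\<^sup>2)"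
    by (rule ext_deviation_square)
  also have "(24 / c_W)\<^sup>2 * C_A * (scale X)\<^sup>2 * scale X ^ (?N - 1) / scale X ^ (2 * ?N) = C_4 / scale X ^ (?N - 1)"
  proof -
    have "scale X ^ (2 * ?N) = (scale X)\<^sup>2 * scale X ^ (?N - 1) * scale X ^ (?N - 1)"
      unfolding mult_2 power_add power_card[of "scale X"] by (simp add: power2_eq_square mult_ac)
    then show ?thesis using D by (simp add: C_4_def)
  qed
  also have "(\<Sum>j\<in>active X. mass j * (norm (0 - site_val v j))\<^sup>2) = (\<Sum>j\<in>Some ` {e. e \<in> boundary_faces \<T> \<and> Some e \<in> active X}. mass j * (norm (0 - site_val v j))\<^sup>2)"
  proof (rule sum.mono_neutral_right[OF finite_active])
    show "\<forall>i\<in>active X - Some ` {e. e \<in> boundary_faces \<T> \<and> Some e \<in> active X}. mass i * (norm (0 - site_val v i))\<^sup>2 = 0"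
    proof
      fix i assume i: "i \<in> active X - Some ` {e. e \<in> boundary_faces \<T> \<and> Some e \<in> active X}"
      then have "i = None" using active_subset sites_cases[of i] by blast
      then show "mass i * (norm (0 - site_val v i))\<^sup>2 = 0" by (simp add: site_val_def)
    qed
  qed auto
  also have "\<dots> = (\<Sum>e | e \<in> boundary_faces \<T> \<and> Some e \<in> active X. wt e * (norm (v e))\<^sup>2)"
    by (simp add: sum.reindex mass_def site_val_def)
  finally show ?thesis .
qed

section \<open>Exchanging sums over elements with sums over boundary faces\<close>

definition C_T :: real where "C_T = ((aspect + 1) / \<kappa>) ^ CARD('n)"

text \<open>The centre of such an element is within \<open>aspect * R\<close> of
  \<open>barycenter e\<close>, and its inner ball has radius at most \<open>R\<close>; the disjoint
  inner balls are packed into one ball about the barycenter.\<close>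

lemma element_growth:
  assumes e: "e \<in> boundary_faces \<T>" and R: "0 < R"
  shows "(\<Sum>T | T \<in> \<T> \<and> Some e \<in> active (center T) \<and> scale (center T) \<le> R. diameter T ^ CARD('n)) \<le> C_T * R ^ CARD('n)"
proof -
  let ?S = "{T. T \<in> \<T> \<and> Some e \<in> active (center T) \<and> scale (center T) \<le> R}"
  have "(\<Sum>T\<in>?S. (\<kappa> * diameter T) ^ DIM(real^'n)) \<le> ((aspect + 1) * R) ^ DIM(real^'n)"
  proof (rule ball_packing[where x = center and X = "barycenter e"])
    show "finite ?S" using finite_mesh by simp
    show "0 \<le> (aspect + 1) * R" using R aspect_ge by simp
    show "0 \<le> \<kappa> * diameter T" if "T \<in> ?S" for T using that \<kappa>_pos diameter_simplex_pos[of T] by simp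
    show "ball (center T) (\<kappa> * diameter T) \<subseteq> ball (barycenter e) ((aspect + 1) * R)" if T: "T \<in> ?S" for T
    proof
      fix w assume w: "w \<in> ball (center T) (\<kappa> * diameter T)"
      have "sdist (center T) (Some e) \<le> aspect * scale (center T)" using T by (simp add: active_def)
      also have "\<dots> \<le> aspect * R" using T aspect_ge by simp
      finally have "dist (center T) (barycenter e) < aspect * R" using boundary_face_diameter(1)[OF e] by (simp add: sdist_def)
      moreover have "dist (center T) w < R" using w scale_center[of T] T by simp
      ultimately show "w \<in> ball (barycenter e) ((aspect + 1) * R)"
        using dist_triangle[of "barycenter e" w "center T"] by (simp add: dist_commute distrib_right)
    qed
    show "ball (center T) (\<kappa> * diameter T) \<inter> ball (center T') (\<kappa> * diameter T') = {}"
      if "T \<in> ?S" "T' \<in> ?S" "T \<noteq> T'" for T T'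
      using center(2)[of T] center(1)[of T'] ball_subset_cball[of "center T'" "\<kappa> * diameter T'"] mesh_interior_Int[of T T'] that by blast
  qed
  then have "\<kappa> ^ CARD('n) * (\<Sum>T\<in>?S. diameter T ^ CARD('n)) \<le> (aspect + 1) ^ CARD('n) * R ^ CARD('n)"
    by (simp add: power_mult_distrib sum_distrib_left)
  then show ?thesis using \<kappa>_pos by (simp add: C_T_def power_divide field_simps)
qed

lemma element_upper_tail:
  assumes e: "e \<in> boundary_faces \<T>" and \<delta>: "0 < \<delta>"
    and I: "\<And>T. T \<in> I \<Longrightarrow> T \<in> \<T> \<and> Some e \<in> active (center T) \<and> \<delta> \<le> scale (center T)"
  shows "(\<Sum>T\<in>I. diameter T ^ CARD('n) / scale (center T) ^ (2 * CARD('n))) \<le> 2 * (C_T * 2 ^ CARD('n) / \<delta> ^ CARD('n))"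
proof -
  have fin: "finite I" by (rule finite_subset[OF _ finite_mesh]) (use I in blast)
  have d0: "0 \<le> diameter T ^ CARD('n)" if "T \<in> \<T>" for T using diameter_simplex_pos[OF that] by simp
  have "(\<Sum>T\<in>I. diameter T ^ CARD('n) / scale (center T) ^ (CARD('n) + CARD('n))) \<le> 2 * (C_T * 2 ^ CARD('n) / \<delta> ^ CARD('n))"
  proof (rule sum_inverse_power_upper_tail[OF fin _ \<delta>, where \<rho> = r2])
    fix R assume R: "0 < R" "R \<le> r2"
    have "(\<Sum>T | T \<in> I \<and> scale (center T) \<le> R. diameter T ^ CARD('n)) \<le>
       (\<Sum>T | T \<in> \<T> \<and> Some e \<in> active (center T) \<and> scale (center T) \<le> R. diameter T ^ CARD('n))"
      using I finite_mesh d0 by (intro sum_mono2) auto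
    then show "(\<Sum>T | T \<in> I \<and> scale (center T) \<le> R. diameter T ^ CARD('n)) \<le> C_T * R ^ CARD('n)"
      using element_growth[OF e R(1)] by linarith
  qed (use I d0 scale_le_r2 aspect_ge \<kappa>_pos in \<open>auto simp: C_T_def Suc_le_eq\<close>)
  then show ?thesis by (simp only: mult_2)
qed

lemma element_lower_tail:
  assumes e: "e \<in> boundary_faces \<T>"
  shows "(\<Sum>T | T \<in> \<T> \<and> Some e \<in> active (center T). diameter T ^ CARD('n) / scale (center T) ^ (CARD('n) - 1)) \<le> C_T * 2 ^ CARD('n)"
proof -
  let ?I = "{T. T \<in> \<T> \<and> Some e \<in> active (center T)}"
  have fin: "finite ?I" using finite_mesh by simp
  have d0: "0 \<le> diameter T ^ CARD('n)" if "T \<in> \<T>" for T using diameter_simplex_pos[OF that] by simp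
  have CT: "0 \<le> C_T" using aspect_ge \<kappa>_pos by (simp add: C_T_def)
  have N: "CARD('n) - 1 + 1 = CARD('n)" by simp
  have "(\<Sum>T\<in>?I. diameter T ^ CARD('n) / scale (center T) ^ (CARD('n) - 1)) \<le> 2 * (C_T * 2 ^ (CARD('n) - 1) * r2)"
  proof (rule sum_inverse_power_lower_tail[OF fin])
    fix R assume R: "0 < R" "R \<le> r2"
    have eq: "{T \<in> ?I. scale (center T) \<le> R} = {T. T \<in> \<T> \<and> Some e \<in> active (center T) \<and> scale (center T) \<le> R}" by auto
    show "(\<Sum>T | T \<in> ?I \<and> scale (center T) \<le> R. diameter T ^ CARD('n)) \<le> C_T * R ^ (CARD('n) - 1 + 1)"
      unfolding eq N by (rule element_growth[OF e R(1)])
  qed (use d0 scale_le_r2 scale_pos CT r2_bounds(1) in auto)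
  also have "\<dots> = C_T * 2 ^ CARD('n) * r2" unfolding power_card[of 2] by simp
  also have "\<dots> \<le> C_T * 2 ^ CARD('n) * 1" using CT r2_bounds by (intro mult_left_mono) auto
  finally show ?thesis by simp
qed

definition C_q :: real where "C_q = 2 * C_T * 2 ^ CARD('n) * (2 * aspect) ^ CARD('n)"

definition Gagliardo :: "((real^'n) set \<Rightarrow> real^'n) \<Rightarrow> real" where
  "Gagliardo v = (\<Sum>e\<in>boundary_faces \<T>. \<Sum>e' | e' \<in> boundary_faces \<T> \<and> fdist e e' \<le> R0.
      wt e * wt e' * (norm (v e - v e'))\<^sup>2 / fdist e e' ^ CARD('n))"

definition L2_sum :: "((real^'n) set \<Rightarrow> real^'n) \<Rightarrow> real" where
  "L2_sum v = (\<Sum>e\<in>boundary_faces \<T>. wt e * (norm (v e))\<^sup>2)"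

lemma Gagliardo_nonneg: "0 \<le> Gagliardo v"
  unfolding Gagliardo_def using wt_pos fdist_bounds(3)
  by (intro sum_nonneg divide_nonneg_pos mult_nonneg_nonneg zero_less_power) (auto intro: less_imp_le)

lemma L2_sum_nonneg: "0 \<le> L2_sum v"
  unfolding L2_sum_def using wt_pos by (intro sum_nonneg mult_nonneg_nonneg) (auto intro: less_imp_le)

text \<open>After the exchange of sums, a pair of sites is weighted by the elements at which both
  are active. For two faces these elements have scale at least
  \<open>fdist e e' / (2 * aspect)\<close>, and their total weight is of order
  \<open>1 / fdist e e' ^ N\<close>, the Gagliardo kernel. A face and the far site meet only where
  the scale is of order \<open>r2\<close>, which produces the L2 term.\<close>

lemma sum_S2_le:
  "(\<Sum>T\<in>\<T>. diameter T ^ CARD('n) / scale (center T) ^ (2 * CARD('n)) * spread (site_val v) (center T)) \<le> C_q * (Gagliardo v + 2 / r2 * L2_sum v)"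
proof -
  let ?N = "CARD('n)" and ?B = "boundary_faces \<T>" and ?g = "site_val v"
  define c where "c T = diameter T ^ ?N / scale (center T) ^ (2 * ?N)" for T
  have c0: "0 \<le> c T" if "T \<in> \<T>" for T using diameter_simplex_pos[OF that] scale_pos[of "center T"] by (simp add: c_def)
  have CT: "0 \<le> C_T" using aspect_ge \<kappa>_pos by (simp add: C_T_def)
  have Cq: "0 \<le> C_q" using CT aspect_ge by (simp add: C_q_def)
  define q where "q i j = mass i * mass j * (norm (?g i - ?g j))\<^sup>2" for i j
  define P where "P i j = (\<Sum>T | T \<in> \<T> \<and> i \<in> active (center T) \<and> j \<in> active (center T). c T)" for i j
  have q0: "0 \<le> q i j" if "i \<in> sites" "j \<in> sites" for i j using that mass_pos by (simp add: q_def less_imp_le)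
  have swap: "(\<Sum>T\<in>\<T>. c T * spread ?g (center T)) = (\<Sum>i\<in>sites. \<Sum>j\<in>sites. q i j * P i j)"
  proof -
    have S2eq: "spread ?g X = (\<Sum>i\<in>sites. \<Sum>j\<in>sites. if i \<in> active X \<and> j \<in> active X then q i j else 0)" for X
    proof -
      have "(\<Sum>i\<in>sites. \<Sum>j\<in>sites. if i \<in> active X \<and> j \<in> active X then q i j else 0) = (\<Sum>i\<in>sites. if i \<in> active X then (\<Sum>j\<in>active X. q i j) else 0)"
      proof (rule sum.cong[OF refl])
        fix i
        have "(\<Sum>j\<in>sites. if j \<in> active X then q i j else 0) = (\<Sum>j\<in>active X. q i j)"
          using sum.inter_restrict[OF finite_sites, of "q i" "active X"] active_subset[of X] by (simp add: Int_absorb1)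
        then show "(\<Sum>j\<in>sites. if i \<in> active X \<and> j \<in> active X then q i j else 0) = (if i \<in> active X then (\<Sum>j\<in>active X. q i j) else 0)" by simp
      qed
      also have "\<dots> = (\<Sum>i\<in>active X. \<Sum>j\<in>active X. q i j)"
        using sum.inter_restrict[OF finite_sites, of "\<lambda>i. \<Sum>j\<in>active X. q i j" "active X"] active_subset[of X] by (simp add: Int_absorb1)
      finally show ?thesis by (simp add: spread_def q_def)
    qed
    have "(\<Sum>T\<in>\<T>. c T * spread ?g (center T)) = (\<Sum>T\<in>\<T>. \<Sum>i\<in>sites. \<Sum>j\<in>sites. if i \<in> active (center T) \<and> j \<in> active (center T) then c T * q i j else 0)"
      unfolding S2eq sum_distrib_left by (intro sum.cong refl) auto
    also have "\<dots> = (\<Sum>i\<in>sites. \<Sum>T\<in>\<T>. \<Sum>j\<in>sites. if i \<in> active (center T) \<and> j \<in> active (center T) then c T * q i j else 0)"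
      by (rule sum.swap)
    also have "\<dots> = (\<Sum>i\<in>sites. \<Sum>j\<in>sites. \<Sum>T\<in>\<T>. if i \<in> active (center T) \<and> j \<in> active (center T) then c T * q i j else 0)"
      by (intro sum.cong refl sum.swap)
    also have "\<dots> = (\<Sum>i\<in>sites. \<Sum>j\<in>sites. q i j * P i j)"
    proof (intro sum.cong refl)
      fix i j
      have "(\<Sum>T\<in>\<T>. if i \<in> active (center T) \<and> j \<in> active (center T) then c T * q i j else 0) =
         (\<Sum>T | T \<in> \<T> \<and> i \<in> active (center T) \<and> j \<in> active (center T). c T * q i j)"
        by (rule sum.inter_filter[symmetric, OF finite_mesh])
      then show "(\<Sum>T\<in>\<T>. if i \<in> active (center T) \<and> j \<in> active (center T) then c T * q i j else 0) = q i j * P i j"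
        by (simp add: P_def sum_distrib_left mult.commute)
    qed
    finally show ?thesis .
  qed
  have Psome: "q (Some e) (Some e') * P (Some e) (Some e') \<le>
      (if fdist e e' \<le> R0 then C_q * (wt e * wt e' * (norm (v e - v e'))\<^sup>2 / fdist e e' ^ ?N) else 0)"
    if e: "e \<in> ?B" and e': "e' \<in> ?B" for e e'
  proof -
    have fp: "0 < fdist e e'" by (rule fdist_bounds(3)[OF e e'])
    let ?I = "{T. T \<in> \<T> \<and> Some e \<in> active (center T) \<and> Some e' \<in> active (center T)}"
    have near: "fdist e e' \<le> 2 * aspect * scale (center T)" if "T \<in> ?I" for T using that fdist_le_active by blast
    show ?thesis
    proof (cases "fdist e e' \<le> R0")
      case True
      have "P (Some e) (Some e') \<le> 2 * (C_T * 2 ^ ?N / (fdist e e' / (2 * aspect)) ^ ?N)"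
        unfolding P_def c_def
        by (rule element_upper_tail[OF e]) (use fp aspect_ge near in \<open>auto simp: field_simps\<close>)
      also have "\<dots> = C_q / fdist e e' ^ ?N" by (simp add: C_q_def power_divide mult_ac)
      finally have "q (Some e) (Some e') * P (Some e) (Some e') \<le> q (Some e) (Some e') * (C_q / fdist e e' ^ ?N)"
        using q0[of "Some e" "Some e'"] e e' by (intro mult_left_mono) (auto simp: sites_def)
      then show ?thesis using True by (simp add: q_def mass_def site_val_def mult_ac)
    next
      case False
      \<comment> \<open>Faces farther apart than \<open>R0\<close> are never active together, so
        such pairs do not occur.\<close>
      have "2 * aspect * scale X \<le> R0" for X
      proof -
        have "2 * aspect * scale X \<le> 2 * aspect * r2" using scale_le_r2 aspect_ge by (intro mult_left_mono) auto
        then show ?thesis using r2_bounds(2) by linarith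
      qed
      then have "T \<notin> ?I" for T using near[of T] False order_trans[of "fdist e e'" "2 * aspect * scale (center T)" R0] by blast
      then have "?I = {}" by blast
      then have "P (Some e) (Some e') = 0" unfolding P_def by (simp only: sum.empty)
      then show ?thesis using False by simp
    qed
  qed
  have Pnone: "(\<Sum>T | T \<in> \<T> \<and> Some e \<in> active (center T) \<and> None \<in> active (center T). c T) \<le> C_q / r2 ^ ?N" if e: "e \<in> ?B" for e
  proof -
    have "(\<Sum>T | T \<in> \<T> \<and> Some e \<in> active (center T) \<and> None \<in> active (center T). c T) \<le> 2 * (C_T * 2 ^ ?N / (r2 / aspect) ^ ?N)"
      unfolding c_def
      by (rule element_upper_tail[OF e])
        (use r2_bounds(1) aspect_ge in \<open>auto simp: active_def sdist_def divide_le_eq mult.commute\<close>)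
    also have "\<dots> = 2 * C_T * 2 ^ ?N * aspect ^ ?N / r2 ^ ?N" by (simp add: power_divide)
    also have "\<dots> \<le> C_q / r2 ^ ?N"
      unfolding C_q_def using CT aspect_ge r2_bounds(1) by (intro divide_right_mono mult_left_mono power_mono) auto
    finally show ?thesis .
  qed
  have none: "q (Some e) None * P (Some e) None \<le> C_q / r2 * (wt e * (norm (v e))\<^sup>2)"
    and none': "q None (Some e) * P None (Some e) \<le> C_q / r2 * (wt e * (norm (v e))\<^sup>2)" if e: "e \<in> ?B" for e
  proof -
    have q1: "q (Some e) None = r2 ^ (?N - 1) * (wt e * (norm (v e))\<^sup>2)" "q None (Some e) = r2 ^ (?N - 1) * (wt e * (norm (v e))\<^sup>2)"
      by (simp_all add: q_def mass_def site_val_def mult_ac)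
    have p1: "P (Some e) None \<le> C_q / r2 ^ ?N" using Pnone[OF e] by (simp add: P_def)
    have "P None (Some e) = P (Some e) None" unfolding P_def by (rule sum.cong) auto
    then have p2: "P None (Some e) \<le> C_q / r2 ^ ?N" using p1 by simp
    have nn: "0 \<le> r2 ^ (?N - 1) * (wt e * (norm (v e))\<^sup>2)" using r2_bounds(1) wt_pos[OF e] by simp
    have eq: "r2 ^ (?N - 1) * (wt e * (norm (v e))\<^sup>2) * (C_q / r2 ^ ?N) = C_q / r2 * (wt e * (norm (v e))\<^sup>2)"
      unfolding power_card[of r2] using r2_bounds(1) by simp
    show "q (Some e) None * P (Some e) None \<le> C_q / r2 * (wt e * (norm (v e))\<^sup>2)"
      using mult_left_mono[OF p1 nn] unfolding q1 eq .
    show "q None (Some e) * P None (Some e) \<le> C_q / r2 * (wt e * (norm (v e))\<^sup>2)"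
      using mult_left_mono[OF p2 nn] unfolding q1 eq .
  qed
  have split: "(\<Sum>i\<in>sites. F i) = F None + (\<Sum>e\<in>?B. F (Some e))" for F :: "(real^'n) set option \<Rightarrow> real"
    unfolding sites_def using finite_boundary_faces by (subst sum.insert) (auto simp: sum.reindex)
  have qnn: "q None None = 0" by (simp add: q_def site_val_def)
  have "(\<Sum>i\<in>sites. \<Sum>j\<in>sites. q i j * P i j) = (\<Sum>e\<in>?B. q None (Some e) * P None (Some e)) +
      (\<Sum>e\<in>?B. q (Some e) None * P (Some e) None + (\<Sum>e'\<in>?B. q (Some e) (Some e') * P (Some e) (Some e')))"
    unfolding split qnn by simp
  also have "\<dots> \<le> (\<Sum>e\<in>?B. C_q / r2 * (wt e * (norm (v e))\<^sup>2)) + (\<Sum>e\<in>?B. C_q / r2 * (wt e * (norm (v e))\<^sup>2) +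
      (\<Sum>e'\<in>?B. if fdist e e' \<le> R0 then C_q * (wt e * wt e' * (norm (v e - v e'))\<^sup>2 / fdist e e' ^ ?N) else 0))"
    by (intro add_mono sum_mono none none' Psome)
  also have "\<dots> = C_q * (Gagliardo v + 2 / r2 * L2_sum v)"
  proof -
    have "(\<Sum>e'\<in>?B. if fdist e e' \<le> R0 then C_q * (wt e * wt e' * (norm (v e - v e'))\<^sup>2 / fdist e e' ^ ?N) else 0) =
      C_q * (\<Sum>e' | e' \<in> ?B \<and> fdist e e' \<le> R0. wt e * wt e' * (norm (v e - v e'))\<^sup>2 / fdist e e' ^ ?N)" for e
      unfolding sum_distrib_left by (rule sum.inter_filter[symmetric, OF finite_boundary_faces])
    then have "(\<Sum>e\<in>?B. C_q / r2 * (wt e * (norm (v e))\<^sup>2) +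
      (\<Sum>e'\<in>?B. if fdist e e' \<le> R0 then C_q * (wt e * wt e' * (norm (v e - v e'))\<^sup>2 / fdist e e' ^ ?N) else 0)) = C_q / r2 * L2_sum v + C_q * Gagliardo v"
      unfolding Gagliardo_def L2_sum_def by (simp only: sum.distrib sum_distrib_left)
    moreover have "(\<Sum>e\<in>?B. C_q / r2 * (wt e * (norm (v e))\<^sup>2)) = C_q / r2 * L2_sum v" by (simp add: L2_sum_def sum_distrib_left)
    ultimately show ?thesis by (simp add: distrib_left)
  qed
  finally show ?thesis unfolding c_def[symmetric] swap .
qed

text \<open>After the exchange of sums, the power \<open>1 - N\<close> of the scale is summed over
  the element volumes near a face; this singularity is weak enough for
  \<open>element_lower_tail\<close> to leave a constant.\<close>

lemma sum_ext_square_le: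
  "(\<Sum>T\<in>\<T>. diameter T ^ CARD('n) * (norm (ext (site_val v) (center T)))\<^sup>2) \<le> C_4 * (C_T * 2 ^ CARD('n)) * L2_sum v"
proof -
  let ?N = "CARD('n)" and ?B = "boundary_faces \<T>"
  define m where "m e = wt e * (norm (v e))\<^sup>2" for e
  define b where "b T = diameter T ^ ?N / scale (center T) ^ (?N - 1)" for T
  have C4: "0 \<le> C_4" using C_A_pos by (simp add: C_4_def)
  have "(\<Sum>T\<in>\<T>. diameter T ^ ?N * (norm (ext (site_val v) (center T)))\<^sup>2) \<le>
      (\<Sum>T\<in>\<T>. C_4 * (\<Sum>e | e \<in> ?B \<and> Some e \<in> active (center T). b T * m e))"
  proof (rule sum_mono)
    fix T assume T: "T \<in> \<T>"
    have "diameter T ^ ?N * (norm (ext (site_val v) (center T)))\<^sup>2 \<le>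
       diameter T ^ ?N * (C_4 / scale (center T) ^ (?N - 1) * (\<Sum>e | e \<in> ?B \<and> Some e \<in> active (center T). m e))"
      unfolding m_def using diameter_simplex_pos[OF T] by (intro mult_left_mono ext_square_le) auto
    also have "\<dots> = C_4 * (b T * (\<Sum>e | e \<in> ?B \<and> Some e \<in> active (center T). m e))" by (simp add: b_def)
    also have "\<dots> = C_4 * (\<Sum>e | e \<in> ?B \<and> Some e \<in> active (center T). b T * m e)" by (simp only: sum_distrib_left)
    finally show "diameter T ^ ?N * (norm (ext (site_val v) (center T)))\<^sup>2 \<le> C_4 * (\<Sum>e | e \<in> ?B \<and> Some e \<in> active (center T). b T * m e)" .
  qed
  also have "\<dots> = C_4 * (\<Sum>T\<in>\<T>. \<Sum>e | e \<in> ?B \<and> Some e \<in> active (center T). b T * m e)" by (simp add: sum_distrib_left)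
  also have "(\<Sum>T\<in>\<T>. \<Sum>e | e \<in> ?B \<and> Some e \<in> active (center T). b T * m e) = (\<Sum>e\<in>?B. \<Sum>T | T \<in> \<T> \<and> Some e \<in> active (center T). b T * m e)"
    by (rule sum.swap_restrict[OF finite_mesh finite_boundary_faces])
  also have "C_4 * \<dots> \<le> C_4 * (\<Sum>e\<in>?B. (C_T * 2 ^ ?N) * m e)"
  proof (intro mult_left_mono sum_mono C4)
    fix e assume e: "e \<in> ?B"
    have "(\<Sum>T | T \<in> \<T> \<and> Some e \<in> active (center T). b T * m e) = (\<Sum>T | T \<in> \<T> \<and> Some e \<in> active (center T). b T) * m e"
      by (simp add: sum_distrib_right)
    also have "\<dots> \<le> (C_T * 2 ^ ?N) * m e"
      unfolding b_def using wt_pos[OF e] by (intro mult_right_mono element_lower_tail[OF e]) (simp add: m_def)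
    finally show "(\<Sum>T | T \<in> \<T> \<and> Some e \<in> active (center T). b T * m e) \<le> (C_T * 2 ^ ?N) * m e" .
  qed
  also have "\<dots> = C_4 * (C_T * 2 ^ ?N) * L2_sum v" by (simp add: L2_sum_def m_def sum_distrib_left mult.assoc)
  finally show ?thesis .
qed

definition C_6 :: real where
  "C_6 = real (CARD('n) + 1) * (3 * C_3 * C_q * (1 + 2 / r2) + 2 * (C_4 * (C_T * 2 ^ CARD('n))))"

text \<open>With \<open>d\<close> the diameter, the weights \<open>d ^ N\<close> and
  \<open>d ^ (N - 2)\<close> are those of facet values in the squared L2 norm and in the squared
  gradient norm on an element. In the second sum the value at the centre is subtracted, because
  gradients ignore constants.\<close>

lemma facet_values_energy:
  "(\<Sum>T\<in>\<T>. diameter T ^ CARD('n) * (\<Sum>a\<in>vertices T. (norm (facet_val v (convex hull (vertices T - {a}))))\<^sup>2) +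
     diameter T ^ (CARD('n) - 2) * (\<Sum>a\<in>vertices T. (norm (facet_val v (convex hull (vertices T - {a})) - ext (site_val v) (center T)))\<^sup>2))
   \<le> C_6 * (Gagliardo v + L2_sum v)"
proof -
  let ?N = "CARD('n)" and ?g = "site_val v"
  define c where "c T = diameter T ^ ?N / scale (center T) ^ (2 * ?N) * spread ?g (center T)" for T
  define b where "b T = diameter T ^ ?N * (norm (ext ?g (center T)))\<^sup>2" for T
  have C3: "0 \<le> C_3" using C_A_pos \<kappa>_pos by (simp add: C_3_def C_ext_def)
  have one: "diameter T ^ ?N * (\<Sum>a\<in>vertices T. (norm (facet_val v (convex hull (vertices T - {a}))))\<^sup>2) +
     diameter T ^ (?N - 2) * (\<Sum>a\<in>vertices T. (norm (facet_val v (convex hull (vertices T - {a})) - ext ?g (center T)))\<^sup>2) \<le>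
     real (?N + 1) * (3 * C_3 * c T + 2 * b T)" if T: "T \<in> \<T>" for T
  proof -
    have d: "0 < diameter T" "diameter T \<le> 1" using diameter_simplex_pos[OF T] diameter_le_1[OF T] by auto
    have card: "real (card (vertices T)) = real (?N + 1)" using simplex_hull_vertices(2)[OF full_simplex[OF T]] by simp
    have each: "diameter T ^ ?N * (norm (facet_val v f))\<^sup>2 + diameter T ^ (?N - 2) * (norm (facet_val v f - ext ?g (center T)))\<^sup>2 \<le> 3 * C_3 * c T + 2 * b T"
      if f: "f facet_of T" for f
    proof -
      let ?u = "facet_val v f" and ?w = "ext ?g (center T)"
      have p: "diameter T ^ ?N = (diameter T)\<^sup>2 * diameter T ^ (?N - 2)"
        unfolding power_card[of "diameter T"] power_card_minus_1[of "diameter T"] by (simp add: power2_eq_square)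
      have "diameter T ^ (?N - 2) * (norm (?u - ?w))\<^sup>2 \<le>
        diameter T ^ (?N - 2) * (C_3 * (diameter T)\<^sup>2 / scale (center T) ^ (2 * ?N) * spread ?g (center T))"
        using d by (intro mult_left_mono facet_value_deviation[OF T f]) auto
      also have "\<dots> = C_3 * c T" unfolding c_def p by simp
      finally have 1: "diameter T ^ (?N - 2) * (norm (?u - ?w))\<^sup>2 \<le> C_3 * c T" .
      have "diameter T ^ ?N \<le> diameter T ^ (?N - 2)" using d by (intro power_decreasing) auto
      then have 2: "diameter T ^ ?N * (norm (?u - ?w))\<^sup>2 \<le> C_3 * c T"
        using 1 mult_right_mono[of "diameter T ^ ?N" "diameter T ^ (?N - 2)" "(norm (?u - ?w))\<^sup>2"] by simp
      have "norm ?u \<le> norm (?u - ?w) + norm ?w" using norm_triangle_ineq[of "?u - ?w" ?w] by simp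
      then have "(norm ?u)\<^sup>2 \<le> (norm (?u - ?w) + norm ?w)\<^sup>2" by (intro power_mono) auto
      also have "\<dots> \<le> 2 * (norm (?u - ?w))\<^sup>2 + 2 * (norm ?w)\<^sup>2"
        using zero_le_power2[of "norm (?u - ?w) - norm ?w"] unfolding power2_sum power2_diff by linarith
      finally have "diameter T ^ ?N * (norm ?u)\<^sup>2 \<le> diameter T ^ ?N * (2 * (norm (?u - ?w))\<^sup>2 + 2 * (norm ?w)\<^sup>2)"
        using d by (intro mult_left_mono) auto
      also have "\<dots> = 2 * (diameter T ^ ?N * (norm (?u - ?w))\<^sup>2) + 2 * b T" by (simp add: b_def algebra_simps)
      finally show ?thesis using 1 2 by linarith
    qed
    have "diameter T ^ ?N * (\<Sum>a\<in>vertices T. (norm (facet_val v (convex hull (vertices T - {a}))))\<^sup>2) +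
     diameter T ^ (?N - 2) * (\<Sum>a\<in>vertices T. (norm (facet_val v (convex hull (vertices T - {a})) - ext ?g (center T)))\<^sup>2) =
     (\<Sum>a\<in>vertices T. diameter T ^ ?N * (norm (facet_val v (convex hull (vertices T - {a}))))\<^sup>2 +
       diameter T ^ (?N - 2) * (norm (facet_val v (convex hull (vertices T - {a})) - ext ?g (center T)))\<^sup>2)"
      by (simp add: sum.distrib sum_distrib_left)
    also have "\<dots> \<le> (\<Sum>a\<in>vertices T. 3 * C_3 * c T + 2 * b T)"
      by (intro sum_mono each) (use simplex_facet_iff[OF full_simplex[OF T]] in blast)
    also have "\<dots> = real (?N + 1) * (3 * C_3 * c T + 2 * b T)" by (simp only: sum_constant card)
    finally show ?thesis .
  qed
  have "(\<Sum>T\<in>\<T>. diameter T ^ ?N * (\<Sum>a\<in>vertices T. (norm (facet_val v (convex hull (vertices T - {a}))))\<^sup>2) +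
     diameter T ^ (?N - 2) * (\<Sum>a\<in>vertices T. (norm (facet_val v (convex hull (vertices T - {a})) - ext ?g (center T)))\<^sup>2))
     \<le> (\<Sum>T\<in>\<T>. real (?N + 1) * (3 * C_3 * c T + 2 * b T))"
    by (intro sum_mono one)
  also have "\<dots> = real (?N + 1) * (3 * C_3 * (\<Sum>T\<in>\<T>. c T) + 2 * (\<Sum>T\<in>\<T>. b T))"
    by (simp only: sum.distrib flip: sum_distrib_left)
  also have "\<dots> \<le> real (?N + 1) * (3 * C_3 * (C_q * (Gagliardo v + 2 / r2 * L2_sum v)) + 2 * (C_4 * (C_T * 2 ^ ?N) * L2_sum v))"
    unfolding c_def b_def using C3 by (intro mult_left_mono add_mono sum_S2_le sum_ext_square_le) auto
  also have "\<dots> \<le> real (?N + 1) * (3 * C_3 * (C_q * ((1 + 2 / r2) * (Gagliardo v + L2_sum v))) + 2 * (C_4 * (C_T * 2 ^ ?N) * (Gagliardo v + L2_sum v)))"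
  proof -
    have "Gagliardo v + 2 / r2 * L2_sum v \<le> (1 + 2 / r2) * (Gagliardo v + L2_sum v)"
      using Gagliardo_nonneg[of v] L2_sum_nonneg[of v] r2_bounds(1) by (simp add: algebra_simps)
    moreover have "0 \<le> C_q" "0 \<le> C_4" "0 \<le> C_T" using aspect_ge \<kappa>_pos C_A_pos by (simp_all add: C_q_def C_T_def C_4_def)
    ultimately show ?thesis
      using C3 Gagliardo_nonneg[of v] by (intro mult_left_mono add_mono) auto
  qed
  also have "\<dots> = C_6 * (Gagliardo v + L2_sum v)"
  proof -
    have "M * (3 * A * (B * (t * s)) + 2 * (D * s)) = M * (3 * A * B * t + 2 * D) * s" for M A B t s D :: real
      by (simp add: algebra_simps)
    then show ?thesis by (simp only: C_6_def)
  qed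
  finally show ?thesis .
qed

end


section \<open>The Crouzeix-Raviart lifting\<close>

text \<open>The scalar factor is the Crouzeix-Raviart basis function of the facet opposite
  \<open>a\<close>; facets are indexed by their opposite vertices.\<close>

definition cr_local :: "(real^'n) set \<Rightarrow> (real^'n \<Rightarrow> real^'n) \<Rightarrow> real^'n \<Rightarrow> real^'n" where
  "cr_local T w x = (\<Sum>a\<in>vertices T. (1 - real CARD('n) * bary T a x) *\<^sub>R w a)"

definition cr_grad :: "(real^'n) set \<Rightarrow> (real^'n \<Rightarrow> real^'n) \<Rightarrow> real^'n \<Rightarrow> real^'n" where
  "cr_grad T w z = - real CARD('n) *\<^sub>R (\<Sum>a\<in>vertices T. (bary_grad T a \<bullet> z) *\<^sub>R w a)"

lemma linear_cr_grad: "linear (cr_grad T w)"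
  by (rule linearI) (simp_all add: cr_grad_def inner_add_right scaleR_add_left sum.distrib scaleR_add_right
      scaleR_right.sum mult_ac)

lemma cr_local_diff: "cr_local T w x - cr_local T w y = cr_grad T w (x - y)"
  for T :: "(real^'n) set"
proof -
  have "(1 - real CARD('n) * bary T a x) *\<^sub>R w a - (1 - real CARD('n) * bary T a y) *\<^sub>R w a =
     - real CARD('n) *\<^sub>R ((bary_grad T a \<bullet> (x - y)) *\<^sub>R w a)" for a
    unfolding bary_diff[symmetric] by (simp add: algebra_simps)
  then show ?thesis unfolding cr_local_def cr_grad_def scaleR_right.sum by (simp only: sum_subtractf[symmetric])
qed

lemma cr_local_affine: "cr_local T w x = matrix (cr_grad T w) *v x + cr_local T w 0"
  using cr_local_diff[of T w x 0] matrix_works[of "cr_grad T w" x] linear_cr_grad[of T w]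
  by (simp add: algebra_simps linear_matrix_vector_mul_eq)

lemma cr_local_has_derivative: "(cr_local T w has_derivative cr_grad T w) (at x within S)"
proof -
  have "cr_local T w = (\<lambda>x. cr_grad T w x + cr_local T w 0)"
  proof
    fix x show "cr_local T w x = cr_grad T w x + cr_local T w 0"
      using cr_local_diff[of T w x 0] by (metis diff_add_cancel diff_zero)
  qed
  moreover have "((\<lambda>x. cr_grad T w x + cr_local T w 0) has_derivative cr_grad T w) (at x within S)"
    using linear_cr_grad[of T w] linear_conv_bounded_linear bounded_linear_imp_has_derivative
    by (intro has_derivative_add_const) blast
  ultimately show ?thesis by simp
qed

text \<open>The gradients of the barycentric coordinates add up to 0, so any constant
  \<open>u\<close> may be subtracted from the facet values.\<close>

lemma norm_cr_grad_le:
  fixes T :: "(real^'n) set"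
  assumes T: "int CARD('n) simplex T" and \<rho>: "0 < \<rho>" "cball c \<rho> \<subseteq> T"
  shows "norm (cr_grad T w z) \<le> real CARD('n) / (2 * \<rho>) * (\<Sum>a\<in>vertices T. norm (w a - u)) * norm z"
proof -
  have "(\<Sum>a\<in>vertices T. (bary_grad T a \<bullet> z) *\<^sub>R u) = ((\<Sum>a\<in>vertices T. bary_grad T a) \<bullet> z) *\<^sub>R u"
    by (simp add: inner_sum_left scaleR_left.sum)
  then have "(\<Sum>a\<in>vertices T. (bary_grad T a \<bullet> z) *\<^sub>R u) = 0" by (simp add: bary_grad_sum[OF T])
  then have "cr_grad T w z = - real CARD('n) *\<^sub>R (\<Sum>a\<in>vertices T. (bary_grad T a \<bullet> z) *\<^sub>R (w a - u))"
    by (simp add: cr_grad_def scaleR_diff_right sum_subtractf)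
  then have "norm (cr_grad T w z) = real CARD('n) * norm (\<Sum>a\<in>vertices T. (bary_grad T a \<bullet> z) *\<^sub>R (w a - u))" by simp
  also have "\<dots> \<le> real CARD('n) * (\<Sum>a\<in>vertices T. norm ((bary_grad T a \<bullet> z) *\<^sub>R (w a - u)))"
    by (intro mult_left_mono norm_sum) auto
  also have "\<dots> \<le> real CARD('n) * (\<Sum>a\<in>vertices T. 1 / (2 * \<rho>) * norm z * norm (w a - u))"
  proof (intro mult_left_mono sum_mono)
    fix a assume a: "a \<in> vertices T"
    have "norm (bary_grad T a) \<le> 1 / (2 * \<rho>)"
      using norm_bary_grad_le[OF T \<rho> a] \<rho>(1) by (simp add: field_simps)
    then have "\<bar>bary_grad T a \<bullet> z\<bar> \<le> 1 / (2 * \<rho>) * norm z"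
      by (intro order_trans[OF Cauchy_Schwarz_ineq2] mult_right_mono norm_ge_zero)
    then show "norm ((bary_grad T a \<bullet> z) *\<^sub>R (w a - u)) \<le> 1 / (2 * \<rho>) * norm z * norm (w a - u)"
      by (simp only: norm_scaleR) (intro mult_right_mono norm_ge_zero)
  qed auto
  also have "\<dots> = real CARD('n) / (2 * \<rho>) * (\<Sum>a\<in>vertices T. norm (w a - u)) * norm z"
    unfolding sum_distrib_left[symmetric] by simp
  finally show ?thesis .
qed

lemma norm_cr_local_le:
  fixes T :: "(real^'n) set"
  assumes T: "int CARD('n) simplex T" and x: "x \<in> T"
  shows "norm (cr_local T w x) \<le> real CARD('n) * (\<Sum>a\<in>vertices T. norm (w a))"
proof -
  have "norm (cr_local T w x) \<le> (\<Sum>a\<in>vertices T. norm ((1 - real CARD('n) * bary T a x) *\<^sub>R w a))"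
    unfolding cr_local_def by (rule norm_sum)
  also have "\<dots> \<le> (\<Sum>a\<in>vertices T. real CARD('n) * norm (w a))"
  proof (rule sum_mono)
    fix a assume a: "a \<in> vertices T"
    have 0: "0 \<le> bary T b x" if "b \<in> vertices T" for b using x simplex_mem_iff[OF T] that by blast
    have "bary T a x \<le> (\<Sum>b\<in>vertices T. bary T b x)" by (rule member_le_sum[OF a _ finite_vertices[OF T]]) (use 0 in blast)
    then have 1: "bary T a x \<le> 1" by (simp only: bary_sum[OF T])
    have "0 < CARD('n)" by simp
    then have N: "1 \<le> real CARD('n)" by linarith
    have "real CARD('n) * bary T a x \<le> real CARD('n) * 1" using 1 by (intro mult_left_mono) auto
    moreover have "0 \<le> real CARD('n) * bary T a x" using 0[OF a] by simp
    ultimately have "\<bar>1 - real CARD('n) * bary T a x\<bar> \<le> real CARD('n)" using N by linarith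
    then show "norm ((1 - real CARD('n) * bary T a x) *\<^sub>R w a) \<le> real CARD('n) * norm (w a)"
      by (simp only: norm_scaleR) (intro mult_right_mono norm_ge_zero)
  qed
  finally show ?thesis by (simp add: sum_distrib_left)
qed

lemma norm_matrix_le:
  fixes L :: "real^'n \<Rightarrow> real^'m"
  assumes "\<And>z. norm (L z) \<le> B * norm z"
  shows "norm (matrix L) \<le> real CARD('m) * (real CARD('n) * B)"
proof -
  have "norm (matrix L) \<le> (\<Sum>i\<in>UNIV. norm (matrix L $ i))"
    unfolding norm_vec_def by (rule L2_set_le_sum) simp
  also have "\<dots> \<le> (\<Sum>i\<in>(UNIV::'m set). real CARD('n) * B)"
  proof (rule sum_mono)
    fix i
    have "norm (matrix L $ i) \<le> (\<Sum>j\<in>UNIV. norm (matrix L $ i $ j))"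
      unfolding norm_vec_def[of "matrix L $ i"] by (rule L2_set_le_sum) simp
    also have "\<dots> \<le> (\<Sum>j\<in>(UNIV::'n set). B)"
    proof (rule sum_mono)
      fix j :: 'n
      have "norm (matrix L $ i $ j) \<le> norm (L (axis j 1))"
        unfolding matrix_def using component_le_norm_cart[of "L (axis j 1)" i] by simp
      also have "\<dots> \<le> B" using assms[of "axis j 1"] by simp
      finally show "norm (matrix L $ i $ j) \<le> B" .
    qed
    finally show "norm (matrix L $ i) \<le> real CARD('n) * B" by simp
  qed
  finally show ?thesis by simp
qed

context boundary_fitted_mesh
begin

abbreviation "fv v T a \<equiv> facet_val v (convex hull (vertices T - {a}))"

text \<open>Interiors of elements are disjoint, so at most one summand is nonzero. On the facets the
  value is 0; what counts there is the trace taken from inside an element.\<close>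

definition cr_lifting :: "((real^'n) set \<Rightarrow> real^'n) \<Rightarrow> real^'n \<Rightarrow> real^'n" where
  "cr_lifting v x = (\<Sum>T\<in>\<T>. if x \<in> interior T then cr_local T (fv v T) x else 0)"

lemma cr_lifting_interior:
  assumes T: "T \<in> \<T>" and x: "x \<in> interior T"
  shows "cr_lifting v x = cr_local T (fv v T) x"
proof -
  have "x \<notin> interior T'" if "T' \<in> \<T>" "T' \<noteq> T" for T'
    using mesh_interior_Int[OF T that(1)] that(2) x interior_subset[of T'] by blast
  then have "cr_lifting v x = (\<Sum>T'\<in>\<T>. if T' = T then cr_local T (fv v T) x else 0)"
    unfolding cr_lifting_def using x by (intro sum.cong) auto
  then show ?thesis using T finite_mesh by simp
qed

lemma elem_trace_crf:
  assumes T: "T \<in> \<T>" and x: "x \<in> T"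
  shows "elem_trace T (cr_lifting v) x = cr_local T (fv v T) x"
  unfolding elem_trace_def
proof (rule tendsto_Lim)
  note fT = full_simplex[OF T]
  have "x islimpt interior T"
  proof (cases "x \<in> interior T")
    case True then show ?thesis using interior_limit_point[of x "interior T"] by simp
  next
    case False then show ?thesis using x closure_interior_simplex[OF fT] by (auto simp: closure_def)
  qed
  then show "\<not> trivial_limit (at x within interior T)" by (simp add: trivial_limit_within)
  have "(cr_local T (fv v T) \<longlongrightarrow> cr_local T (fv v T) x) (at x within interior T)"
    using has_derivative_continuous[OF cr_local_has_derivative] by (simp add: continuous_within)
  then show "(cr_lifting v \<longlongrightarrow> cr_local T (fv v T) x) (at x within interior T)"
    by (rule Lim_transform_eventually) (simp add: eventually_at_filter cr_lifting_interior[OF T])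
qed

lemma elem_trace_crf_barycenter:
  assumes T: "T \<in> \<T>" and f: "f facet_of T"
  shows "elem_trace T (cr_lifting v) (barycenter f) = facet_val v f"
proof -
  obtain a where a: "a \<in> vertices T" "f = convex hull (vertices T - {a})" by (rule facet_opposite[OF T f])
  have "barycenter f \<in> T"
    using barycenter_rel_interior[OF T a(1)] facet_subset[OF T f] rel_interior_subset[of f] a(2) by blast
  then have "elem_trace T (cr_lifting v) (barycenter f) = cr_local T (fv v T) (barycenter f)" by (rule elem_trace_crf[OF T])
  also have "\<dots> = (\<Sum>b\<in>vertices T. if b = a then fv v T a else 0)"
    unfolding cr_local_def a(2) by (rule sum.cong) (auto simp: bary_barycenter[OF T a(1)])
  also have "\<dots> = facet_val v f" using a finite_vertices[OF full_simplex[OF T]] by simp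
  finally show ?thesis .
qed

lemma cr_lifting_CR_space: "cr_lifting v \<in> CR_space \<T>"
proof -
  have "\<exists>A b. \<forall>x\<in>interior T. cr_lifting v x = A *v x + b" if "T \<in> \<T>" for T
  proof (intro exI ballI)
    fix x assume x: "x \<in> interior T"
    show "cr_lifting v x = matrix (cr_grad T (fv v T)) *v x + cr_local T (fv v T) 0"
      by (rule trans[OF cr_lifting_interior[OF that x] cr_local_affine])
  qed
  then show ?thesis unfolding CR_space_def by (auto simp: elem_trace_crf_barycenter)
qed

definition C_7 :: real where
  "C_7 = unit_ball_vol (real CARD('n)) * real (CARD('n) + 1) * ((real CARD('n))\<^sup>2 + (real CARD('n) ^ 3 / (2 * \<kappa>))\<^sup>2)"

lemma sum_vertices_square_le:
  assumes "T \<in> \<T>"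
  shows "(\<Sum>a\<in>vertices T. f a)\<^sup>2 \<le> real (CARD('n) + 1) * (\<Sum>a\<in>vertices T. (f a)\<^sup>2)"
  using sum_squared_le_sum_of_squares[of f "vertices T"] simplex_hull_vertices(2)[OF full_simplex[OF assms]]
  by (simp add: mult_ac)

lemma measure_interior_le:
  assumes T: "T \<in> \<T>"
  shows "measure lebesgue (interior T) \<le> unit_ball_vol (real CARD('n)) * diameter T ^ CARD('n)"
    "interior T \<in> lmeasurable"
proof -
  show m: "interior T \<in> lmeasurable" by (rule lmeasurable_interior[OF bounded_simplex[OF T]])
  have "interior T \<subseteq> cball (center T) (diameter T)"
    using diameter_bounded_bound[OF bounded_simplex[OF T] center(3)[OF T]] interior_subset[of T] by (auto simp: mem_cball)
  then have "measure lebesgue (interior T) \<le> measure lebesgue (cball (center T) (diameter T))"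
    by (rule measure_mono_fmeasurable[OF _ _ lmeasurable_cball]) (use m in auto)
  also have "\<dots> = unit_ball_vol (real CARD('n)) * diameter T ^ CARD('n)"
    using diameter_simplex_pos[OF T] content_cball[of "diameter T" "center T"] by (simp add: measure_completion)
  finally show "measure lebesgue (interior T) \<le> unit_ball_vol (real CARD('n)) * diameter T ^ CARD('n)" .
qed

lemma norm_crf_square_le:
  assumes T: "T \<in> \<T>" and x: "x \<in> interior T"
  shows "(norm (cr_lifting v x))\<^sup>2 \<le> (real CARD('n))\<^sup>2 * (real (CARD('n) + 1) * (\<Sum>a\<in>vertices T. (norm (fv v T a))\<^sup>2))"
proof -
  have "(norm (cr_lifting v x))\<^sup>2 \<le> (real CARD('n) * (\<Sum>a\<in>vertices T. norm (fv v T a)))\<^sup>2"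
    unfolding cr_lifting_interior[OF assms]
    by (rule power_mono[OF norm_cr_local_le[OF full_simplex[OF T]]]) (use x interior_subset in auto)
  also have "\<dots> \<le> (real CARD('n))\<^sup>2 * (real (CARD('n) + 1) * (\<Sum>a\<in>vertices T. (norm (fv v T a))\<^sup>2))"
    unfolding power_mult_distrib by (intro mult_left_mono sum_vertices_square_le[OF T]) auto
  finally show ?thesis .
qed

lemma norm_crf_derivative_square_le:
  assumes T: "T \<in> \<T>" and x: "x \<in> interior T"
  shows "(norm (matrix (frechet_derivative (cr_lifting v) (at x))))\<^sup>2 \<le>
    (real CARD('n) ^ 3 / (2 * \<kappa>))\<^sup>2 / (diameter T)\<^sup>2 * (real (CARD('n) + 1) * (\<Sum>a\<in>vertices T. (norm (fv v T a - u))\<^sup>2))"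
proof -
  let ?d = "diameter T" and ?N = "real CARD('n)" and ?s = "\<Sum>a\<in>vertices T. norm (fv v T a - u)"
  have d: "0 < ?d" by (rule diameter_simplex_pos[OF T])
  have "(cr_lifting v has_derivative cr_grad T (fv v T)) (at x)"
    by (rule has_derivative_transform_within_open[OF cr_local_has_derivative open_interior x]) (simp add: cr_lifting_interior[OF T])
  then have fr: "frechet_derivative (cr_lifting v) (at x) = cr_grad T (fv v T)" by (rule frechet_derivative_at[symmetric])
  have "norm (cr_grad T (fv v T) z) \<le> ?N / (2 * (\<kappa> * ?d)) * ?s * norm z" for z
    by (rule norm_cr_grad_le[OF full_simplex[OF T] _ center(1)[OF T]]) (use d \<kappa>_pos in simp)
  then have "norm (matrix (cr_grad T (fv v T))) \<le> ?N * (?N * (?N / (2 * (\<kappa> * ?d)) * ?s))" by (rule norm_matrix_le)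
  also have "\<dots> = ?N ^ 3 / (2 * \<kappa>) / ?d * ?s" by (simp add: power3_eq_cube)
  finally have "(norm (matrix (cr_grad T (fv v T))))\<^sup>2 \<le> (?N ^ 3 / (2 * \<kappa>) / ?d * ?s)\<^sup>2" by (intro power_mono) auto
  also have "\<dots> = (?N ^ 3 / (2 * \<kappa>))\<^sup>2 / ?d\<^sup>2 * ?s\<^sup>2" unfolding power_mult_distrib power_divide ..
  also have "\<dots> \<le> (?N ^ 3 / (2 * \<kappa>))\<^sup>2 / ?d\<^sup>2 * (real (CARD('n) + 1) * (\<Sum>a\<in>vertices T. (norm (fv v T a - u))\<^sup>2))"
    by (intro mult_left_mono sum_vertices_square_le[OF T]) auto
  finally show ?thesis unfolding fr .
qed

text \<open>Both integrands are dominated by step functions that are constant on the interior of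
  each element. Volume bounds and the factor \<open>1 / d^2\<close> of the gradients, with
  \<open>d\<close> the diameter, turn their integrals into the two sums of
  \<open>facet_values_energy\<close>.\<close>

lemma CR_norm_crf_le: "(CR_norm \<T> (cr_lifting v))\<^sup>2 \<le> C_7 * (C_6 * (Gagliardo v + L2_sum v))"
proof -
  let ?N = "CARD('n)" and ?\<omega> = "unit_ball_vol (real CARD('n))"
  define s0 where "s0 T = (\<Sum>a\<in>vertices T. (norm (fv v T a))\<^sup>2)" for T
  define s1 where "s1 T = (\<Sum>a\<in>vertices T. (norm (fv v T a - ext (site_val v) (center T)))\<^sup>2)" for T
  define c0 where "c0 = (real ?N)\<^sup>2"
  define c1 where "c1 = (real ?N ^ 3 / (2 * \<kappa>))\<^sup>2"
  define M where "M = real (?N + 1)"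
  have nn: "0 \<le> s0 T" "0 \<le> s1 T" "0 \<le> c0" "0 \<le> c1" "0 \<le> M" for T
    unfolding s0_def s1_def c0_def c1_def M_def by (auto intro: sum_nonneg)
  have \<omega>: "0 \<le> ?\<omega>" by simp
  have int: "integrable lebesgue (\<lambda>x. C * indicator (interior T) x :: real)" if "T \<in> \<T>" for C T
    using measure_interior_le(2)[OF that] by (simp add: fmeasurable_def)
  have val: "(LINT x|lebesgue. C * indicator (interior T) x) = C * measure lebesgue (interior T)" for C and T :: "(real^'n) set"
    by simp
  have 1: "(LINT x:mesh_domain \<T>|lebesgue. (norm (cr_lifting v x))\<^sup>2) \<le> (\<Sum>T\<in>\<T>. ?\<omega> * M * (c0 * (diameter T ^ ?N * s0 T)))"
  proof -
    have "(LINT x:mesh_domain \<T>|lebesgue. (norm (cr_lifting v x))\<^sup>2) \<le>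
      (LINT x|lebesgue. (\<Sum>T\<in>\<T>. (c0 * (M * s0 T)) * indicator (interior T) x))"
      unfolding set_lebesgue_integral_def
    \<comment> \<open>Domination by an integrable nonnegative function suffices here: an integrand
      that is not integrable has integral 0.\<close>
    proof (rule integral_mono')
      show "integrable lebesgue (\<lambda>x. \<Sum>T\<in>\<T>. (c0 * (M * s0 T)) * indicator (interior T) x)"
        by (intro Bochner_Integration.integrable_sum int)
      fix x :: "real^'n"
      have nonneg: "0 \<le> (c0 * (M * s0 T)) * indicator (interior T) x" for T
        using nn by (intro mult_nonneg_nonneg) auto
      show 0: "0 \<le> (\<Sum>T\<in>\<T>. (c0 * (M * s0 T)) * indicator (interior T) x)" by (rule sum_nonneg) (rule nonneg)
      have "(norm (cr_lifting v x))\<^sup>2 \<le> (\<Sum>T\<in>\<T>. (c0 * (M * s0 T)) * indicator (interior T) x)"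
      proof (cases "\<exists>T\<in>\<T>. x \<in> interior T")
        case True
        then obtain T where T: "T \<in> \<T>" "x \<in> interior T" by blast
        have "(norm (cr_lifting v x))\<^sup>2 \<le> (c0 * (M * s0 T)) * indicator (interior T) x"
          using norm_crf_square_le[OF T] T(2) by (simp add: c0_def M_def s0_def)
        also have "\<dots> \<le> (\<Sum>T\<in>\<T>. (c0 * (M * s0 T)) * indicator (interior T) x)"
          by (rule member_le_sum[OF T(1) _ finite_mesh]) (rule nonneg)
        finally show ?thesis .
      next
        case False
        then have "cr_lifting v x = 0" unfolding cr_lifting_def by (intro sum.neutral) auto
        then show ?thesis using 0 by simp
      qed
      then show "indicat_real (mesh_domain \<T>) x *\<^sub>R (norm (cr_lifting v x))\<^sup>2 \<le> (\<Sum>T\<in>\<T>. (c0 * (M * s0 T)) * indicator (interior T) x)"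
        using 0 by (auto simp: indicator_def)
    qed
    also have "\<dots> = (\<Sum>T\<in>\<T>. (c0 * (M * s0 T)) * measure lebesgue (interior T))"
      by (subst Bochner_Integration.integral_sum) (auto simp only: val intro!: int)
    also have "\<dots> \<le> (\<Sum>T\<in>\<T>. (c0 * (M * s0 T)) * (?\<omega> * diameter T ^ ?N))"
      using nn by (intro sum_mono mult_left_mono measure_interior_le(1) mult_nonneg_nonneg) auto
    also have "\<dots> = (\<Sum>T\<in>\<T>. ?\<omega> * M * (c0 * (diameter T ^ ?N * s0 T)))" by (simp only: mult_ac)
    finally show ?thesis .
  qed
  have 2: "(LINT x:interior T|lebesgue. (norm (matrix (frechet_derivative (cr_lifting v) (at x))))\<^sup>2) \<le>
      ?\<omega> * M * (c1 * (diameter T ^ (?N - 2) * s1 T))" if T: "T \<in> \<T>" for T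
  proof -
    have d: "0 < diameter T" by (rule diameter_simplex_pos[OF T])
    have "(LINT x:interior T|lebesgue. (norm (matrix (frechet_derivative (cr_lifting v) (at x))))\<^sup>2) \<le>
      (LINT x|lebesgue. (c1 / (diameter T)\<^sup>2 * (M * s1 T)) * indicator (interior T) x)"
      unfolding set_lebesgue_integral_def
    proof (rule integral_mono'[OF int[OF T]])
      fix x :: "real^'n"
      show "0 \<le> c1 / (diameter T)\<^sup>2 * (M * s1 T) * indicator (interior T) x"
        using nn by (intro mult_nonneg_nonneg divide_nonneg_nonneg) auto
      show "indicat_real (interior T) x *\<^sub>R (norm (matrix (frechet_derivative (cr_lifting v) (at x))))\<^sup>2 \<le>
        c1 / (diameter T)\<^sup>2 * (M * s1 T) * indicator (interior T) x"
        using norm_crf_derivative_square_le[OF T, of x v "ext (site_val v) (center T)"]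
        by (cases "x \<in> interior T") (simp_all add: c1_def M_def s1_def)
    qed
    also have "\<dots> = (c1 / (diameter T)\<^sup>2 * (M * s1 T)) * measure lebesgue (interior T)" by (rule val)
    also have "\<dots> \<le> (c1 / (diameter T)\<^sup>2 * (M * s1 T)) * (?\<omega> * diameter T ^ ?N)"
      using nn by (intro mult_left_mono measure_interior_le(1)[OF T] mult_nonneg_nonneg divide_nonneg_nonneg) auto
    also have "diameter T ^ ?N = (diameter T)\<^sup>2 * diameter T ^ (?N - 2)"
      unfolding power_card[of "diameter T"] power_card_minus_1[of "diameter T"] by (simp add: power2_eq_square)
    also have "(c1 / (diameter T)\<^sup>2 * (M * s1 T)) * (?\<omega> * ((diameter T)\<^sup>2 * diameter T ^ (?N - 2))) =
      ?\<omega> * M * (c1 * (diameter T ^ (?N - 2) * s1 T))"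
      using d by simp
    finally show ?thesis .
  qed
  have nonneg: "0 \<le> (LINT x:mesh_domain \<T>|lebesgue. (norm (cr_lifting v x))\<^sup>2)"
    "0 \<le> (\<Sum>T\<in>\<T>. LINT x:interior T|lebesgue. (norm (matrix (frechet_derivative (cr_lifting v) (at x))))\<^sup>2)"
    unfolding set_lebesgue_integral_def by (auto intro!: sum_nonneg Bochner_Integration.integral_nonneg)
  have "(CR_norm \<T> (cr_lifting v))\<^sup>2 = (LINT x:mesh_domain \<T>|lebesgue. (norm (cr_lifting v x))\<^sup>2) +
     (\<Sum>T\<in>\<T>. LINT x:interior T|lebesgue. (norm (matrix (frechet_derivative (cr_lifting v) (at x))))\<^sup>2)"
    unfolding CR_norm_def by (rule real_sqrt_pow2) (use nonneg in linarith)
  also have "\<dots> \<le> (\<Sum>T\<in>\<T>. ?\<omega> * M * (c0 * (diameter T ^ ?N * s0 T))) + (\<Sum>T\<in>\<T>. ?\<omega> * M * (c1 * (diameter T ^ (?N - 2) * s1 T)))"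
    by (intro add_mono 1 sum_mono 2)
  also have "\<dots> = (\<Sum>T\<in>\<T>. ?\<omega> * M * (c0 * (diameter T ^ ?N * s0 T) + c1 * (diameter T ^ (?N - 2) * s1 T)))"
    by (simp only: sum.distrib[symmetric] distrib_left)
  also have "\<dots> \<le> (\<Sum>T\<in>\<T>. ?\<omega> * M * ((c0 + c1) * (diameter T ^ ?N * s0 T + diameter T ^ (?N - 2) * s1 T)))"
  proof (intro sum_mono mult_left_mono)
    fix T assume T: "T \<in> \<T>"
    have "0 \<le> diameter T ^ ?N * s0 T" "0 \<le> diameter T ^ (?N - 2) * s1 T"
      using nn diameter_simplex_pos[OF T] by (auto intro!: mult_nonneg_nonneg)
    then have "0 \<le> c1 * (diameter T ^ ?N * s0 T)" "0 \<le> c0 * (diameter T ^ (?N - 2) * s1 T)" using nn by (auto intro: mult_nonneg_nonneg)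
    then show "c0 * (diameter T ^ ?N * s0 T) + c1 * (diameter T ^ (?N - 2) * s1 T) \<le>
      (c0 + c1) * (diameter T ^ ?N * s0 T + diameter T ^ (?N - 2) * s1 T)"
      unfolding distrib_right distrib_left by linarith
  qed (use nn in auto)
  also have "\<dots> = C_7 * (\<Sum>T\<in>\<T>. diameter T ^ ?N * s0 T + diameter T ^ (?N - 2) * s1 T)"
    unfolding sum_distrib_left C_7_def c0_def c1_def M_def by (simp only: mult.assoc)
  also have "\<dots> \<le> C_7 * (C_6 * (Gagliardo v + L2_sum v))"
    unfolding s0_def s1_def using \<omega> by (intro mult_left_mono facet_values_energy) (simp add: C_7_def)
  finally show ?thesis .
qed

text \<open>The absolute value and the added 1 make positivity immediate. Only
  \<open>\<kappa>\<close>, \<open>K\<close>, \<open>r\<close> and the dimension enter, so the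
  constant is common to all meshes.\<close>

definition C_stable :: real where
  "C_stable = sqrt \<bar>C_7 * C_6 * (C_V + C_L2)\<bar> + 1"

lemma stable_normal_lifting:
  obtains v where "v \<in> CR_space \<T>"
    "\<And>e T. e \<in> boundary_faces \<T> \<Longrightarrow> T \<in> \<T> \<Longrightarrow> e facet_of T \<Longrightarrow>
       elem_trace T v (barycenter e) \<bullet> outer_normal \<T> e = \<mu> (barycenter e)"
    "CR_norm \<T> v \<le> C_stable * Lambda_half_norm h \<T> \<mu>"
proof -
  \<comment> \<open>The full vector along the normal is prescribed; as the normal has norm 1, its
    normal component is exactly the given value.\<close>
  define g where "g e = \<mu> (barycenter e) *\<^sub>R outer_normal \<T> e" for e
  let ?\<Lambda> = "Lambda_half_norm h \<T> \<mu>" and ?C = "\<bar>C_7 * C_6 * (C_V + C_L2)\<bar>"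
  have trace: "elem_trace T (cr_lifting g) (barycenter e) \<bullet> outer_normal \<T> e = \<mu> (barycenter e)"
    if "e \<in> boundary_faces \<T>" "T \<in> \<T>" "e facet_of T" for e T
    using norm_outer_normal[OF that(1)] that(1)
    by (simp add: elem_trace_crf_barycenter[OF that(2,3)] facet_val_def g_def dot_square_norm)
  have L2_sum: "L2_sum g \<le> C_L2 * ?\<Lambda>\<^sup>2"
  proof -
    have "L2_sum g = (\<Sum>e\<in>boundary_faces \<T>. wt e * (\<mu> (barycenter e))\<^sup>2)"
      unfolding L2_sum_def g_def by (rule sum.cong) (simp_all add: norm_outer_normal)
    then show ?thesis using discrete_L2_bound by simp
  qed
  have Gagliardo: "Gagliardo g \<le> C_V * ?\<Lambda>\<^sup>2" unfolding Gagliardo_def g_def by (rule discrete_vector_bound)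
  have C6: "0 \<le> C_7 * C_6"
  proof -
    have "0 \<le> C_7" by (simp add: C_7_def)
    moreover have "0 \<le> C_6"
      using aspect_ge \<kappa>_pos C_A_pos r2_bounds(1)
      by (simp add: C_6_def C_3_def C_4_def C_q_def C_T_def C_ext_def)
    ultimately show ?thesis by simp
  qed
  have "(CR_norm \<T> (cr_lifting g))\<^sup>2 \<le> C_7 * C_6 * (Gagliardo g + L2_sum g)" using CR_norm_crf_le[of g] by (simp only: mult.assoc)
  also have "\<dots> \<le> C_7 * C_6 * ((C_V + C_L2) * ?\<Lambda>\<^sup>2)" using Gagliardo L2_sum C6 unfolding distrib_right[of C_V] by (intro mult_left_mono add_mono)
  also have "\<dots> \<le> ?C * ?\<Lambda>\<^sup>2" unfolding mult.assoc[symmetric] by (intro mult_right_mono) auto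
  finally have "CR_norm \<T> (cr_lifting g) \<le> sqrt (?C * ?\<Lambda>\<^sup>2)" by (rule real_le_rsqrt)
  also have "\<dots> = sqrt ?C * ?\<Lambda>" using half_norm_square(4)[of \<mu>] by (simp only: real_sqrt_mult real_sqrt_abs abs_of_nonneg)
  also have "\<dots> \<le> C_stable * ?\<Lambda>"
    unfolding C_stable_def by (intro mult_right_mono half_norm_square(4)) simp
  finally show ?thesis using cr_lifting_CR_space trace by (intro that)
qed

end


section \<open>From regular mesh families to fitted meshes\<close>

lemma inscribed_ball:
  fixes T :: "(real^'n) set"
  assumes T: "bounded T" "T \<noteq> {}" and c: "0 < c" "c * diameter T \<le> inscribed_diameter T"
  shows "\<exists>x. cball x (c / 4 * diameter T) \<subseteq> T"
proof (cases "diameter T = 0")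
  case True
  then show ?thesis using T(2) by auto
next
  case False
  then have d: "0 < diameter T" using diameter_ge_0[OF T(1)] by simp
  let ?S = "{2 * r | r x. 0 \<le> r \<and> cball x r \<subseteq> T}"
  obtain p where p: "p \<in> T" using T(2) by blast
  then have "2 * 0 \<in> ?S" by (intro CollectI exI[of _ 0] exI[of _ p]) auto
  then have ne: "?S \<noteq> {}" by blast
  have bdd: "bdd_above ?S"
  proof (rule bdd_aboveI[of _ "diameter T"])
    fix s assume "s \<in> ?S"
    then obtain \<rho> x where "s = 2 * \<rho>" "0 \<le> \<rho>" "cball x \<rho> \<subseteq> T" by blast
    then show "s \<le> diameter T" using diameter_subset[of "cball x \<rho>" T] T(1) by simp
  qed
  \<comment> \<open>The supremum need not be attained: halving \<open>c\<close> makes the inequality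
    strict, and passing from diameter to radius halves it again, hence \<open>c / 4\<close>.\<close>
  have "c / 2 * diameter T < inscribed_diameter T" using c d by (intro less_le_trans[OF _ c(2)]) simp
  then obtain s where "s \<in> ?S" "c / 2 * diameter T < s"
    unfolding inscribed_diameter_def less_cSup_iff[OF ne bdd] by blast
  then obtain \<rho> x where \<rho>: "c / 2 * diameter T < 2 * \<rho>" "cball x \<rho> \<subseteq> T" by blast
  then have "c / 4 * diameter T \<le> \<rho>" by simp
  then have "cball x (c / 4 * diameter T) \<subseteq> cball x \<rho>" by (rule subset_cball)
  then show ?thesis using \<rho>(2) by blast
qed

lemma regular_mesh_shape_regular:
  fixes \<T> :: "(real^'n) set set"
  assumes N: "2 \<le> CARD('n)" and c: "0 < c" and mesh: "regular_mesh \<Omega> c h \<T>"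
  shows "shape_regular_mesh \<T> (c / 4) h"
proof -
  have t: "triangulation \<T>" using mesh by (simp add: regular_mesh_def)
  have s: "int CARD('n) simplex T" "diameter T \<le> h" "c * diameter T \<le> inscribed_diameter T" if "T \<in> \<T>" for T
    using mesh that by (auto simp: regular_mesh_def)
  have sm: "simplicial_mesh \<T>" using t s(1) N by unfold_locales auto
  have "\<exists>x. cball x (c / 4 * diameter T) \<subseteq> T" if "T \<in> \<T>" for T
    using compact_imp_bounded[OF compact_simplex'[OF s(1)[OF that]]] interior_simplex_ne[OF s(1)[OF that]] s(3)[OF that]
    by (intro inscribed_ball c) auto
  then show ?thesis using sm c s(2) by (simp add: shape_regular_mesh_def shape_regular_mesh_axioms_def)
qed

lemma regular_mesh_family_fitted:
  fixes \<Omega> :: "(real^'n) set"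
  assumes N: "2 \<le> CARD('n)" and c: "0 < c" and o: "open \<Omega>" and K: "0 < K" and r: "0 < r" "100 * K * r \<le> 1" "r \<le> 1"
    and \<nu>: "\<And>q. q \<in> frontier \<Omega> \<Longrightarrow> two_sided \<Omega> K r q (\<nu> q)" and fam: "regular_mesh_family \<Omega> c H \<T>"
  shows "\<exists>h0>0. \<forall>h\<in>H. h \<le> h0 \<longrightarrow> boundary_fitted_mesh (\<T> h) (c / 4) h \<Omega> K r \<nu>"
proof -
  obtain h1 Kf where h1: "0 < h1"
    and hom: "\<And>h. h \<in> H \<Longrightarrow> h \<le> h1 \<Longrightarrow> \<exists>q. homeomorphism (mesh_boundary (\<T> h)) (frontier \<Omega>) (closest_point (frontier \<Omega>)) q"
    and dist: "\<And>h e x. h \<in> H \<Longrightarrow> h \<le> h1 \<Longrightarrow> e \<in> boundary_faces (\<T> h) \<Longrightarrow> x \<in> e \<Longrightarrow> infdist x (frontier \<Omega>) \<le> Kf * (diameter e)\<^sup>2"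
    using fam unfolding regular_mesh_family_def by blast
  \<comment> \<open>One bound per requirement: the standing facts for small mesh sizes,
    \<open>h \<le> 1\<close>, \<open>1000 * h \<le> r\<close>,
    \<open>100 * K * h \<le> \<kappa>\<close> with \<open>\<kappa> = c / 4\<close>,
    \<open>h_tiny\<close>, and the closeness of the mesh boundary to the frontier within
    \<open>r / 1000\<close>.\<close>
  define h0 where "h0 = min h1 (min 1 (min (r / 1000) (min (c / 4 / (100 * K))
    (min (r / (10000 * (1 + 1 / (c / 4)\<^sup>2))) (r / (1000 * (\<bar>Kf\<bar> + 1)))))))"
  have q: "0 < 10000 * (1 + 1 / (c / 4)\<^sup>2)" "0 < 1000 * (\<bar>Kf\<bar> + 1)" using c by (simp_all add: add_pos_nonneg)
  have "0 < h0" unfolding h0_def min_less_iff_conj using h1 r(1) c K q by (intro conjI divide_pos_pos) simp_all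
  moreover have "boundary_fitted_mesh (\<T> h) (c / 4) h \<Omega> K r \<nu>" if h: "h \<in> H" "h \<le> h0" for h
  proof -
    have mesh: "regular_mesh \<Omega> c h (\<T> h)" and hpos: "0 < h" using fam h(1) by (auto simp: regular_mesh_family_def)
    have hh: "h \<le> h1" "h \<le> 1" "h \<le> r / 1000" "h \<le> c / 4 / (100 * K)" "h \<le> r / (10000 * (1 + 1 / (c / 4)\<^sup>2))"
      "h \<le> r / (1000 * (\<bar>Kf\<bar> + 1))"
      using h(2) unfolding h0_def min.bounded_iff by blast+
    interpret shape_regular_mesh "\<T> h" "c / 4" h by (rule regular_mesh_shape_regular[OF N c mesh])
    have near: "infdist x (frontier \<Omega>) \<le> r / 1000" if x: "x \<in> mesh_boundary (\<T> h)" for x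
    proof -
      obtain e where e: "e \<in> boundary_faces (\<T> h)" "x \<in> e" using x mesh_boundary_eq_Union by blast
      obtain T where T: "T \<in> \<T> h" "e facet_of T" using e(1) by (auto simp: boundary_faces_def faces_def)
      have d: "0 < diameter e" "diameter e \<le> h" using facet_diameter(3,4)[OF T] .
      have "infdist x (frontier \<Omega>) \<le> Kf * (diameter e)\<^sup>2" by (rule dist[OF h(1) hh(1) e])
      also have "\<dots> \<le> (\<bar>Kf\<bar> + 1) * h\<^sup>2"
        using d by (intro mult_mono power_mono) auto
      also have "\<dots> \<le> (\<bar>Kf\<bar> + 1) * h"
        using hpos hh(2) mult_left_mono[of h 1 h] by (intro mult_left_mono) (auto simp: power2_eq_square)
      also have "\<dots> \<le> r / 1000" using hh(6) q(2) by (simp add: pos_le_divide_eq mult_ac)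
      finally show ?thesis .
    qed
    obtain q' where q': "homeomorphism (mesh_boundary (\<T> h)) (frontier \<Omega>) (closest_point (frontier \<Omega>)) q'"
      using hom[OF h(1) hh(1)] by blast
    have 1: "100 * K * h \<le> c / 4" using hh(4) K by (simp only: pos_le_divide_eq mult_pos_pos mult_ac zero_less_numeral)
    have 2: "10000 * (1 + 1 / (c / 4)\<^sup>2) * h \<le> r" using hh(5) q(1) by (simp only: pos_le_divide_eq mult_ac)
    show ?thesis
    proof unfold_locales
      show "p \<in> frontier \<Omega>" if "e \<in> boundary_faces (\<T> h)" "p \<in> vertices e" for e p
        using mesh that by (simp add: regular_mesh_def vertices_def)
      show "inj_on (closest_point (frontier \<Omega>)) (mesh_boundary (\<T> h))"
        by (rule inj_on_inverseI[of _ q']) (rule homeomorphism_apply1[OF q'])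
      show "closest_point (frontier \<Omega>) ` mesh_boundary (\<T> h) = frontier \<Omega>" by (rule homeomorphism_image1[OF q'])
      show "1000 * h \<le> r" using hh(3) by simp
    qed (fact o K r \<nu> near 1 2)+
  qed
  ultimately show ?thesis by blast
qed

theorem lemma3p4:
  fixes \<Omega> :: "(real^'n) set" and c :: real
  assumes "CARD('n) = 2 \<or> CARD('n) = 3"
    and "bounded_smooth_domain \<Omega>"
    and "c > 0"
  shows "\<exists>C>0. \<forall>H \<T>. regular_mesh_family \<Omega> c H \<T> \<longrightarrow>
    (\<exists>h0>0. \<forall>h\<in>H. h \<le> h0 \<longrightarrow>
      (\<forall>\<mu>\<in>Lambda (\<T> h). \<exists>v\<in>CR_space (\<T> h).
        (\<forall>e\<in>boundary_faces (\<T> h). \<forall>T\<in>\<T> h. e facet_of T \<longrightarrow>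
           elem_trace T v (barycenter e) \<bullet> outer_normal (\<T> h) e = \<mu> (barycenter e)) \<and>
        CR_norm (\<T> h) v \<le> C * Lambda_half_norm h (\<T> h) \<mu>))"
proof -
  obtain K r0 where K: "0 < K" and r0: "0 < r0" and n: "\<forall>q\<in>frontier \<Omega>. \<exists>n. two_sided \<Omega> K r0 q n"
    using smooth_domain_two_sided[OF assms(2)] by blast
  \<comment> \<open>A smaller radius preserves the touching property and secures
    \<open>100 * K * r \<le> 1\<close> and \<open>r \<le> 1\<close>.\<close>
  define r where "r = min r0 (min (1 / (100 * K)) 1)"
  have "r \<le> 1 / (100 * K)" by (simp add: r_def)
  then have r: "0 < r" "100 * K * r \<le> 1" "r \<le> 1" "r \<le> r0"
    using r0 K by (simp_all add: r_def pos_le_divide_eq mult_ac)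
  obtain \<nu> where "\<forall>q\<in>frontier \<Omega>. two_sided \<Omega> K r0 q (\<nu> q)" using bchoice[OF n] by blast
  then have \<nu>: "two_sided \<Omega> K r q (\<nu> q)" if "q \<in> frontier \<Omega>" for q using that two_sided_mono r(4) by blast
  \<comment> \<open>Fixed before the mesh family: the value depends on the dimension, on
    \<open>c\<close> and, through \<open>K\<close> and \<open>r\<close>, on the domain.\<close>
  define C where "C = max 1 (boundary_fitted_mesh.C_stable TYPE('n) (c / 4) K r)"
  have o: "open \<Omega>" using assms(2) by (simp add: bounded_smooth_domain_def)
  have N: "2 \<le> CARD('n)" using assms(1) by auto
  show ?thesis
  proof (rule exI[of _ C], intro conjI allI impI)
    show "0 < C" by (simp add: C_def)
    fix H and \<T> :: "real \<Rightarrow> (real^'n) set set" assume "regular_mesh_family \<Omega> c H \<T>"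
    then obtain h0 where h0: "0 < h0" "\<And>h. h \<in> H \<Longrightarrow> h \<le> h0 \<Longrightarrow> boundary_fitted_mesh (\<T> h) (c / 4) h \<Omega> K r \<nu>"
      using regular_mesh_family_fitted[OF N assms(3) o K r(1-3) \<nu>] by blast
    show "\<exists>h0>0. \<forall>h\<in>H. h \<le> h0 \<longrightarrow>
      (\<forall>\<mu>\<in>Lambda (\<T> h). \<exists>v\<in>CR_space (\<T> h).
        (\<forall>e\<in>boundary_faces (\<T> h). \<forall>T\<in>\<T> h. e facet_of T \<longrightarrow>
           elem_trace T v (barycenter e) \<bullet> outer_normal (\<T> h) e = \<mu> (barycenter e)) \<and>
        CR_norm (\<T> h) v \<le> C * Lambda_half_norm h (\<T> h) \<mu>)"
    proof (intro exI[of _ h0] conjI ballI impI h0(1))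
      fix h \<mu> assume "h \<in> H" "h \<le> h0"
      then interpret boundary_fitted_mesh "\<T> h" "c / 4" h \<Omega> K r \<nu> by (rule h0(2))
      show "\<exists>v\<in>CR_space (\<T> h).
        (\<forall>e\<in>boundary_faces (\<T> h). \<forall>T\<in>\<T> h. e facet_of T \<longrightarrow>
           elem_trace T v (barycenter e) \<bullet> outer_normal (\<T> h) e = \<mu> (barycenter e)) \<and>
        CR_norm (\<T> h) v \<le> C * Lambda_half_norm h (\<T> h) \<mu>"
      proof (rule stable_normal_lifting[of \<mu>])
        fix v assume v: "v \<in> CR_space (\<T> h)"
          and trace: "\<And>e T. e \<in> boundary_faces (\<T> h) \<Longrightarrow> T \<in> \<T> h \<Longrightarrow> e facet_of T \<Longrightarrow>
             elem_trace T v (barycenter e) \<bullet> outer_normal (\<T> h) e = \<mu> (barycenter e)"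
          and le: "CR_norm (\<T> h) v \<le> C_stable * Lambda_half_norm h (\<T> h) \<mu>"
        have "C_stable * Lambda_half_norm h (\<T> h) \<mu> \<le> C * Lambda_half_norm h (\<T> h) \<mu>"
          unfolding C_def by (intro mult_right_mono half_norm_square(4)) simp
        with le have "CR_norm (\<T> h) v \<le> C * Lambda_half_norm h (\<T> h) \<mu>" by linarith
        with v trace show ?thesis by (intro bexI[of _ v] conjI ballI impI)
      qed
    qed
  qed
qed

end
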